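(* Let $\Bbbk$ be a commutative ring, let $A$ be an associative unital $\Bbbk$-algebra which is projective as a $\Bbbk$-module, let $\delta:A\to A$ be a $\Bbbk$-linear derivation, and let $\delta^e=\delta\otimes1+1\otimes\delta:A^e\to A^e$ be the induced derivation of the enveloping algebra $A^e=A\otimes A^{\mathrm{op}}$. View $\delta:A\to A$ as a $\delta^e$-operator both on the right $A^e$-module $A$ and on the left $A^e$-module $A$. Then the map $$\nabla_\bullet^{\delta,\delta}:H\!H_\bullet(A)\to H\!H_\bullet(A)$$ which these $\delta^e$-operators induce on $H\!H_\bullet(A)=\operatorname{Tor}_\bullet^{A^e}(A,A)$ coincides with the Lie derivative $L_\delta$ considered by Goodwillie and Loday, that is, with the map induced on homology by the endomorphism of the standard Hochschild complex given by $$a_0\otimes a_1\otimes\cdots\otimes a_n\mapsto\sum_{j=0}^na_0\otimes\cdots\otimes\delta(a_j)\otimes\cdots\otimes a_n.$$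
   Context: Unadorned $\otimes$ is over $\Bbbk$, and linear means $\Bbbk$-linear. Since $A$ is $\Bbbk$-projective, Hochschild homology $H\!H_\bullet(A)$, the homology of the standard Hochschild complex $(A^{\otimes(n+1)})_{n\ge0}$ with the usual Hochschild boundary, is identified canonically with $\operatorname{Tor}^{A^e}_\bullet(A,A)$. For an algebra $B$ with a derivation $d$, a $d$-operator on a left $B$-module $N$ is a linear map $g:N\to N$ with $g(bn)=d(b)n+bg(n)$, and on a right $B$-module $M$ it is a linear map $f:M\to M$ with $f(mb)=f(m)b+md(b)$. If $\eta:Q_\bullet\to N$ is a projective resolution, a $d$-lifting of $g$ to $Q_\bullet$ is a sequence $(g_i)_{i\ge0}$ of $d$-operators $g_i:Q_i\to Q_i$ commuting with the differentials and with $\eta g_0=g\eta$; such liftings exist. The morphism of complexes $M\otimes_BQ_\bullet\to M\otimes_BQ_\bullet$ given by $m\otimes q\mapsto f(m)\otimes q+m\otimes g_i(q)$ in degree $i$ induces a map $\nabla_\bullet^{f,g}:\operatorname{Tor}^B_\bullet(M,N)\to\operatorname{Tor}^B_\bullet(M,N)$ which is independent of the choice of $Q_\bullet$ and of the lifting. The map $\nabla^{\delta,\delta}_\bullet$ of the claim is this one with $B=A^e$, $d=\delta^e$, $M=N=A$ and $f=g=\delta$. *)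

theory Defs
  imports "HOL-Algebra.Module" "HOL-Algebra.AbelCoset"
begin

section \<open>Algebras and one-sided modules\<close>

text \<open>The locale \<^locale>\<open>algebra\<close> of HOL-Algebra only covers commutative algebras, and
  \<^locale>\<open>module\<close> only commutative rings of scalars.\<close>

locale assoc_algebra = module k A + A?: ring A
  for k :: "('k, 'x) ring_scheme" (structure) and A :: "('k, 'a, 'y) module_scheme" (structure) +
  assumes smult_mult_left:
      "\<lbrakk>r \<in> carrier k; x \<in> carrier A; y \<in> carrier A\<rbrakk>
        \<Longrightarrow> (r \<odot>\<^bsub>A\<^esub> x) \<otimes>\<^bsub>A\<^esub> y = r \<odot>\<^bsub>A\<^esub> (x \<otimes>\<^bsub>A\<^esub> y)"
    and smult_mult_right:
      "\<lbrakk>r \<in> carrier k; x \<in> carrier A; y \<in> carrier A\<rbrakk>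
        \<Longrightarrow> x \<otimes>\<^bsub>A\<^esub> (r \<odot>\<^bsub>A\<^esub> y) = r \<odot>\<^bsub>A\<^esub> (x \<otimes>\<^bsub>A\<^esub> y)"

locale left_module = B?: ring B + N?: abelian_group N
  for B :: "('b, 'x) ring_scheme" (structure) and N :: "('b, 'n, 'y) module_scheme" (structure) +
  assumes act_closed: "\<lbrakk>b \<in> carrier B; x \<in> carrier N\<rbrakk> \<Longrightarrow> b \<odot>\<^bsub>N\<^esub> x \<in> carrier N"
    and act_add_left: "\<lbrakk>b \<in> carrier B; c \<in> carrier B; x \<in> carrier N\<rbrakk>
        \<Longrightarrow> (b \<oplus>\<^bsub>B\<^esub> c) \<odot>\<^bsub>N\<^esub> x = b \<odot>\<^bsub>N\<^esub> x \<oplus>\<^bsub>N\<^esub> c \<odot>\<^bsub>N\<^esub> x"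
    and act_add_right: "\<lbrakk>b \<in> carrier B; x \<in> carrier N; y \<in> carrier N\<rbrakk>
        \<Longrightarrow> b \<odot>\<^bsub>N\<^esub> (x \<oplus>\<^bsub>N\<^esub> y) = b \<odot>\<^bsub>N\<^esub> x \<oplus>\<^bsub>N\<^esub> b \<odot>\<^bsub>N\<^esub> y"
    and act_mult: "\<lbrakk>b \<in> carrier B; c \<in> carrier B; x \<in> carrier N\<rbrakk>
        \<Longrightarrow> (b \<otimes>\<^bsub>B\<^esub> c) \<odot>\<^bsub>N\<^esub> x = b \<odot>\<^bsub>N\<^esub> (c \<odot>\<^bsub>N\<^esub> x)"
    and act_one: "x \<in> carrier N \<Longrightarrow> \<one>\<^bsub>B\<^esub> \<odot>\<^bsub>N\<^esub> x = x"

text \<open>A right module is stored in the same record type; there \<open>b \<odot>\<^bsub>M\<^esub> m\<close> stands for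
  \<open>m b\<close>. Right modules occur below as arguments of the balanced tensor product and of
  \<open>right_operator\<close>.\<close>

definition lmod_hom ::
    "('b, 'x) ring_scheme \<Rightarrow> ('b, 'm, 'y) module_scheme \<Rightarrow> ('b, 'n, 'z) module_scheme
      \<Rightarrow> ('m \<Rightarrow> 'n) set" where
  "lmod_hom B M N = {h \<in> carrier M \<rightarrow> carrier N.
     (\<forall>x\<in>carrier M. \<forall>y\<in>carrier M. h (x \<oplus>\<^bsub>M\<^esub> y) = h x \<oplus>\<^bsub>N\<^esub> h y) \<and>
     (\<forall>b\<in>carrier B. \<forall>x\<in>carrier M. h (b \<odot>\<^bsub>M\<^esub> x) = b \<odot>\<^bsub>N\<^esub> h x)}"

definition lmod_iso ::
    "('b, 'x) ring_scheme \<Rightarrow> ('b, 'm, 'y) module_scheme \<Rightarrow> ('b, 'n, 'z) module_scheme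
      \<Rightarrow> ('m \<Rightarrow> 'n) set" where
  "lmod_iso B M N = {h \<in> lmod_hom B M N. bij_betw h (carrier M) (carrier N)}"

section \<open>Free modules, quotients, projective modules\<close>

definition free_module :: "('b, 'x) ring_scheme \<Rightarrow> 'i set \<Rightarrow> ('b, 'i \<Rightarrow> 'b) module" where
  "free_module B I =
    \<lparr>carrier = {f. (\<forall>i. f i \<in> carrier B) \<and> (\<forall>i. i \<notin> I \<longrightarrow> f i = \<zero>\<^bsub>B\<^esub>)
                  \<and> finite {i. f i \<noteq> \<zero>\<^bsub>B\<^esub>}},
     mult = undefined, one = undefined,
     zero = (\<lambda>i. \<zero>\<^bsub>B\<^esub>), add = (\<lambda>f g i. f i \<oplus>\<^bsub>B\<^esub> g i),
     smult = (\<lambda>b f i. b \<otimes>\<^bsub>B\<^esub> f i)\<rparr>"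

definition free_gen :: "('b, 'x) ring_scheme \<Rightarrow> 'i \<Rightarrow> 'i \<Rightarrow> 'b" where
  "free_gen B i = (\<lambda>j. if j = i then \<one>\<^bsub>B\<^esub> else \<zero>\<^bsub>B\<^esub>)"

definition free_ext ::
    "('b, 'x) ring_scheme \<Rightarrow> ('b, 'n, 'z) module_scheme \<Rightarrow> ('i \<Rightarrow> 'n) \<Rightarrow> ('i \<Rightarrow> 'b) \<Rightarrow> 'n" where
  "free_ext B N \<phi> f = (\<Oplus>\<^bsub>N\<^esub>i\<in>{i. f i \<noteq> \<zero>\<^bsub>B\<^esub>}. f i \<odot>\<^bsub>N\<^esub> \<phi> i)"

text \<open>Projective means: direct summand (retract) of a free module. A lifting property against
  modules of all types cannot be quantified over in HOL. Restricting the basis to subsets of the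
  type of \<open>P\<close> loses nothing: if \<open>P\<close> is a retract of any free module, then it is a retract of the
  free module on \<open>carrier P\<close>.\<close>

definition projective_module :: "('b, 'x) ring_scheme \<Rightarrow> ('b, 'p, 'y) module_scheme \<Rightarrow> bool" where
  "projective_module B P \<longleftrightarrow> left_module B P \<and>
     (\<exists>(I :: 'p set) s r. s \<in> lmod_hom B P (free_module B I) \<and> r \<in> lmod_hom B (free_module B I) P
        \<and> (\<forall>x\<in>carrier P. r (s x) = x))"

definition module_span :: "('k, 'x) ring_scheme \<Rightarrow> ('k, 'm, 'y) module_scheme \<Rightarrow> 'm set \<Rightarrow> 'm set" where
  "module_span k M X = \<Inter>{H. submodule H k M \<and> X \<subseteq> H}"

text \<open>The map induced on cosets is \<open>S + x \<mapsto> T + h x\<close>; \<^const>\<open>the_elem\<close> extracts the common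
  value on all representatives, as in the homomorphism theorems of HOL-Algebra.\<close>

definition coset_map :: "('n, 'z) ring_scheme \<Rightarrow> 'n set \<Rightarrow> ('m \<Rightarrow> 'n) \<Rightarrow> 'm set \<Rightarrow> 'n set" where
  "coset_map N T h X = the_elem ((\<lambda>x. T +>\<^bsub>N\<^esub> h x) ` X)"

definition quot_module :: "('k, 'm, 'y) module_scheme \<Rightarrow> 'm set \<Rightarrow> ('k, 'm set) module" where
  "quot_module M S =
    \<lparr>carrier = a_rcosets\<^bsub>M\<^esub> S, mult = undefined, one = undefined,
     zero = S, add = (<+>\<^bsub>M\<^esub>), smult = (\<lambda>r. coset_map M S (\<lambda>x. r \<odot>\<^bsub>M\<^esub> x))\<rparr>"

section \<open>Tensor products\<close>

text \<open>The tensor product over \<open>k\<close> of a list of \<open>k\<close>-modules: the free module on the tuples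
  (as lists) modulo multilinearity. Lists keep all tensor powers in one HOL type.\<close>

definition tensor_free :: "('k, 'x) ring_scheme \<Rightarrow> ('k, 'a, 'y) module_scheme list \<Rightarrow> ('k, 'a list \<Rightarrow> 'k) module" where
  "tensor_free k Ms = free_module k (listset (map carrier Ms))"

definition tensor_rel :: "('k, 'x) ring_scheme \<Rightarrow> ('k, 'a, 'y) module_scheme list \<Rightarrow> ('a list \<Rightarrow> 'k) set" where
  "tensor_rel k Ms = module_span k (tensor_free k Ms)
    ({free_gen k (xs[i := a \<oplus>\<^bsub>Ms ! i\<^esub> b])
        \<ominus>\<^bsub>tensor_free k Ms\<^esub> (free_gen k (xs[i := a]) \<oplus>\<^bsub>tensor_free k Ms\<^esub> free_gen k (xs[i := b]))
      | xs i a b. xs \<in> listset (map carrier Ms) \<and> i < length Ms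
          \<and> a \<in> carrier (Ms ! i) \<and> b \<in> carrier (Ms ! i)} \<union>
     {free_gen k (xs[i := r \<odot>\<^bsub>Ms ! i\<^esub> a])
        \<ominus>\<^bsub>tensor_free k Ms\<^esub> (r \<odot>\<^bsub>tensor_free k Ms\<^esub> free_gen k (xs[i := a]))
      | xs i a r. xs \<in> listset (map carrier Ms) \<and> i < length Ms
          \<and> a \<in> carrier (Ms ! i) \<and> r \<in> carrier k})"

definition tensor :: "('k, 'x) ring_scheme \<Rightarrow> ('k, 'a, 'y) module_scheme list \<Rightarrow> ('k, ('a list \<Rightarrow> 'k) set) module" where
  "tensor k Ms = quot_module (tensor_free k Ms) (tensor_rel k Ms)"

definition pure_tensor :: "('k, 'x) ring_scheme \<Rightarrow> ('k, 'a, 'y) module_scheme list \<Rightarrow> 'a list \<Rightarrow> ('a list \<Rightarrow> 'k) set" where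
  "pure_tensor k Ms xs = tensor_rel k Ms +>\<^bsub>tensor_free k Ms\<^esub> free_gen k xs"

text \<open>The tensor product \<open>M \<otimes>\<^sub>B N\<close> of a right and a left module over a \<open>k\<close>-algebra \<open>B\<close>.
  Modules over \<open>B\<close> are \<open>k\<close>-modules through \<open>r \<mapsto> r \<odot> \<one>\<close>. Starting from the free
  \<open>k\<close>-module, the last family of relations identifies the scalar action with this one on \<open>M\<close>;
  linearity in \<open>N\<close> then follows from balancing.\<close>

definition bal_free :: "('k, 'x) ring_scheme \<Rightarrow> ('b, 'm, 'y) module_scheme \<Rightarrow> ('b, 'n, 'z) module_scheme
    \<Rightarrow> ('k, 'm \<times> 'n \<Rightarrow> 'k) module" where
  "bal_free k M N = free_module k (carrier M \<times> carrier N)"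

definition bal_rel :: "('k, 'x) ring_scheme \<Rightarrow> ('k, 'b, 'w) module_scheme \<Rightarrow> ('b, 'm, 'y) module_scheme
    \<Rightarrow> ('b, 'n, 'z) module_scheme \<Rightarrow> ('m \<times> 'n \<Rightarrow> 'k) set" where
  "bal_rel k B M N = module_span k (bal_free k M N)
    ({free_gen k (m \<oplus>\<^bsub>M\<^esub> m', n)
        \<ominus>\<^bsub>bal_free k M N\<^esub> (free_gen k (m, n) \<oplus>\<^bsub>bal_free k M N\<^esub> free_gen k (m', n))
      | m m' n. m \<in> carrier M \<and> m' \<in> carrier M \<and> n \<in> carrier N} \<union>
     {free_gen k (m, n \<oplus>\<^bsub>N\<^esub> n')
        \<ominus>\<^bsub>bal_free k M N\<^esub> (free_gen k (m, n) \<oplus>\<^bsub>bal_free k M N\<^esub> free_gen k (m, n'))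
      | m n n'. m \<in> carrier M \<and> n \<in> carrier N \<and> n' \<in> carrier N} \<union>
     {free_gen k (b \<odot>\<^bsub>M\<^esub> m, n) \<ominus>\<^bsub>bal_free k M N\<^esub> free_gen k (m, b \<odot>\<^bsub>N\<^esub> n)
      | m b n. m \<in> carrier M \<and> b \<in> carrier B \<and> n \<in> carrier N} \<union>
     {free_gen k ((r \<odot>\<^bsub>B\<^esub> \<one>\<^bsub>B\<^esub>) \<odot>\<^bsub>M\<^esub> m, n)
        \<ominus>\<^bsub>bal_free k M N\<^esub> (r \<odot>\<^bsub>bal_free k M N\<^esub> free_gen k (m, n))
      | r m n. r \<in> carrier k \<and> m \<in> carrier M \<and> n \<in> carrier N})"

definition bal_tensor :: "('k, 'x) ring_scheme \<Rightarrow> ('k, 'b, 'w) module_scheme \<Rightarrow> ('b, 'm, 'y) module_scheme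
    \<Rightarrow> ('b, 'n, 'z) module_scheme \<Rightarrow> ('k, ('m \<times> 'n \<Rightarrow> 'k) set) module" where
  "bal_tensor k B M N = quot_module (bal_free k M N) (bal_rel k B M N)"

definition bal_pure :: "('k, 'x) ring_scheme \<Rightarrow> ('k, 'b, 'w) module_scheme \<Rightarrow> ('b, 'm, 'y) module_scheme
    \<Rightarrow> ('b, 'n, 'z) module_scheme \<Rightarrow> 'm \<Rightarrow> 'n \<Rightarrow> ('m \<times> 'n \<Rightarrow> 'k) set" where
  "bal_pure k B M N m n = bal_rel k B M N +>\<^bsub>bal_free k M N\<^esub> free_gen k (m, n)"

text \<open>The linear map out of a tensor product (of either kind) into \<open>P\<close> with prescribed values
  \<open>\<phi>\<close> on pure tensors; meaningful whenever \<open>\<phi>\<close> respects the defining relations.\<close>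

definition tensor_lift :: "('k, 'x) ring_scheme \<Rightarrow> ('k, 'p, 'z) module_scheme \<Rightarrow> ('i \<Rightarrow> 'p)
    \<Rightarrow> ('i \<Rightarrow> 'k) set \<Rightarrow> 'p" where
  "tensor_lift k P \<phi> X = the_elem (free_ext k P \<phi> ` X)"

section \<open>Complexes and homology\<close>

text \<open>Nonnegatively graded complexes, with differentials \<open>d n : C (n + 1) \<rightarrow> C n\<close>.\<close>

definition cycles :: "(nat \<Rightarrow> ('k, 'c, 'y) module_scheme) \<Rightarrow> (nat \<Rightarrow> 'c \<Rightarrow> 'c) \<Rightarrow> nat \<Rightarrow> 'c set" where
  "cycles C d n = (case n of 0 \<Rightarrow> carrier (C 0)
     | Suc m \<Rightarrow> {x \<in> carrier (C (Suc m)). d m x = \<zero>\<^bsub>C m\<^esub>})"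

definition boundaries :: "(nat \<Rightarrow> ('k, 'c, 'y) module_scheme) \<Rightarrow> (nat \<Rightarrow> 'c \<Rightarrow> 'c) \<Rightarrow> nat \<Rightarrow> 'c set" where
  "boundaries C d n = d n ` carrier (C (Suc n))"

definition homology :: "(nat \<Rightarrow> ('k, 'c, 'y) module_scheme) \<Rightarrow> (nat \<Rightarrow> 'c \<Rightarrow> 'c) \<Rightarrow> nat
    \<Rightarrow> ('k, 'c set) module" where
  "homology C d n = quot_module ((C n)\<lparr>carrier := cycles C d n\<rparr>) (boundaries C d n)"

definition homology_map :: "(nat \<Rightarrow> ('k, 'c, 'y) module_scheme) \<Rightarrow> (nat \<Rightarrow> 'c \<Rightarrow> 'c)
    \<Rightarrow> (nat \<Rightarrow> 'e \<Rightarrow> 'c) \<Rightarrow> nat \<Rightarrow> 'e set \<Rightarrow> 'c set" where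
  "homology_map D d f n = coset_map (D n) (boundaries D d n) (f n)"

definition projective_resolution :: "('b, 'x) ring_scheme \<Rightarrow> ('b, 'n, 'z) module_scheme
    \<Rightarrow> (nat \<Rightarrow> ('b, 'q, 'y) module_scheme) \<Rightarrow> (nat \<Rightarrow> 'q \<Rightarrow> 'q) \<Rightarrow> ('q \<Rightarrow> 'n) \<Rightarrow> bool" where
  "projective_resolution B N Q d \<eta> \<longleftrightarrow>
     (\<forall>n. projective_module B (Q n)) \<and>
     (\<forall>n. d n \<in> lmod_hom B (Q (Suc n)) (Q n)) \<and>
     \<eta> \<in> lmod_hom B (Q 0) N \<and> \<eta> ` carrier (Q 0) = carrier N \<and>
     {x \<in> carrier (Q 0). \<eta> x = \<zero>\<^bsub>N\<^esub>} = boundaries Q d 0 \<and>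
     (\<forall>n. cycles Q d (Suc n) = boundaries Q d (Suc n))"

text \<open>Morphisms of augmented complexes of left modules lying over the identity of the module being
  resolved.\<close>

definition comparison_map :: "('b, 'x) ring_scheme
    \<Rightarrow> (nat \<Rightarrow> ('b, 'p, 'y) module_scheme) \<Rightarrow> (nat \<Rightarrow> 'p \<Rightarrow> 'p) \<Rightarrow> ('p \<Rightarrow> 'n)
    \<Rightarrow> (nat \<Rightarrow> ('b, 'q, 'z) module_scheme) \<Rightarrow> (nat \<Rightarrow> 'q \<Rightarrow> 'q) \<Rightarrow> ('q \<Rightarrow> 'n)
    \<Rightarrow> (nat \<Rightarrow> 'p \<Rightarrow> 'q) \<Rightarrow> bool" where
  "comparison_map B P d \<epsilon> Q d' \<eta> \<phi> \<longleftrightarrow>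
     (\<forall>n. \<phi> n \<in> lmod_hom B (P n) (Q n)) \<and>
     (\<forall>n. \<forall>x\<in>carrier (P (Suc n)). d' n (\<phi> (Suc n) x) = \<phi> n (d n x)) \<and>
     (\<forall>x\<in>carrier (P 0). \<eta> (\<phi> 0 x) = \<epsilon> x)"

section \<open>Derivations, operators, and the induced maps on Tor\<close>

definition derivation :: "('k, 'x) ring_scheme \<Rightarrow> ('k, 'a, 'y) module_scheme \<Rightarrow> ('a \<Rightarrow> 'a) \<Rightarrow> bool" where
  "derivation k A \<delta> \<longleftrightarrow> \<delta> \<in> lmod_hom k A A \<and>
     (\<forall>x\<in>carrier A. \<forall>y\<in>carrier A. \<delta> (x \<otimes>\<^bsub>A\<^esub> y) = \<delta> x \<otimes>\<^bsub>A\<^esub> y \<oplus>\<^bsub>A\<^esub> x \<otimes>\<^bsub>A\<^esub> \<delta> y)"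

text \<open>For a \<open>k\<close>-algebra \<open>B\<close>, a map \<open>N \<rightarrow> N\<close> on a \<open>B\<close>-module (left or right) is
  \<open>k\<close>-linear.\<close>

definition linear_endo :: "('k, 'x) ring_scheme \<Rightarrow> ('k, 'b, 'y) module_scheme \<Rightarrow> ('b, 'n, 'z) module_scheme
    \<Rightarrow> ('n \<Rightarrow> 'n) \<Rightarrow> bool" where
  "linear_endo k B N g \<longleftrightarrow> g \<in> carrier N \<rightarrow> carrier N \<and>
     (\<forall>x\<in>carrier N. \<forall>y\<in>carrier N. g (x \<oplus>\<^bsub>N\<^esub> y) = g x \<oplus>\<^bsub>N\<^esub> g y) \<and>
     (\<forall>r\<in>carrier k. \<forall>x\<in>carrier N. g ((r \<odot>\<^bsub>B\<^esub> \<one>\<^bsub>B\<^esub>) \<odot>\<^bsub>N\<^esub> x) = (r \<odot>\<^bsub>B\<^esub> \<one>\<^bsub>B\<^esub>) \<odot>\<^bsub>N\<^esub> g x)"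

definition left_operator :: "('k, 'x) ring_scheme \<Rightarrow> ('k, 'b, 'y) module_scheme \<Rightarrow> ('b \<Rightarrow> 'b)
    \<Rightarrow> ('b, 'n, 'z) module_scheme \<Rightarrow> ('n \<Rightarrow> 'n) \<Rightarrow> bool" where
  "left_operator k B d N g \<longleftrightarrow> linear_endo k B N g \<and>
     (\<forall>b\<in>carrier B. \<forall>x\<in>carrier N. g (b \<odot>\<^bsub>N\<^esub> x) = d b \<odot>\<^bsub>N\<^esub> x \<oplus>\<^bsub>N\<^esub> b \<odot>\<^bsub>N\<^esub> g x)"

definition right_operator :: "('k, 'x) ring_scheme \<Rightarrow> ('k, 'b, 'y) module_scheme \<Rightarrow> ('b \<Rightarrow> 'b)
    \<Rightarrow> ('b, 'n, 'z) module_scheme \<Rightarrow> ('n \<Rightarrow> 'n) \<Rightarrow> bool" where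
  "right_operator k B d M f \<longleftrightarrow> linear_endo k B M f \<and>
     (\<forall>b\<in>carrier B. \<forall>x\<in>carrier M. f (b \<odot>\<^bsub>M\<^esub> x) = b \<odot>\<^bsub>M\<^esub> f x \<oplus>\<^bsub>M\<^esub> d b \<odot>\<^bsub>M\<^esub> x)"

definition operator_lifting :: "('k, 'x) ring_scheme \<Rightarrow> ('k, 'b, 'y) module_scheme \<Rightarrow> ('b \<Rightarrow> 'b)
    \<Rightarrow> (nat \<Rightarrow> ('b, 'q, 'z) module_scheme) \<Rightarrow> (nat \<Rightarrow> 'q \<Rightarrow> 'q) \<Rightarrow> ('q \<Rightarrow> 'n)
    \<Rightarrow> ('n \<Rightarrow> 'n) \<Rightarrow> (nat \<Rightarrow> 'q \<Rightarrow> 'q) \<Rightarrow> bool" where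
  "operator_lifting k B d Q dQ \<eta> g gs \<longleftrightarrow>
     (\<forall>i. left_operator k B d (Q i) (gs i)) \<and>
     (\<forall>i. \<forall>x\<in>carrier (Q (Suc i)). dQ i (gs (Suc i) x) = gs i (dQ i x)) \<and>
     (\<forall>x\<in>carrier (Q 0). \<eta> (gs 0 x) = g (\<eta> x))"

text \<open>\<open>Tor k B M Q dQ n\<close> is \<open>Tor\<^sub>n\<close> computed from a given projective resolution \<open>Q\<close> of the
  left module: the homology of \<open>M \<otimes>\<^sub>B Q\<close>.\<close>

definition tensor_diff :: "('k, 'x) ring_scheme \<Rightarrow> ('k, 'b, 'w) module_scheme \<Rightarrow> ('b, 'm, 'y) module_scheme
    \<Rightarrow> (nat \<Rightarrow> ('b, 'q, 'z) module_scheme) \<Rightarrow> (nat \<Rightarrow> 'q \<Rightarrow> 'q)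
    \<Rightarrow> nat \<Rightarrow> ('m \<times> 'q \<Rightarrow> 'k) set \<Rightarrow> ('m \<times> 'q \<Rightarrow> 'k) set" where
  "tensor_diff k B M Q dQ n =
     tensor_lift k (bal_tensor k B M (Q n)) (\<lambda>(m, q). bal_pure k B M (Q n) m (dQ n q))"

definition Tor :: "('k, 'x) ring_scheme \<Rightarrow> ('k, 'b, 'w) module_scheme \<Rightarrow> ('b, 'm, 'y) module_scheme
    \<Rightarrow> (nat \<Rightarrow> ('b, 'q, 'z) module_scheme) \<Rightarrow> (nat \<Rightarrow> 'q \<Rightarrow> 'q)
    \<Rightarrow> nat \<Rightarrow> ('k, ('m \<times> 'q \<Rightarrow> 'k) set set) module" where
  "Tor k B M Q dQ = homology (\<lambda>n. bal_tensor k B M (Q n)) (tensor_diff k B M Q dQ)"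

definition nabla :: "('k, 'x) ring_scheme \<Rightarrow> ('k, 'b, 'w) module_scheme \<Rightarrow> ('b, 'm, 'y) module_scheme
    \<Rightarrow> (nat \<Rightarrow> ('b, 'q, 'z) module_scheme) \<Rightarrow> (nat \<Rightarrow> 'q \<Rightarrow> 'q)
    \<Rightarrow> ('m \<Rightarrow> 'm) \<Rightarrow> (nat \<Rightarrow> 'q \<Rightarrow> 'q)
    \<Rightarrow> nat \<Rightarrow> ('m \<times> 'q \<Rightarrow> 'k) set set \<Rightarrow> ('m \<times> 'q \<Rightarrow> 'k) set set" where
  "nabla k B M Q dQ f gs =
     homology_map (\<lambda>n. bal_tensor k B M (Q n)) (tensor_diff k B M Q dQ)
       (\<lambda>n. tensor_lift k (bal_tensor k B M (Q n))
          (\<lambda>(m, q). bal_pure k B M (Q n) (f m) q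
                      \<oplus>\<^bsub>bal_tensor k B M (Q n)\<^esub> bal_pure k B M (Q n) m (gs n q)))"

section \<open>The enveloping algebra\<close>

definition opposite :: "('k, 'a, 'y) module_scheme \<Rightarrow> ('k, 'a, 'y) module_scheme" where
  "opposite A = A\<lparr>mult := (\<lambda>x y. y \<otimes>\<^bsub>A\<^esub> x)\<rparr>"

definition enveloping :: "('k, 'x) ring_scheme \<Rightarrow> ('k, 'a, 'y) module_scheme
    \<Rightarrow> ('k, ('a list \<Rightarrow> 'k) set) module" where
  "enveloping k A = (let T = tensor k [A, opposite A] in
     T\<lparr>mult := (\<lambda>X Y. tensor_lift k T (\<lambda>u. tensor_lift k T (\<lambda>v.
             pure_tensor k [A, opposite A]
               [u ! 0 \<otimes>\<^bsub>A\<^esub> v ! 0, u ! 1 \<otimes>\<^bsub>opposite A\<^esub> v ! 1]) Y) X),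
       one := pure_tensor k [A, opposite A] [\<one>\<^bsub>A\<^esub>, \<one>\<^bsub>A\<^esub>]\<rparr>)"

text \<open>\<open>A\<close> as a left module, \<open>(a \<otimes> b) x = a x b\<close>, and as a right module, \<open>x (a \<otimes> b) = b x a\<close>,
  over its enveloping algebra.\<close>

definition env_left :: "('k, 'x) ring_scheme \<Rightarrow> ('k, 'a, 'y) module_scheme
    \<Rightarrow> (('a list \<Rightarrow> 'k) set, 'a) module" where
  "env_left k A = \<lparr>carrier = carrier A, mult = mult A, one = one A, zero = zero A, add = add A,
     smult = (\<lambda>E x. tensor_lift k A (\<lambda>u. u ! 0 \<otimes>\<^bsub>A\<^esub> x \<otimes>\<^bsub>A\<^esub> u ! 1) E)\<rparr>"

definition env_right :: "('k, 'x) ring_scheme \<Rightarrow> ('k, 'a, 'y) module_scheme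
    \<Rightarrow> (('a list \<Rightarrow> 'k) set, 'a) module" where
  "env_right k A = \<lparr>carrier = carrier A, mult = mult A, one = one A, zero = zero A, add = add A,
     smult = (\<lambda>E x. tensor_lift k A (\<lambda>u. u ! 1 \<otimes>\<^bsub>A\<^esub> x \<otimes>\<^bsub>A\<^esub> u ! 0) E)\<rparr>"

text \<open>\<open>x\<^sub>0 \<otimes> \<dots> \<otimes> x\<^sub>n \<mapsto> \<Sum>\<^sub>j x\<^sub>0 \<otimes> \<dots> \<otimes> \<delta> x\<^sub>j \<otimes> \<dots> \<otimes> x\<^sub>n\<close>. On two factors this is
  \<open>\<delta> \<otimes> 1 + 1 \<otimes> \<delta>\<close>.\<close>

definition leibniz_map :: "('k, 'x) ring_scheme \<Rightarrow> ('k, 'a, 'y) module_scheme list \<Rightarrow> ('a \<Rightarrow> 'a)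
    \<Rightarrow> ('a list \<Rightarrow> 'k) set \<Rightarrow> ('a list \<Rightarrow> 'k) set" where
  "leibniz_map k Ms \<delta> = tensor_lift k (tensor k Ms)
     (\<lambda>xs. \<Oplus>\<^bsub>tensor k Ms\<^esub>j\<in>{..<length Ms}. pure_tensor k Ms (xs[j := \<delta> (xs ! j)]))"

definition env_derivation :: "('k, 'x) ring_scheme \<Rightarrow> ('k, 'a, 'y) module_scheme \<Rightarrow> ('a \<Rightarrow> 'a)
    \<Rightarrow> ('a list \<Rightarrow> 'k) set \<Rightarrow> ('a list \<Rightarrow> 'k) set" where
  "env_derivation k A \<delta> = leibniz_map k [A, opposite A] \<delta>"

section \<open>Hochschild homology\<close>

definition sgn_pow :: "('k, 'x) ring_scheme \<Rightarrow> nat \<Rightarrow> 'k" where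
  "sgn_pow k i = (\<ominus>\<^bsub>k\<^esub> \<one>\<^bsub>k\<^esub>) [^]\<^bsub>k\<^esub> i"

definition merge_at :: "('a, 'y) ring_scheme \<Rightarrow> nat \<Rightarrow> 'a list \<Rightarrow> 'a list" where
  "merge_at A i xs = take i xs @ [xs ! i \<otimes>\<^bsub>A\<^esub> xs ! Suc i] @ drop (i + 2) xs"

definition tensor_pow :: "('k, 'x) ring_scheme \<Rightarrow> ('k, 'a, 'y) module_scheme \<Rightarrow> nat
    \<Rightarrow> ('k, ('a list \<Rightarrow> 'k) set) module" where
  "tensor_pow k A n = tensor k (replicate n A)"

definition pure_pow :: "('k, 'x) ring_scheme \<Rightarrow> ('k, 'a, 'y) module_scheme \<Rightarrow> 'a list
    \<Rightarrow> ('a list \<Rightarrow> 'k) set" where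
  "pure_pow k A xs = pure_tensor k (replicate (length xs) A) xs"

definition hochschild :: "('k, 'x) ring_scheme \<Rightarrow> ('k, 'a, 'y) module_scheme \<Rightarrow> nat
    \<Rightarrow> ('k, ('a list \<Rightarrow> 'k) set) module" where
  "hochschild k A n = tensor_pow k A (Suc n)"

definition hochschild_diff :: "('k, 'x) ring_scheme \<Rightarrow> ('k, 'a, 'y) module_scheme \<Rightarrow> nat
    \<Rightarrow> ('a list \<Rightarrow> 'k) set \<Rightarrow> ('a list \<Rightarrow> 'k) set" where
  "hochschild_diff k A n = tensor_lift k (hochschild k A n)
     (\<lambda>xs. (\<Oplus>\<^bsub>hochschild k A n\<^esub>i\<in>{..n}.
               sgn_pow k i \<odot>\<^bsub>hochschild k A n\<^esub> pure_pow k A (merge_at A i xs))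
           \<oplus>\<^bsub>hochschild k A n\<^esub>
             sgn_pow k (Suc n) \<odot>\<^bsub>hochschild k A n\<^esub>
               pure_pow k A ((last xs \<otimes>\<^bsub>A\<^esub> hd xs) # butlast (tl xs)))"

definition HH :: "('k, 'x) ring_scheme \<Rightarrow> ('k, 'a, 'y) module_scheme \<Rightarrow> nat
    \<Rightarrow> ('k, ('a list \<Rightarrow> 'k) set set) module" where
  "HH k A = homology (hochschild k A) (hochschild_diff k A)"

definition lie_derivative :: "('k, 'x) ring_scheme \<Rightarrow> ('k, 'a, 'y) module_scheme \<Rightarrow> ('a \<Rightarrow> 'a)
    \<Rightarrow> nat \<Rightarrow> ('a list \<Rightarrow> 'k) set set \<Rightarrow> ('a list \<Rightarrow> 'k) set set" where
  "lie_derivative k A \<delta> = homology_map (hochschild k A) (hochschild_diff k A)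
     (\<lambda>n. leibniz_map k (replicate (Suc n) A) \<delta>)"

section \<open>The canonical identification of Hochschild homology with Tor\<close>

text \<open>The bar resolution \<open>A\<^bsup>\<otimes>(n+2)\<^esup>\<close>, with \<open>a \<otimes> b\<close> acting by multiplying the first factor by \<open>a\<close>
  on the left and the last factor by \<open>b\<close> on the right, augmented by the multiplication of \<open>A\<close>.\<close>

definition bar :: "('k, 'x) ring_scheme \<Rightarrow> ('k, 'a, 'y) module_scheme \<Rightarrow> nat
    \<Rightarrow> (('a list \<Rightarrow> 'k) set, ('a list \<Rightarrow> 'k) set) module" where
  "bar k A n = (let T = tensor_pow k A (n + 2) in
     \<lparr>carrier = carrier T, mult = mult T, one = one T, zero = zero T, add = add T,
      smult = (\<lambda>E X. tensor_lift k T (\<lambda>u. tensor_lift k T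
          (\<lambda>xs. pure_pow k A
             (xs[0 := u ! 0 \<otimes>\<^bsub>A\<^esub> xs ! 0, Suc n := xs ! Suc n \<otimes>\<^bsub>A\<^esub> u ! 1])) X) E)\<rparr>)"

definition bar_diff :: "('k, 'x) ring_scheme \<Rightarrow> ('k, 'a, 'y) module_scheme \<Rightarrow> nat
    \<Rightarrow> ('a list \<Rightarrow> 'k) set \<Rightarrow> ('a list \<Rightarrow> 'k) set" where
  "bar_diff k A n = tensor_lift k (tensor_pow k A (n + 2))
     (\<lambda>xs. \<Oplus>\<^bsub>tensor_pow k A (n + 2)\<^esub>i\<in>{..Suc n}.
        sgn_pow k i \<odot>\<^bsub>tensor_pow k A (n + 2)\<^esub> pure_pow k A (merge_at A i xs))"

definition bar_aug :: "('k, 'x) ring_scheme \<Rightarrow> ('k, 'a, 'y) module_scheme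
    \<Rightarrow> ('a list \<Rightarrow> 'k) set \<Rightarrow> 'a" where
  "bar_aug k A = tensor_lift k A (\<lambda>xs. xs ! 0 \<otimes>\<^bsub>A\<^esub> xs ! 1)"

text \<open>Given a comparison map \<open>\<phi>\<close> from the bar resolution to a projective resolution \<open>Q\<close> of \<open>A\<close>, the
  identification of \<open>HH\<close> with \<open>Tor\<close> computed from \<open>Q\<close> is induced by the isomorphism from the
  Hochschild complex to \<open>A\<close> tensored with the bar resolution,
  \<open>a\<^sub>0 \<otimes> a\<^sub>1 \<otimes> \<dots> \<otimes> a\<^sub>n \<mapsto> a\<^sub>0 \<otimes> (1 \<otimes> a\<^sub>1 \<otimes> \<dots> \<otimes> a\<^sub>n \<otimes> 1)\<close>, followed by \<open>1 \<otimes> \<phi>\<close>.\<close>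

definition HH_to_Tor :: "('k, 'x) ring_scheme \<Rightarrow> ('k, 'a, 'y) module_scheme
    \<Rightarrow> (nat \<Rightarrow> (('a list \<Rightarrow> 'k) set, 'q, 'z) module_scheme) \<Rightarrow> (nat \<Rightarrow> 'q \<Rightarrow> 'q)
    \<Rightarrow> (nat \<Rightarrow> ('a list \<Rightarrow> 'k) set \<Rightarrow> 'q)
    \<Rightarrow> nat \<Rightarrow> ('a list \<Rightarrow> 'k) set set \<Rightarrow> ('a \<times> 'q \<Rightarrow> 'k) set set" where
  "HH_to_Tor k A Q dQ \<phi> =
     homology_map (\<lambda>n. bal_tensor k (enveloping k A) (env_right k A) (Q n))
       (tensor_diff k (enveloping k A) (env_right k A) Q dQ)
       (\<lambda>n. tensor_lift k (bal_tensor k (enveloping k A) (env_right k A) (Q n))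
          (\<lambda>xs. bal_pure k (enveloping k A) (env_right k A) (Q n) (hd xs)
                  (\<phi> n (pure_pow k A (\<one>\<^bsub>A\<^esub> # tl xs @ [\<one>\<^bsub>A\<^esub>])))))"

end

theory Submission
  imports Defs
begin

text \<open>Since \<open>A\<close> is \<open>k\<close>-projective, the bar resolution \<open>Bar\<^sub>n = A\<^bsup>\<otimes>(n+2)\<^esup>\<close> of \<open>A\<close> is a projective
  resolution over \<open>A\<^sup>e\<close>, and the Leibniz extension \<open>L\<close> of \<open>\<delta>\<close> is a \<open>\<delta>\<^sup>e\<close>-lifting of \<open>\<delta>\<close> to it. Let \<open>\<phi>\<close>
  compare \<open>Bar\<close> with a projective resolution \<open>Q\<close> on which \<open>g\<close> lifts \<open>\<delta>\<close>. The defects of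
  \<open>A\<^sup>e\<close>-linearity of \<open>g\<phi>\<close> and of \<open>\<phi>L\<close> agree, so \<open>g\<phi> - \<phi>L\<close> is an \<open>A\<^sup>e\<close>-linear chain map over
  \<open>\<delta> - \<delta> = 0\<close>, hence null-homotopic over \<open>A\<^sup>e\<close>. Tensoring the homotopy with \<open>A\<close> transports \<open>\<nabla>\<close> to
  the operator \<open>\<delta> \<otimes> 1 + 1 \<otimes> L\<close> on \<open>A \<otimes> Bar\<close> (over \<open>A\<^sup>e\<close>). Under the isomorphism
  \<open>a\<^sub>0 \<otimes> \<dots> \<otimes> a\<^sub>n \<mapsto> a\<^sub>0 \<otimes> (1 \<otimes> a\<^sub>1 \<otimes> \<dots> \<otimes> a\<^sub>n \<otimes> 1)\<close> with the Hochschild complex this is the Lie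
  derivative, because \<open>\<delta>(1) = 0\<close>.\<close>

section \<open>Homomorphisms of left modules\<close>

text \<open>Neither \<open>gs \<phi>\<close> nor \<open>\<phi> Lie\<close> is
  \<open>Ae\<close>-linear, so uniqueness of comparison maps up to homotopy cannot be applied to
  them as it stands. For this reason a homotopy is set up as a relation between arbitrary functions
  with a linear homotopy operator, and the uniqueness theorem asks for linearity of the difference
  only. Tensoring meets the same obstacle: \<open>\<delta> \<otimes> 1\<close> and
  \<open>1 \<otimes> gs\<close> do not separately respect the relations of a balanced tensor
  product, their sum does. The homotopy is therefore transported with the common summand
  \<open>\<delta> m \<otimes> \<phi> q\<close> carried along. Projectivity of \<open>A\<close> over
  \<open>k\<close> is used as a lifting property for multilinear maps, which avoids constructing
  bases of tensor powers. Identities in the bar complex are tested on tensors that begin with the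
  unit; these generate it over \<open>A\<^sup>e\<close>, and there the contraction gives explicit
  formulas, so no double sum over faces has to be rearranged. The Hochschild complex inherits its
  identities from the tensored bar complex instead of by computation.\<close>

lemma lmod_homI:
  assumes "\<And>x. x \<in> carrier M \<Longrightarrow> h x \<in> carrier N"
    and "\<And>x y. \<lbrakk>x \<in> carrier M; y \<in> carrier M\<rbrakk> \<Longrightarrow> h (x \<oplus>\<^bsub>M\<^esub> y) = h x \<oplus>\<^bsub>N\<^esub> h y"
    and "\<And>b x. \<lbrakk>b \<in> carrier B; x \<in> carrier M\<rbrakk> \<Longrightarrow> h (b \<odot>\<^bsub>M\<^esub> x) = b \<odot>\<^bsub>N\<^esub> h x"
  shows "h \<in> lmod_hom B M N"
  using assms by (auto simp: lmod_hom_def)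

lemma lmod_hom_closed: "\<lbrakk>h \<in> lmod_hom B M N; x \<in> carrier M\<rbrakk> \<Longrightarrow> h x \<in> carrier N"
  by (auto simp: lmod_hom_def)

lemma lmod_hom_add:
  "\<lbrakk>h \<in> lmod_hom B M N; x \<in> carrier M; y \<in> carrier M\<rbrakk> \<Longrightarrow> h (x \<oplus>\<^bsub>M\<^esub> y) = h x \<oplus>\<^bsub>N\<^esub> h y"
  by (auto simp: lmod_hom_def)

lemma lmod_hom_smult:
  "\<lbrakk>h \<in> lmod_hom B M N; b \<in> carrier B; x \<in> carrier M\<rbrakk> \<Longrightarrow> h (b \<odot>\<^bsub>M\<^esub> x) = b \<odot>\<^bsub>N\<^esub> h x"
  by (auto simp: lmod_hom_def)

text \<open>Terms describing the same map often agree on the carrier only. The module structure on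
  \<open>M\<close> keeps sums and multiples inside the region of agreement.\<close>

lemma lmod_hom_cong:
  assumes "h \<in> lmod_hom B M N" "left_module B M" "\<And>x. x \<in> carrier M \<Longrightarrow> h' x = h x"
  shows "h' \<in> lmod_hom B M N"
proof -
  interpret M: left_module B M by fact
  show ?thesis
    by (rule lmod_homI) (auto simp: assms(3) M.act_closed lmod_hom_closed[OF assms(1)]
        lmod_hom_add[OF assms(1)] lmod_hom_smult[OF assms(1)])
qed

lemma lmod_hom_id: "(\<lambda>x. x) \<in> lmod_hom B M M"
  by (auto simp: lmod_hom_def)

lemma lmod_hom_comp:
  "\<lbrakk>h \<in> lmod_hom B M N; h' \<in> lmod_hom B N P\<rbrakk> \<Longrightarrow> (\<lambda>x. h' (h x)) \<in> lmod_hom B M P"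
  by (auto simp: lmod_hom_def Pi_iff)

lemma additive_zero:
  assumes "abelian_group M" "abelian_group N" "h \<in> carrier M \<rightarrow> carrier N"
    and "\<And>x y. \<lbrakk>x \<in> carrier M; y \<in> carrier M\<rbrakk> \<Longrightarrow> h (x \<oplus>\<^bsub>M\<^esub> y) = h x \<oplus>\<^bsub>N\<^esub> h y"
  shows "h \<zero>\<^bsub>M\<^esub> = \<zero>\<^bsub>N\<^esub>"
proof -
  interpret M: abelian_group M by fact
  interpret N: abelian_group N by fact
  have c: "h \<zero>\<^bsub>M\<^esub> \<in> carrier N" using assms(3) by auto
  have "h \<zero>\<^bsub>M\<^esub> \<oplus>\<^bsub>N\<^esub> h \<zero>\<^bsub>M\<^esub> = h \<zero>\<^bsub>M\<^esub>"
    using assms(4)[of "\<zero>\<^bsub>M\<^esub>" "\<zero>\<^bsub>M\<^esub>"] by simp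
  then show ?thesis using c by (metis N.add.r_cancel_one')
qed

lemma lmod_hom_zero:
  assumes "h \<in> lmod_hom B M N" "abelian_group M" "abelian_group N"
  shows "h \<zero>\<^bsub>M\<^esub> = \<zero>\<^bsub>N\<^esub>"
  using assms by (intro additive_zero) (auto simp: lmod_hom_def)

lemma lmod_hom_inv:
  assumes h: "h \<in> lmod_hom B M N" and M: "abelian_group M" and N: "abelian_group N"
    and x: "x \<in> carrier M"
  shows "h (\<ominus>\<^bsub>M\<^esub> x) = \<ominus>\<^bsub>N\<^esub> h x"
proof -
  interpret M: abelian_group M by fact
  interpret N: abelian_group N by fact
  have "h (\<ominus>\<^bsub>M\<^esub> x) \<oplus>\<^bsub>N\<^esub> h x = \<zero>\<^bsub>N\<^esub>"
    using lmod_hom_add[OF h, of "\<ominus>\<^bsub>M\<^esub> x" x] x lmod_hom_zero[OF h M N] by (simp add: M.l_neg)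
  then show ?thesis using x h by (metis M.a_inv_closed N.minus_equality lmod_hom_closed)
qed

lemma lmod_hom_minus:
  assumes "h \<in> lmod_hom B M N" "abelian_group M" "abelian_group N"
    and "x \<in> carrier M" "y \<in> carrier M"
  shows "h (x \<ominus>\<^bsub>M\<^esub> y) = h x \<ominus>\<^bsub>N\<^esub> h y"
proof -
  interpret M: abelian_group M by fact
  show ?thesis
    using assms by (simp add: a_minus_def lmod_hom_add lmod_hom_inv)
qed

lemma lmod_hom_finsum:
  assumes h: "h \<in> lmod_hom B M N" and M: "abelian_group M" and N: "abelian_group N"
    and f: "f \<in> S \<rightarrow> carrier M"
  shows "h (\<Oplus>\<^bsub>M\<^esub>i\<in>S. f i) = (\<Oplus>\<^bsub>N\<^esub>i\<in>S. h (f i))"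
proof -
  interpret M: abelian_group M by fact
  interpret N: abelian_group N by fact
  show ?thesis
  proof (cases "finite S")
    case True
    then show ?thesis using f
    proof (induction S)
      case empty
      then show ?case by (simp add: lmod_hom_zero[OF h M N])
    next
      case (insert i S)
      then show ?case
        by (subst M.finsum_insert, simp_all add: Pi_iff)
          (subst N.finsum_insert, auto simp: Pi_iff lmod_hom_closed[OF h] lmod_hom_add[OF h] M.finsum_closed)
    qed
  qed (simp add: lmod_hom_zero[OF h M N])
qed

text \<open>Splits off the first index rather than the last: in the Leibniz sums below the first
  tensor factor is the special one, being either an inserted unit or the coefficient in
  \<open>A\<close>.\<close>

lemma (in abelian_monoid) finsum_lessThan_Suc:
  assumes "P \<in> {..<Suc n} \<rightarrow> carrier G"
  shows "(\<Oplus>j\<in>{..<Suc n}. P j) = P 0 \<oplus> (\<Oplus>j\<in>{..<n}. P (Suc j))"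
proof -
  have "(\<Oplus>j\<in>insert 0 (Suc ` {..<n}). P j) = P 0 \<oplus> (\<Oplus>j\<in>Suc ` {..<n}. P j)"
    by (rule finsum_insert) (use assms in auto)
  also have "(\<Oplus>j\<in>Suc ` {..<n}. P j) = (\<Oplus>j\<in>{..<n}. P (Suc j))"
    by (rule finsum_reindex) (use assms in auto)
  finally show ?thesis by (simp add: lessThan_Suc_eq_insert_0)
qed

lemma (in abelian_group) minus_zero: "x \<in> carrier G \<Longrightarrow> x \<ominus> \<zero> = x"
  by (simp add: a_minus_def)

lemma (in abelian_group) minus_self: "x \<in> carrier G \<Longrightarrow> x \<ominus> x = \<zero>"
  by (simp add: a_minus_def r_neg)

section \<open>Arithmetic of a module action\<close>

lemma (in left_module) act_zero_left: "x \<in> carrier N \<Longrightarrow> \<zero>\<^bsub>B\<^esub> \<odot>\<^bsub>N\<^esub> x = \<zero>\<^bsub>N\<^esub>"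
  using additive_zero[of B N "\<lambda>b. b \<odot>\<^bsub>N\<^esub> x"] B.is_abelian_group N.abelian_group_axioms
  by (auto simp: act_closed act_add_left)

lemma (in left_module) act_zero_right: "b \<in> carrier B \<Longrightarrow> b \<odot>\<^bsub>N\<^esub> \<zero>\<^bsub>N\<^esub> = \<zero>\<^bsub>N\<^esub>"
  using additive_zero[of N N "\<lambda>x. b \<odot>\<^bsub>N\<^esub> x"] N.abelian_group_axioms
  by (auto simp: act_closed act_add_right)

lemma (in left_module) act_inv_right:
  assumes "b \<in> carrier B" "x \<in> carrier N"
  shows "b \<odot>\<^bsub>N\<^esub> (\<ominus>\<^bsub>N\<^esub> x) = \<ominus>\<^bsub>N\<^esub> (b \<odot>\<^bsub>N\<^esub> x)"
proof -
  have "b \<odot>\<^bsub>N\<^esub> (\<ominus>\<^bsub>N\<^esub> x) \<oplus>\<^bsub>N\<^esub> b \<odot>\<^bsub>N\<^esub> x = \<zero>\<^bsub>N\<^esub>"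
    using assms act_add_right[of b "\<ominus>\<^bsub>N\<^esub> x" x] by (simp add: N.l_neg act_zero_right)
  then show ?thesis using assms by (metis N.a_inv_closed N.minus_equality act_closed)
qed

lemma (in left_module) act_inv_left:
  assumes "b \<in> carrier B" "x \<in> carrier N"
  shows "(\<ominus>\<^bsub>B\<^esub> b) \<odot>\<^bsub>N\<^esub> x = \<ominus>\<^bsub>N\<^esub> (b \<odot>\<^bsub>N\<^esub> x)"
proof -
  have "(\<ominus>\<^bsub>B\<^esub> b) \<odot>\<^bsub>N\<^esub> x \<oplus>\<^bsub>N\<^esub> b \<odot>\<^bsub>N\<^esub> x = \<zero>\<^bsub>N\<^esub>"
    using assms act_add_left[of "\<ominus>\<^bsub>B\<^esub> b" b x] by (simp add: B.l_neg act_zero_left)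
  then show ?thesis using assms by (metis B.a_inv_closed N.minus_equality act_closed)
qed

lemma (in left_module) act_minus_right:
  "\<lbrakk>b \<in> carrier B; x \<in> carrier N; y \<in> carrier N\<rbrakk>
    \<Longrightarrow> b \<odot>\<^bsub>N\<^esub> (x \<ominus>\<^bsub>N\<^esub> y) = b \<odot>\<^bsub>N\<^esub> x \<ominus>\<^bsub>N\<^esub> b \<odot>\<^bsub>N\<^esub> y"
  by (simp add: a_minus_def act_add_right act_inv_right)

lemma (in left_module) act_finsum:
  assumes "b \<in> carrier B" "f \<in> S \<rightarrow> carrier N"
  shows "b \<odot>\<^bsub>N\<^esub> (\<Oplus>\<^bsub>N\<^esub>i\<in>S. f i) = (\<Oplus>\<^bsub>N\<^esub>i\<in>S. b \<odot>\<^bsub>N\<^esub> f i)"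
proof (cases "finite S")
  case True
  then show ?thesis using assms(2)
  proof (induction S)
    case empty
    then show ?case by (simp add: act_zero_right assms)
  next
    case (insert i S)
    then show ?case
      by (subst N.finsum_insert, simp_all add: Pi_iff)
        (subst N.finsum_insert, auto simp: Pi_iff assms act_add_right act_closed N.finsum_closed)
  qed
qed (simp add: act_zero_right assms)

section \<open>Pointwise operations on homomorphisms\<close>

lemma lmod_hom_zero_fun:
  assumes "left_module B N"
  shows "(\<lambda>x. \<zero>\<^bsub>N\<^esub>) \<in> lmod_hom B M N"
proof -
  interpret N: left_module B N by fact
  show ?thesis by (auto simp: lmod_hom_def N.act_zero_right)
qed

lemma lmod_hom_plus:
  assumes "left_module B N" "f \<in> lmod_hom B M N" "g \<in> lmod_hom B M N"
  shows "(\<lambda>x. f x \<oplus>\<^bsub>N\<^esub> g x) \<in> lmod_hom B M N"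
proof -
  interpret N: left_module B N by fact
  note c = lmod_hom_closed[OF assms(2)] lmod_hom_closed[OF assms(3)]
  show ?thesis
    by (rule lmod_homI) (auto simp: c lmod_hom_add[OF assms(2)] lmod_hom_add[OF assms(3)]
      lmod_hom_smult[OF assms(2)] lmod_hom_smult[OF assms(3)] N.act_add_right N.N.a_ac)
qed

lemma lmod_hom_uminus:
  assumes "left_module B N" "f \<in> lmod_hom B M N"
  shows "(\<lambda>x. \<ominus>\<^bsub>N\<^esub> f x) \<in> lmod_hom B M N"
proof -
  interpret N: left_module B N by fact
  note c = lmod_hom_closed[OF assms(2)]
  show ?thesis
    by (rule lmod_homI) (auto simp: c lmod_hom_add[OF assms(2)] lmod_hom_smult[OF assms(2)]
       N.act_inv_right N.N.minus_add)
qed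

lemma lmod_hom_diff:
  assumes "left_module B N" "f \<in> lmod_hom B M N" "g \<in> lmod_hom B M N"
  shows "(\<lambda>x. f x \<ominus>\<^bsub>N\<^esub> g x) \<in> lmod_hom B M N"
  unfolding a_minus_def by (intro lmod_hom_plus lmod_hom_uminus assms)

lemma lmod_hom_sum:
  assumes N: "left_module B N" and "\<And>i. i \<in> S \<Longrightarrow> f i \<in> lmod_hom B M N"
  shows "(\<lambda>x. \<Oplus>\<^bsub>N\<^esub>i\<in>S. f i x) \<in> lmod_hom B M N"
proof (rule lmod_homI)
  interpret N: left_module B N by fact
  fix x assume x: "x \<in> carrier M"
  have cx: "(\<lambda>i. f i x) \<in> S \<rightarrow> carrier N" using assms(2) x by (auto intro: lmod_hom_closed)
  then show "(\<Oplus>\<^bsub>N\<^esub>i\<in>S. f i x) \<in> carrier N" by (rule N.N.finsum_closed)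
  { fix y assume y: "y \<in> carrier M"
    have cy: "(\<lambda>i. f i y) \<in> S \<rightarrow> carrier N" using assms(2) y by (auto intro: lmod_hom_closed)
    have "(\<Oplus>\<^bsub>N\<^esub>i\<in>S. f i (x \<oplus>\<^bsub>M\<^esub> y)) = (\<Oplus>\<^bsub>N\<^esub>i\<in>S. f i x \<oplus>\<^bsub>N\<^esub> f i y)"
      using assms(2) x y cx cy by (intro N.N.finsum_cong') (auto intro: lmod_hom_add)
    then show "(\<Oplus>\<^bsub>N\<^esub>i\<in>S. f i (x \<oplus>\<^bsub>M\<^esub> y)) = (\<Oplus>\<^bsub>N\<^esub>i\<in>S. f i x) \<oplus>\<^bsub>N\<^esub> (\<Oplus>\<^bsub>N\<^esub>i\<in>S. f i y)"
      using cx cy by (simp add: N.N.finsum_addf) }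
  fix b assume b: "b \<in> carrier B"
  have "(\<Oplus>\<^bsub>N\<^esub>i\<in>S. f i (b \<odot>\<^bsub>M\<^esub> x)) = (\<Oplus>\<^bsub>N\<^esub>i\<in>S. b \<odot>\<^bsub>N\<^esub> f i x)"
    using assms(2) x b cx by (intro N.N.finsum_cong') (auto intro: lmod_hom_smult N.act_closed)
  then show "(\<Oplus>\<^bsub>N\<^esub>i\<in>S. f i (b \<odot>\<^bsub>M\<^esub> x)) = b \<odot>\<^bsub>N\<^esub> (\<Oplus>\<^bsub>N\<^esub>i\<in>S. f i x)"
    using b cx by (simp add: N.act_finsum)
qed

text \<open>Commutativity of \<open>k\<close> makes multiplication by \<open>r\<close> commute with
  the action of the other scalars.\<close>

lemma lmod_hom_scale:
  assumes "cring k" "left_module k N" "f \<in> lmod_hom k M N" "r \<in> carrier k"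
  shows "(\<lambda>x. r \<odot>\<^bsub>N\<^esub> f x) \<in> lmod_hom k M N"
proof -
  interpret k: cring k by fact
  interpret N: left_module k N by fact
  note c = lmod_hom_closed[OF assms(3)]
  show ?thesis
    by (rule lmod_homI) (auto simp: c assms(4) lmod_hom_add[OF assms(3)] lmod_hom_smult[OF assms(3)]
       N.act_closed N.act_add_right N.act_mult[symmetric] k.m_comm)
qed

lemma left_moduleI:
  assumes "ring B" "abelian_group N"
    and "\<And>b x. \<lbrakk>b \<in> carrier B; x \<in> carrier N\<rbrakk> \<Longrightarrow> b \<odot>\<^bsub>N\<^esub> x \<in> carrier N"
    and "\<And>b c x. \<lbrakk>b \<in> carrier B; c \<in> carrier B; x \<in> carrier N\<rbrakk>
        \<Longrightarrow> (b \<oplus>\<^bsub>B\<^esub> c) \<odot>\<^bsub>N\<^esub> x = b \<odot>\<^bsub>N\<^esub> x \<oplus>\<^bsub>N\<^esub> c \<odot>\<^bsub>N\<^esub> x"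
    and "\<And>b x y. \<lbrakk>b \<in> carrier B; x \<in> carrier N; y \<in> carrier N\<rbrakk>
        \<Longrightarrow> b \<odot>\<^bsub>N\<^esub> (x \<oplus>\<^bsub>N\<^esub> y) = b \<odot>\<^bsub>N\<^esub> x \<oplus>\<^bsub>N\<^esub> b \<odot>\<^bsub>N\<^esub> y"
    and "\<And>b c x. \<lbrakk>b \<in> carrier B; c \<in> carrier B; x \<in> carrier N\<rbrakk>
        \<Longrightarrow> (b \<otimes>\<^bsub>B\<^esub> c) \<odot>\<^bsub>N\<^esub> x = b \<odot>\<^bsub>N\<^esub> (c \<odot>\<^bsub>N\<^esub> x)"
    and "\<And>x. x \<in> carrier N \<Longrightarrow> \<one>\<^bsub>B\<^esub> \<odot>\<^bsub>N\<^esub> x = x"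
  shows "left_module B N"
  using assms by (intro left_module.intro left_module_axioms.intro) auto

lemma module_left_module: "module k M \<Longrightarrow> left_module k M"
proof -
  assume "module k M"
  then interpret module k M .
  show ?thesis
    by (rule left_moduleI) (auto simp: smult_l_distr smult_r_distr smult_assoc1 R.ring_axioms M.abelian_group_axioms)
qed

section \<open>Free modules\<close>

lemma free_module_simps:
  "f \<oplus>\<^bsub>free_module B I\<^esub> g = (\<lambda>i. f i \<oplus>\<^bsub>B\<^esub> g i)"
  "b \<odot>\<^bsub>free_module B I\<^esub> f = (\<lambda>i. b \<otimes>\<^bsub>B\<^esub> f i)"
  "\<zero>\<^bsub>free_module B I\<^esub> = (\<lambda>i. \<zero>\<^bsub>B\<^esub>)"
  by (simp_all add: free_module_def)

lemma free_module_carrier: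
  "f \<in> carrier (free_module B I) \<longleftrightarrow>
    (\<forall>i. f i \<in> carrier B) \<and> (\<forall>i. i \<notin> I \<longrightarrow> f i = \<zero>\<^bsub>B\<^esub>) \<and> finite {i. f i \<noteq> \<zero>\<^bsub>B\<^esub>}"
  by (simp add: free_module_def)

lemma free_moduleI:
  assumes "\<And>i. f i \<in> carrier B" "\<And>i. i \<notin> I \<Longrightarrow> f i = \<zero>\<^bsub>B\<^esub>"
    and "finite S" "\<And>i. i \<notin> S \<Longrightarrow> f i = \<zero>\<^bsub>B\<^esub>"
  shows "f \<in> carrier (free_module B I)"
proof -
  have "{i. f i \<noteq> \<zero>\<^bsub>B\<^esub>} \<subseteq> S" using assms(4) by auto
  then show ?thesis using assms(1,2,3) finite_subset unfolding free_module_carrier by blast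
qed

lemma free_module_left_module:
  assumes "ring B"
  shows "left_module B (free_module B I)"
proof -
  interpret B: ring B by fact
  note [simp] = free_module_simps
  let ?F = "free_module B I"
  have add: "f \<oplus>\<^bsub>?F\<^esub> g \<in> carrier ?F" if "f \<in> carrier ?F" "g \<in> carrier ?F" for f g
    using that by (intro free_moduleI[where S = "{i. f i \<noteq> \<zero>\<^bsub>B\<^esub>} \<union> {i. g i \<noteq> \<zero>\<^bsub>B\<^esub>}"])
      (auto simp: free_module_carrier)
  have act: "b \<odot>\<^bsub>?F\<^esub> f \<in> carrier ?F" if "b \<in> carrier B" "f \<in> carrier ?F" for b f
    using that by (intro free_moduleI[where S = "{i. f i \<noteq> \<zero>\<^bsub>B\<^esub>}"]) (auto simp: free_module_carrier)
  have "abelian_group ?F"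
  proof (rule abelian_groupI)
    fix f assume f: "f \<in> carrier ?F"
    then have "(\<lambda>i. \<ominus>\<^bsub>B\<^esub> f i) \<in> carrier ?F"
      by (intro free_moduleI[where S = "{i. f i \<noteq> \<zero>\<^bsub>B\<^esub>}"]) (auto simp: free_module_carrier)
    moreover have "(\<lambda>i. \<ominus>\<^bsub>B\<^esub> f i) \<oplus>\<^bsub>?F\<^esub> f = \<zero>\<^bsub>?F\<^esub>"
      using f by (simp add: free_module_carrier B.l_neg)
    ultimately show "\<exists>g\<in>carrier ?F. g \<oplus>\<^bsub>?F\<^esub> f = \<zero>\<^bsub>?F\<^esub>" by blast
  next
    show "\<zero>\<^bsub>?F\<^esub> \<in> carrier ?F" by (simp add: free_module_carrier)
  next
    fix f g h assume "f \<in> carrier ?F" "g \<in> carrier ?F" "h \<in> carrier ?F"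
    then have c: "f i \<in> carrier B" "g i \<in> carrier B" "h i \<in> carrier B" for i
      by (simp_all add: free_module_carrier)
    show "f \<oplus>\<^bsub>?F\<^esub> g \<oplus>\<^bsub>?F\<^esub> h = f \<oplus>\<^bsub>?F\<^esub> (g \<oplus>\<^bsub>?F\<^esub> h)" using c by (simp add: B.a_assoc)
  next
    fix f g assume "f \<in> carrier ?F" "g \<in> carrier ?F"
    then have c: "f i \<in> carrier B" "g i \<in> carrier B" for i
      by (simp_all add: free_module_carrier)
    show "f \<oplus>\<^bsub>?F\<^esub> g = g \<oplus>\<^bsub>?F\<^esub> f" using c by (simp add: B.a_comm)
    show "\<zero>\<^bsub>?F\<^esub> \<oplus>\<^bsub>?F\<^esub> f = f" using c by simp
  qed (rule add)
  then show ?thesis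
  proof (rule left_moduleI[OF assms])
    fix b c f assume "b \<in> carrier B" "c \<in> carrier B" and f: "f \<in> carrier ?F"
    moreover have "f i \<in> carrier B" for i using f by (simp add: free_module_carrier)
    ultimately show "(b \<oplus>\<^bsub>B\<^esub> c) \<odot>\<^bsub>?F\<^esub> f = b \<odot>\<^bsub>?F\<^esub> f \<oplus>\<^bsub>?F\<^esub> c \<odot>\<^bsub>?F\<^esub> f"
      "(b \<otimes>\<^bsub>B\<^esub> c) \<odot>\<^bsub>?F\<^esub> f = b \<odot>\<^bsub>?F\<^esub> (c \<odot>\<^bsub>?F\<^esub> f)"
      by (simp_all add: B.l_distr B.m_assoc)
  next
    fix f assume f: "f \<in> carrier ?F"
    then have "f i \<in> carrier B" for i by (simp add: free_module_carrier)
    then show "\<one>\<^bsub>B\<^esub> \<odot>\<^bsub>?F\<^esub> f = f" by simp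
  next
    fix b f g assume "b \<in> carrier B" and f: "f \<in> carrier ?F" "g \<in> carrier ?F"
    moreover have "f i \<in> carrier B" "g i \<in> carrier B" for i using f by (simp_all add: free_module_carrier)
    ultimately show "b \<odot>\<^bsub>?F\<^esub> (f \<oplus>\<^bsub>?F\<^esub> g) = b \<odot>\<^bsub>?F\<^esub> f \<oplus>\<^bsub>?F\<^esub> b \<odot>\<^bsub>?F\<^esub> g"
      by (simp add: B.r_distr)
  qed (rule act)
qed

lemma free_gen_closed:
  assumes "ring B" "i \<in> I"
  shows "free_gen B i \<in> carrier (free_module B I)"
proof -
  interpret B: ring B by fact
  show ?thesis
    by (rule free_moduleI[where S = "{i}"]) (use assms(2) in \<open>auto simp: free_gen_def\<close>)
qed

text \<open>\<open>free_ext\<close> sums over the exact support, which can shrink when coefficients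
  are added or multiplied. Further indices contribute zero terms, so any finite index set containing
  the support gives the same value, and different vectors can be summed over a common set.\<close>

lemma free_ext_superset:
  assumes "left_module B N" "f \<in> carrier (free_module B I)" "\<phi> \<in> I \<rightarrow> carrier N"
    and "finite S" "{i. f i \<noteq> \<zero>\<^bsub>B\<^esub>} \<subseteq> S" "S \<subseteq> I"
  shows "free_ext B N \<phi> f = (\<Oplus>\<^bsub>N\<^esub>i\<in>S. f i \<odot>\<^bsub>N\<^esub> \<phi> i)"
proof -
  interpret N: left_module B N by fact
  show ?thesis unfolding free_ext_def
    using assms(2-) by (intro N.N.add.finprod_mono_neutral_cong_left)
      (auto simp: free_module_carrier N.act_zero_left N.act_closed Pi_iff subset_iff)
qed

lemma free_support:
  assumes "f \<in> carrier (free_module B I)"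
  shows "finite {i. f i \<noteq> \<zero>\<^bsub>B\<^esub>}" "{i. f i \<noteq> \<zero>\<^bsub>B\<^esub>} \<subseteq> I"
  using assms by (auto simp: free_module_carrier)

lemma free_ext_hom:
  assumes "left_module B N" "\<phi> \<in> I \<rightarrow> carrier N"
  shows "free_ext B N \<phi> \<in> lmod_hom B (free_module B I) N"
proof -
  interpret N: left_module B N by fact
  interpret F: left_module B "free_module B I"
    by (rule free_module_left_module) (rule N.B.ring_axioms)
  note [simp] = free_module_simps
  let ?F = "free_module B I"
  show ?thesis
  proof (rule lmod_homI)
    fix f assume f: "f \<in> carrier ?F"
    have fc: "f i \<in> carrier B" for i using f by (auto simp: free_module_carrier)
    let ?S = "{i. f i \<noteq> \<zero>\<^bsub>B\<^esub>}"
    have S: "finite ?S" "?S \<subseteq> I" using free_support[OF f] .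
    show "free_ext B N \<phi> f \<in> carrier N" unfolding free_ext_def
      using S assms(2) fc by (intro N.N.finsum_closed) (auto simp: N.act_closed Pi_iff)
    { fix b assume b: "b \<in> carrier B"
      \<comment> \<open>Zero divisors can make the support of \<open>b f\<close> smaller than that
        of \<open>f\<close>; the sum is kept over the support of \<open>f\<close>.\<close>
      have "free_ext B N \<phi> (b \<odot>\<^bsub>?F\<^esub> f) = (\<Oplus>\<^bsub>N\<^esub>i\<in>?S. (b \<odot>\<^bsub>?F\<^esub> f) i \<odot>\<^bsub>N\<^esub> \<phi> i)"
        using b fc by (intro free_ext_superset[OF assms(1) F.act_closed[OF b f] assms(2) S(1) _ S(2)]) auto
      also have "\<dots> = (\<Oplus>\<^bsub>N\<^esub>i\<in>?S. b \<odot>\<^bsub>N\<^esub> (f i \<odot>\<^bsub>N\<^esub> \<phi> i))"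
        using b fc S assms(2) by (intro N.N.finsum_cong') (auto simp: N.act_mult N.act_closed Pi_iff subset_iff)
      also have "\<dots> = b \<odot>\<^bsub>N\<^esub> free_ext B N \<phi> f" unfolding free_ext_def
        using b fc S assms(2) by (subst N.act_finsum) (auto simp: N.act_closed Pi_iff subset_iff)
      finally show "free_ext B N \<phi> (b \<odot>\<^bsub>?F\<^esub> f) = b \<odot>\<^bsub>N\<^esub> free_ext B N \<phi> f" . }
    fix g assume g: "g \<in> carrier ?F"
    have gc: "g i \<in> carrier B" for i using g by (auto simp: free_module_carrier)
    let ?T = "{i. g i \<noteq> \<zero>\<^bsub>B\<^esub>}" let ?U = "?S \<union> ?T"
    have T: "finite ?T" "?T \<subseteq> I" using free_support[OF g] .
    have U: "finite ?U" "?U \<subseteq> I" using S T by auto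
    have c: "(\<lambda>i. f i \<odot>\<^bsub>N\<^esub> \<phi> i) \<in> ?U \<rightarrow> carrier N" "(\<lambda>i. g i \<odot>\<^bsub>N\<^esub> \<phi> i) \<in> ?U \<rightarrow> carrier N"
      using assms(2) U fc gc by (auto simp: N.act_closed Pi_iff subset_iff)
    have "free_ext B N \<phi> (f \<oplus>\<^bsub>?F\<^esub> g) = (\<Oplus>\<^bsub>N\<^esub>i\<in>?U. (f \<oplus>\<^bsub>?F\<^esub> g) i \<odot>\<^bsub>N\<^esub> \<phi> i)"
      by (intro free_ext_superset[OF assms(1) _ assms(2) U(1) _ U(2)]) (use f g F.N.a_closed in auto)
    also have "\<dots> = (\<Oplus>\<^bsub>N\<^esub>i\<in>?U. f i \<odot>\<^bsub>N\<^esub> \<phi> i \<oplus>\<^bsub>N\<^esub> g i \<odot>\<^bsub>N\<^esub> \<phi> i)"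
      using c U assms(2) fc gc
      by (intro N.N.finsum_cong') (auto simp: N.act_add_left Pi_iff subset_iff)
    also have "\<dots> = (\<Oplus>\<^bsub>N\<^esub>i\<in>?U. f i \<odot>\<^bsub>N\<^esub> \<phi> i) \<oplus>\<^bsub>N\<^esub> (\<Oplus>\<^bsub>N\<^esub>i\<in>?U. g i \<odot>\<^bsub>N\<^esub> \<phi> i)"
      using c by (rule N.N.finsum_addf)
    also have "(\<Oplus>\<^bsub>N\<^esub>i\<in>?U. f i \<odot>\<^bsub>N\<^esub> \<phi> i) = free_ext B N \<phi> f"
      by (rule free_ext_superset[OF assms(1) f assms(2) U(1) _ U(2), symmetric]) auto
    also have "(\<Oplus>\<^bsub>N\<^esub>i\<in>?U. g i \<odot>\<^bsub>N\<^esub> \<phi> i) = free_ext B N \<phi> g"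
      by (rule free_ext_superset[OF assms(1) g assms(2) U(1) _ U(2), symmetric]) auto
    finally show "free_ext B N \<phi> (f \<oplus>\<^bsub>?F\<^esub> g) = free_ext B N \<phi> f \<oplus>\<^bsub>N\<^esub> free_ext B N \<phi> g" .
  qed
qed

lemma free_ext_gen:
  assumes "left_module B N" "\<phi> \<in> I \<rightarrow> carrier N" "i \<in> I"
  shows "free_ext B N \<phi> (free_gen B i) = \<phi> i"
proof -
  interpret N: left_module B N by fact
  have p: "\<phi> i \<in> carrier N" using assms by auto
  have "free_ext B N \<phi> (free_gen B i) = (\<Oplus>\<^bsub>N\<^esub>j\<in>{i}. free_gen B i j \<odot>\<^bsub>N\<^esub> \<phi> j)"
    using assms by (intro free_ext_superset free_gen_closed N.B.ring_axioms) (auto simp: free_gen_def)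
  also have "\<dots> = \<phi> i"
    using p by (subst N.N.add.finprod_singleton_swap[of i "{i}", simplified] | simp add: free_gen_def N.act_one)+
  finally show ?thesis .
qed

text \<open>Induction over a finite set containing the support: clearing the coordinate at
  \<open>j\<close> leaves a vector supported on the smaller set, and the part removed is a multiple
  of a generator. The induction claim quantifies over all such vectors because clearing a coordinate
  changes the vector.\<close>

lemma free_hom_eq_ext:
  assumes "left_module B N" "h \<in> lmod_hom B (free_module B I) N" "f \<in> carrier (free_module B I)"
  shows "h f = free_ext B N (\<lambda>i. h (free_gen B i)) f"
proof -
  interpret N: left_module B N by fact
  interpret F: left_module B "free_module B I"
    by (rule free_module_left_module) (rule N.B.ring_axioms)
  note [simp] = free_module_simps
  let ?F = "free_module B I" and ?e = "free_ext B N (\<lambda>i. h (free_gen B i))"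
  have g: "free_gen B i \<in> carrier ?F" if "i \<in> I" for i
    using that by (intro free_gen_closed N.B.ring_axioms)
  have hg: "(\<lambda>i. h (free_gen B i)) \<in> I \<rightarrow> carrier N"
    using g lmod_hom_closed[OF assms(2)] by auto
  have e: "?e \<in> lmod_hom B ?F N" by (rule free_ext_hom[OF assms(1) hg])
  have "\<forall>f\<in>carrier ?F. {i. f i \<noteq> \<zero>\<^bsub>B\<^esub>} \<subseteq> S \<longrightarrow> h f = ?e f" if "finite S" "S \<subseteq> I" for S
    using that
  proof (induction S)
    case empty
    have "f = \<zero>\<^bsub>?F\<^esub>" if "f \<in> carrier ?F" "{i. f i \<noteq> \<zero>\<^bsub>B\<^esub>} \<subseteq> {}" for f using that by auto
    moreover have "h \<zero>\<^bsub>?F\<^esub> = ?e \<zero>\<^bsub>?F\<^esub>"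
      by (simp only: lmod_hom_zero[OF e F.N.abelian_group_axioms N.N.abelian_group_axioms]
          lmod_hom_zero[OF assms(2) F.N.abelian_group_axioms N.N.abelian_group_axioms])
    ultimately show ?case by metis
  next
    case (insert j S)
    show ?case
    proof (intro ballI impI)
      fix f assume f: "f \<in> carrier ?F" "{i. f i \<noteq> \<zero>\<^bsub>B\<^esub>} \<subseteq> insert j S"
      let ?f = "f(j := \<zero>\<^bsub>B\<^esub>)"
      have fj: "f j \<in> carrier B" using f by (auto simp: free_module_carrier)
      have f': "?f \<in> carrier ?F"
        using f(1) by (intro free_moduleI[where S = "{i. f i \<noteq> \<zero>\<^bsub>B\<^esub>}"]) (auto simp: free_module_carrier)
      have d: "f = ?f \<oplus>\<^bsub>?F\<^esub> f j \<odot>\<^bsub>?F\<^esub> free_gen B j"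
        using f(1) by (auto simp: free_module_carrier free_gen_def)
      have "{i. ?f i \<noteq> \<zero>\<^bsub>B\<^esub>} \<subseteq> S" using f(2) by auto
      then have "h ?f = ?e ?f" using insert.IH insert.prems f' by blast
      moreover have jI: "j \<in> I" using insert by auto
      ultimately have "h (?f \<oplus>\<^bsub>?F\<^esub> f j \<odot>\<^bsub>?F\<^esub> free_gen B j) = ?e (?f \<oplus>\<^bsub>?F\<^esub> f j \<odot>\<^bsub>?F\<^esub> free_gen B j)"
        using f' fj g[OF jI]
        by (simp only: lmod_hom_add[OF assms(2)] lmod_hom_smult[OF assms(2)] lmod_hom_add[OF e]
            lmod_hom_smult[OF e] F.act_closed free_ext_gen[OF assms(1) hg])
      then show "h f = ?e f" using d by simp
    qed
  qed
  then show ?thesis using free_support[OF assms(3)] assms(3) by auto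
qed

lemma free_hom_unique:
  assumes "left_module B N" "h \<in> lmod_hom B (free_module B I) N" "h' \<in> lmod_hom B (free_module B I) N"
    and "\<And>i. i \<in> I \<Longrightarrow> h (free_gen B i) = h' (free_gen B i)" "f \<in> carrier (free_module B I)"
  shows "h f = h' f"
proof -
  have "free_ext B N (\<lambda>i. h (free_gen B i)) f = free_ext B N (\<lambda>i. h' (free_gen B i)) f"
  proof -
    interpret N: left_module B N by fact
    have "h (free_gen B i) \<in> carrier N" "h' (free_gen B i) \<in> carrier N" if "i \<in> I" for i
      using free_gen_closed[OF N.B.ring_axioms that] lmod_hom_closed[OF assms(2)] lmod_hom_closed[OF assms(3)]
      by auto
    then show ?thesis
      unfolding free_ext_def using assms(4,5) free_support[OF assms(5)]
      by (intro N.N.finsum_cong') (auto simp: free_module_carrier subset_iff intro!: N.act_closed)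
  qed
  then show ?thesis
    using free_hom_eq_ext[OF assms(1,2,5)] free_hom_eq_ext[OF assms(1,3,5)] by simp
qed

section \<open>Quotients and modules given by generators and relations\<close>

lemma quot_module_simps:
  "carrier (quot_module M S) = a_rcosets\<^bsub>M\<^esub> S"
  "X \<oplus>\<^bsub>quot_module M S\<^esub> Y = X <+>\<^bsub>M\<^esub> Y"
  "\<zero>\<^bsub>quot_module M S\<^esub> = S"
  "r \<odot>\<^bsub>quot_module M S\<^esub> X = coset_map M S (\<lambda>x. r \<odot>\<^bsub>M\<^esub> x) X"
  by (simp_all add: quot_module_def)

lemma submodule_abelian_subgroup:
  assumes "left_module B M" "submodule S B M"
  shows "abelian_subgroup S M"
proof -
  interpret M: left_module B M by fact
  interpret S: submodule S B M by fact
  show ?thesis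
    by (rule abelian_subgroupI3[OF additive_subgroup.intro[OF S.subgroup_axioms] M.N.abelian_group_axioms])
qed

text \<open>Two representatives of a coset differ by some \<open>s\<close> in \<open>S\<close>, and
  \<open>h s\<close> lies in \<open>T\<close>. Hence the image set in \<open>coset_map\<close> is a
  singleton, and \<open>the_elem\<close> reads off its member.\<close>

lemma coset_map_coset:
  assumes M: "abelian_subgroup S M" and N: "abelian_subgroup T N"
    and h: "h \<in> carrier M \<rightarrow> carrier N"
      "\<And>x y. \<lbrakk>x \<in> carrier M; y \<in> carrier M\<rbrakk> \<Longrightarrow> h (x \<oplus>\<^bsub>M\<^esub> y) = h x \<oplus>\<^bsub>N\<^esub> h y"
    and ST: "h ` S \<subseteq> T" and x: "x \<in> carrier M"
  shows "coset_map N T h (S +>\<^bsub>M\<^esub> x) = T +>\<^bsub>N\<^esub> h x"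
proof -
  interpret M: abelian_subgroup S M by fact
  interpret N: abelian_subgroup T N by fact
  have "T +>\<^bsub>N\<^esub> h y = T +>\<^bsub>N\<^esub> h x" if y: "y \<in> S +>\<^bsub>M\<^esub> x" for y
  proof -
    obtain s where s: "s \<in> S" "y = s \<oplus>\<^bsub>M\<^esub> x" using y unfolding a_r_coset_def' by blast
    then have "h y = h s \<oplus>\<^bsub>N\<^esub> h x" using h(2) x M.a_subset by auto
    moreover have "h s \<in> T" using ST s by auto
    ultimately have "h y \<in> T +>\<^bsub>N\<^esub> h x" unfolding a_r_coset_def' by blast
    moreover have "h x \<in> carrier N" using h(1) x by auto
    ultimately show ?thesis by (rule N.a_repr_independence'[symmetric])
  qed
  moreover have "x \<in> S +>\<^bsub>M\<^esub> x" using x by (rule M.a_rcos_self)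
  ultimately have "(\<lambda>y. T +>\<^bsub>N\<^esub> h y) ` (S +>\<^bsub>M\<^esub> x) = {T +>\<^bsub>N\<^esub> h x}" by blast
  then show ?thesis by (simp add: coset_map_def)
qed

text \<open>Serves two purposes: tensor products, with a span of relators as \<open>S\<close>, and
  homology, with the boundaries inside the record of cycles.\<close>

locale quotient = M?: left_module B M for B :: "('b, 'x) ring_scheme" (structure)
    and M :: "('b, 'm, 'y) module_scheme" (structure) +
  fixes S
  assumes sub: "submodule S B M"
begin

abbreviation "Q \<equiv> quot_module M S"

sublocale S: abelian_subgroup S M
  by (rule submodule_abelian_subgroup[OF M.left_module_axioms sub])

lemma quot_carrier: "X \<in> carrier Q \<longleftrightarrow> (\<exists>x\<in>carrier M. X = S +>\<^bsub>M\<^esub> x)"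
  unfolding quot_module_simps A_RCOSETS_def' a_r_coset_def' by blast

lemma coset_closed: "x \<in> carrier M \<Longrightarrow> S +>\<^bsub>M\<^esub> x \<in> carrier Q"
  using quot_carrier by blast

lemma coset_add:
  "\<lbrakk>x \<in> carrier M; y \<in> carrier M\<rbrakk> \<Longrightarrow> (S +>\<^bsub>M\<^esub> x) \<oplus>\<^bsub>Q\<^esub> (S +>\<^bsub>M\<^esub> y) = S +>\<^bsub>M\<^esub> (x \<oplus>\<^bsub>M\<^esub> y)"
  by (simp add: quot_module_simps S.a_rcos_sum)

lemma coset_smult:
  "\<lbrakk>b \<in> carrier B; x \<in> carrier M\<rbrakk> \<Longrightarrow> b \<odot>\<^bsub>Q\<^esub> (S +>\<^bsub>M\<^esub> x) = S +>\<^bsub>M\<^esub> (b \<odot>\<^bsub>M\<^esub> x)"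
  unfolding quot_module_simps using submodule.smult_closed[OF sub]
  by (intro coset_map_coset S.abelian_subgroup_axioms) (auto simp: M.act_closed M.act_add_right)

lemma coset_zero: "S +>\<^bsub>M\<^esub> \<zero>\<^bsub>M\<^esub> = \<zero>\<^bsub>Q\<^esub>"
  using M.N.a_coset_add_zero[of S] S.a_subset by (simp add: quot_module_simps)

lemma coset_eq_zero: "x \<in> carrier M \<Longrightarrow> S +>\<^bsub>M\<^esub> x = \<zero>\<^bsub>Q\<^esub> \<longleftrightarrow> x \<in> S"
  using S.a_rcos_self[of x] S.a_rcos_const[of x] by (auto simp: quot_module_simps)

lemma coset_eq:
  "\<lbrakk>x \<in> carrier M; y \<in> carrier M\<rbrakk> \<Longrightarrow> S +>\<^bsub>M\<^esub> x = S +>\<^bsub>M\<^esub> y \<longleftrightarrow> x \<ominus>\<^bsub>M\<^esub> y \<in> S"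
  using S.a_rcos_module[of y x] S.a_rcos_self[of x] S.a_repr_independence'[of x y]
  by (auto simp: a_minus_def)

lemma quot_left_module: "left_module B Q"
proof (rule left_moduleI)
  show "ring B" by (rule M.B.ring_axioms)
  show "abelian_group Q"
  proof (rule abelian_groupI)
    show "\<zero>\<^bsub>Q\<^esub> \<in> carrier Q" using coset_closed[of "\<zero>\<^bsub>M\<^esub>"] coset_zero by simp
  next
    fix X assume "X \<in> carrier Q"
    then obtain x where x: "x \<in> carrier M" "X = S +>\<^bsub>M\<^esub> x" unfolding quot_carrier by blast
    have "(S +>\<^bsub>M\<^esub> (\<ominus>\<^bsub>M\<^esub> x)) \<oplus>\<^bsub>Q\<^esub> X = \<zero>\<^bsub>Q\<^esub>"
      using x by (simp only: coset_add M.N.a_inv_closed M.N.l_neg coset_zero)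
    then show "\<exists>Y\<in>carrier Q. Y \<oplus>\<^bsub>Q\<^esub> X = \<zero>\<^bsub>Q\<^esub>" using x coset_closed by blast
    show "\<zero>\<^bsub>Q\<^esub> \<oplus>\<^bsub>Q\<^esub> X = X"
      using x coset_add[of "\<zero>\<^bsub>M\<^esub>" x] by (simp only: coset_zero M.N.l_zero M.N.zero_closed)
  next
    fix X Y assume "X \<in> carrier Q" "Y \<in> carrier Q"
    then obtain x y where x: "x \<in> carrier M" "X = S +>\<^bsub>M\<^esub> x" "y \<in> carrier M" "Y = S +>\<^bsub>M\<^esub> y"
      unfolding quot_carrier by blast
    then show "X \<oplus>\<^bsub>Q\<^esub> Y \<in> carrier Q" by (simp only: coset_add coset_closed M.N.a_closed)
    show "X \<oplus>\<^bsub>Q\<^esub> Y = Y \<oplus>\<^bsub>Q\<^esub> X" using x by (simp only: coset_add M.N.a_comm)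
    fix Z assume "Z \<in> carrier Q"
    then obtain z where z: "z \<in> carrier M" "Z = S +>\<^bsub>M\<^esub> z" unfolding quot_carrier by blast
    show "X \<oplus>\<^bsub>Q\<^esub> Y \<oplus>\<^bsub>Q\<^esub> Z = X \<oplus>\<^bsub>Q\<^esub> (Y \<oplus>\<^bsub>Q\<^esub> Z)"
      using x z by (simp only: coset_add M.N.a_assoc M.N.a_closed)
  qed
next
  fix b c X assume b: "b \<in> carrier B" "c \<in> carrier B" and "X \<in> carrier Q"
  then obtain x where x: "x \<in> carrier M" "X = S +>\<^bsub>M\<^esub> x" unfolding quot_carrier by blast
  show "(b \<oplus>\<^bsub>B\<^esub> c) \<odot>\<^bsub>Q\<^esub> X = b \<odot>\<^bsub>Q\<^esub> X \<oplus>\<^bsub>Q\<^esub> c \<odot>\<^bsub>Q\<^esub> X"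
    using x b by (simp only: coset_smult coset_add M.act_closed M.act_add_left M.B.a_closed)
  show "(b \<otimes>\<^bsub>B\<^esub> c) \<odot>\<^bsub>Q\<^esub> X = b \<odot>\<^bsub>Q\<^esub> (c \<odot>\<^bsub>Q\<^esub> X)"
    using x b by (simp only: coset_smult M.act_closed M.act_mult M.B.m_closed)
next
  fix X assume "X \<in> carrier Q"
  then obtain x where x: "x \<in> carrier M" "X = S +>\<^bsub>M\<^esub> x" unfolding quot_carrier by blast
  show "\<one>\<^bsub>B\<^esub> \<odot>\<^bsub>Q\<^esub> X = X" using x by (simp only: coset_smult M.act_one M.B.one_closed)
  fix b assume b: "b \<in> carrier B"
  show "b \<odot>\<^bsub>Q\<^esub> X \<in> carrier Q" using x b by (simp only: coset_smult coset_closed M.act_closed)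
next
  fix b X Y assume b: "b \<in> carrier B" and "X \<in> carrier Q" "Y \<in> carrier Q"
  then obtain x y where x: "x \<in> carrier M" "X = S +>\<^bsub>M\<^esub> x" "y \<in> carrier M" "Y = S +>\<^bsub>M\<^esub> y"
    unfolding quot_carrier by blast
  then show "b \<odot>\<^bsub>Q\<^esub> (X \<oplus>\<^bsub>Q\<^esub> Y) = b \<odot>\<^bsub>Q\<^esub> X \<oplus>\<^bsub>Q\<^esub> b \<odot>\<^bsub>Q\<^esub> Y"
    using b by (simp only: coset_smult coset_add M.act_closed M.act_add_right M.N.a_closed)
qed

lemma coset_hom: "(\<lambda>x. S +>\<^bsub>M\<^esub> x) \<in> lmod_hom B M Q"
  by (rule lmod_homI) (simp_all only: coset_closed coset_add coset_smult)

end

lemma (in left_module) kernel_submodule: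
  assumes P: "left_module B P" and h: "h \<in> lmod_hom B N P"
  shows "submodule {x \<in> carrier N. h x = \<zero>\<^bsub>P\<^esub>} B N"
proof -
  interpret P: left_module B P by fact
  note A = N.abelian_group_axioms P.N.abelian_group_axioms
  show ?thesis
    using lmod_hom_zero[OF h A] lmod_hom_inv[OF h A]
    by (intro submodule.intro N.add.subgroupI submodule_axioms.intro)
      (auto simp: act_closed lmod_hom_add[OF h] lmod_hom_smult[OF h] P.act_zero_right)
qed

lemma (in left_module) span_submodule:
  assumes "X \<subseteq> carrier N"
  shows "submodule (module_span B N X) B N" "X \<subseteq> module_span B N X"
proof -
  have "submodule (carrier N) B N"
    by (intro submodule.intro N.add.subgroupI submodule_axioms.intro)
      (auto simp: act_closed)
  \<comment> \<open>An intersection over the empty family would be the whole type, so a member of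
    the family has to be exhibited.\<close>
  then have ne: "{H. submodule H B N \<and> X \<subseteq> H} \<noteq> {}" using assms by auto
  have "subgroup (\<Inter>{H. submodule H B N \<and> X \<subseteq> H}) (add_monoid N)"
    by (rule N.add.subgroups_Inter) (use ne in \<open>auto simp: submodule_def\<close>)
  then show "submodule (module_span B N X) B N"
    unfolding module_span_def
    by (intro submodule.intro submodule_axioms.intro) (auto dest: submodule.smult_closed)
qed (auto simp: module_span_def)

text \<open>The module with generators \<open>I\<close> and relators \<open>R\<close>. Tensor powers
  and balanced tensor products are both instances, so existence and uniqueness of linear maps out of
  them are proved once, here.\<close>

locale presented =
  fixes k :: "('k, 'x) ring_scheme" and I :: "'i set" and R :: "('i \<Rightarrow> 'k) set"
  assumes ring: "ring k" and relators: "R \<subseteq> carrier (free_module k I)"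
begin

abbreviation "F \<equiv> free_module k I"
abbreviation "S \<equiv> module_span k F R"
abbreviation "T \<equiv> quot_module F S"
abbreviation "cls i \<equiv> S +>\<^bsub>F\<^esub> free_gen k i"

sublocale F: left_module k F by (rule free_module_left_module[OF ring])

sublocale quotient k F S
  by (intro quotient.intro quotient_axioms.intro F.span_submodule[OF relators] F.left_module_axioms)

lemma cls_closed: "i \<in> I \<Longrightarrow> cls i \<in> carrier T"
  by (intro coset_closed free_gen_closed ring)

text \<open>The kernel of the linear extension is a submodule containing the relators, hence it
  contains their span.\<close>

lemma free_ext_span:
  assumes "left_module k P" "\<phi> \<in> I \<rightarrow> carrier P" "\<And>r. r \<in> R \<Longrightarrow> free_ext k P \<phi> r = \<zero>\<^bsub>P\<^esub>"
    and "f \<in> S"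
  shows "free_ext k P \<phi> f = \<zero>\<^bsub>P\<^esub>"
proof -
  have "S \<subseteq> {x \<in> carrier F. free_ext k P \<phi> x = \<zero>\<^bsub>P\<^esub>}"
    unfolding module_span_def
    using F.kernel_submodule[OF assms(1) free_ext_hom[OF assms(1,2)]] assms(3) relators
    by (intro Inter_lower) auto
  then show ?thesis using assms(4) by auto
qed

text \<open>Representatives of a coset differ by an element of the span, where the linear extension
  vanishes; so the set inside \<open>tensor_lift\<close> is a singleton.\<close>

lemma lift_coset:
  assumes P: "left_module k P" and \<phi>: "\<phi> \<in> I \<rightarrow> carrier P"
    and z: "\<And>r. r \<in> R \<Longrightarrow> free_ext k P \<phi> r = \<zero>\<^bsub>P\<^esub>" and f: "f \<in> carrier F"
  shows "tensor_lift k P \<phi> (S +>\<^bsub>F\<^esub> f) = free_ext k P \<phi> f"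
proof -
  interpret P: left_module k P by fact
  note h = free_ext_hom[OF P \<phi>]
  have "free_ext k P \<phi> g = free_ext k P \<phi> f" if g: "g \<in> S +>\<^bsub>F\<^esub> f" for g
  proof -
    obtain s where s: "s \<in> S" "g = s \<oplus>\<^bsub>F\<^esub> f" using g unfolding a_r_coset_def' by blast
    then have "free_ext k P \<phi> g = free_ext k P \<phi> s \<oplus>\<^bsub>P\<^esub> free_ext k P \<phi> f"
      using f S.a_subset by (auto simp only: lmod_hom_add[OF h])
    then show ?thesis using free_ext_span[OF P \<phi> z s(1)] lmod_hom_closed[OF h f] by simp
  qed
  moreover have "f \<in> S +>\<^bsub>F\<^esub> f" using f by (rule S.a_rcos_self)
  ultimately have "free_ext k P \<phi> ` (S +>\<^bsub>F\<^esub> f) = {free_ext k P \<phi> f}" by blast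
  then show ?thesis by (simp add: tensor_lift_def)
qed

lemma lift_hom:
  assumes P: "left_module k P" and \<phi>: "\<phi> \<in> I \<rightarrow> carrier P"
    and z: "\<And>r. r \<in> R \<Longrightarrow> free_ext k P \<phi> r = \<zero>\<^bsub>P\<^esub>"
  shows "tensor_lift k P \<phi> \<in> lmod_hom k T P"
proof (rule lmod_homI)
  note h = free_ext_hom[OF P \<phi>]
  fix X assume "X \<in> carrier T"
  then obtain x where x: "x \<in> carrier F" "X = S +>\<^bsub>F\<^esub> x" unfolding quot_carrier by blast
  show "tensor_lift k P \<phi> X \<in> carrier P"
    using x lmod_hom_closed[OF h] by (simp only: lift_coset[OF P \<phi> z])
  { fix Y assume "Y \<in> carrier T"
    then obtain y where y: "y \<in> carrier F" "Y = S +>\<^bsub>F\<^esub> y" unfolding quot_carrier by blast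
    show "tensor_lift k P \<phi> (X \<oplus>\<^bsub>T\<^esub> Y) = tensor_lift k P \<phi> X \<oplus>\<^bsub>P\<^esub> tensor_lift k P \<phi> Y"
      using x y by (simp only: coset_add lift_coset[OF P \<phi> z] F.N.a_closed lmod_hom_add[OF h]) }
  fix b assume "b \<in> carrier k"
  then show "tensor_lift k P \<phi> (b \<odot>\<^bsub>T\<^esub> X) = b \<odot>\<^bsub>P\<^esub> tensor_lift k P \<phi> X"
    using x by (simp only: coset_smult lift_coset[OF P \<phi> z] F.act_closed lmod_hom_smult[OF h])
qed

lemma lift_cls:
  assumes P: "left_module k P" and \<phi>: "\<phi> \<in> I \<rightarrow> carrier P"
    and z: "\<And>r. r \<in> R \<Longrightarrow> free_ext k P \<phi> r = \<zero>\<^bsub>P\<^esub>" and i: "i \<in> I"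
  shows "tensor_lift k P \<phi> (cls i) = \<phi> i"
  using lift_coset[OF P \<phi> z free_gen_closed[OF ring i]] free_ext_gen[OF P \<phi> i] by simp

text \<open>Composition with the projection from the free module reduces the claim to uniqueness on
  generators.\<close>

lemma hom_unique:
  assumes P: "left_module k P" and h: "h \<in> lmod_hom k T P" "h' \<in> lmod_hom k T P"
    and "\<And>i. i \<in> I \<Longrightarrow> h (cls i) = h' (cls i)" "X \<in> carrier T"
  shows "h X = h' X"
proof -
  obtain x where x: "x \<in> carrier F" "X = S +>\<^bsub>F\<^esub> x" using assms(5) unfolding quot_carrier by blast
  have "h (S +>\<^bsub>F\<^esub> x) = h' (S +>\<^bsub>F\<^esub> x)"
    by (rule free_hom_unique[OF P lmod_hom_comp[OF coset_hom h(1)] lmod_hom_comp[OF coset_hom h(2)] assms(4) x(1)])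
  then show ?thesis using x by simp
qed

end

section \<open>Homology\<close>

definition chain_complex ::
    "('k, 'x) ring_scheme \<Rightarrow> (nat \<Rightarrow> ('k, 'c, 'y) module_scheme) \<Rightarrow> (nat \<Rightarrow> 'c \<Rightarrow> 'c) \<Rightarrow> bool" where
  "chain_complex k C d \<longleftrightarrow> (\<forall>n. left_module k (C n)) \<and> (\<forall>n. d n \<in> lmod_hom k (C (Suc n)) (C n)) \<and>
     (\<forall>n. \<forall>x\<in>carrier (C (Suc (Suc n))). d n (d (Suc n) x) = \<zero>\<^bsub>C n\<^esub>)"

definition chain_map ::
    "('k, 'x) ring_scheme \<Rightarrow> (nat \<Rightarrow> ('k, 'c, 'y) module_scheme) \<Rightarrow> (nat \<Rightarrow> 'c \<Rightarrow> 'c)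
      \<Rightarrow> (nat \<Rightarrow> ('k, 'e, 'z) module_scheme) \<Rightarrow> (nat \<Rightarrow> 'e \<Rightarrow> 'e) \<Rightarrow> (nat \<Rightarrow> 'c \<Rightarrow> 'e) \<Rightarrow> bool" where
  "chain_map k C d D d' f \<longleftrightarrow> (\<forall>n. f n \<in> lmod_hom k (C n) (D n)) \<and>
     (\<forall>n. \<forall>x\<in>carrier (C (Suc n)). d' n (f (Suc n) x) = f n (d n x))"

text \<open>The relation \<open>f = g + (d s + s d)\<close>; degree zero is separate because there
  is no differential leaving it. Linearity is imposed on \<open>s\<close> but not on
  \<open>f\<close> and \<open>g\<close>, so that operators satisfying a Leibniz rule can be compared
  as well.\<close>

definition chain_homotopic ::
    "('k, 'x) ring_scheme \<Rightarrow> (nat \<Rightarrow> ('k, 'c, 'y) module_scheme) \<Rightarrow> (nat \<Rightarrow> 'c \<Rightarrow> 'c)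
      \<Rightarrow> (nat \<Rightarrow> ('k, 'e, 'z) module_scheme) \<Rightarrow> (nat \<Rightarrow> 'e \<Rightarrow> 'e)
      \<Rightarrow> (nat \<Rightarrow> 'c \<Rightarrow> 'e) \<Rightarrow> (nat \<Rightarrow> 'c \<Rightarrow> 'e) \<Rightarrow> bool" where
  "chain_homotopic k C d D d' f g \<longleftrightarrow> (\<exists>s. (\<forall>n. s n \<in> lmod_hom k (C n) (D (Suc n))) \<and>
     (\<forall>x\<in>carrier (C 0). f 0 x = g 0 x \<oplus>\<^bsub>D 0\<^esub> d' 0 (s 0 x)) \<and>
     (\<forall>n. \<forall>x\<in>carrier (C (Suc n)). f (Suc n) x =
        g (Suc n) x \<oplus>\<^bsub>D (Suc n)\<^esub> (d' (Suc n) (s (Suc n) x) \<oplus>\<^bsub>D (Suc n)\<^esub> s n (d n x))))"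

lemma chain_complexD:
  assumes "chain_complex k C d"
  shows "left_module k (C n)" "d n \<in> lmod_hom k (C (Suc n)) (C n)"
    and "x \<in> carrier (C (Suc (Suc n))) \<Longrightarrow> d n (d (Suc n) x) = \<zero>\<^bsub>C n\<^esub>"
  using assms by (auto simp: chain_complex_def)

lemma chain_mapD:
  assumes "chain_map k C d D d' f"
  shows "f n \<in> lmod_hom k (C n) (D n)"
    and "x \<in> carrier (C (Suc n)) \<Longrightarrow> d' n (f (Suc n) x) = f n (d n x)"
  using assms by (auto simp: chain_map_def)

lemma chain_map_comp:
  assumes "chain_map k C d D d' f" "chain_map k D d' E d'' g"
  shows "chain_map k C d E d'' (\<lambda>n x. g n (f n x))"
  unfolding chain_map_def
  using lmod_hom_comp[OF chain_mapD(1)[OF assms(1)] chain_mapD(1)[OF assms(2)]]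
    lmod_hom_closed[OF chain_mapD(1)[OF assms(1)]] chain_mapD(2)[OF assms(1)] chain_mapD(2)[OF assms(2)]
  by simp

section \<open>Cycles, boundaries and homology as modules\<close>

lemma submodule_left_module:
  assumes M: "left_module B M" and S: "submodule S B M"
  shows "left_module B (M\<lparr>carrier := S\<rparr>)"
proof -
  interpret M: left_module B M by fact
  interpret S: submodule S B M by fact
  let ?S = "M\<lparr>carrier := S\<rparr>"
  have sub: "x \<in> carrier M" if "x \<in> S" for x using S.subset that by auto
  have add: "x \<oplus>\<^bsub>M\<^esub> y \<in> S" if "x \<in> S" "y \<in> S" for x y using S.m_closed[OF that] by simp
  have inv: "\<ominus>\<^bsub>M\<^esub> x \<in> S" if "x \<in> S" for x using S.m_inv_closed[OF that] by (simp add: a_inv_def)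
  have "abelian_group ?S"
  proof (rule abelian_groupI)
    fix x assume "x \<in> carrier ?S"
    then have x: "x \<in> S" by simp
    show "\<exists>y\<in>carrier ?S. y \<oplus>\<^bsub>?S\<^esub> x = \<zero>\<^bsub>?S\<^esub>"
      using inv[OF x] sub[OF x] by (intro bexI[of _ "\<ominus>\<^bsub>M\<^esub> x"]) (simp_all add: M.N.l_neg)
    show "\<zero>\<^bsub>?S\<^esub> \<oplus>\<^bsub>?S\<^esub> x = x" using sub[OF x] by simp
  next
    show "\<zero>\<^bsub>?S\<^esub> \<in> carrier ?S" using S.one_closed by simp
  qed (use sub add in \<open>simp_all add: M.N.a_ac\<close>)
  then show ?thesis
    by (rule left_moduleI[OF M.B.ring_axioms])
      (use sub in \<open>simp_all add: M.act_add_left M.act_add_right M.act_mult M.act_one\<close>)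
qed

lemma image_submodule:
  assumes M: "left_module B M" and N: "left_module B N" and h: "h \<in> lmod_hom B M N"
  shows "submodule (h ` carrier M) B N"
proof -
  interpret M: left_module B M by fact
  interpret N: left_module B N by fact
  have inv: "\<ominus>\<^bsub>N\<^esub> h x \<in> h ` carrier M" if "x \<in> carrier M" for x
    using lmod_hom_inv[OF h M.N.abelian_group_axioms N.N.abelian_group_axioms that] that
    by (metis M.N.a_inv_closed image_eqI)
  have add: "h x \<oplus>\<^bsub>N\<^esub> h y \<in> h ` carrier M" if "x \<in> carrier M" "y \<in> carrier M" for x y
    using lmod_hom_add[OF h that] that by (metis M.N.a_closed image_eqI)
  have act: "b \<odot>\<^bsub>N\<^esub> h x \<in> h ` carrier M" if "x \<in> carrier M" "b \<in> carrier B" for x b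
    using lmod_hom_smult[OF h that(2,1)] that by (metis M.act_closed image_eqI)
  show ?thesis
    by (intro submodule.intro N.N.add.subgroupI submodule_axioms.intro)
      (use inv add act lmod_hom_closed[OF h] M.N.zero_closed in \<open>auto simp del: M.N.zero_closed\<close>)
qed

lemma submodule_restrict:
  assumes "submodule S B M" "submodule S' B M" "S \<subseteq> S'" "left_module B M"
  shows "submodule S B (M\<lparr>carrier := S'\<rparr>)"
proof -
  interpret S: submodule S B M by fact
  interpret M: left_module B M by fact
  interpret S': left_module B "M\<lparr>carrier := S'\<rparr>" by (rule submodule_left_module) fact+
  have S'M: "S' \<subseteq> carrier M" using assms(2) submodule.axioms(1) subgroup.subset by fastforce
  \<comment> \<open>The negative in the restricted record is defined as an inverse found in
    \<open>S'\<close>, not as the negative of \<open>M\<close>; uniqueness of inverses identifies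
    the two.\<close>
  have inv: "\<ominus>\<^bsub>M\<lparr>carrier := S'\<rparr>\<^esub> x \<in> S" if x: "x \<in> S" for x
  proof -
    have y: "\<ominus>\<^bsub>M\<^esub> x \<in> S" using S.m_inv_closed[OF x] by (simp add: a_inv_def)
    moreover have "\<ominus>\<^bsub>M\<^esub> x \<oplus>\<^bsub>M\<lparr>carrier := S'\<rparr>\<^esub> x = \<zero>\<^bsub>M\<lparr>carrier := S'\<rparr>\<^esub>"
      using x assms(3) S'M by (auto simp: M.N.l_neg subset_iff)
    ultimately have "\<ominus>\<^bsub>M\<lparr>carrier := S'\<rparr>\<^esub> x = \<ominus>\<^bsub>M\<^esub> x"
      using x assms(3) by (intro S'.N.minus_equality) auto
    then show ?thesis using y by simp
  qed
  show ?thesis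
    by (intro submodule.intro S'.N.add.subgroupI submodule_axioms.intro)
      (use inv S.m_closed S.one_closed assms(3) in auto)
qed

context
  fixes k C d
  assumes C: "chain_complex k C d"
begin

lemma boundaries_submodule: "submodule (boundaries C d n) k (C n)"
  unfolding boundaries_def
  by (rule image_submodule) (rule chain_complexD(1)[OF C] chain_complexD(2)[OF C])+

lemma cycles_submodule: "submodule (cycles C d n) k (C n)"
proof (cases n)
  case 0
  \<comment> \<open>Every chain of degree zero is a cycle, and the full module is obtained as the
    image of the identity.\<close>
  have "submodule ((\<lambda>x. x) ` carrier (C 0)) k (C 0)"
    by (intro image_submodule lmod_hom_id chain_complexD[OF C])
  then show ?thesis by (simp add: 0 cycles_def)
next
  case (Suc m)
  interpret left_module k "C (Suc m)" by (rule chain_complexD[OF C])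
  show ?thesis unfolding Suc cycles_def nat.case
    by (rule kernel_submodule) (rule chain_complexD[OF C])+
qed

lemma cycles_closed: "z \<in> cycles C d n \<Longrightarrow> z \<in> carrier (C n)"
  by (auto simp: cycles_def split: nat.splits)

lemma boundaries_subset_cycles: "boundaries C d n \<subseteq> cycles C d n"
proof (cases n)
  case 0
  then show ?thesis
    using lmod_hom_closed[OF chain_complexD(2)[OF C, of 0]] by (auto simp: boundaries_def cycles_def)
next
  case (Suc m)
  then show ?thesis
    using lmod_hom_closed[OF chain_complexD(2)[OF C, of "Suc m"]] chain_complexD(3)[OF C]
    by (auto simp: boundaries_def cycles_def)
qed

lemma homology_quotient: "quotient k ((C n)\<lparr>carrier := cycles C d n\<rparr>) (boundaries C d n)"
  by (intro quotient.intro quotient_axioms.intro submodule_left_module submodule_restrict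
      chain_complexD[OF C] cycles_submodule boundaries_submodule boundaries_subset_cycles)

text \<open>Homology is formed in the record of cycles, which shares its addition with
  \<open>C n\<close>; its cosets can therefore be written as cosets in \<open>C n\<close>.\<close>

lemma homology_carrier:
  "X \<in> carrier (homology C d n) \<longleftrightarrow> (\<exists>z\<in>cycles C d n. X = boundaries C d n +>\<^bsub>C n\<^esub> z)"
  unfolding homology_def quotient.quot_carrier[OF homology_quotient] by (simp add: a_r_coset_def')

lemma homology_add:
  "\<lbrakk>y \<in> cycles C d n; z \<in> cycles C d n\<rbrakk> \<Longrightarrow>
    (boundaries C d n +>\<^bsub>C n\<^esub> y) \<oplus>\<^bsub>homology C d n\<^esub> (boundaries C d n +>\<^bsub>C n\<^esub> z)
      = boundaries C d n +>\<^bsub>C n\<^esub> (y \<oplus>\<^bsub>C n\<^esub> z)"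
  using quotient.coset_add[OF homology_quotient, of y n z]
  by (simp only: homology_def) (simp add: a_r_coset_def')

lemma homology_smult:
  "\<lbrakk>r \<in> carrier k; z \<in> cycles C d n\<rbrakk> \<Longrightarrow>
    r \<odot>\<^bsub>homology C d n\<^esub> (boundaries C d n +>\<^bsub>C n\<^esub> z) = boundaries C d n +>\<^bsub>C n\<^esub> (r \<odot>\<^bsub>C n\<^esub> z)"
  using quotient.coset_smult[OF homology_quotient, of r z n]
  by (simp only: homology_def) (simp add: a_r_coset_def')

lemma homologous:
  assumes "y \<in> carrier (C n)" "b \<in> boundaries C d n"
  shows "boundaries C d n +>\<^bsub>C n\<^esub> (y \<oplus>\<^bsub>C n\<^esub> b) = boundaries C d n +>\<^bsub>C n\<^esub> y"
proof -
  interpret left_module k "C n" by (rule chain_complexD[OF C])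
  interpret S: abelian_subgroup "boundaries C d n" "C n"
    by (rule submodule_abelian_subgroup[OF left_module_axioms boundaries_submodule])
  have "y \<oplus>\<^bsub>C n\<^esub> b = b \<oplus>\<^bsub>C n\<^esub> y" using assms S.a_subset by (intro N.a_comm) auto
  then have "y \<oplus>\<^bsub>C n\<^esub> b \<in> boundaries C d n +>\<^bsub>C n\<^esub> y"
    using assms unfolding a_r_coset_def' by blast
  then show ?thesis using assms(1) by (rule S.a_repr_independence'[symmetric])
qed

end

section \<open>Functoriality and homotopy invariance of homology\<close>

lemma chain_map_cycles:
  assumes C: "chain_complex k C d" and D: "chain_complex k D d'" and f: "chain_map k C d D d' f"
    and z: "z \<in> cycles C d n"
  shows "f n z \<in> cycles D d' n"
proof (cases n)
  case 0
  then show ?thesis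
    using z lmod_hom_closed[OF chain_mapD(1)[OF f]] by (auto simp: cycles_def)
next
  case (Suc m)
  have z': "z \<in> carrier (C (Suc m))" "d m z = \<zero>\<^bsub>C m\<^esub>" using z Suc by (auto simp: cycles_def)
  interpret C: left_module k "C m" by (rule chain_complexD[OF C])
  interpret D: left_module k "D m" by (rule chain_complexD[OF D])
  have "d' m (f (Suc m) z) = \<zero>\<^bsub>D m\<^esub>"
    using chain_mapD[OF f] z' lmod_hom_zero[OF chain_mapD(1)[OF f] C.N.abelian_group_axioms D.N.abelian_group_axioms]
    by simp
  then show ?thesis using z' lmod_hom_closed[OF chain_mapD(1)[OF f]] Suc by (auto simp: cycles_def)
qed

lemma homology_map_class:
  assumes C: "chain_complex k C d" and D: "chain_complex k D d'" and f: "chain_map k C d D d' f"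
    and z: "z \<in> cycles C d n"
  shows "homology_map D d' f n (boundaries C d n +>\<^bsub>C n\<^esub> z) = boundaries D d' n +>\<^bsub>D n\<^esub> f n z"
proof -
  note f' = chain_mapD(1)[OF f, of n]
  \<comment> \<open>Boundaries go to boundaries, which is what makes the map on cosets well
    defined.\<close>
  have bd: "f n ` boundaries C d n \<subseteq> boundaries D d' n"
    using chain_mapD(2)[OF f, symmetric] lmod_hom_closed[OF chain_mapD(1)[OF f]]
    unfolding boundaries_def by blast
  show ?thesis unfolding homology_map_def
    by (intro coset_map_coset bd submodule_abelian_subgroup[where B = k] boundaries_submodule
        chain_complexD[OF C] chain_complexD[OF D] C D)
      (use f' lmod_hom_closed[OF f'] lmod_hom_add[OF f'] cycles_closed[OF C z] in auto)
qed

lemma homology_map_hom: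
  assumes C: "chain_complex k C d" and D: "chain_complex k D d'" and f: "chain_map k C d D d' f"
  shows "homology_map D d' f n \<in> lmod_hom k (homology C d n) (homology D d' n)"
proof (rule lmod_homI)
  note f' = chain_mapD(1)[OF f, of n] and c = chain_map_cycles[OF C D f] and m = homology_map_class[OF C D f]
  note cc = cycles_closed[OF C]
  interpret Z: left_module k "(C n)\<lparr>carrier := cycles C d n\<rparr>"
    by (intro submodule_left_module chain_complexD[OF C] cycles_submodule[OF C])
  fix X assume "X \<in> carrier (homology C d n)"
  then obtain x where x: "x \<in> cycles C d n" "X = boundaries C d n +>\<^bsub>C n\<^esub> x"
    unfolding homology_carrier[OF C] by blast
  show "homology_map D d' f n X \<in> carrier (homology D d' n)"
    using x c m unfolding homology_carrier[OF D] by blast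
  { fix Y assume "Y \<in> carrier (homology C d n)"
    then obtain y where y: "y \<in> cycles C d n" "Y = boundaries C d n +>\<^bsub>C n\<^esub> y"
      unfolding homology_carrier[OF C] by blast
    have xy: "x \<oplus>\<^bsub>C n\<^esub> y \<in> cycles C d n" using Z.N.a_closed[of x y] x y by simp
    show "homology_map D d' f n (X \<oplus>\<^bsub>homology C d n\<^esub> Y)
        = homology_map D d' f n X \<oplus>\<^bsub>homology D d' n\<^esub> homology_map D d' f n Y"
      using x y xy by (simp only: homology_add[OF C] homology_add[OF D] m c lmod_hom_add[OF f'] cc) }
  fix r assume r: "r \<in> carrier k"
  have rx: "r \<odot>\<^bsub>C n\<^esub> x \<in> cycles C d n" using Z.act_closed[of r x] x r by simp
  show "homology_map D d' f n (r \<odot>\<^bsub>homology C d n\<^esub> X)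
        = r \<odot>\<^bsub>homology D d' n\<^esub> homology_map D d' f n X"
    using x r rx by (simp only: homology_smult[OF C] homology_smult[OF D] m c lmod_hom_smult[OF f'] cc)
qed

text \<open>On a cycle the term \<open>s d\<close> vanishes, so the two values differ by the
  boundary of \<open>s z\<close>.\<close>

lemma homotopic_homologous:
  assumes C: "chain_complex k C d" and D: "chain_complex k D d'"
    and f: "chain_homotopic k C d D d' f g" and g: "g n \<in> lmod_hom k (C n) (D n)"
    and z: "z \<in> cycles C d n"
  shows "boundaries D d' n +>\<^bsub>D n\<^esub> f n z = boundaries D d' n +>\<^bsub>D n\<^esub> g n z"
proof -
  obtain s where s: "\<And>n. s n \<in> lmod_hom k (C n) (D (Suc n))"
    "\<And>x. x \<in> carrier (C 0) \<Longrightarrow> f 0 x = g 0 x \<oplus>\<^bsub>D 0\<^esub> d' 0 (s 0 x)"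
    "\<And>n x. x \<in> carrier (C (Suc n)) \<Longrightarrow> f (Suc n) x =
        g (Suc n) x \<oplus>\<^bsub>D (Suc n)\<^esub> (d' (Suc n) (s (Suc n) x) \<oplus>\<^bsub>D (Suc n)\<^esub> s n (d n x))"
    using f unfolding chain_homotopic_def by blast
  have z': "z \<in> carrier (C n)" using z by (rule cycles_closed[OF C])
  have b: "d' n (s n z) \<in> boundaries D d' n"
    using z' lmod_hom_closed[OF s(1)] by (auto simp: boundaries_def)
  have "f n z = g n z \<oplus>\<^bsub>D n\<^esub> d' n (s n z)"
  proof (cases n)
    case 0
    then show ?thesis using s(2) z' by simp
  next
    case (Suc m)
    interpret C: left_module k "C m" by (rule chain_complexD[OF C])
    interpret D: left_module k "D (Suc m)" by (rule chain_complexD[OF D])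
    have "s m (d m z) = \<zero>\<^bsub>D (Suc m)\<^esub>"
      using lmod_hom_zero[OF s(1) C.N.abelian_group_axioms D.N.abelian_group_axioms] z Suc
      by (auto simp: cycles_def)
    moreover have "d' (Suc m) (s (Suc m) z) \<in> carrier (D (Suc m))"
      using z' Suc by (auto intro!: lmod_hom_closed[OF chain_complexD(2)[OF D]] lmod_hom_closed[OF s(1)])
    ultimately show ?thesis using s(3)[of z m] z' Suc by simp
  qed
  then show ?thesis
    using homologous[OF D lmod_hom_closed[OF g z'] b] by simp
qed

text \<open>Homotopy inverse chain maps become mutually inverse on homology classes, which gives
  bijectivity.\<close>

lemma homology_map_lmod_iso:
  assumes C: "chain_complex k C d" and D: "chain_complex k D d'"
    and f: "chain_map k C d D d' f" and g: "chain_map k D d' C d g"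
    and gf: "chain_homotopic k C d C d (\<lambda>n x. g n (f n x)) (\<lambda>n x. x)"
    and fg: "chain_homotopic k D d' D d' (\<lambda>n x. f n (g n x)) (\<lambda>n x. x)"
  shows "homology_map D d' f n \<in> lmod_iso k (homology C d n) (homology D d' n)"
proof -
  let ?f = "homology_map D d' f n" and ?g = "homology_map C d g n"
  note F = homology_map_hom[OF C D f, of n] and G = homology_map_hom[OF D C g, of n]
  have gf': "?g (?f X) = X" if "X \<in> carrier (homology C d n)" for X
    using that homotopic_homologous[OF C C gf lmod_hom_id] chain_map_cycles[OF C D f]
    unfolding homology_carrier[OF C] by (auto simp: homology_map_class[OF C D f] homology_map_class[OF D C g])
  have fg': "?f (?g X) = X" if "X \<in> carrier (homology D d' n)" for X
    using that homotopic_homologous[OF D D fg lmod_hom_id] chain_map_cycles[OF D C g]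
    unfolding homology_carrier[OF D] by (auto simp: homology_map_class[OF C D f] homology_map_class[OF D C g])
  have "bij_betw ?f (carrier (homology C d n)) (carrier (homology D d' n))"
    by (rule bij_betw_byWitness[where f' = ?g])
      (use gf' fg' lmod_hom_closed[OF F] lmod_hom_closed[OF G] in auto)
  then show ?thesis using F by (simp add: lmod_iso_def)
qed

section \<open>Composition of homotopies with chain maps\<close>

lemma chain_homotopic_precomp:
  assumes "chain_homotopic k D d' E d'' f g" "chain_map k C d D d' a"
  shows "chain_homotopic k C d E d'' (\<lambda>n x. f n (a n x)) (\<lambda>n x. g n (a n x))"
proof -
  obtain s where s: "\<And>n. s n \<in> lmod_hom k (D n) (E (Suc n))"
    "\<And>x. x \<in> carrier (D 0) \<Longrightarrow> f 0 x = g 0 x \<oplus>\<^bsub>E 0\<^esub> d'' 0 (s 0 x)"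
    "\<And>n x. x \<in> carrier (D (Suc n)) \<Longrightarrow> f (Suc n) x =
        g (Suc n) x \<oplus>\<^bsub>E (Suc n)\<^esub> (d'' (Suc n) (s (Suc n) x) \<oplus>\<^bsub>E (Suc n)\<^esub> s n (d' n x))"
    using assms(1) unfolding chain_homotopic_def by blast
  note a = chain_mapD[OF assms(2)]
  show ?thesis unfolding chain_homotopic_def
    by (rule exI[of _ "\<lambda>n x. s n (a n x)"])
      (simp add: lmod_hom_comp[OF a(1) s(1)] s(2,3) lmod_hom_closed[OF a(1)] a(2))
qed

text \<open>The map \<open>b\<close> is distributed over the sum in the homotopy relation. Being
  additive on the carrier only, it needs every summand to lie there, which is the purpose of the
  closure assumptions.\<close>

lemma chain_homotopic_postcomp:
  assumes "chain_homotopic k C d D d' f g" "chain_map k D d' E d'' b"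
    and C: "chain_complex k C d" and D: "chain_complex k D d'"
    and g: "\<And>n x. x \<in> carrier (C n) \<Longrightarrow> g n x \<in> carrier (D n)"
  shows "chain_homotopic k C d E d'' (\<lambda>n x. b n (f n x)) (\<lambda>n x. b n (g n x))"
proof -
  obtain s where s: "\<And>n. s n \<in> lmod_hom k (C n) (D (Suc n))"
    "\<And>x. x \<in> carrier (C 0) \<Longrightarrow> f 0 x = g 0 x \<oplus>\<^bsub>D 0\<^esub> d' 0 (s 0 x)"
    "\<And>n x. x \<in> carrier (C (Suc n)) \<Longrightarrow> f (Suc n) x =
        g (Suc n) x \<oplus>\<^bsub>D (Suc n)\<^esub> (d' (Suc n) (s (Suc n) x) \<oplus>\<^bsub>D (Suc n)\<^esub> s n (d n x))"
    using assms(1) unfolding chain_homotopic_def by blast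
  note b = chain_mapD[OF assms(2)]
  note cl = lmod_hom_closed[OF s(1)] lmod_hom_closed[OF chain_complexD(2)[OF D]]
    lmod_hom_closed[OF chain_complexD(2)[OF C]]
  have ac: "x \<oplus>\<^bsub>D n\<^esub> y \<in> carrier (D n)" if "x \<in> carrier (D n)" "y \<in> carrier (D n)" for n x y
    using chain_complexD(1)[OF D, of n] that
    by (auto simp: left_module_def abelian_group_def abelian_monoid.a_closed)
  show ?thesis unfolding chain_homotopic_def
    by (rule exI[of _ "\<lambda>n x. b (Suc n) (s n x)"])
      (simp add: lmod_hom_comp[OF s(1) b(1)] s(2,3) lmod_hom_add[OF b(1)] cl g ac b(2))
qed

lemma chain_homotopic_cong:
  assumes "chain_homotopic k C d D d' f g"
    and "\<And>n x. x \<in> carrier (C n) \<Longrightarrow> f' n x = f n x" "\<And>n x. x \<in> carrier (C n) \<Longrightarrow> g' n x = g n x"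
  shows "chain_homotopic k C d D d' f' g'"
  using assms by (simp add: chain_homotopic_def)

section \<open>Projective resolutions\<close>

lemma (in abelian_group) minus_eq_imp_eq_plus:
  assumes "x \<ominus> y = z" "x \<in> carrier G" "y \<in> carrier G"
  shows "x = y \<oplus> z"
  using assms by (auto simp: a_minus_def a_lcomm r_neg)

text \<open>Recovers the lifting property from the definition by retracts: preimages under
  \<open>g\<close> are chosen for the images of the free generators, extended linearly, and
  precomposed with the section \<open>s\<close>. The condition is containment of images because
  \<open>g\<close> will be a differential, whose image is known by exactness.\<close>

lemma projective_lifting:
  assumes P: "projective_module B P" and X: "left_module B X" and Y: "left_module B Y"
    and g: "g \<in> lmod_hom B X Y" and f: "f \<in> lmod_hom B P Y" and im: "f ` carrier P \<subseteq> g ` carrier X"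
  shows "\<exists>h\<in>lmod_hom B P X. \<forall>x\<in>carrier P. g (h x) = f x"
proof -
  obtain I :: "'c set" and s r where s: "s \<in> lmod_hom B P (free_module B I)"
    and r: "r \<in> lmod_hom B (free_module B I) P" and rs: "\<And>x. x \<in> carrier P \<Longrightarrow> r (s x) = x"
    using P unfolding projective_module_def by blast
  have B: "ring B" using X by (simp add: left_module_def)
  have "\<exists>x. x \<in> carrier X \<and> g x = f (r (free_gen B i))" if "i \<in> I" for i
    using im lmod_hom_closed[OF r free_gen_closed[OF B that]] by fastforce
  then obtain x where x: "\<And>i. i \<in> I \<Longrightarrow> x i \<in> carrier X" "\<And>i. i \<in> I \<Longrightarrow> g (x i) = f (r (free_gen B i))"
    by metis
  have xI: "x \<in> I \<rightarrow> carrier X" using x by auto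
  let ?e = "free_ext B X x"
  have e: "?e \<in> lmod_hom B (free_module B I) X" by (rule free_ext_hom[OF X xI])
  have "g (?e u) = f (r u)" if u: "u \<in> carrier (free_module B I)" for u
    by (rule free_hom_unique[OF Y lmod_hom_comp[OF e g] lmod_hom_comp[OF r f] _ u])
      (simp add: free_ext_gen[OF X xI] x)
  then show ?thesis
    using rs lmod_hom_closed[OF s] by (intro bexI[OF _ lmod_hom_comp[OF s e]]) auto
qed

lemma projective_resolutionD:
  assumes "projective_resolution B N Q d \<eta>"
  shows "projective_module B (Q n)" "left_module B (Q n)" "d n \<in> lmod_hom B (Q (Suc n)) (Q n)"
    and "\<eta> \<in> lmod_hom B (Q 0) N" "\<eta> ` carrier (Q 0) = carrier N"
    and "\<lbrakk>x \<in> carrier (Q 0); \<eta> x = \<zero>\<^bsub>N\<^esub>\<rbrakk> \<Longrightarrow> x \<in> d 0 ` carrier (Q (Suc 0))"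
    and "\<lbrakk>x \<in> carrier (Q (Suc n)); d n x = \<zero>\<^bsub>Q n\<^esub>\<rbrakk> \<Longrightarrow> x \<in> d (Suc n) ` carrier (Q (Suc (Suc n)))"
    and "x \<in> carrier (Q (Suc 0)) \<Longrightarrow> \<eta> (d 0 x) = \<zero>\<^bsub>N\<^esub>"
    and "x \<in> carrier (Q (Suc (Suc n))) \<Longrightarrow> d n (d (Suc n) x) = \<zero>\<^bsub>Q n\<^esub>"
proof -
  note r = assms[unfolded projective_resolution_def]
  show "projective_module B (Q n)" using r by blast
  then show "left_module B (Q n)" by (simp add: projective_module_def)
  show "d n \<in> lmod_hom B (Q (Suc n)) (Q n)" "\<eta> \<in> lmod_hom B (Q 0) N" "\<eta> ` carrier (Q 0) = carrier N"
    using r by blast+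
  have 0: "{x \<in> carrier (Q 0). \<eta> x = \<zero>\<^bsub>N\<^esub>} = d 0 ` carrier (Q (Suc 0))"
    using r by (simp add: boundaries_def)
  have S: "{x \<in> carrier (Q (Suc n)). d n x = \<zero>\<^bsub>Q n\<^esub>} = d (Suc n) ` carrier (Q (Suc (Suc n)))"
    using r by (simp add: boundaries_def cycles_def)
  show "\<lbrakk>x \<in> carrier (Q 0); \<eta> x = \<zero>\<^bsub>N\<^esub>\<rbrakk> \<Longrightarrow> x \<in> d 0 ` carrier (Q (Suc 0))"
    "x \<in> carrier (Q (Suc 0)) \<Longrightarrow> \<eta> (d 0 x) = \<zero>\<^bsub>N\<^esub>"
    using 0 by blast+
  show "\<lbrakk>x \<in> carrier (Q (Suc n)); d n x = \<zero>\<^bsub>Q n\<^esub>\<rbrakk> \<Longrightarrow> x \<in> d (Suc n) ` carrier (Q (Suc (Suc n)))"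
    "x \<in> carrier (Q (Suc (Suc n))) \<Longrightarrow> d n (d (Suc n) x) = \<zero>\<^bsub>Q n\<^esub>"
    using S by blast+
qed

lemma projective_resolution_complex:
  assumes "projective_resolution B N Q d \<eta>"
  shows "chain_complex B Q d"
  unfolding chain_complex_def
  using projective_resolutionD(2,3,9)[OF assms] by (intro conjI allI ballI)

text \<open>The classical degreewise construction of a homotopy uses the maps only through their
  difference. Hence \<open>f\<close> and \<open>g\<close> need to commute with the differentials and
  augmentations, while linearity is demanded of \<open>f n - g n\<close>. This covers both the
  homotopies between comparison maps and the homotopy between two operators with the same Leibniz
  defect.\<close>

lemma projective_resolution_homotopic:
  assumes P: "projective_resolution B N P d \<epsilon>" and Q: "projective_resolution B N Q d' \<eta>"
    and N: "left_module B N"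
    and f: "\<And>n x. x \<in> carrier (P n) \<Longrightarrow> f n x \<in> carrier (Q n)"
      "\<And>n x. x \<in> carrier (P (Suc n)) \<Longrightarrow> d' n (f (Suc n) x) = f n (d n x)"
    and g: "\<And>n x. x \<in> carrier (P n) \<Longrightarrow> g n x \<in> carrier (Q n)"
      "\<And>n x. x \<in> carrier (P (Suc n)) \<Longrightarrow> d' n (g (Suc n) x) = g n (d n x)"
    and fg: "\<And>n. (\<lambda>x. f n x \<ominus>\<^bsub>Q n\<^esub> g n x) \<in> lmod_hom B (P n) (Q n)"
    and aug: "\<And>x. x \<in> carrier (P 0) \<Longrightarrow> \<eta> (f 0 x) = \<eta> (g 0 x)"
  shows "chain_homotopic B P d Q d' f g"
proof -
  define u where "u n x = f n x \<ominus>\<^bsub>Q n\<^esub> g n x" for n x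
  note PD = projective_resolutionD[OF P] and QD = projective_resolutionD[OF Q]
  note dP = lmod_hom_closed[OF PD(3)] and dQ = lmod_hom_closed[OF QD(3)]
  have Qn: "abelian_group (Q n)" "abelian_group (P n)" "abelian_group N" for n
    using QD(2) PD(2) N by (auto simp: left_module_def)
  note Q0 = abelian_group.minus_closed[OF Qn(1)]
  have u: "u n \<in> lmod_hom B (P n) (Q n)" for n using fg[of n] unfolding u_def[abs_def] .
  note uc = lmod_hom_closed[OF u]
  have ud: "d' n (u (Suc n) x) = u n (d n x)" if "x \<in> carrier (P (Suc n))" for n x
    using that f g by (simp add: u_def lmod_hom_minus[OF QD(3) Qn(1) Qn(1)])
  have diag: "x \<ominus>\<^bsub>Q n\<^esub> x = \<zero>\<^bsub>Q n\<^esub>" if "x \<in> carrier (Q n)" for n x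
    using that abelian_group.r_neg[OF Qn(1)] by (simp add: a_minus_def)
  have Nm: "left_module B N" by fact
  \<comment> \<open>\<open>?R\<close> is the homotopy relation linking consecutive degrees. The last
    clause of \<open>?I\<close> says that the element to be lifted next is a cycle, so exactness
    supplies preimages; the clause guarded by \<open>n = 0\<close> records the relation in degree
    zero, which has no predecessor.\<close>
  let ?R = "\<lambda>n s s'. \<forall>x\<in>carrier (P (Suc n)). d' (Suc n) (s' x) = u (Suc n) x \<ominus>\<^bsub>Q (Suc n)\<^esub> s (d n x)"
  let ?I = "\<lambda>n s. s \<in> lmod_hom B (P n) (Q (Suc n)) \<and>
      (n = 0 \<longrightarrow> (\<forall>x\<in>carrier (P 0). d' 0 (s x) = u 0 x)) \<and>
      (\<forall>x\<in>carrier (P (Suc n)). d' n (u (Suc n) x \<ominus>\<^bsub>Q (Suc n)\<^esub> s (d n x)) = \<zero>\<^bsub>Q n\<^esub>)"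
  have "\<exists>s. \<forall>n. ?I n (s n) \<and> ?R n (s n) (s (Suc n))"
  proof (rule dependent_nat_choice)
    \<comment> \<open>Equality over the augmentation puts \<open>u 0 x\<close> into the kernel of
      \<open>\<eta>\<close>, hence into the image of the first differential.\<close>
    have "u 0 ` carrier (P 0) \<subseteq> d' 0 ` carrier (Q (Suc 0))"
    proof (rule image_subsetI)
      fix x assume x: "x \<in> carrier (P 0)"
      interpret N: left_module B N by fact
      have "\<eta> (u 0 x) = \<eta> (f 0 x) \<ominus>\<^bsub>N\<^esub> \<eta> (g 0 x)"
        unfolding u_def using x f(1) g(1) by (intro lmod_hom_minus[OF QD(4) Qn(1,3)])
      also have "\<dots> = \<zero>\<^bsub>N\<^esub>" using aug[OF x] lmod_hom_closed[OF QD(4) g(1)[OF x]]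
        by (simp add: a_minus_def N.N.r_neg)
      finally show "u 0 x \<in> d' 0 ` carrier (Q (Suc 0))" by (rule QD(6)[OF uc[OF x]])
    qed
    then obtain s where s: "s \<in> lmod_hom B (P 0) (Q (Suc 0))" "\<And>x. x \<in> carrier (P 0) \<Longrightarrow> d' 0 (s x) = u 0 x"
      using projective_lifting[OF PD(1)[of 0] QD(2)[of "Suc 0"] QD(2)[of 0] QD(3)[of 0] u[of 0]] by blast
    have "d' 0 (u (Suc 0) x \<ominus>\<^bsub>Q (Suc 0)\<^esub> s (d 0 x)) = \<zero>\<^bsub>Q 0\<^esub>" if x: "x \<in> carrier (P (Suc 0))" for x
      using x dP uc lmod_hom_closed[OF s(1)]
      by (simp add: lmod_hom_minus[OF QD(3) Qn(1) Qn(1)] s(2) ud diag)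
    then show "\<exists>s. ?I 0 s" using s by blast
  next
    fix s n assume "?I n s"
    then have s: "s \<in> lmod_hom B (P n) (Q (Suc n))"
      and z: "\<And>x. x \<in> carrier (P (Suc n)) \<Longrightarrow> d' n (u (Suc n) x \<ominus>\<^bsub>Q (Suc n)\<^esub> s (d n x)) = \<zero>\<^bsub>Q n\<^esub>"
      by blast+
    note sc = lmod_hom_closed[OF s]
    let ?v = "\<lambda>x. u (Suc n) x \<ominus>\<^bsub>Q (Suc n)\<^esub> s (d n x)"
    have v: "?v \<in> lmod_hom B (P (Suc n)) (Q (Suc n))"
      by (intro lmod_hom_diff QD(2) u lmod_hom_comp[OF PD(3) s])
    have "?v ` carrier (P (Suc n)) \<subseteq> d' (Suc n) ` carrier (Q (Suc (Suc n)))"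
      using QD(7) z lmod_hom_closed[OF v] by blast
    then obtain s' where s': "s' \<in> lmod_hom B (P (Suc n)) (Q (Suc (Suc n)))"
      "\<And>x. x \<in> carrier (P (Suc n)) \<Longrightarrow> d' (Suc n) (s' x) = ?v x"
      using projective_lifting[OF PD(1)[of "Suc n"] QD(2)[of "Suc (Suc n)"] QD(2)[of "Suc n"] QD(3)[of "Suc n"] v]
      by blast
    \<comment> \<open>Here \<open>d' s' d = u d - s d d = u d\<close>, since \<open>d d = 0\<close>;
      and \<open>d' u = u d\<close>, so the difference is annihilated.\<close>
    have "d' (Suc n) (u (Suc (Suc n)) x \<ominus>\<^bsub>Q (Suc (Suc n))\<^esub> s' (d (Suc n) x)) = \<zero>\<^bsub>Q (Suc n)\<^esub>"
      if x: "x \<in> carrier (P (Suc (Suc n)))" for x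
    proof -
      have "s (d n (d (Suc n) x)) = \<zero>\<^bsub>Q (Suc n)\<^esub>"
        using lmod_hom_zero[OF s Qn(2,1)] PD(9)[OF x] by simp
      moreover have "\<ominus>\<^bsub>Q (Suc n)\<^esub> \<zero>\<^bsub>Q (Suc n)\<^esub> = \<zero>\<^bsub>Q (Suc n)\<^esub>"
        using Qn(1) by (simp add: abelian_group.minus_equality abelian_monoid.l_zero abelian_monoid.zero_closed abelian_group.axioms)
      ultimately show ?thesis
        using x dP uc lmod_hom_closed[OF s'(1)] abelian_monoid.r_zero[OF abelian_group.axioms(1)[OF Qn(1)]]
        by (simp add: lmod_hom_minus[OF QD(3) Qn(1) Qn(1)] s'(2) ud diag)
          (simp add: a_minus_def abelian_group.r_neg[OF Qn(1)])
    qed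
    then show "\<exists>s'. ?I (Suc n) s' \<and> ?R n s s'" using s' by blast
  qed
  then obtain s where s0: "\<forall>n. ?I n (s n) \<and> ?R n (s n) (s (Suc n))" by (elim exE)
  have s: "?I n (s n)" "?R n (s n) (s (Suc n))" for n
    using spec[OF s0, of n] by (rule conjunct1, rule conjunct2)
  have sc: "s n x \<in> carrier (Q (Suc n))" if "x \<in> carrier (P n)" for n x
    using s(1)[of n] that by (auto dest: lmod_hom_closed)
  show ?thesis unfolding chain_homotopic_def
  proof (intro exI[of _ s] conjI allI ballI)
    fix n show "s n \<in> lmod_hom B (P n) (Q (Suc n))" using s(1)[of n] by (rule conjunct1)
  next
    fix x assume x: "x \<in> carrier (P 0)"
    have "f 0 x \<ominus>\<^bsub>Q 0\<^esub> g 0 x = d' 0 (s 0 x)" using s(1)[of 0] x by (simp add: u_def)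
    then show "f 0 x = g 0 x \<oplus>\<^bsub>Q 0\<^esub> d' 0 (s 0 x)"
      by (rule abelian_group.minus_eq_imp_eq_plus[OF Qn(1) _ f(1)[OF x] g(1)[OF x]])
  next
    fix n x assume x: "x \<in> carrier (P (Suc n))"
    have c: "s n (d n x) \<in> carrier (Q (Suc n))" "u (Suc n) x \<in> carrier (Q (Suc n))"
      using sc dP uc x by blast+
    have "u (Suc n) x \<ominus>\<^bsub>Q (Suc n)\<^esub> s n (d n x) = d' (Suc n) (s (Suc n) x)"
      using s(2)[of n] x by simp
    then have "u (Suc n) x = s n (d n x) \<oplus>\<^bsub>Q (Suc n)\<^esub> d' (Suc n) (s (Suc n) x)"
      by (rule abelian_group.minus_eq_imp_eq_plus[OF Qn(1) _ c(2,1)])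
    also have "\<dots> = d' (Suc n) (s (Suc n) x) \<oplus>\<^bsub>Q (Suc n)\<^esub> s n (d n x)"
      by (rule abelian_monoid.a_comm[OF abelian_group.axioms(1)[OF Qn(1)] c(1) dQ[OF sc[OF x]]])
    finally show "f (Suc n) x = g (Suc n) x \<oplus>\<^bsub>Q (Suc n)\<^esub> (d' (Suc n) (s (Suc n) x) \<oplus>\<^bsub>Q (Suc n)\<^esub> s n (d n x))"
      unfolding u_def by (rule abelian_group.minus_eq_imp_eq_plus[OF Qn(1) _ f(1)[OF x] g(1)[OF x]])
  qed
qed

text \<open>A map in degree \<open>Suc n\<close> exists as soon as \<open>h d\<close> lands in the
  image of \<open>d'\<close>; this condition is therefore carried along as the last clause of
  \<open>?I\<close>.\<close>

lemma comparison_map_exists: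
  assumes P: "projective_resolution B N P d \<epsilon>" and Q: "projective_resolution B N Q d' \<eta>"
    and N: "left_module B N"
  shows "\<exists>\<phi>. comparison_map B P d \<epsilon> Q d' \<eta> \<phi>"
proof -
  note PD = projective_resolutionD[OF P] and QD = projective_resolutionD[OF Q]
  note dP = lmod_hom_closed[OF PD(3)]
  have Qn: "abelian_group (Q n)" "abelian_group (P n)" "abelian_group N" for n
    using QD(2) PD(2) N by (auto simp: left_module_def)
  let ?I = "\<lambda>n h. h \<in> lmod_hom B (P n) (Q n) \<and>
      (n = 0 \<longrightarrow> (\<forall>x\<in>carrier (P 0). \<eta> (h x) = \<epsilon> x)) \<and>
      (\<forall>x\<in>carrier (P (Suc n)). h (d n x) \<in> d' n ` carrier (Q (Suc n)))"
  let ?R = "\<lambda>n h h'. \<forall>x\<in>carrier (P (Suc n)). d' n (h' x) = h (d n x)"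
  have "\<exists>\<phi>. \<forall>n. ?I n (\<phi> n) \<and> ?R n (\<phi> n) (\<phi> (Suc n))"
  proof (rule dependent_nat_choice)
    obtain h where h: "h \<in> lmod_hom B (P 0) (Q 0)" "\<And>x. x \<in> carrier (P 0) \<Longrightarrow> \<eta> (h x) = \<epsilon> x"
      using projective_lifting[OF PD(1)[of 0] QD(2)[of 0] N QD(4) PD(4)] PD(5) QD(5) by auto
    then show "\<exists>h. ?I 0 h"
      using dP PD(8) lmod_hom_closed[OF h(1)] by (intro exI[of _ h]) (auto intro!: QD(6))
  next
    fix h n assume "?I n h"
    then have h: "h \<in> lmod_hom B (P n) (Q n)"
      and im: "\<And>x. x \<in> carrier (P (Suc n)) \<Longrightarrow> h (d n x) \<in> d' n ` carrier (Q (Suc n))" by blast+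
    obtain h' where h': "h' \<in> lmod_hom B (P (Suc n)) (Q (Suc n))"
      "\<And>x. x \<in> carrier (P (Suc n)) \<Longrightarrow> d' n (h' x) = h (d n x)"
      using projective_lifting[OF PD(1)[of "Suc n"] QD(2)[of "Suc n"] QD(2)[of n] QD(3)[of n] lmod_hom_comp[OF PD(3)[of n] h]] im
      by blast
    \<comment> \<open>\<open>d' h' d = h d d = 0\<close>, so exactness of \<open>Q\<close> yields
      the invariant one degree higher.\<close>
    have "h' (d (Suc n) x) \<in> d' (Suc n) ` carrier (Q (Suc (Suc n)))"
      if x: "x \<in> carrier (P (Suc (Suc n)))" for x
      using x dP lmod_hom_closed[OF h'(1)] h'(2) PD(9) lmod_hom_zero[OF h Qn(2,1)]
      by (intro QD(7)) auto
    then show "\<exists>h'. ?I (Suc n) h' \<and> ?R n h h'" using h' by blast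
  qed
  then obtain \<phi> where s0: "\<forall>n. ?I n (\<phi> n) \<and> ?R n (\<phi> n) (\<phi> (Suc n))" by (elim exE)
  have s: "?I n (\<phi> n)" "?R n (\<phi> n) (\<phi> (Suc n))" for n
    using spec[OF s0, of n] by (rule conjunct1, rule conjunct2)
  show ?thesis unfolding comparison_map_def
    by (intro exI[of _ \<phi>]) (use s in simp)
qed

section \<open>Tensor powers of an algebra\<close>

definition bilinear_map ::
    "('k, 'x) ring_scheme \<Rightarrow> ('k, 'm, 'y) module_scheme \<Rightarrow> ('k, 'n, 'z) module_scheme
      \<Rightarrow> ('k, 'w, 'v) module_scheme \<Rightarrow> ('m \<Rightarrow> 'n \<Rightarrow> 'w) \<Rightarrow> bool" where
  "bilinear_map k M N W \<beta> \<longleftrightarrow> (\<forall>y\<in>carrier N. (\<lambda>x. \<beta> x y) \<in> lmod_hom k M W) \<and>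
     (\<forall>x\<in>carrier M. \<beta> x \<in> lmod_hom k N W)"

lemma bilinear_mapD:
  assumes "bilinear_map k M N W \<beta>"
  shows "y \<in> carrier N \<Longrightarrow> (\<lambda>x. \<beta> x y) \<in> lmod_hom k M W"
    and "x \<in> carrier M \<Longrightarrow> \<beta> x \<in> lmod_hom k N W"
  using assms by (simp_all add: bilinear_map_def)

lemma bilinear_map_closed:
  assumes "bilinear_map k M N W \<beta>" "x \<in> carrier M" "y \<in> carrier N"
  shows "\<beta> x y \<in> carrier W"
  using lmod_hom_closed[OF bilinear_mapD(2)[OF assms(1,2)] assms(3)] .

lemma bilinear_map_compose:
  assumes "bilinear_map k M N W \<beta>" "h \<in> lmod_hom k W V"
  shows "bilinear_map k M N V (\<lambda>x y. h (\<beta> x y))"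
  unfolding bilinear_map_def
  using lmod_hom_comp[OF bilinear_mapD(1)[OF assms(1)] assms(2)]
    lmod_hom_comp[OF bilinear_mapD(2)[OF assms(1)] assms(2)] by simp

lemma bilinear_map_arg1:
  assumes "bilinear_map k M N W \<beta>" "h \<in> lmod_hom k M' M"
  shows "bilinear_map k M' N W (\<lambda>x y. \<beta> (h x) y)"
  unfolding bilinear_map_def
  using lmod_hom_comp[OF assms(2) bilinear_mapD(1)[OF assms(1)]]
    bilinear_mapD(2)[OF assms(1) lmod_hom_closed[OF assms(2)]] by simp

lemma bilinear_map_arg2:
  assumes "bilinear_map k M N W \<beta>" "h \<in> lmod_hom k N' N"
  shows "bilinear_map k M N' W (\<lambda>x y. \<beta> x (h y))"
  unfolding bilinear_map_def
  using lmod_hom_comp[OF assms(2) bilinear_mapD(2)[OF assms(1)]]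
    bilinear_mapD(1)[OF assms(1) lmod_hom_closed[OF assms(2)]] by simp

lemma bilinear_map_plus:
  assumes "left_module k W" "bilinear_map k M N W \<beta>" "bilinear_map k M N W \<beta>'"
  shows "bilinear_map k M N W (\<lambda>x y. \<beta> x y \<oplus>\<^bsub>W\<^esub> \<beta>' x y)"
  unfolding bilinear_map_def
  using lmod_hom_plus[OF assms(1) bilinear_mapD(1)[OF assms(2)] bilinear_mapD(1)[OF assms(3)]]
    lmod_hom_plus[OF assms(1) bilinear_mapD(2)[OF assms(2)] bilinear_mapD(2)[OF assms(3)]] by blast

locale k_algebra =
  fixes k :: "('k, 'x) ring_scheme" and A :: "('k, 'a, 'y) module_scheme" (structure)
  assumes k_cring: "cring k" and k_alg: "assoc_algebra k A"
begin

sublocale A: assoc_algebra k A by (rule k_alg)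

sublocale Am: left_module k A
  by (rule module_left_module) (rule A.module_axioms)

lemma k_ring: "ring k" using k_cring by (simp add: cring_def)

lemma mult_left_hom: "a \<in> carrier A \<Longrightarrow> (\<lambda>c. a \<otimes> c) \<in> lmod_hom k A A"
  by (rule lmod_homI) (simp_all add: A.A.r_distr A.smult_mult_right)

lemma mult_right_hom: "a \<in> carrier A \<Longrightarrow> (\<lambda>c. c \<otimes> a) \<in> lmod_hom k A A"
  by (rule lmod_homI) (simp_all add: A.A.l_distr A.smult_mult_left)

section \<open>Tensor powers of the algebra as presented modules\<close>

definition tuples :: "nat \<Rightarrow> 'a list set" where
  "tuples n = {xs. length xs = n \<and> set xs \<subseteq> carrier A}"

lemma listset_tuples: "listset (map carrier (replicate n A)) = tuples n"
proof (induction n)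
  case (Suc n)
  then show ?case
    by (simp add: set_Cons_def) (auto simp: tuples_def length_Suc_conv)
qed (auto simp: tuples_def)

lemma tuples_update: "\<lbrakk>xs \<in> tuples n; c \<in> carrier A\<rbrakk> \<Longrightarrow> xs[i := c] \<in> tuples n"
  using set_update_subset_insert[of xs i c] by (auto simp: tuples_def)

lemma tuples_nth: "\<lbrakk>xs \<in> tuples n; i < n\<rbrakk> \<Longrightarrow> xs ! i \<in> carrier A"
  by (auto simp: tuples_def)

lemma tuples_length: "xs \<in> tuples n \<Longrightarrow> length xs = n"
  by (simp add: tuples_def)

lemma tuples_Cons: "x # xs \<in> tuples (Suc n) \<longleftrightarrow> x \<in> carrier A \<and> xs \<in> tuples n"
  by (auto simp: tuples_def)

lemma tuples_snoc: "xs @ [x] \<in> tuples (Suc n) \<longleftrightarrow> x \<in> carrier A \<and> xs \<in> tuples n"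
  by (auto simp: tuples_def)

lemma tuples_SucE:
  assumes "xs \<in> tuples (Suc n)"
  obtains x ys where "xs = x # ys" "x \<in> carrier A" "ys \<in> tuples n"
  using assms by (cases xs) (auto simp: tuples_def)

text \<open>The two families in \<open>tensor_rel\<close> for \<open>n\<close> equal factors,
  isolated from the span so that the tensor power becomes an instance of
  \<open>presented\<close>.\<close>

definition relators :: "nat \<Rightarrow> ('a list \<Rightarrow> 'k) set" where
  "relators n = (let F = free_module k (tuples n) in
    {free_gen k (xs[i := a \<oplus> b]) \<ominus>\<^bsub>F\<^esub> (free_gen k (xs[i := a]) \<oplus>\<^bsub>F\<^esub> free_gen k (xs[i := b]))
      | xs i a b. xs \<in> tuples n \<and> i < n \<and> a \<in> carrier A \<and> b \<in> carrier A} \<union>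
    {free_gen k (xs[i := r \<odot> a]) \<ominus>\<^bsub>F\<^esub> (r \<odot>\<^bsub>F\<^esub> free_gen k (xs[i := a]))
      | xs i a r. xs \<in> tuples n \<and> i < n \<and> a \<in> carrier A \<and> r \<in> carrier k})"

lemma tensor_rel_relators:
  "tensor_rel k (replicate n A) = module_span k (free_module k (tuples n)) (relators n)"
  unfolding tensor_rel_def relators_def tensor_free_def listset_tuples Let_def
  by (simp cong: conj_cong) (simp cong: rev_conj_cong)

lemma free_gen_tuples: "xs \<in> tuples n \<Longrightarrow> free_gen k xs \<in> carrier (free_module k (tuples n))"
  by (rule free_gen_closed[OF k_ring])

lemma presented_tuples: "presented k (tuples n) (relators n)"
proof (intro presented.intro k_ring subsetI)
  interpret F: left_module k "free_module k (tuples n)" by (rule free_module_left_module[OF k_ring])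
  fix r assume "r \<in> relators n"
  then show "r \<in> carrier (free_module k (tuples n))"
    unfolding relators_def Let_def
    by (elim UnE CollectE exE conjE)
      (simp_all only: F.N.minus_closed F.N.a_closed F.act_closed free_gen_tuples tuples_update
        Am.act_closed A.M.a_closed)
qed

lemma tensor_pow_eq:
  "tensor_pow k A n = quot_module (free_module k (tuples n)) (module_span k (free_module k (tuples n)) (relators n))"
  unfolding tensor_pow_def tensor_def tensor_rel_relators by (simp add: tensor_free_def listset_tuples[simplified])

lemma pure_pow_eq:
  "xs \<in> tuples n \<Longrightarrow> pure_pow k A xs
    = module_span k (free_module k (tuples n)) (relators n) +>\<^bsub>free_module k (tuples n)\<^esub> free_gen k xs"
  unfolding pure_pow_def pure_tensor_def tuples_length tensor_rel_relators
  by (simp add: tensor_free_def listset_tuples[simplified])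

lemma tensor_pow_left_module: "left_module k (tensor_pow k A n)"
proof -
  interpret presented k "tuples n" "relators n" by (rule presented_tuples)
  show ?thesis unfolding tensor_pow_eq by (rule quot_left_module)
qed

lemma tensor_pow_group: "abelian_group (tensor_pow k A n)"
  using tensor_pow_left_module by (simp add: left_module_def)

lemma pure_closed: "xs \<in> tuples n \<Longrightarrow> pure_pow k A xs \<in> carrier (tensor_pow k A n)"
  using presented.cls_closed[OF presented_tuples] by (simp add: pure_pow_eq tensor_pow_eq)

text \<open>Linearity in a slot is phrased by list update, in the same way as the relators. The
  closure clause covers \<open>n = 0\<close>, where there is no slot to vary.\<close>

definition multilinear :: "nat \<Rightarrow> ('k, 'w, 'z) module_scheme \<Rightarrow> ('a list \<Rightarrow> 'w) \<Rightarrow> bool" where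
  "multilinear n W f \<longleftrightarrow> (\<forall>xs\<in>tuples n. f xs \<in> carrier W) \<and>
     (\<forall>xs\<in>tuples n. \<forall>i<n. (\<lambda>c. f (xs[i := c])) \<in> lmod_hom k A W)"

lemma multilinearD:
  assumes "multilinear n W f" "xs \<in> tuples n"
  shows "f xs \<in> carrier W" "i < n \<Longrightarrow> (\<lambda>c. f (xs[i := c])) \<in> lmod_hom k A W"
  using assms by (simp_all add: multilinear_def)

lemma multilinear_pure: "multilinear n (tensor_pow k A n) (pure_pow k A)"
  unfolding multilinear_def
proof (intro conjI ballI allI impI lmod_homI)
  interpret p: presented k "tuples n" "relators n" by (rule presented_tuples)
  fix xs assume xs: "xs \<in> tuples n"
  then show "pure_pow k A xs \<in> carrier (tensor_pow k A n)" by (rule pure_closed)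
  fix i c assume i: "i < n" and c: "c \<in> carrier A"
  have u: "xs[i := c] \<in> tuples n" if "c \<in> carrier A" for c using xs that by (rule tuples_update)
  have g: "free_gen k (xs[i := c]) \<in> carrier p.F" if "c \<in> carrier A" for c
    using u[OF that] by (rule free_gen_tuples)
  show "pure_pow k A (xs[i := c]) \<in> carrier (tensor_pow k A n)" using u[OF c] by (rule pure_closed)
  { fix b assume b: "b \<in> carrier A"
    have "free_gen k (xs[i := c \<oplus> b]) \<ominus>\<^bsub>p.F\<^esub> (free_gen k (xs[i := c]) \<oplus>\<^bsub>p.F\<^esub> free_gen k (xs[i := b])) \<in> relators n"
      unfolding relators_def Let_def using xs i c b by blast
    then have "p.S +>\<^bsub>p.F\<^esub> free_gen k (xs[i := c \<oplus> b])
        = p.S +>\<^bsub>p.F\<^esub> (free_gen k (xs[i := c]) \<oplus>\<^bsub>p.F\<^esub> free_gen k (xs[i := b]))"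
      using b c by (subst p.coset_eq) (auto intro: g p.F.N.a_closed A.M.a_closed p.F.span_submodule(2)[OF p.relators, THEN subsetD])
    then show "pure_pow k A (xs[i := c \<oplus> b])
        = pure_pow k A (xs[i := c]) \<oplus>\<^bsub>tensor_pow k A n\<^esub> pure_pow k A (xs[i := b])"
      using b c by (simp add: pure_pow_eq[OF u] A.M.a_closed tensor_pow_eq p.coset_add g) }
  { fix r assume r: "r \<in> carrier k"
    have "free_gen k (xs[i := r \<odot> c]) \<ominus>\<^bsub>p.F\<^esub> (r \<odot>\<^bsub>p.F\<^esub> free_gen k (xs[i := c])) \<in> relators n"
      unfolding relators_def Let_def using xs i c r by blast
    then have "p.S +>\<^bsub>p.F\<^esub> free_gen k (xs[i := r \<odot> c]) = p.S +>\<^bsub>p.F\<^esub> (r \<odot>\<^bsub>p.F\<^esub> free_gen k (xs[i := c]))"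
      using r c by (subst p.coset_eq) (auto intro: g p.F.act_closed Am.act_closed p.F.span_submodule(2)[OF p.relators, THEN subsetD])
    then show "pure_pow k A (xs[i := r \<odot> c]) = r \<odot>\<^bsub>tensor_pow k A n\<^esub> pure_pow k A (xs[i := c])"
      using r c by (simp add: pure_pow_eq[OF u] Am.act_closed tensor_pow_eq p.coset_smult g) }
qed

lemma multilinear_relators:
  assumes W: "left_module k W" and f: "multilinear n W f" and r: "r \<in> relators n"
  shows "free_ext k W f r = \<zero>\<^bsub>W\<^esub>"
proof -
  interpret W: left_module k W by fact
  let ?F = "free_module k (tuples n)"
  interpret F: left_module k ?F by (rule free_module_left_module[OF k_ring])
  have f': "f \<in> tuples n \<rightarrow> carrier W" using f by (simp add: multilinear_def)
  note e = free_ext_hom[OF W f'] and eg = free_ext_gen[OF W f']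
  note em = lmod_hom_minus[OF e F.N.abelian_group_axioms W.N.abelian_group_axioms]
  have *: "x \<ominus>\<^bsub>W\<^esub> x = \<zero>\<^bsub>W\<^esub>" if "x \<in> carrier W" for x using that by (simp add: a_minus_def W.N.r_neg)
  from r consider
    xs i a b where "xs \<in> tuples n" "i < n" "a \<in> carrier A" "b \<in> carrier A"
      "r = free_gen k (xs[i := a \<oplus> b]) \<ominus>\<^bsub>?F\<^esub> (free_gen k (xs[i := a]) \<oplus>\<^bsub>?F\<^esub> free_gen k (xs[i := b]))"
  | xs i a c where "xs \<in> tuples n" "i < n" "a \<in> carrier A" "c \<in> carrier k"
      "r = free_gen k (xs[i := c \<odot> a]) \<ominus>\<^bsub>?F\<^esub> (c \<odot>\<^bsub>?F\<^esub> free_gen k (xs[i := a]))"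
    unfolding relators_def Let_def by blast
  then show ?thesis
  proof cases
    case 1
    note h = multilinearD(2)[OF f 1(1,2)]
    show ?thesis unfolding 1(5) using 1(1-4)
      by (simp add: em free_gen_tuples tuples_update A.M.a_closed F.N.a_closed lmod_hom_add[OF e] eg
          lmod_hom_add[OF h] lmod_hom_closed[OF h] * W.N.a_closed)
  next
    case 2
    note h = multilinearD(2)[OF f 2(1,2)]
    show ?thesis unfolding 2(5) using 2(1-4)
      by (simp add: em free_gen_tuples tuples_update Am.act_closed F.act_closed lmod_hom_smult[OF e] eg
          lmod_hom_smult[OF h] lmod_hom_closed[OF h] * W.act_closed)
  qed
qed

lemma tensor_lift_hom:
  assumes W: "left_module k W" and f: "multilinear n W f"
  shows "tensor_lift k W f \<in> lmod_hom k (tensor_pow k A n) W"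
  unfolding tensor_pow_eq
  by (rule presented.lift_hom[OF presented_tuples W _ multilinear_relators[OF W f]])
    (use f in \<open>simp_all add: multilinear_def\<close>)

lemma tensor_lift_pure:
  assumes W: "left_module k W" and f: "multilinear n W f" and xs: "xs \<in> tuples n"
  shows "tensor_lift k W f (pure_pow k A xs) = f xs"
  unfolding pure_pow_eq[OF xs]
  by (rule presented.lift_cls[OF presented_tuples W _ multilinear_relators[OF W f] xs])
    (use f in \<open>simp_all add: multilinear_def\<close>)

lemma tensor_hom_eq:
  assumes W: "left_module k W"
    and h: "h \<in> lmod_hom k (tensor_pow k A n) W" "h' \<in> lmod_hom k (tensor_pow k A n) W"
    and eq: "\<And>xs. xs \<in> tuples n \<Longrightarrow> h (pure_pow k A xs) = h' (pure_pow k A xs)"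
    and X: "X \<in> carrier (tensor_pow k A n)"
  shows "h X = h' X"
  by (rule presented.hom_unique[OF presented_tuples W h[unfolded tensor_pow_eq] _ X[unfolded tensor_pow_eq]])
    (use eq in \<open>simp add: pure_pow_eq\<close>)

text \<open>Extensionality on pure tensors is applied to one variable at a time. Module axioms over
  \<open>Ae\<close>, linearity over \<open>Ae\<close> and the Leibniz rules are all reduced to pure
  tensors in this way.\<close>

lemma bilinear_eq:
  assumes W: "left_module k W"
    and b: "bilinear_map k (tensor_pow k A m) (tensor_pow k A n) W \<beta>"
      "bilinear_map k (tensor_pow k A m) (tensor_pow k A n) W \<beta>'"
    and eq: "\<And>u v. \<lbrakk>u \<in> tuples m; v \<in> tuples n\<rbrakk> \<Longrightarrow> \<beta> (pure_pow k A u) (pure_pow k A v) = \<beta>' (pure_pow k A u) (pure_pow k A v)"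
    and X: "X \<in> carrier (tensor_pow k A m)" "Y \<in> carrier (tensor_pow k A n)"
  shows "\<beta> X Y = \<beta>' X Y"
proof (rule tensor_hom_eq[OF W bilinear_mapD(1)[OF b(1) X(2)] bilinear_mapD(1)[OF b(2) X(2)] _ X(1)])
  fix u assume u: "u \<in> tuples m"
  show "\<beta> (pure_pow k A u) Y = \<beta>' (pure_pow k A u) Y"
    by (rule tensor_hom_eq[OF W bilinear_mapD(2)[OF b(1) pure_closed[OF u]] bilinear_mapD(2)[OF b(2) pure_closed[OF u]] eq[OF u] X(2)])
qed

text \<open>The product of \<open>enveloping\<close> and the action on \<open>bar\<close> are nested
  lifts of this form, so this lemma is what gives them meaning: the inner lift must depend
  multilinearly on the parameter \<open>u\<close> before the outer lift can be taken.\<close>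

lemma bilinear_lift:
  assumes W: "left_module k W"
    and f1: "\<And>u. u \<in> tuples m \<Longrightarrow> multilinear n W (f u)"
    and f2: "\<And>v. v \<in> tuples n \<Longrightarrow> multilinear m W (\<lambda>u. f u v)"
  defines "\<beta> \<equiv> \<lambda>X Y. tensor_lift k W (\<lambda>u. tensor_lift k W (f u) Y) X"
  shows "bilinear_map k (tensor_pow k A m) (tensor_pow k A n) W \<beta>"
    and "\<lbrakk>u \<in> tuples m; v \<in> tuples n\<rbrakk> \<Longrightarrow> \<beta> (pure_pow k A u) (pure_pow k A v) = f u v"
proof -
  interpret W: left_module k W by fact
  note h = tensor_lift_hom[OF W f1]
  \<comment> \<open>For pure \<open>Y\<close> this is multilinearity of \<open>f\<close> in its
    first argument; for general \<open>Y\<close> both sides of each identity are linear in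
    \<open>Y\<close> and agree on pure tensors.\<close>
  have ml: "multilinear m W (\<lambda>u. tensor_lift k W (f u) Y)" if Y: "Y \<in> carrier (tensor_pow k A n)" for Y
    unfolding multilinear_def
  proof (intro conjI ballI allI impI lmod_homI)
    fix u assume u: "u \<in> tuples m"
    then show "tensor_lift k W (f u) Y \<in> carrier W" by (rule lmod_hom_closed[OF h Y])
    fix i c assume i: "i < m" and c: "c \<in> carrier A"
    note uu = tuples_update[OF u]
    show "tensor_lift k W (f (u[i := c])) Y \<in> carrier W" by (rule lmod_hom_closed[OF h Y]) (rule uu[OF c])
    { fix b assume b: "b \<in> carrier A"
      show "tensor_lift k W (f (u[i := c \<oplus> b])) Y
          = tensor_lift k W (f (u[i := c])) Y \<oplus>\<^bsub>W\<^esub> tensor_lift k W (f (u[i := b])) Y"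
        using c b uu A.M.a_closed[OF c b] lmod_hom_add[OF multilinearD(2)[OF f2 u i], of _ c b]
        by (intro tensor_hom_eq[OF W h lmod_hom_plus[OF W h h] _ Y])
          (simp_all add: tensor_lift_pure[OF W f1]) }
    { fix r assume r: "r \<in> carrier k"
      show "tensor_lift k W (f (u[i := r \<odot> c])) Y = r \<odot>\<^bsub>W\<^esub> tensor_lift k W (f (u[i := c])) Y"
        using c r uu Am.act_closed[OF r c] lmod_hom_smult[OF multilinearD(2)[OF f2 u i], of _ r c]
        by (intro tensor_hom_eq[OF W h lmod_hom_scale[OF k_cring W h] _ Y])
          (simp_all add: tensor_lift_pure[OF W f1]) }
  qed
  have 1: "(\<lambda>X. \<beta> X Y) \<in> lmod_hom k (tensor_pow k A m) W" if "Y \<in> carrier (tensor_pow k A n)" for Y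
    unfolding \<beta>_def by (rule tensor_lift_hom[OF W ml[OF that]])
  have p: "\<beta> (pure_pow k A u) Y = tensor_lift k W (f u) Y"
    if "u \<in> tuples m" "Y \<in> carrier (tensor_pow k A n)" for u Y
    unfolding \<beta>_def by (rule tensor_lift_pure[OF W ml[OF that(2)] that(1)])
  interpret T: left_module k "tensor_pow k A n" by (rule tensor_pow_left_module)
  have 2: "\<beta> X \<in> lmod_hom k (tensor_pow k A n) W" if X: "X \<in> carrier (tensor_pow k A m)" for X
  proof (rule lmod_homI)
    fix Y assume Y: "Y \<in> carrier (tensor_pow k A n)"
    show "\<beta> X Y \<in> carrier W" by (rule lmod_hom_closed[OF 1[OF Y] X])
    { fix Z assume Z: "Z \<in> carrier (tensor_pow k A n)"
      show "\<beta> X (Y \<oplus>\<^bsub>tensor_pow k A n\<^esub> Z) = \<beta> X Y \<oplus>\<^bsub>W\<^esub> \<beta> X Z"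
        by (rule tensor_hom_eq[OF W 1[OF T.N.a_closed[OF Y Z]] lmod_hom_plus[OF W 1[OF Y] 1[OF Z]] _ X])
          (simp add: p Y Z T.N.a_closed lmod_hom_add[OF h]) }
    { fix r assume r: "r \<in> carrier k"
      show "\<beta> X (r \<odot>\<^bsub>tensor_pow k A n\<^esub> Y) = r \<odot>\<^bsub>W\<^esub> \<beta> X Y"
        by (rule tensor_hom_eq[OF W 1[OF T.act_closed[OF r Y]] lmod_hom_scale[OF k_cring W 1[OF Y] r] _ X])
          (simp add: p Y r T.act_closed lmod_hom_smult[OF h]) }
  qed
  show "bilinear_map k (tensor_pow k A m) (tensor_pow k A n) W \<beta>"
    using 1 2 by (simp add: bilinear_map_def)
  show "\<beta> (pure_pow k A u) (pure_pow k A v) = f u v" if "u \<in> tuples m" "v \<in> tuples n"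
    using that by (simp add: p pure_closed tensor_lift_pure[OF W f1])
qed

section \<open>Construction of multilinear maps\<close>

lemma multilinear_hom:
  assumes "multilinear n V f" "h \<in> lmod_hom k V W"
  shows "multilinear n W (\<lambda>xs. h (f xs))"
  unfolding multilinear_def
  using lmod_hom_comp[OF multilinearD(2)[OF assms(1)] assms(2)]
    lmod_hom_closed[OF assms(2) multilinearD(1)[OF assms(1)]] by blast

text \<open>Criterion for a transformation of tuples: varying entry \<open>i\<close> of the argument
  must vary a single entry \<open>j\<close> of the value through a linear map \<open>l\<close>. Face
  maps, insertion of units, multiplication at the ends and application of a derivation to one slot
  all fit this pattern.\<close>

lemma multilinear_subst:
  assumes "multilinear m W g" "\<And>xs. xs \<in> tuples n \<Longrightarrow> F xs \<in> tuples m"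
    and "\<And>xs i. \<lbrakk>xs \<in> tuples n; i < n\<rbrakk> \<Longrightarrow>
      \<exists>ys\<in>tuples m. \<exists>j<m. \<exists>l\<in>lmod_hom k A A. \<forall>c\<in>carrier A. F (xs[i := c]) = ys[j := l c]"
  shows "multilinear n W (\<lambda>xs. g (F xs))"
  unfolding multilinear_def
proof (intro conjI ballI allI impI)
  fix xs assume xs: "xs \<in> tuples n"
  show "g (F xs) \<in> carrier W" by (rule multilinearD(1)[OF assms(1) assms(2)[OF xs]])
  fix i assume "i < n"
  then obtain ys j l where y: "ys \<in> tuples m" "j < m" "l \<in> lmod_hom k A A"
    "\<And>c. c \<in> carrier A \<Longrightarrow> F (xs[i := c]) = ys[j := l c]"
    using assms(3)[OF xs] by blast
  show "(\<lambda>c. g (F (xs[i := c]))) \<in> lmod_hom k A W"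
    by (rule lmod_hom_cong[OF lmod_hom_comp[OF y(3) multilinearD(2)[OF assms(1) y(1,2)]] Am.left_module_axioms])
      (simp add: y(4))
qed

lemma multilinear_cong:
  assumes "multilinear n W f" "\<And>xs. xs \<in> tuples n \<Longrightarrow> g xs = f xs"
  shows "multilinear n W g"
  unfolding multilinear_def
proof (intro conjI ballI allI impI)
  fix xs assume xs: "xs \<in> tuples n"
  then show "g xs \<in> carrier W" using multilinearD(1)[OF assms(1)] assms(2) by simp
  fix i assume i: "i < n"
  show "(\<lambda>c. g (xs[i := c])) \<in> lmod_hom k A W"
    by (rule lmod_hom_cong[OF multilinearD(2)[OF assms(1) xs i] Am.left_module_axioms])
      (simp add: assms(2) xs tuples_update)
qed

lemma multilinear_plus:
  assumes "left_module k W" "multilinear n W f" "multilinear n W g"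
  shows "multilinear n W (\<lambda>xs. f xs \<oplus>\<^bsub>W\<^esub> g xs)"
proof -
  interpret W: left_module k W by fact
  show ?thesis
    using assms(2,3) by (simp add: multilinear_def lmod_hom_plus[OF assms(1)])
qed

lemma multilinear_scale:
  assumes "left_module k W" "multilinear n W f" "r \<in> carrier k"
  shows "multilinear n W (\<lambda>xs. r \<odot>\<^bsub>W\<^esub> f xs)"
proof -
  interpret W: left_module k W by fact
  show ?thesis
    using assms(2,3) by (simp add: multilinear_def lmod_hom_scale[OF k_cring assms(1)] W.act_closed)
qed

lemma multilinear_sum:
  assumes "left_module k W" "\<And>i. i \<in> S \<Longrightarrow> multilinear n W (f i)"
  shows "multilinear n W (\<lambda>xs. \<Oplus>\<^bsub>W\<^esub>i\<in>S. f i xs)"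
proof -
  interpret W: left_module k W by fact
  show ?thesis
    using assms(2) unfolding multilinear_def
    by (auto intro!: W.N.finsum_closed lmod_hom_sum[OF assms(1)])
qed

end

section \<open>The enveloping algebra and its modules\<close>

text \<open>Several modules below are new records around an existing additive group, with only the
  action or the product replaced; the group axioms see just carrier, addition and zero.\<close>

lemma abelian_group_cong:
  assumes N: "abelian_group N"
    and eq: "carrier N' = carrier N" "(\<oplus>\<^bsub>N'\<^esub>) = (\<oplus>\<^bsub>N\<^esub>)" "\<zero>\<^bsub>N'\<^esub> = \<zero>\<^bsub>N\<^esub>"
  shows "abelian_group N'"
proof -
  interpret N: abelian_group N by fact
  show ?thesis
    by (rule abelian_groupI) (use abelian_groupE(6)[OF N] in \<open>simp_all add: eq N.a_assoc, simp_all add: N.a_comm\<close>)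
qed

lemma left_module_cong:
  assumes N: "left_module B N" and "ring B'"
    and "carrier B' = carrier B" "(\<oplus>\<^bsub>B'\<^esub>) = (\<oplus>\<^bsub>B\<^esub>)" "(\<otimes>\<^bsub>B'\<^esub>) = (\<otimes>\<^bsub>B\<^esub>)" "\<one>\<^bsub>B'\<^esub> = \<one>\<^bsub>B\<^esub>"
    and "carrier N' = carrier N" "(\<oplus>\<^bsub>N'\<^esub>) = (\<oplus>\<^bsub>N\<^esub>)" "\<zero>\<^bsub>N'\<^esub> = \<zero>\<^bsub>N\<^esub>"
    and "\<And>b x. \<lbrakk>b \<in> carrier B; x \<in> carrier N\<rbrakk> \<Longrightarrow> b \<odot>\<^bsub>N'\<^esub> x = b \<odot>\<^bsub>N\<^esub> x"
  shows "left_module B' N'"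
proof -
  interpret N: left_module B N by fact
  have "abelian_group N'" by (rule abelian_group_cong[OF N.N.abelian_group_axioms assms(7-9)])
  then show ?thesis
    by (rule left_moduleI[OF assms(2)])
      (simp_all add: assms(3-10) N.act_closed N.act_add_left N.act_add_right N.act_mult N.act_one)
qed

lemma lmod_hom_cong_structure:
  assumes "carrier M' = carrier M" "(\<oplus>\<^bsub>M'\<^esub>) = (\<oplus>\<^bsub>M\<^esub>)"
    "\<And>b x. \<lbrakk>b \<in> carrier B; x \<in> carrier M\<rbrakk> \<Longrightarrow> b \<odot>\<^bsub>M'\<^esub> x = b \<odot>\<^bsub>M\<^esub> x"
    and "carrier N' = carrier N" "(\<oplus>\<^bsub>N'\<^esub>) = (\<oplus>\<^bsub>N\<^esub>)"
    "\<And>b x. \<lbrakk>b \<in> carrier B; x \<in> carrier N\<rbrakk> \<Longrightarrow> b \<odot>\<^bsub>N'\<^esub> x = b \<odot>\<^bsub>N\<^esub> x"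
  shows "lmod_hom B M' N' = lmod_hom B M N"
  unfolding lmod_hom_def using assms by (auto simp: Pi_iff)

context k_algebra
begin

abbreviation "T n \<equiv> tensor_pow k A n"
abbreviation "pure \<equiv> pure_pow k A"
abbreviation "Ae \<equiv> enveloping k A"

section \<open>The ring structure of the enveloping algebra\<close>

lemma opposite_simps [simp]:
  "carrier (opposite A) = carrier A" "(\<oplus>\<^bsub>opposite A\<^esub>) = (\<oplus>)" "(\<odot>\<^bsub>opposite A\<^esub>) = (\<odot>)"
  "x \<otimes>\<^bsub>opposite A\<^esub> y = y \<otimes> x"
  by (simp_all add: opposite_def)

text \<open>\<open>A\<close> and its opposite differ in the multiplication only, which a tensor
  product of modules never mentions. The module underlying the enveloping algebra is therefore
  literally the tensor square \<open>T 2\<close>.\<close>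

lemma env_factors:
  assumes "i < 2"
  shows "carrier ([A, opposite A] ! i) = carrier (replicate 2 A ! i)"
    and "(\<oplus>\<^bsub>[A, opposite A] ! i\<^esub>) = (\<oplus>\<^bsub>replicate 2 A ! i\<^esub>)"
    and "(\<odot>\<^bsub>[A, opposite A] ! i\<^esub>) = (\<odot>\<^bsub>replicate 2 A ! i\<^esub>)"
  using less_2_cases[OF assms] by auto

lemma tensor_free_env: "tensor_free k [A, opposite A] = tensor_free k (replicate 2 A)"
  by (simp add: tensor_free_def numeral_2_eq_2)

lemma tensor_rel_env: "tensor_rel k [A, opposite A] = tensor_rel k (replicate 2 A)"
proof -
  have l: "length [A, opposite A] = 2" "length (replicate 2 A) = 2"
    "listset (map carrier [A, opposite A]) = listset (map carrier (replicate 2 A))"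
    by (simp_all add: numeral_2_eq_2)
  show ?thesis unfolding tensor_rel_def l tensor_free_env
    using env_factors by (simp del: nth_replicate cong: conj_cong) (simp del: nth_replicate cong: rev_conj_cong)
qed

lemma tensor_env: "tensor k [A, opposite A] = T 2"
  by (simp add: tensor_def tensor_free_env tensor_rel_env tensor_pow_def)

lemma pure_env: "length xs = 2 \<Longrightarrow> pure_tensor k [A, opposite A] xs = pure xs"
  by (simp add: pure_tensor_def pure_pow_def tensor_free_env tensor_rel_env)

lemma env_simps:
  "carrier Ae = carrier (T 2)" "(\<oplus>\<^bsub>Ae\<^esub>) = (\<oplus>\<^bsub>T 2\<^esub>)" "\<zero>\<^bsub>Ae\<^esub> = \<zero>\<^bsub>T 2\<^esub>" "(\<odot>\<^bsub>Ae\<^esub>) = (\<odot>\<^bsub>T 2\<^esub>)"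
  "\<one>\<^bsub>Ae\<^esub> = pure [\<one>, \<one>]"
  "X \<otimes>\<^bsub>Ae\<^esub> Y = tensor_lift k (T 2) (\<lambda>u. tensor_lift k (T 2)
      (\<lambda>v. pure [u ! 0 \<otimes> v ! 0, v ! 1 \<otimes> u ! 1]) Y) X"
  by (simp_all add: enveloping_def Let_def tensor_env pure_env)

lemma tuples2: "u \<in> tuples 2 \<longleftrightarrow> (\<exists>a\<in>carrier A. \<exists>b\<in>carrier A. u = [a, b])"
proof -
  have "length u = 2 \<longleftrightarrow> (\<exists>a b. u = [a, b])" by (auto simp: numeral_2_eq_2 length_Suc_conv)
  then show ?thesis by (auto simp: tuples_def)
qed

lemma pair_tuples: "\<lbrakk>a \<in> carrier A; b \<in> carrier A\<rbrakk> \<Longrightarrow> [a, b] \<in> tuples 2"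
  by (auto simp: tuples2)

lemma pure_add:
  assumes "xs \<in> tuples n" "i < n" "a \<in> carrier A" "b \<in> carrier A"
  shows "pure (xs[i := a \<oplus> b]) = pure (xs[i := a]) \<oplus>\<^bsub>T n\<^esub> pure (xs[i := b])"
  using lmod_hom_add[OF multilinearD(2)[OF multilinear_pure assms(1,2)] assms(3,4)] .

lemma pure_smult:
  assumes "xs \<in> tuples n" "i < n" "a \<in> carrier A" "r \<in> carrier k"
  shows "pure (xs[i := r \<odot> a]) = r \<odot>\<^bsub>T n\<^esub> pure (xs[i := a])"
  using lmod_hom_smult[OF multilinearD(2)[OF multilinear_pure assms(1,2)] assms(4,3)] .

lemma pure_zero:
  assumes "xs \<in> tuples n" "i < n"
  shows "pure (xs[i := \<zero>]) = \<zero>\<^bsub>T n\<^esub>"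
  using lmod_hom_zero[OF multilinearD(2)[OF multilinear_pure assms] A.M.abelian_group_axioms tensor_pow_group] .

lemma pair_hom:
  assumes "a \<in> carrier A"
  shows "(\<lambda>c. pure [c, a]) \<in> lmod_hom k A (T 2)" "(\<lambda>c. pure [a, c]) \<in> lmod_hom k A (T 2)"
  using multilinearD(2)[OF multilinear_pure pair_tuples[OF assms assms], of 0]
    multilinearD(2)[OF multilinear_pure pair_tuples[OF assms assms], of 1] by simp_all

lemma pair_add:
  assumes "a \<in> carrier A" "b \<in> carrier A" "c \<in> carrier A"
  shows "pure [a \<oplus> b, c] = pure [a, c] \<oplus>\<^bsub>T 2\<^esub> pure [b, c]"
    and "pure [c, a \<oplus> b] = pure [c, a] \<oplus>\<^bsub>T 2\<^esub> pure [c, b]"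
  using pure_add[OF pair_tuples[OF assms(1,3)], of 0 a b] pure_add[OF pair_tuples[OF assms(3,1)], of 1 a b] assms
  by simp_all

lemma env_mult:
  shows env_mult_bilinear: "bilinear_map k (T 2) (T 2) (T 2) (\<otimes>\<^bsub>Ae\<^esub>)"
    and env_mult_pure: "\<lbrakk>a \<in> carrier A; b \<in> carrier A; c \<in> carrier A; d \<in> carrier A\<rbrakk>
      \<Longrightarrow> pure [a, b] \<otimes>\<^bsub>Ae\<^esub> pure [c, d] = pure [a \<otimes> c, d \<otimes> b]"
proof -
  let ?f = "\<lambda>u v. pure [u ! 0 \<otimes> v ! 0, v ! 1 \<otimes> u ! 1]"
  have 1: "multilinear 2 (T 2) (?f u)" if u: "u \<in> tuples 2" for u
  proof (rule multilinear_subst[OF multilinear_pure])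
    fix v i assume v: "v \<in> tuples 2" and i: "i < (2::nat)"
    let ?ys = "[u ! 0 \<otimes> v ! 0, v ! 1 \<otimes> u ! 1]"
    have c: "u ! 0 \<in> carrier A" "u ! 1 \<in> carrier A" "v ! 0 \<in> carrier A" "v ! 1 \<in> carrier A"
      using u v tuples_nth by auto
    have y: "?ys \<in> tuples 2" using c by (simp add: tuples2)
    have l: "length v = 2" using v by (rule tuples_length)
    show "\<exists>ys\<in>tuples 2. \<exists>j<2. \<exists>l\<in>lmod_hom k A A. \<forall>c\<in>carrier A.
         [u ! 0 \<otimes> v[i := c] ! 0, v[i := c] ! 1 \<otimes> u ! 1] = ys[j := l c]"
    proof (rule disjE[OF less_2_cases[OF i]])
      assume "i = 0"
      then show ?thesis
        by (intro bexI[OF _ y] exI[of _ 0] conjI bexI[OF _ mult_left_hom[OF c(1)]]) (simp_all add: l)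
    next
      assume "i = Suc 0"
      then show ?thesis
        by (intro bexI[OF _ y] exI[of _ 1] conjI bexI[OF _ mult_right_hom[OF c(2)]]) (simp_all add: l)
    qed
  qed (use u in \<open>auto simp: tuples2\<close>)
  have 2: "multilinear 2 (T 2) (\<lambda>u. ?f u v)" if v: "v \<in> tuples 2" for v
  proof (rule multilinear_subst[OF multilinear_pure])
    fix u i assume u: "u \<in> tuples 2" and i: "i < (2::nat)"
    let ?ys = "[u ! 0 \<otimes> v ! 0, v ! 1 \<otimes> u ! 1]"
    have c: "u ! 0 \<in> carrier A" "u ! 1 \<in> carrier A" "v ! 0 \<in> carrier A" "v ! 1 \<in> carrier A"
      using u v tuples_nth by auto
    have y: "?ys \<in> tuples 2" using c by (simp add: tuples2)
    have l: "length u = 2" using u by (rule tuples_length)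
    show "\<exists>ys\<in>tuples 2. \<exists>j<2. \<exists>l\<in>lmod_hom k A A. \<forall>c\<in>carrier A.
         [u[i := c] ! 0 \<otimes> v ! 0, v ! 1 \<otimes> u[i := c] ! 1] = ys[j := l c]"
    proof (rule disjE[OF less_2_cases[OF i]])
      assume "i = 0"
      then show ?thesis
        by (intro bexI[OF _ y] exI[of _ 0] conjI bexI[OF _ mult_right_hom[OF c(3)]]) (simp_all add: l)
    next
      assume "i = Suc 0"
      then show ?thesis
        by (intro bexI[OF _ y] exI[of _ 1] conjI bexI[OF _ mult_left_hom[OF c(4)]]) (simp_all add: l)
    qed
  qed (use v in \<open>auto simp: tuples2\<close>)
  have m: "(\<otimes>\<^bsub>Ae\<^esub>) = (\<lambda>X Y. tensor_lift k (T 2) (\<lambda>u. tensor_lift k (T 2) (?f u) Y) X)"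
    by (intro ext) (simp add: env_simps)
  show "bilinear_map k (T 2) (T 2) (T 2) (\<otimes>\<^bsub>Ae\<^esub>)"
    unfolding m by (rule bilinear_lift(1)[OF tensor_pow_left_module 1 2])
  show "pure [a, b] \<otimes>\<^bsub>Ae\<^esub> pure [c, d] = pure [a \<otimes> c, d \<otimes> b]"
    if "a \<in> carrier A" "b \<in> carrier A" "c \<in> carrier A" "d \<in> carrier A"
    unfolding m using bilinear_lift(2)[OF tensor_pow_left_module 1 2, of "[a,b]" "[c,d]"] that
    by (simp add: pair_tuples)
qed

lemma env_left_module: "left_module k Ae"
  by (rule left_module_cong[OF tensor_pow_left_module[of 2] k_ring]) (simp_all add: env_simps)

lemma env_one_closed: "pure [\<one>, \<one>] \<in> carrier (T 2)"
  by (intro pure_closed pair_tuples A.A.one_closed)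

lemma env_ring: "ring Ae"
proof (rule ringI)
  note c = bilinear_map_closed[OF env_mult_bilinear]
  note m1 = bilinear_mapD(1)[OF env_mult_bilinear] and m2 = bilinear_mapD(2)[OF env_mult_bilinear]
  show "abelian_group Ae" using env_left_module by (simp add: left_module_def)
  show "monoid Ae"
  proof (rule monoidI)
    fix X Y Z assume XYZ: "X \<in> carrier Ae" "Y \<in> carrier Ae" "Z \<in> carrier Ae"
    then have e: "X \<in> carrier (T 2)" "Y \<in> carrier (T 2)" "Z \<in> carrier (T 2)" by (simp_all add: env_simps)
    show "X \<otimes>\<^bsub>Ae\<^esub> Y \<in> carrier Ae" using c[OF e(1,2)] by (simp add: env_simps(1))
    \<comment> \<open>Both sides are trilinear: \<open>bilinear_eq\<close> makes \<open>X\<close>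
      and \<open>Y\<close> pure for fixed \<open>Z\<close>, and extensionality in \<open>Z\<close>
      finishes.\<close>
    show "X \<otimes>\<^bsub>Ae\<^esub> Y \<otimes>\<^bsub>Ae\<^esub> Z = X \<otimes>\<^bsub>Ae\<^esub> (Y \<otimes>\<^bsub>Ae\<^esub> Z)"
    proof (rule bilinear_eq[OF tensor_pow_left_module _ _ _ e(1,2)])
      show "bilinear_map k (T 2) (T 2) (T 2) (\<lambda>X Y. X \<otimes>\<^bsub>Ae\<^esub> Y \<otimes>\<^bsub>Ae\<^esub> Z)"
        by (rule bilinear_map_compose[OF env_mult_bilinear m1[OF e(3)]])
      show "bilinear_map k (T 2) (T 2) (T 2) (\<lambda>X Y. X \<otimes>\<^bsub>Ae\<^esub> (Y \<otimes>\<^bsub>Ae\<^esub> Z))"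
        by (rule bilinear_map_arg2[OF env_mult_bilinear m1[OF e(3)]])
      fix u v assume u: "u \<in> tuples 2" and v: "v \<in> tuples 2"
      note p = pure_closed[OF u] pure_closed[OF v]
      show "pure u \<otimes>\<^bsub>Ae\<^esub> pure v \<otimes>\<^bsub>Ae\<^esub> Z = pure u \<otimes>\<^bsub>Ae\<^esub> (pure v \<otimes>\<^bsub>Ae\<^esub> Z)"
        by (rule tensor_hom_eq[OF tensor_pow_left_module m2[OF c[OF p]] lmod_hom_comp[OF m2[OF p(2)] m2[OF p(1)]] _ e(3)])
          (use u v in \<open>auto simp: tuples2 env_mult_pure A.A.m_assoc\<close>)
    qed
  next
    show "\<one>\<^bsub>Ae\<^esub> \<in> carrier Ae" using env_one_closed by (simp add: env_simps)
    fix X assume "X \<in> carrier Ae"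
    then have e: "X \<in> carrier (T 2)" by (simp add: env_simps)
    show "\<one>\<^bsub>Ae\<^esub> \<otimes>\<^bsub>Ae\<^esub> X = X" unfolding env_simps(5)
      by (rule tensor_hom_eq[OF tensor_pow_left_module m2[OF env_one_closed] lmod_hom_id _ e])
        (auto simp: tuples2 env_mult_pure)
    show "X \<otimes>\<^bsub>Ae\<^esub> \<one>\<^bsub>Ae\<^esub> = X" unfolding env_simps(5)
      by (rule tensor_hom_eq[OF tensor_pow_left_module m1[OF env_one_closed] lmod_hom_id _ e])
        (auto simp: tuples2 env_mult_pure)
  qed
  fix X Y Z assume "X \<in> carrier Ae" "Y \<in> carrier Ae" "Z \<in> carrier Ae"
  then have e: "X \<in> carrier (T 2)" "Y \<in> carrier (T 2)" "Z \<in> carrier (T 2)" by (simp_all only: env_simps(1))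
  show "(X \<oplus>\<^bsub>Ae\<^esub> Y) \<otimes>\<^bsub>Ae\<^esub> Z = X \<otimes>\<^bsub>Ae\<^esub> Z \<oplus>\<^bsub>Ae\<^esub> Y \<otimes>\<^bsub>Ae\<^esub> Z"
    unfolding env_simps(2) by (rule lmod_hom_add[OF m1[OF e(3)] e(1,2)])
  show "Z \<otimes>\<^bsub>Ae\<^esub> (X \<oplus>\<^bsub>Ae\<^esub> Y) = Z \<otimes>\<^bsub>Ae\<^esub> X \<oplus>\<^bsub>Ae\<^esub> Z \<otimes>\<^bsub>Ae\<^esub> Y"
    unfolding env_simps(2) by (rule lmod_hom_add[OF m2[OF e(3)] e(1,2)])
qed

sublocale Ae: ring Ae by (rule env_ring)

section \<open>Restriction of scalars from the enveloping algebra to the base ring\<close>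

lemma env_smult_mult:
  assumes "r \<in> carrier k" "X \<in> carrier Ae" "Y \<in> carrier Ae"
  shows "(r \<odot>\<^bsub>Ae\<^esub> X) \<otimes>\<^bsub>Ae\<^esub> Y = r \<odot>\<^bsub>Ae\<^esub> (X \<otimes>\<^bsub>Ae\<^esub> Y)"
    and "X \<otimes>\<^bsub>Ae\<^esub> (r \<odot>\<^bsub>Ae\<^esub> Y) = r \<odot>\<^bsub>Ae\<^esub> (X \<otimes>\<^bsub>Ae\<^esub> Y)"
  using lmod_hom_smult[OF bilinear_mapD(1)[OF env_mult_bilinear] assms(1), of Y X]
    lmod_hom_smult[OF bilinear_mapD(2)[OF env_mult_bilinear] assms(1), of X Y] assms
  by (simp_all only: env_simps(1,4))

text \<open>The structure map of the \<open>k\<close>-algebra \<open>Ae\<close>; by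
  \<open>scal_mult\<close> its values are central.\<close>

definition scal :: "'k \<Rightarrow> ('a list \<Rightarrow> 'k) set" where
  "scal r = r \<odot>\<^bsub>Ae\<^esub> \<one>\<^bsub>Ae\<^esub>"

text \<open>Universal properties of tensor powers are statements over \<open>k\<close>, while
  resolutions live over \<open>Ae\<close>. This record lets an \<open>Ae\<close>-module serve as the
  target of a lift over \<open>k\<close>.\<close>

definition restrict_scalars :: "(('a list \<Rightarrow> 'k) set, 'n, 'z) module_scheme \<Rightarrow> ('k, 'n) module" where
  "restrict_scalars N = \<lparr>carrier = carrier N, mult = mult N, one = one N, zero = zero N, add = add N,
     smult = (\<lambda>r x. scal r \<odot>\<^bsub>N\<^esub> x)\<rparr>"

lemma restrict_scalars_simps [simp]:
  "carrier (restrict_scalars N) = carrier N" "(\<oplus>\<^bsub>restrict_scalars N\<^esub>) = (\<oplus>\<^bsub>N\<^esub>)"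
  "\<zero>\<^bsub>restrict_scalars N\<^esub> = \<zero>\<^bsub>N\<^esub>" "r \<odot>\<^bsub>restrict_scalars N\<^esub> x = scal r \<odot>\<^bsub>N\<^esub> x"
  by (simp_all add: restrict_scalars_def)

interpretation E: left_module k Ae by (rule env_left_module)

lemma scal_closed: "r \<in> carrier k \<Longrightarrow> scal r \<in> carrier Ae"
  by (simp add: scal_def E.act_closed)

lemma scal_mult:
  assumes "r \<in> carrier k" "X \<in> carrier Ae"
  shows "scal r \<otimes>\<^bsub>Ae\<^esub> X = r \<odot>\<^bsub>Ae\<^esub> X" "X \<otimes>\<^bsub>Ae\<^esub> scal r = r \<odot>\<^bsub>Ae\<^esub> X"
  using assms by (simp_all add: scal_def env_smult_mult)

lemma scal_pure: "r \<in> carrier k \<Longrightarrow> scal r = pure [r \<odot> \<one>, \<one>]"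
  using pure_smult[OF pair_tuples[of "\<one>" "\<one>"], of 0 "\<one>" r] by (simp add: scal_def env_simps)

lemma restrict_scalars_left_module:
  assumes "left_module Ae N"
  shows "left_module k (restrict_scalars N)"
proof -
  interpret N: left_module Ae N by fact
  have "abelian_group (restrict_scalars N)"
    by (rule abelian_group_cong[OF N.N.abelian_group_axioms]) simp_all
  then show ?thesis
  proof (rule left_moduleI[OF k_ring])
    fix r s x assume rs: "r \<in> carrier k" "s \<in> carrier k" and "x \<in> carrier (restrict_scalars N)"
    then have x: "x \<in> carrier N" by simp
    have "scal (r \<oplus>\<^bsub>k\<^esub> s) = scal r \<oplus>\<^bsub>Ae\<^esub> scal s" using rs by (simp add: scal_def E.act_add_left)
    then show "(r \<oplus>\<^bsub>k\<^esub> s) \<odot>\<^bsub>restrict_scalars N\<^esub> x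
        = r \<odot>\<^bsub>restrict_scalars N\<^esub> x \<oplus>\<^bsub>restrict_scalars N\<^esub> s \<odot>\<^bsub>restrict_scalars N\<^esub> x"
      using rs x by (simp add: N.act_add_left scal_closed)
    have "scal (r \<otimes>\<^bsub>k\<^esub> s) = scal r \<otimes>\<^bsub>Ae\<^esub> scal s"
      using rs by (simp add: scal_mult(1) scal_closed) (simp add: scal_def E.act_mult)
    then show "(r \<otimes>\<^bsub>k\<^esub> s) \<odot>\<^bsub>restrict_scalars N\<^esub> x = r \<odot>\<^bsub>restrict_scalars N\<^esub> (s \<odot>\<^bsub>restrict_scalars N\<^esub> x)"
      using rs x by (simp add: N.act_mult scal_closed)
  next
    fix x assume "x \<in> carrier (restrict_scalars N)"
    moreover have "scal \<one>\<^bsub>k\<^esub> = \<one>\<^bsub>Ae\<^esub>" by (simp add: scal_def E.act_one)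
    ultimately show "\<one>\<^bsub>k\<^esub> \<odot>\<^bsub>restrict_scalars N\<^esub> x = x" by (simp add: N.act_one)
  qed (simp_all add: N.act_closed scal_closed N.act_add_right)
qed

lemma restrict_scalars_hom:
  "h \<in> lmod_hom Ae M N \<Longrightarrow> h \<in> lmod_hom k (restrict_scalars M) (restrict_scalars N)"
  by (rule lmod_homI) (simp_all add: lmod_hom_closed lmod_hom_add lmod_hom_smult scal_closed)

text \<open>Linearity over \<open>k\<close> in the module argument rests on the centrality of
  \<open>scal r\<close>.\<close>

lemma action_bilinear:
  assumes "left_module Ae N"
  shows "bilinear_map k (T 2) (restrict_scalars N) (restrict_scalars N) (\<odot>\<^bsub>N\<^esub>)"
  unfolding bilinear_map_def
proof (intro conjI ballI lmod_homI)
  interpret N: left_module Ae N by fact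
  fix x E assume "x \<in> carrier (restrict_scalars N)" "E \<in> carrier (T 2)"
  then have x: "x \<in> carrier N" and E: "E \<in> carrier Ae" by (simp_all add: env_simps)
  show "E \<odot>\<^bsub>N\<^esub> x \<in> carrier (restrict_scalars N)" using x E by (simp add: N.act_closed)
  { fix E' assume "E' \<in> carrier (T 2)"
    then show "(E \<oplus>\<^bsub>T 2\<^esub> E') \<odot>\<^bsub>N\<^esub> x = E \<odot>\<^bsub>N\<^esub> x \<oplus>\<^bsub>restrict_scalars N\<^esub> E' \<odot>\<^bsub>N\<^esub> x"
      using N.act_add_left[OF E _ x, of E'] by (simp add: env_simps) }
  { fix r assume r: "r \<in> carrier k"
    have "scal r \<odot>\<^bsub>N\<^esub> (E \<odot>\<^bsub>N\<^esub> x) = (r \<odot>\<^bsub>Ae\<^esub> E) \<odot>\<^bsub>N\<^esub> x"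
      using r x E N.act_mult[OF scal_closed[OF r] E x] by (simp only: scal_mult)
    then show "(r \<odot>\<^bsub>T 2\<^esub> E) \<odot>\<^bsub>N\<^esub> x = r \<odot>\<^bsub>restrict_scalars N\<^esub> (E \<odot>\<^bsub>N\<^esub> x)"
      by (simp add: env_simps) }
next
  interpret N: left_module Ae N by fact
  fix x E assume "E \<in> carrier (T 2)" "x \<in> carrier (restrict_scalars N)"
  then have x: "x \<in> carrier N" and E: "E \<in> carrier Ae" by (simp_all add: env_simps)
  show "E \<odot>\<^bsub>N\<^esub> x \<in> carrier (restrict_scalars N)" using x E by (simp add: N.act_closed)
  { fix y assume "y \<in> carrier (restrict_scalars N)"
    then show "E \<odot>\<^bsub>N\<^esub> (x \<oplus>\<^bsub>restrict_scalars N\<^esub> y) = E \<odot>\<^bsub>N\<^esub> x \<oplus>\<^bsub>restrict_scalars N\<^esub> E \<odot>\<^bsub>N\<^esub> y"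
      using N.act_add_right[OF E x] by simp }
  { fix r assume r: "r \<in> carrier k"
    show "E \<odot>\<^bsub>N\<^esub> (r \<odot>\<^bsub>restrict_scalars N\<^esub> x) = r \<odot>\<^bsub>restrict_scalars N\<^esub> (E \<odot>\<^bsub>N\<^esub> x)"
      using r x E N.act_mult[OF scal_closed[OF r] E x] N.act_mult[OF E scal_closed[OF r] x]
      by (simp add: scal_mult) }
qed

text \<open>The flag \<open>l\<close> selects \<open>a x b\<close> or \<open>b x a\<close>, so the
  left and the right action of \<open>A\<^sup>e\<close> on \<open>A\<close> come from one
  argument.\<close>

lemma sandwich_bilinear:
  fixes l :: bool
  defines "s \<equiv> \<lambda>u x. if l then u ! 0 \<otimes> x \<otimes> u ! 1 else u ! 1 \<otimes> x \<otimes> u ! 0"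
  shows "bilinear_map k (T 2) A A (\<lambda>E x. tensor_lift k A (\<lambda>u. s u x) E)"
    and "\<lbrakk>u \<in> tuples 2; x \<in> carrier A\<rbrakk> \<Longrightarrow> tensor_lift k A (\<lambda>u. s u x) (pure u) = s u x"
proof -
  have ml: "multilinear 2 A (\<lambda>u. s u x)" if x: "x \<in> carrier A" for x
    unfolding multilinear_def
  proof (intro conjI ballI allI impI)
    fix u assume "u \<in> tuples 2"
    then obtain a b where u: "u = [a, b]" and ab: "a \<in> carrier A" "b \<in> carrier A" by (auto simp: tuples2)
    show "s u x \<in> carrier A" using x ab by (simp add: s_def u)
    fix i :: nat assume "i < 2"
    have 1: "(\<lambda>c. c \<otimes> x \<otimes> e) \<in> lmod_hom k A A" "(\<lambda>c. e \<otimes> x \<otimes> c) \<in> lmod_hom k A A"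
      if "e \<in> carrier A" for e
      using that x lmod_hom_comp[OF mult_right_hom[OF x] mult_right_hom[OF that]] mult_left_hom[of "e \<otimes> x"]
      by auto
    show "(\<lambda>c. s (u[i := c]) x) \<in> lmod_hom k A A"
      using less_2_cases[OF \<open>i < 2\<close>] ab 1 by (cases l) (auto simp: s_def u)
  qed
  show pure: "tensor_lift k A (\<lambda>u. s u x) (pure u) = s u x" if "u \<in> tuples 2" "x \<in> carrier A" for u x
    by (rule tensor_lift_pure[OF Am.left_module_axioms ml[OF that(2)] that(1)])
  note h = tensor_lift_hom[OF Am.left_module_axioms ml]
  show "bilinear_map k (T 2) A A (\<lambda>E x. tensor_lift k A (\<lambda>u. s u x) E)"
    unfolding bilinear_map_def
  proof (intro conjI ballI h)
    fix E assume E: "E \<in> carrier (T 2)"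
    show "(\<lambda>x. tensor_lift k A (\<lambda>u. s u x) E) \<in> lmod_hom k A A"
    proof (rule lmod_homI)
      fix x assume x: "x \<in> carrier A"
      show "tensor_lift k A (\<lambda>u. s u x) E \<in> carrier A" by (rule lmod_hom_closed[OF h[OF x] E])
      { fix y assume y: "y \<in> carrier A"
        show "tensor_lift k A (\<lambda>u. s u (x \<oplus> y)) E
            = tensor_lift k A (\<lambda>u. s u x) E \<oplus> tensor_lift k A (\<lambda>u. s u y) E"
          by (rule tensor_hom_eq[OF Am.left_module_axioms h[OF A.M.a_closed[OF x y]]
                lmod_hom_plus[OF Am.left_module_axioms h[OF x] h[OF y]] _ E])
            (use x y in \<open>auto simp: pure A.M.a_closed, auto simp: s_def tuples2 A.A.l_distr A.A.r_distr\<close>) }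
      { fix r assume r: "r \<in> carrier k"
        show "tensor_lift k A (\<lambda>u. s u (r \<odot> x)) E = r \<odot> tensor_lift k A (\<lambda>u. s u x) E"
          by (rule tensor_hom_eq[OF Am.left_module_axioms h[OF Am.act_closed[OF r x]]
                lmod_hom_scale[OF k_cring Am.left_module_axioms h[OF x] r] _ E])
            (use x r in \<open>auto simp: pure, auto simp: s_def tuples2 A.smult_mult_left A.smult_mult_right\<close>) }
    qed
  qed
qed

lemma env_left_simps [simp]:
  "carrier (env_left k A) = carrier A" "(\<oplus>\<^bsub>env_left k A\<^esub>) = (\<oplus>)" "\<zero>\<^bsub>env_left k A\<^esub> = \<zero>"
  by (simp_all add: env_left_def)

lemma env_right_simps [simp]:
  "carrier (env_right k A) = carrier A" "(\<oplus>\<^bsub>env_right k A\<^esub>) = (\<oplus>)" "\<zero>\<^bsub>env_right k A\<^esub> = \<zero>"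
  by (simp_all add: env_right_def)

lemma env_left_bilinear: "bilinear_map k (T 2) A A (\<odot>\<^bsub>env_left k A\<^esub>)"
  and env_left_pure: "\<lbrakk>a \<in> carrier A; b \<in> carrier A; x \<in> carrier A\<rbrakk>
    \<Longrightarrow> pure [a, b] \<odot>\<^bsub>env_left k A\<^esub> x = a \<otimes> x \<otimes> b"
  using sandwich_bilinear[where l = True] by (simp_all add: env_left_def pair_tuples)

lemma env_right_bilinear: "bilinear_map k (T 2) A A (\<odot>\<^bsub>env_right k A\<^esub>)"
  and env_right_pure: "\<lbrakk>a \<in> carrier A; b \<in> carrier A; x \<in> carrier A\<rbrakk>
    \<Longrightarrow> pure [a, b] \<odot>\<^bsub>env_right k A\<^esub> x = b \<otimes> x \<otimes> a"
  using sandwich_bilinear[where l = False] by (simp_all add: env_right_def pair_tuples)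

lemma scal_env_left: "\<lbrakk>r \<in> carrier k; x \<in> carrier A\<rbrakk> \<Longrightarrow> scal r \<odot>\<^bsub>env_left k A\<^esub> x = r \<odot> x"
  by (simp add: scal_pure env_left_pure A.smult_mult_left)

lemma scal_env_right: "\<lbrakk>r \<in> carrier k; x \<in> carrier A\<rbrakk> \<Longrightarrow> scal r \<odot>\<^bsub>env_right k A\<^esub> x = r \<odot> x"
  by (simp add: scal_pure env_right_pure A.smult_mult_right)

lemma env_left_left_module: "left_module Ae (env_left k A)"
proof (rule left_moduleI[OF env_ring])
  note m1 = bilinear_mapD(1)[OF env_left_bilinear] and m2 = bilinear_mapD(2)[OF env_left_bilinear]
  show "abelian_group (env_left k A)"
    by (rule abelian_group_cong[OF A.M.abelian_group_axioms]) simp_all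
  fix E x assume "E \<in> carrier Ae" "x \<in> carrier (env_left k A)"
  then have E: "E \<in> carrier (T 2)" and x: "x \<in> carrier A" by (simp_all add: env_simps)
  show "E \<odot>\<^bsub>env_left k A\<^esub> x \<in> carrier (env_left k A)"
    using lmod_hom_closed[OF m1[OF x] E] by simp
  { fix y assume "y \<in> carrier (env_left k A)"
    then show "E \<odot>\<^bsub>env_left k A\<^esub> (x \<oplus>\<^bsub>env_left k A\<^esub> y)
        = E \<odot>\<^bsub>env_left k A\<^esub> x \<oplus>\<^bsub>env_left k A\<^esub> E \<odot>\<^bsub>env_left k A\<^esub> y"
      using lmod_hom_add[OF m2[OF E] x] by simp }
next
  note m1 = bilinear_mapD(1)[OF env_left_bilinear] and m2 = bilinear_mapD(2)[OF env_left_bilinear]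
  fix E E' x assume "E \<in> carrier Ae" "E' \<in> carrier Ae" "x \<in> carrier (env_left k A)"
  then have E: "E \<in> carrier (T 2)" "E' \<in> carrier (T 2)" and x: "x \<in> carrier A" by (simp_all add: env_simps)
  show "(E \<oplus>\<^bsub>Ae\<^esub> E') \<odot>\<^bsub>env_left k A\<^esub> x = E \<odot>\<^bsub>env_left k A\<^esub> x \<oplus>\<^bsub>env_left k A\<^esub> E' \<odot>\<^bsub>env_left k A\<^esub> x"
    using lmod_hom_add[OF m1[OF x] E] by (simp add: env_simps)
  show "(E \<otimes>\<^bsub>Ae\<^esub> E') \<odot>\<^bsub>env_left k A\<^esub> x = E \<odot>\<^bsub>env_left k A\<^esub> (E' \<odot>\<^bsub>env_left k A\<^esub> x)"
    by (rule bilinear_eq[OF Am.left_module_axioms bilinear_map_compose[OF env_mult_bilinear m1[OF x]]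
          bilinear_map_arg2[OF env_left_bilinear m1[OF x]] _ E])
      (use x in \<open>auto simp: tuples2 env_mult_pure env_left_pure A.A.m_assoc\<close>)
next
  fix x assume "x \<in> carrier (env_left k A)"
  then show "\<one>\<^bsub>Ae\<^esub> \<odot>\<^bsub>env_left k A\<^esub> x = x" by (simp add: env_simps(5) env_left_pure)
qed

lemma env_right_closed:
  "\<lbrakk>E \<in> carrier Ae; x \<in> carrier A\<rbrakk> \<Longrightarrow> E \<odot>\<^bsub>env_right k A\<^esub> x \<in> carrier A"
  using bilinear_map_closed[OF env_right_bilinear] by (simp add: env_simps)

end

section \<open>The bar resolution\<close>

context k_algebra
begin

text \<open>The effect of \<open>a \<otimes> b\<close> on a tuple of length \<open>n + 2\<close>.
  The positions \<open>0\<close> and \<open>Suc n\<close> are its ends, distinct even for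
  \<open>n = 0\<close>.\<close>

definition sandwich :: "nat \<Rightarrow> 'a \<Rightarrow> 'a \<Rightarrow> 'a list \<Rightarrow> 'a list" where
  "sandwich n a b xs = xs[0 := a \<otimes> xs ! 0, Suc n := xs ! Suc n \<otimes> b]"

lemma sandwich_tuples:
  "\<lbrakk>a \<in> carrier A; b \<in> carrier A; xs \<in> tuples (n + 2)\<rbrakk> \<Longrightarrow> sandwich n a b xs \<in> tuples (n + 2)"
  by (simp add: sandwich_def tuples_update tuples_nth)

lemma sandwich_ends:
  "length ys = n \<Longrightarrow> sandwich n a b (x # ys @ [z]) = (a \<otimes> x) # ys @ [z \<otimes> b]"
  by (auto simp: sandwich_def nth_append list_update_append)

lemma tuples_ends:
  assumes "xs \<in> tuples (n + 2)"
  obtains x ys z where "xs = x # ys @ [z]" "x \<in> carrier A" "ys \<in> tuples n" "z \<in> carrier A"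
proof -
  obtain x ws where xs: "xs = x # ws" "ws \<in> tuples (Suc n)" "x \<in> carrier A"
    using assms by (cases xs) (auto simp: tuples_def)
  then have "ws = butlast ws @ [last ws]" by (cases ws) (auto simp: tuples_def)
  then show thesis using xs that tuples_snoc by metis
qed

lemma ends_tuples:
  "\<lbrakk>x \<in> carrier A; ys \<in> tuples n; z \<in> carrier A\<rbrakk> \<Longrightarrow> x # ys @ [z] \<in> tuples (n + 2)"
  by (simp add: tuples_Cons tuples_snoc)

lemma bar_simps:
  "carrier (bar k A n) = carrier (T (n + 2))" "(\<oplus>\<^bsub>bar k A n\<^esub>) = (\<oplus>\<^bsub>T (n + 2)\<^esub>)"
  "\<zero>\<^bsub>bar k A n\<^esub> = \<zero>\<^bsub>T (n + 2)\<^esub>"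
  "E \<odot>\<^bsub>bar k A n\<^esub> X = tensor_lift k (T (n + 2)) (\<lambda>u. tensor_lift k (T (n + 2))
      (\<lambda>xs. pure (sandwich n (u ! 0) (u ! 1) xs)) X) E"
  by (simp_all add: bar_def Let_def sandwich_def)

lemma bar_action:
  shows bar_bilinear: "bilinear_map k (T 2) (T (n + 2)) (T (n + 2)) (\<odot>\<^bsub>bar k A n\<^esub>)"
    and bar_pure: "\<lbrakk>a \<in> carrier A; b \<in> carrier A; xs \<in> tuples (n + 2)\<rbrakk>
      \<Longrightarrow> pure [a, b] \<odot>\<^bsub>bar k A n\<^esub> pure xs = pure (sandwich n a b xs)"
proof -
  let ?f = "\<lambda>u xs. pure (sandwich n (u ! 0) (u ! 1) xs)"
  have 1: "multilinear (n + 2) (T (n + 2)) (?f u)" if u: "u \<in> tuples 2" for u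
  proof (rule multilinear_subst[OF multilinear_pure])
    have c: "u ! 0 \<in> carrier A" "u ! 1 \<in> carrier A" using u tuples_nth by auto
    show s: "sandwich n (u ! 0) (u ! 1) xs \<in> tuples (n + 2)" if "xs \<in> tuples (n + 2)" for xs
      using sandwich_tuples c that by blast
    fix xs i assume xs: "xs \<in> tuples (n + 2)" and i: "i < n + 2"
    have l: "length xs = n + 2" using xs by (rule tuples_length)
    consider "i = 0" | "i = Suc n" | "i \<noteq> 0" "i \<noteq> Suc n" by blast
    then show "\<exists>ys\<in>tuples (n + 2). \<exists>j<n + 2. \<exists>l\<in>lmod_hom k A A. \<forall>c\<in>carrier A.
        sandwich n (u ! 0) (u ! 1) (xs[i := c]) = ys[j := l c]"
    proof cases
      case 1
      then show ?thesis
        by (intro bexI[OF _ s[OF xs]] exI[of _ i] conjI bexI[OF _ mult_left_hom[OF c(1)]] ballI nth_equalityI i)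
          (auto simp: sandwich_def l nth_list_update)
    next
      case 2
      then show ?thesis
        by (intro bexI[OF _ s[OF xs]] exI[of _ i] conjI bexI[OF _ mult_right_hom[OF c(2)]] ballI nth_equalityI i)
          (auto simp: sandwich_def l nth_list_update)
    next
      case 3
      then show ?thesis using i
        by (intro bexI[OF _ s[OF xs]] exI[of _ i] conjI bexI[OF _ lmod_hom_id] ballI nth_equalityI i)
          (auto simp: sandwich_def l nth_list_update)
    qed
  qed
  have 2: "multilinear 2 (T (n + 2)) (\<lambda>u. ?f u xs)" if xs: "xs \<in> tuples (n + 2)" for xs
  proof (rule multilinear_subst[OF multilinear_pure])
    show s: "sandwich n (u ! 0) (u ! 1) xs \<in> tuples (n + 2)" if "u \<in> tuples 2" for u
      using sandwich_tuples[OF tuples_nth[OF that] tuples_nth[OF that] xs] by simp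
    fix u i assume u: "u \<in> tuples 2" and i: "i < (2::nat)"
    have l: "length xs = n + 2" "length u = 2" using xs u tuples_length by auto
    have c: "xs ! 0 \<in> carrier A" "xs ! Suc n \<in> carrier A" using xs tuples_nth by auto
    show "\<exists>ys\<in>tuples (n + 2). \<exists>j<n + 2. \<exists>l\<in>lmod_hom k A A. \<forall>c\<in>carrier A.
        sandwich n (u[i := c] ! 0) (u[i := c] ! 1) xs = ys[j := l c]"
    proof (rule disjE[OF less_2_cases[OF i]])
      assume "i = 0"
      then show ?thesis
        by (intro bexI[OF _ s[OF u]] exI[of _ 0] conjI bexI[OF _ mult_right_hom[OF c(1)]] ballI nth_equalityI)
          (auto simp: sandwich_def l nth_list_update)
    next
      assume "i = Suc 0"
      then show ?thesis
        by (intro bexI[OF _ s[OF u]] exI[of _ "Suc n"] conjI bexI[OF _ mult_left_hom[OF c(2)]] ballI nth_equalityI)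
          (auto simp: sandwich_def l nth_list_update)
    qed
  qed
  have m: "(\<odot>\<^bsub>bar k A n\<^esub>) = (\<lambda>X Y. tensor_lift k (T (n + 2)) (\<lambda>u. tensor_lift k (T (n + 2)) (?f u) Y) X)"
    by (intro ext) (simp only: bar_simps)
  show "bilinear_map k (T 2) (T (n + 2)) (T (n + 2)) (\<odot>\<^bsub>bar k A n\<^esub>)"
    unfolding m by (rule bilinear_lift(1)[OF tensor_pow_left_module 1 2])
  show "pure [a, b] \<odot>\<^bsub>bar k A n\<^esub> pure xs = pure (sandwich n a b xs)"
    if "a \<in> carrier A" "b \<in> carrier A" "xs \<in> tuples (n + 2)"
    unfolding m using bilinear_lift(2)[OF tensor_pow_left_module 1 2, of "[a,b]" xs] that
    by (simp add: pair_tuples)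
qed

lemma bar_pure_ends:
  assumes "a \<in> carrier A" "b \<in> carrier A" "x \<in> carrier A" "ys \<in> tuples n" "z \<in> carrier A"
  shows "pure [a, b] \<odot>\<^bsub>bar k A n\<^esub> pure (x # ys @ [z]) = pure ((a \<otimes> x) # ys @ [z \<otimes> b])"
  using bar_pure[OF assms(1,2) ends_tuples[OF assms(3-5)]] sandwich_ends[OF tuples_length[OF assms(4)]] by simp

lemma bar_group: "abelian_group (bar k A n)"
  by (rule abelian_group_cong[OF tensor_pow_group bar_simps(1-3)])

lemma bar_left_module: "left_module Ae (bar k A n)"
proof (rule left_moduleI[OF env_ring bar_group])
  note m1 = bilinear_mapD(1)[OF bar_bilinear] and m2 = bilinear_mapD(2)[OF bar_bilinear]
  note c = bilinear_map_closed[OF bar_bilinear]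
  fix X assume "X \<in> carrier (bar k A n)"
  then have X: "X \<in> carrier (T (n + 2))" by (simp only: bar_simps)
  show "\<one>\<^bsub>Ae\<^esub> \<odot>\<^bsub>bar k A n\<^esub> X = X" unfolding env_simps(5)
    by (rule tensor_hom_eq[OF tensor_pow_left_module m2[OF env_one_closed] lmod_hom_id _ X])
      (erule tuples_ends, simp add: bar_pure_ends)
  fix E assume "E \<in> carrier Ae"
  then have E: "E \<in> carrier (T 2)" by (simp only: env_simps)
  show "E \<odot>\<^bsub>bar k A n\<^esub> X \<in> carrier (bar k A n)" unfolding bar_simps(1) by (rule c[OF E X])
  { fix Y assume "Y \<in> carrier (bar k A n)"
    then have Y: "Y \<in> carrier (T (n + 2))" by (simp only: bar_simps)
    show "E \<odot>\<^bsub>bar k A n\<^esub> (X \<oplus>\<^bsub>bar k A n\<^esub> Y) = E \<odot>\<^bsub>bar k A n\<^esub> X \<oplus>\<^bsub>bar k A n\<^esub> E \<odot>\<^bsub>bar k A n\<^esub> Y"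
      unfolding bar_simps(2) by (rule lmod_hom_add[OF m2[OF E] X Y]) }
next
  note m1 = bilinear_mapD(1)[OF bar_bilinear] and m2 = bilinear_mapD(2)[OF bar_bilinear]
  note c = bilinear_map_closed[OF bar_bilinear]
  fix E E' X assume "E \<in> carrier Ae" "E' \<in> carrier Ae" "X \<in> carrier (bar k A n)"
  then have E: "E \<in> carrier (T 2)" "E' \<in> carrier (T 2)" and X: "X \<in> carrier (T (n + 2))"
    by (simp_all only: env_simps bar_simps)
  show "(E \<oplus>\<^bsub>Ae\<^esub> E') \<odot>\<^bsub>bar k A n\<^esub> X = E \<odot>\<^bsub>bar k A n\<^esub> X \<oplus>\<^bsub>bar k A n\<^esub> E' \<odot>\<^bsub>bar k A n\<^esub> X"
    unfolding bar_simps(2) env_simps(2) by (rule lmod_hom_add[OF m1[OF X] E])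
  show "(E \<otimes>\<^bsub>Ae\<^esub> E') \<odot>\<^bsub>bar k A n\<^esub> X = E \<odot>\<^bsub>bar k A n\<^esub> (E' \<odot>\<^bsub>bar k A n\<^esub> X)"
  proof (rule bilinear_eq[OF tensor_pow_left_module bilinear_map_compose[OF env_mult_bilinear m1[OF X]]
          bilinear_map_arg2[OF bar_bilinear m1[OF X]] _ E])
    fix u v assume u: "u \<in> tuples 2" and v: "v \<in> tuples 2"
    note p = pure_closed[OF u] pure_closed[OF v]
    show "(pure u \<otimes>\<^bsub>Ae\<^esub> pure v) \<odot>\<^bsub>bar k A n\<^esub> X = pure u \<odot>\<^bsub>bar k A n\<^esub> (pure v \<odot>\<^bsub>bar k A n\<^esub> X)"
    proof (rule tensor_hom_eq[OF tensor_pow_left_module m2 lmod_hom_comp[OF m2[OF p(2)] m2[OF p(1)]] _ X])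
      show "pure u \<otimes>\<^bsub>Ae\<^esub> pure v \<in> carrier (T 2)" by (rule bilinear_map_closed[OF env_mult_bilinear p])
      fix xs assume "xs \<in> tuples (n + 2)"
      then show "(pure u \<otimes>\<^bsub>Ae\<^esub> pure v) \<odot>\<^bsub>bar k A n\<^esub> pure xs = pure u \<odot>\<^bsub>bar k A n\<^esub> (pure v \<odot>\<^bsub>bar k A n\<^esub> pure xs)"
        using u v by (elim tuples_ends) (auto simp: tuples2 env_mult_pure bar_pure_ends A.A.m_assoc)
    qed
  qed
qed

text \<open>Scalars of \<open>k\<close> act on \<open>bar\<close> through \<open>Ae\<close> and
  through the tensor power; absorbing \<open>r\<close> into the first factor shows that the two
  actions agree. This identifies linear maps on the restricted bar module with linear maps on
  \<open>T (n + 2)\<close>.\<close>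

lemma scal_bar:
  assumes r: "r \<in> carrier k" and X: "X \<in> carrier (T (n + 2))"
  shows "scal r \<odot>\<^bsub>bar k A n\<^esub> X = r \<odot>\<^bsub>T (n + 2)\<^esub> X"
proof -
  have "scal r \<in> carrier (T 2)" using scal_closed[OF r] by (simp only: env_simps)
  then show ?thesis
  proof (intro tensor_hom_eq[OF tensor_pow_left_module bilinear_mapD(2)[OF bar_bilinear]
          lmod_hom_scale[OF k_cring tensor_pow_left_module lmod_hom_id r] _ X])
    fix xs assume xs: "xs \<in> tuples (n + 2)"
    then show "scal r \<odot>\<^bsub>bar k A n\<^esub> pure xs = r \<odot>\<^bsub>T (n + 2)\<^esub> pure xs"
      using r pure_smult[OF xs, of 0 "xs ! 0" r]
      by (elim tuples_ends) (simp add: scal_pure bar_pure_ends A.smult_mult_left)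
  qed
qed

lemma bar_hom_restrict: "lmod_hom k (restrict_scalars (bar k A n)) W = lmod_hom k (T (n + 2)) W"
  by (rule lmod_hom_cong_structure) (simp_all add: bar_simps(1-3) scal_bar del: add_2_eq_Suc')

lemma bar_hom_restrict2:
  "lmod_hom k M (restrict_scalars (bar k A n)) = lmod_hom k M (T (n + 2))"
  by (rule lmod_hom_cong_structure) (simp_all add: bar_simps(1-3) scal_bar del: add_2_eq_Suc')

text \<open>Both sides of \<open>Ae\<close>-linearity are bilinear over \<open>k\<close> in scalar
  and vector, so checking pure tensors suffices.\<close>

lemma bar_homI:
  assumes N: "left_module Ae N" and h: "h \<in> lmod_hom k (T (n + 2)) (restrict_scalars N)"
    and eq: "\<And>a b xs. \<lbrakk>a \<in> carrier A; b \<in> carrier A; xs \<in> tuples (n + 2)\<rbrakk>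
      \<Longrightarrow> h (pure (sandwich n a b xs)) = pure [a, b] \<odot>\<^bsub>N\<^esub> h (pure xs)"
  shows "h \<in> lmod_hom Ae (bar k A n) N"
proof (rule lmod_homI)
  note W = restrict_scalars_left_module[OF N]
  fix X assume X: "X \<in> carrier (bar k A n)"
  then show "h X \<in> carrier N" using lmod_hom_closed[OF h] by (simp only: bar_simps restrict_scalars_simps)
  { fix Y assume "Y \<in> carrier (bar k A n)"
    then show "h (X \<oplus>\<^bsub>bar k A n\<^esub> Y) = h X \<oplus>\<^bsub>N\<^esub> h Y"
      using X lmod_hom_add[OF h] by (simp only: bar_simps restrict_scalars_simps) }
  fix E assume "E \<in> carrier Ae"
  then have E: "E \<in> carrier (T 2)" by (simp only: env_simps)
  show "h (E \<odot>\<^bsub>bar k A n\<^esub> X) = E \<odot>\<^bsub>N\<^esub> h X"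
    by (rule bilinear_eq[OF W bilinear_map_compose[OF bar_bilinear h] bilinear_map_arg2[OF action_bilinear[OF N] h]
          _ E X[unfolded bar_simps]])
      (auto simp: tuples2 bar_pure eq simp del: add_2_eq_Suc')
qed

lemma bar_hom_linear:
  assumes "h \<in> lmod_hom Ae (bar k A n) N"
  shows "h \<in> lmod_hom k (T (n + 2)) (restrict_scalars N)"
  using restrict_scalars_hom[OF assms] unfolding bar_hom_restrict .

text \<open>Since \<open>x \<otimes> ys \<otimes> z\<close> is \<open>x \<otimes> \<one>\<close>
  acting on \<open>\<one> \<otimes> ys \<otimes> z\<close>, the tensors beginning with the unit
  generate the module. They are the values of the contraction on pure tensors, which makes this the
  test used in the inductions on degree.\<close>

lemma bar_hom_eq:
  assumes N: "left_module Ae N" and h: "h \<in> lmod_hom Ae (bar k A n) N" "h' \<in> lmod_hom Ae (bar k A n) N"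
    and eq: "\<And>xs. xs \<in> tuples (Suc n) \<Longrightarrow> h (pure (\<one> # xs)) = h' (pure (\<one> # xs))"
    and X: "X \<in> carrier (T (n + 2))"
  shows "h X = h' X"
proof (rule tensor_hom_eq[OF restrict_scalars_left_module[OF N] bar_hom_linear[OF h(1)] bar_hom_linear[OF h(2)] _ X])
  fix xs assume "xs \<in> tuples (n + 2)"
  then obtain x ys z where xs: "xs = x # ys @ [z]" "x \<in> carrier A" "ys \<in> tuples n" "z \<in> carrier A"
    by (rule tuples_ends)
  have p: "pure [x, \<one>] \<in> carrier Ae" "pure (\<one> # ys @ [z]) \<in> carrier (bar k A n)"
    unfolding env_simps bar_simps using xs by (auto intro!: pure_closed pair_tuples ends_tuples simp del: add_2_eq_Suc')
  have "pure xs = pure [x, \<one>] \<odot>\<^bsub>bar k A n\<^esub> pure (\<one> # ys @ [z])"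
    using xs by (simp add: bar_pure_ends)
  then show "h (pure xs) = h' (pure xs)"
    using eq[of "ys @ [z]"] xs
    by (simp add: lmod_hom_smult[OF h(1) p] lmod_hom_smult[OF h(2) p] tuples_snoc)
qed

section \<open>Faces and differential of the bar complex\<close>

lemma nth_merge_at:
  assumes "length xs = Suc m" "i < m" "p < m"
  shows "merge_at A i xs ! p = (if p < i then xs ! p else if p = i then xs ! i \<otimes> xs ! Suc i else xs ! Suc p)"
  using assms by (auto simp: merge_at_def nth_append min_def nth_Cons split: nat.splits)
    (auto simp: Suc_diff_Suc numeral_2_eq_2 intro!: arg_cong[where f = "nth xs"])

lemma length_merge_at: "\<lbrakk>length xs = Suc m; i < m\<rbrakk> \<Longrightarrow> length (merge_at A i xs) = m"
  by (simp add: merge_at_def)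

lemma merge_at_tuples:
  assumes "xs \<in> tuples (Suc m)" "i < m"
  shows "merge_at A i xs \<in> tuples m"
proof -
  have "set (merge_at A i xs) \<subseteq> carrier A"
    using assms tuples_nth[OF assms(1)] nth_merge_at[OF tuples_length[OF assms(1)] assms(2)]
      length_merge_at[OF tuples_length[OF assms(1)] assms(2)]
    by (auto simp: in_set_conv_nth)
  then show ?thesis using length_merge_at[OF tuples_length[OF assms(1)] assms(2)] by (simp add: tuples_def)
qed

lemma merge_at_Cons: "merge_at A (Suc i) (x # xs) = x # merge_at A i xs"
  by (simp add: merge_at_def)

lemma merge_at_0: "merge_at A 0 (x # y # xs) = (x \<otimes> y) # xs"
  by (simp add: merge_at_def)

text \<open>A slot before the merged pair keeps its index, the two slots of the pair enter through
  right and left multiplication, and a slot after the pair moves down by one.\<close>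

lemma multilinear_merge_at:
  assumes i: "i < m"
  shows "multilinear (Suc m) (T m) (\<lambda>xs. pure (merge_at A i xs))"
proof (rule multilinear_subst[OF multilinear_pure merge_at_tuples[OF _ i]])
  fix xs j assume xs: "xs \<in> tuples (Suc m)" and j: "j < Suc m"
  have l: "length xs = Suc m" using xs by (rule tuples_length)
  note y = merge_at_tuples[OF xs i]
  note n = nth_merge_at[OF _ i] length_merge_at[OF _ i]
  have c: "xs ! i \<in> carrier A" "xs ! Suc i \<in> carrier A" using tuples_nth[OF xs] i by auto
  consider "j < i" | "j = i" | "j = Suc i" | "Suc i < j" by linarith
  then show "\<exists>ys\<in>tuples m. \<exists>j'<m. \<exists>l\<in>lmod_hom k A A. \<forall>c\<in>carrier A.
      merge_at A i (xs[j := c]) = ys[j' := l c]"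
  proof cases
    case 1
    then show ?thesis using i l
      by (intro bexI[OF _ y] exI[of _ j] conjI bexI[OF _ lmod_hom_id] ballI nth_equalityI)
        (auto simp: n nth_list_update)
  next
    case 2
    then show ?thesis using i l
      by (intro bexI[OF _ y] exI[of _ i] conjI bexI[OF _ mult_right_hom[OF c(2)]] ballI nth_equalityI)
        (auto simp: n nth_list_update)
  next
    case 3
    then show ?thesis using i l
      by (intro bexI[OF _ y] exI[of _ i] conjI bexI[OF _ mult_left_hom[OF c(1)]] ballI nth_equalityI)
        (auto simp: n nth_list_update)
  next
    case 4
    then show ?thesis using i l j
      by (intro bexI[OF _ y] exI[of _ "j - 1"] conjI bexI[OF _ lmod_hom_id] ballI nth_equalityI)
        (auto simp: n nth_list_update)
  qed
qed

lemma sgn_pow_closed: "sgn_pow k i \<in> carrier k"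
  by (simp add: sgn_pow_def A.R.nat_pow_closed)

lemma sgn_pow_Suc_act:
  assumes "left_module k W" "x \<in> carrier W"
  shows "sgn_pow k (Suc i) \<odot>\<^bsub>W\<^esub> x = \<ominus>\<^bsub>W\<^esub> (sgn_pow k i \<odot>\<^bsub>W\<^esub> x)"
proof -
  interpret W: left_module k W by fact
  have "sgn_pow k (Suc i) = \<ominus>\<^bsub>k\<^esub> (sgn_pow k i)"
    using sgn_pow_closed[of i] by (simp add: sgn_pow_def A.R.r_minus)
  then show ?thesis using assms(2) sgn_pow_closed by (simp add: W.act_inv_left)
qed

lemma sgn_pow_0_act: "\<lbrakk>left_module k W; x \<in> carrier W\<rbrakk> \<Longrightarrow> sgn_pow k 0 \<odot>\<^bsub>W\<^esub> x = x"
  by (simp add: sgn_pow_def left_module.act_one)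

lemma bar_diff_multilinear:
  "multilinear (Suc n + 2) (T (n + 2)) (\<lambda>xs. \<Oplus>\<^bsub>T (n + 2)\<^esub>i\<in>{..Suc n}.
        sgn_pow k i \<odot>\<^bsub>T (n + 2)\<^esub> pure (merge_at A i xs))"
  using multilinear_merge_at[of _ "n + 2"]
  by (intro multilinear_sum multilinear_scale tensor_pow_left_module sgn_pow_closed) auto

lemma bar_diff_linear: "bar_diff k A n \<in> lmod_hom k (T (Suc n + 2)) (T (n + 2))"
  unfolding bar_diff_def by (rule tensor_lift_hom[OF tensor_pow_left_module bar_diff_multilinear])

lemma bar_diff_pure:
  "xs \<in> tuples (Suc n + 2) \<Longrightarrow> bar_diff k A n (pure xs)
    = (\<Oplus>\<^bsub>T (n + 2)\<^esub>i\<in>{..Suc n}. sgn_pow k i \<odot>\<^bsub>T (n + 2)\<^esub> pure (merge_at A i xs))"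
  unfolding bar_diff_def by (rule tensor_lift_pure[OF tensor_pow_left_module bar_diff_multilinear])

text \<open>Each face is compatible with the action because the outer factors only touch the ends;
  where the merged pair includes an end, associativity is used.\<close>

lemma merge_at_sandwich:
  assumes xs: "xs \<in> tuples (Suc n + 2)" and i: "i \<le> Suc n" and ab: "a \<in> carrier A" "b \<in> carrier A"
  shows "merge_at A i (sandwich (Suc n) a b xs) = sandwich n a b (merge_at A i xs)"
proof -
  have l: "length xs = Suc (n + 2)" using tuples_length[OF xs] by simp
  have i': "i < n + 2" using i by simp
  have c: "xs ! p \<in> carrier A" if "p < n + 3" for p using tuples_nth[OF xs] that by simp
  have n: "length zs = Suc (n + 2) \<Longrightarrow> p < n + 2 \<Longrightarrow> merge_at A i zs ! p
    = (if p < i then zs ! p else if p = i then zs ! i \<otimes> zs ! Suc i else zs ! Suc p)" for zs p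
    using nth_merge_at[OF _ i'] by blast
  note m = length_merge_at[OF _ i']
  show ?thesis
  proof (rule nth_equalityI)
    show "length (merge_at A i (sandwich (Suc n) a b xs)) = length (sandwich n a b (merge_at A i xs))"
      using l by (simp add: sandwich_def m)
    fix p assume "p < length (merge_at A i (sandwich (Suc n) a b xs))"
    then have p: "p < n + 2" using l by (simp add: sandwich_def m)
    show "merge_at A i (sandwich (Suc n) a b xs) ! p = sandwich n a b (merge_at A i xs) ! p"
      using p l i c[of 0] c[of 1] c[of "Suc n"] c[of "Suc (Suc n)"] ab
      by (auto simp: sandwich_def n m nth_list_update A.A.m_assoc)
  qed
qed

lemma bar_diff_hom: "bar_diff k A n \<in> lmod_hom Ae (bar k A (Suc n)) (bar k A n)"
proof (rule bar_homI[OF bar_left_module])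
  show "bar_diff k A n \<in> lmod_hom k (T (Suc n + 2)) (restrict_scalars (bar k A n))"
    unfolding bar_hom_restrict2 by (rule bar_diff_linear)
  fix a b xs assume ab: "a \<in> carrier A" "b \<in> carrier A" and xs: "xs \<in> tuples (Suc n + 2)"
  interpret t: left_module k "T (n + 2)" by (rule tensor_pow_left_module)
  note m = bilinear_mapD(2)[OF bar_bilinear pure_closed[OF pair_tuples[OF ab]], of n]
  have mt: "merge_at A i xs \<in> tuples (n + 2)" if "i \<le> Suc n" for i
    using merge_at_tuples[of xs "n + 2" i] xs that by simp
  have c: "sgn_pow k i \<odot>\<^bsub>T (n + 2)\<^esub> pure ys \<in> carrier (T (n + 2))" if "ys \<in> tuples (n + 2)" for ys i
    using that by (intro t.act_closed sgn_pow_closed pure_closed)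
  have "bar_diff k A n (pure (sandwich (Suc n) a b xs))
     = (\<Oplus>\<^bsub>T (n + 2)\<^esub>i\<in>{..Suc n}. sgn_pow k i \<odot>\<^bsub>T (n + 2)\<^esub> pure (merge_at A i (sandwich (Suc n) a b xs)))"
    by (rule bar_diff_pure[OF sandwich_tuples[OF ab xs]])
  also have "\<dots> = (\<Oplus>\<^bsub>T (n + 2)\<^esub>i\<in>{..Suc n}. pure [a, b] \<odot>\<^bsub>bar k A n\<^esub> (sgn_pow k i \<odot>\<^bsub>T (n + 2)\<^esub> pure (merge_at A i xs)))"
  proof (rule t.N.finsum_cong'[OF refl])
    show "(\<lambda>i. pure [a, b] \<odot>\<^bsub>bar k A n\<^esub> (sgn_pow k i \<odot>\<^bsub>T (n + 2)\<^esub> pure (merge_at A i xs))) \<in> {..Suc n} \<rightarrow> carrier (T (n + 2))"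
      using lmod_hom_closed[OF m c[OF mt]] by auto
    fix i assume "i \<in> {..Suc n}"
    then have i: "i \<le> Suc n" by simp
    show "sgn_pow k i \<odot>\<^bsub>T (n + 2)\<^esub> pure (merge_at A i (sandwich (Suc n) a b xs))
        = pure [a, b] \<odot>\<^bsub>bar k A n\<^esub> (sgn_pow k i \<odot>\<^bsub>T (n + 2)\<^esub> pure (merge_at A i xs))"
      using lmod_hom_smult[OF m sgn_pow_closed pure_closed[OF mt[OF i]]] bar_pure[OF ab mt[OF i]]
      by (simp only: merge_at_sandwich[OF xs i ab])
  qed
  also have "\<dots> = pure [a, b] \<odot>\<^bsub>bar k A n\<^esub> (\<Oplus>\<^bsub>T (n + 2)\<^esub>i\<in>{..Suc n}. sgn_pow k i \<odot>\<^bsub>T (n + 2)\<^esub> pure (merge_at A i xs))"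
    by (rule lmod_hom_finsum[OF m tensor_pow_group tensor_pow_group, symmetric]) (use c mt in auto)
  also have "\<dots> = pure [a, b] \<odot>\<^bsub>bar k A n\<^esub> bar_diff k A n (pure xs)"
    by (simp only: bar_diff_pure[OF xs])
  finally show "bar_diff k A n (pure (sandwich (Suc n) a b xs)) = pure [a, b] \<odot>\<^bsub>bar k A n\<^esub> bar_diff k A n (pure xs)" .
qed

section \<open>The augmentation and the contracting homotopy\<close>

lemma bar_aug_linear: "bar_aug k A \<in> lmod_hom k (T 2) A"
  and bar_aug_pure: "\<lbrakk>x \<in> carrier A; z \<in> carrier A\<rbrakk> \<Longrightarrow> bar_aug k A (pure [x, z]) = x \<otimes> z"
proof -
  have ml: "multilinear 2 A (\<lambda>u. u ! 0 \<otimes> u ! 1)"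
    unfolding multilinear_def
  proof (intro conjI ballI allI impI)
    fix u assume "u \<in> tuples 2"
    then obtain a b where u: "u = [a, b]" and ab: "a \<in> carrier A" "b \<in> carrier A" by (auto simp: tuples2)
    show "u ! 0 \<otimes> u ! 1 \<in> carrier A" using ab by (simp add: u)
    fix i :: nat assume "i < 2"
    then show "(\<lambda>c. u[i := c] ! 0 \<otimes> u[i := c] ! 1) \<in> lmod_hom k A A"
      using less_2_cases[of i] ab mult_left_hom mult_right_hom by (auto simp: u)
  qed
  show "bar_aug k A \<in> lmod_hom k (T 2) A" unfolding bar_aug_def
    by (rule tensor_lift_hom[OF Am.left_module_axioms ml])
  show "bar_aug k A (pure [x, z]) = x \<otimes> z" if "x \<in> carrier A" "z \<in> carrier A"
    unfolding bar_aug_def using tensor_lift_pure[OF Am.left_module_axioms ml pair_tuples[OF that]] by simp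
qed

lemma bar_aug_hom: "bar_aug k A \<in> lmod_hom Ae (bar k A 0) (env_left k A)"
proof (rule bar_homI[OF env_left_left_module])
  have "lmod_hom k (T 2) (restrict_scalars (env_left k A)) = lmod_hom k (T 2) A"
    by (rule lmod_hom_cong_structure) (simp_all add: scal_env_left)
  then show "bar_aug k A \<in> lmod_hom k (T (0 + 2)) (restrict_scalars (env_left k A))"
    using bar_aug_linear by (simp only: add_0)
  fix a b xs assume "a \<in> carrier A" "b \<in> carrier A" "xs \<in> tuples (0 + 2)"
  then have "a \<in> carrier A" "b \<in> carrier A" "xs \<in> tuples 2" by (simp_all only: add_0)
  then show "bar_aug k A (pure (sandwich 0 a b xs)) = pure [a, b] \<odot>\<^bsub>env_left k A\<^esub> bar_aug k A (pure xs)"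
    by (auto simp: tuples2 sandwich_def bar_aug_pure env_left_pure A.A.m_assoc)
qed

text \<open>The extra degeneracy of the bar construction, which contracts the augmented bar complex
  over \<open>k\<close>.\<close>

definition insert_one :: "nat \<Rightarrow> ('a list \<Rightarrow> 'k) set \<Rightarrow> ('a list \<Rightarrow> 'k) set" where
  "insert_one n = tensor_lift k (T (Suc n)) (\<lambda>xs. pure (\<one> # xs))"

lemma insert_one_hom: "insert_one n \<in> lmod_hom k (T n) (T (Suc n))"
  and insert_one_pure: "xs \<in> tuples n \<Longrightarrow> insert_one n (pure xs) = pure (\<one> # xs)"
proof -
  have ml: "multilinear n (T (Suc n)) (\<lambda>xs. pure (\<one> # xs))"
  proof (rule multilinear_subst[OF multilinear_pure])
    show t: "\<one> # xs \<in> tuples (Suc n)" if "xs \<in> tuples n" for xs using that by (simp add: tuples_Cons)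
    fix xs i assume xs: "xs \<in> tuples n" and "i < n"
    then show "\<exists>ys\<in>tuples (Suc n). \<exists>j<Suc n. \<exists>l\<in>lmod_hom k A A. \<forall>c\<in>carrier A. \<one> # xs[i := c] = ys[j := l c]"
      by (intro bexI[OF _ t[OF xs]] exI[of _ "Suc i"] conjI bexI[OF _ lmod_hom_id]) auto
  qed
  show "insert_one n \<in> lmod_hom k (T n) (T (Suc n))" unfolding insert_one_def
    by (rule tensor_lift_hom[OF tensor_pow_left_module ml])
  show "insert_one n (pure xs) = pure (\<one> # xs)" if "xs \<in> tuples n"
    unfolding insert_one_def by (rule tensor_lift_pure[OF tensor_pow_left_module ml that])
qed

text \<open>Face \<open>0\<close> of \<open>\<one> # xs\<close> removes the unit, and face
  \<open>Suc i\<close> is the unit in front of face \<open>i\<close> of \<open>xs\<close>, with the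
  opposite sign. Indexing by tuple length lets \<open>m = 0\<close> serve the augmentation and
  positive \<open>m\<close> the differentials.\<close>

lemma alternating_merge_sum_Cons_one:
  assumes xs: "xs \<in> tuples (Suc (Suc m))"
  shows "(\<Oplus>\<^bsub>T (Suc (Suc m))\<^esub>i\<in>{..Suc m}. sgn_pow k i \<odot>\<^bsub>T (Suc (Suc m))\<^esub> pure (merge_at A i (\<one> # xs)))
    = pure xs \<ominus>\<^bsub>T (Suc (Suc m))\<^esub> insert_one (Suc m)
        (\<Oplus>\<^bsub>T (Suc m)\<^esub>i\<in>{..m}. sgn_pow k i \<odot>\<^bsub>T (Suc m)\<^esub> pure (merge_at A i xs))"
proof -
  let ?W = "T (Suc (Suc m))" and ?V = "T (Suc m)"
  interpret W: left_module k ?W by (rule tensor_pow_left_module)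
  interpret V: left_module k ?V by (rule tensor_pow_left_module)
  let ?P = "\<lambda>i. sgn_pow k i \<odot>\<^bsub>?W\<^esub> pure (merge_at A i (\<one> # xs))"
  let ?R = "\<lambda>i. sgn_pow k i \<odot>\<^bsub>?V\<^esub> pure (merge_at A i xs)"
  have mt: "merge_at A i xs \<in> tuples (Suc m)" if "i \<le> m" for i
    using merge_at_tuples[OF xs] that by simp
  have t: "\<one> # xs \<in> tuples (Suc (Suc (Suc m)))" using xs by (simp add: tuples_Cons)
  have Pc: "?P i \<in> carrier ?W" if "i \<le> Suc m" for i
    using merge_at_tuples[OF t, of i] that by (intro W.act_closed sgn_pow_closed pure_closed) simp
  have Rc: "?R i \<in> carrier ?V" if "i \<le> m" for i
    using mt[OF that] by (intro V.act_closed sgn_pow_closed pure_closed)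
  obtain x ys where x: "xs = x # ys" "x \<in> carrier A" using xs by (cases xs) (auto simp: tuples_def)
  have P0: "?P 0 = pure xs"
    using x xs by (simp add: merge_at_0 sgn_pow_0_act[OF tensor_pow_left_module] pure_closed)
  have PS: "?P (Suc i) = \<ominus>\<^bsub>?W\<^esub> insert_one (Suc m) (?R i)" if i: "i \<le> m" for i
    using lmod_hom_smult[OF insert_one_hom sgn_pow_closed pure_closed[OF mt[OF i]]] mt[OF i]
    by (simp add: merge_at_Cons insert_one_pure sgn_pow_Suc_act[OF tensor_pow_left_module] pure_closed tuples_Cons)
  have n: "(\<lambda>X. \<ominus>\<^bsub>?W\<^esub> insert_one (Suc m) X) \<in> lmod_hom k ?V ?W"
    by (intro lmod_hom_uminus tensor_pow_left_module insert_one_hom)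
  have "(\<Oplus>\<^bsub>?W\<^esub>i\<in>{..Suc m}. ?P i) = (\<Oplus>\<^bsub>?W\<^esub>i\<in>{..m}. ?P (Suc i)) \<oplus>\<^bsub>?W\<^esub> ?P 0"
    by (rule W.N.finsum_Suc2) (use Pc in auto)
  also have "(\<Oplus>\<^bsub>?W\<^esub>i\<in>{..m}. ?P (Suc i)) = (\<Oplus>\<^bsub>?W\<^esub>i\<in>{..m}. \<ominus>\<^bsub>?W\<^esub> insert_one (Suc m) (?R i))"
    by (rule W.N.finsum_cong'[OF refl]) (use lmod_hom_closed[OF n Rc] PS in auto)
  also have "\<dots> = \<ominus>\<^bsub>?W\<^esub> insert_one (Suc m) (\<Oplus>\<^bsub>?V\<^esub>i\<in>{..m}. ?R i)"
    by (rule lmod_hom_finsum[OF n tensor_pow_group tensor_pow_group, symmetric]) (use Rc in auto)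
  also have "\<dots> \<oplus>\<^bsub>?W\<^esub> ?P 0 = pure xs \<ominus>\<^bsub>?W\<^esub> insert_one (Suc m) (\<Oplus>\<^bsub>?V\<^esub>i\<in>{..m}. ?R i)"
    unfolding P0 a_minus_def
    by (rule W.N.a_comm) (rule lmod_hom_closed[OF n V.N.finsum_closed], use Rc pure_closed[OF xs] in auto)
  finally show ?thesis .
qed

lemma bar_contraction:
  assumes X: "X \<in> carrier (T (Suc n + 2))"
  shows "bar_diff k A (Suc n) (insert_one (Suc n + 2) X)
    = X \<ominus>\<^bsub>T (Suc n + 2)\<^esub> insert_one (n + 2) (bar_diff k A n X)"
proof (rule tensor_hom_eq[OF tensor_pow_left_module _ _ _ X])
  show "(\<lambda>X. bar_diff k A (Suc n) (insert_one (Suc n + 2) X)) \<in> lmod_hom k (T (Suc n + 2)) (T (Suc n + 2))"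
    by (rule lmod_hom_comp[OF insert_one_hom bar_diff_linear[of "Suc n", unfolded add_Suc], folded add_Suc])
  show "(\<lambda>X. X \<ominus>\<^bsub>T (Suc n + 2)\<^esub> insert_one (n + 2) (bar_diff k A n X)) \<in> lmod_hom k (T (Suc n + 2)) (T (Suc n + 2))"
    by (rule lmod_hom_diff[OF tensor_pow_left_module lmod_hom_id
          lmod_hom_comp[OF bar_diff_linear[of n, unfolded add_Suc] insert_one_hom], folded add_Suc])
  fix xs assume xs: "xs \<in> tuples (Suc n + 2)"
  then have "\<one> # xs \<in> tuples (Suc (Suc n) + 2)" by (simp add: tuples_Cons)
  then show "bar_diff k A (Suc n) (insert_one (Suc n + 2) (pure xs))
      = pure xs \<ominus>\<^bsub>T (Suc n + 2)\<^esub> insert_one (n + 2) (bar_diff k A n (pure xs))"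
    using alternating_merge_sum_Cons_one[of xs "Suc n"] xs
    by (simp add: insert_one_pure bar_diff_pure)
qed

text \<open>The augmentation replaces the missing differential: the single face of
  \<open>[x, z]\<close> is the product of \<open>x\<close> and \<open>z\<close>.\<close>

lemma bar_contraction_0:
  assumes X: "X \<in> carrier (T 2)"
  shows "bar_diff k A 0 (insert_one 2 X) = X \<ominus>\<^bsub>T 2\<^esub> pure [\<one>, bar_aug k A X]"
proof (rule tensor_hom_eq[OF tensor_pow_left_module _ _ _ X])
  have "bar_diff k A 0 \<in> lmod_hom k (T (Suc 2)) (T 2)"
    using bar_diff_linear[of 0] by (simp only: add_Suc add_0)
  then show "(\<lambda>X. bar_diff k A 0 (insert_one 2 X)) \<in> lmod_hom k (T 2) (T 2)"
    by (rule lmod_hom_comp[OF insert_one_hom])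
  have "(\<lambda>c. pure [\<one>, c]) \<in> lmod_hom k A (T 2)"
    using multilinearD(2)[OF multilinear_pure pair_tuples[of "\<one>" "\<one>"], of 1] by simp
  then show "(\<lambda>X. X \<ominus>\<^bsub>T 2\<^esub> pure [\<one>, bar_aug k A X]) \<in> lmod_hom k (T 2) (T 2)"
    by (intro lmod_hom_diff tensor_pow_left_module lmod_hom_id lmod_hom_comp[OF bar_aug_linear])
  fix xs assume xs: "xs \<in> tuples 2"
  then obtain x z where x: "xs = [x, z]" "x \<in> carrier A" "z \<in> carrier A" by (auto simp: tuples2)
  interpret t: left_module k "T (Suc 0)" by (rule tensor_pow_left_module)
  have 1: "[x \<otimes> z] \<in> tuples (Suc 0)" using x by (simp add: tuples_def)
  have s: "(\<Oplus>\<^bsub>T (Suc 0)\<^esub>i\<in>{..0}. sgn_pow k i \<odot>\<^bsub>T (Suc 0)\<^esub> pure (merge_at A i xs)) = pure [x \<otimes> z]"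
    using pure_closed[OF 1] by (simp add: t.N.finsum_0 x merge_at_0 sgn_pow_0_act[OF tensor_pow_left_module])
  have t: "\<one> # xs \<in> tuples (Suc 0 + 2)" using xs by (simp add: tuples_Cons numeral_2_eq_2)
  have "bar_diff k A 0 (insert_one 2 (pure xs)) = bar_diff k A 0 (pure (\<one> # xs))"
    using xs by (simp add: insert_one_pure)
  also have "\<dots> = (\<Oplus>\<^bsub>T 2\<^esub>i\<in>{..Suc 0}. sgn_pow k i \<odot>\<^bsub>T 2\<^esub> pure (merge_at A i (\<one> # xs)))"
    using bar_diff_pure[OF t] by (simp only: add_0)
  also have "\<dots> = pure xs \<ominus>\<^bsub>T 2\<^esub> insert_one (Suc 0) (pure [x \<otimes> z])"
    using alternating_merge_sum_Cons_one[of xs 0] xs s by (simp add: numeral_2_eq_2)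
  finally show "bar_diff k A 0 (insert_one 2 (pure xs)) = pure xs \<ominus>\<^bsub>T 2\<^esub> pure [\<one>, bar_aug k A (pure xs)]"
    using 1 x by (simp add: insert_one_pure bar_aug_pure)
qed

lemma bar_diff_closed: "X \<in> carrier (T (Suc n + 2)) \<Longrightarrow> bar_diff k A n X \<in> carrier (T (n + 2))"
  by (rule lmod_hom_closed[OF bar_diff_linear])

lemma insert_one_closed: "X \<in> carrier (T n) \<Longrightarrow> insert_one n X \<in> carrier (T (Suc n))"
  by (rule lmod_hom_closed[OF insert_one_hom])

text \<open>On a generator \<open>\<one> # xs\<close> the contraction formula gives the augmentation
  of \<open>P\<close> minus that of \<open>\<one> \<otimes> c\<close>, where \<open>c\<close> is the
  augmentation of \<open>P\<close>; both are \<open>c\<close>.\<close>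

lemma bar_aug_diff:
  assumes X: "X \<in> carrier (T (Suc 0 + 2))"
  shows "bar_aug k A (bar_diff k A 0 X) = \<zero>"
proof -
  have "bar_aug k A (bar_diff k A 0 X) = (\<lambda>_. \<zero>\<^bsub>env_left k A\<^esub>) X"
  proof (rule bar_hom_eq[OF env_left_left_module lmod_hom_comp[OF bar_diff_hom bar_aug_hom]
        lmod_hom_zero_fun[OF env_left_left_module] _ X])
    fix xs assume "xs \<in> tuples (Suc (Suc 0))"
    then have xs: "xs \<in> tuples 2" by (simp add: numeral_2_eq_2)
    then obtain x z where x: "xs = [x, z]" "x \<in> carrier A" "z \<in> carrier A" by (auto simp: tuples2)
    have "bar_diff k A 0 (pure (\<one> # xs)) = pure xs \<ominus>\<^bsub>T 2\<^esub> pure [\<one>, bar_aug k A (pure xs)]"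
      using bar_contraction_0[OF pure_closed[OF xs]] insert_one_pure[OF xs] by simp
    then show "bar_aug k A (bar_diff k A 0 (pure (\<one> # xs))) = \<zero>\<^bsub>env_left k A\<^esub>"
      using x by (simp add: lmod_hom_minus[OF bar_aug_linear tensor_pow_group A.M.abelian_group_axioms]
          pure_closed pair_tuples bar_aug_pure) (simp add: a_minus_def A.M.r_neg)
  qed
  then show ?thesis by simp
qed

text \<open>With \<open>h\<close> the insertion of \<open>1\<close> in front, \<open>dh = 1 - hd\<close>. The image of \<open>h\<close> generates \<open>Bar\<^sub>n\<^sub>+\<^sub>1\<close> over
  \<open>A\<^sup>e\<close>, so \<open>d\<^sup>2 = 0\<close> follows by induction from \<open>d\<^sup>2h = d - dhd = hd\<^sup>2\<close>. The same induction shows that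
  \<open>d\<close> commutes with the Leibniz extension of a derivation.\<close>

lemma bar_diff_diff:
  "X \<in> carrier (T (Suc (Suc n) + 2)) \<Longrightarrow> bar_diff k A n (bar_diff k A (Suc n) X) = \<zero>\<^bsub>T (n + 2)\<^esub>"
proof (induction n arbitrary: X)
  case 0
  have "bar_diff k A 0 (bar_diff k A (Suc 0) X) = (\<lambda>_. \<zero>\<^bsub>bar k A 0\<^esub>) X"
  proof (rule bar_hom_eq[OF bar_left_module lmod_hom_comp[OF bar_diff_hom bar_diff_hom]
        lmod_hom_zero_fun[OF bar_left_module] _ 0])
    interpret t: left_module k "T 2" by (rule tensor_pow_left_module)
    fix xs assume "xs \<in> tuples (Suc (Suc (Suc 0)))"
    then have xs: "xs \<in> tuples (Suc 0 + 2)" by simp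
    \<comment> \<open>With \<open>h\<close> the contraction,
      \<open>d (\<one> # xs) = pure xs - h Y\<close>, and \<open>d h Y = Y\<close> because the term
      \<open>h d Y\<close>, here its augmented version, vanishes. Applying \<open>d\<close> gives
      \<open>Y - Y\<close>.\<close>
    define Y where "Y = bar_diff k A 0 (pure xs)"
    have Y: "Y \<in> carrier (T 2)" using bar_diff_closed[OF pure_closed[OF xs]] by (simp only: Y_def add_0)
    have i: "insert_one 2 Y \<in> carrier (T (Suc 0 + 2))" using insert_one_closed[OF Y] by (simp only: add_Suc add_0)
    have d: "bar_diff k A (Suc 0) (pure (\<one> # xs)) = pure xs \<ominus>\<^bsub>T (Suc 0 + 2)\<^esub> insert_one 2 Y"
      using bar_contraction[OF pure_closed[OF xs]] insert_one_pure[OF xs] by (simp only: Y_def add_0)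
    \<comment> \<open>In degree zero the augmentation identity plays the role of the induction
      hypothesis.\<close>
    have "bar_aug k A Y = \<zero>" unfolding Y_def by (rule bar_aug_diff[OF pure_closed[OF xs]])
    then have z: "pure [\<one>, bar_aug k A Y] = \<zero>\<^bsub>T 2\<^esub>"
      using pure_zero[OF pair_tuples[of "\<one>" "\<one>"], of 1] by simp
    have "bar_diff k A 0 (insert_one 2 Y) = Y"
      unfolding bar_contraction_0[OF Y] z by (rule t.N.minus_zero[OF Y])
    then show "bar_diff k A 0 (bar_diff k A (Suc 0) (pure (\<one> # xs))) = \<zero>\<^bsub>bar k A 0\<^esub>"
      unfolding d lmod_hom_minus[OF bar_diff_linear tensor_pow_group tensor_pow_group pure_closed[OF xs] i] bar_simps
      by (simp only: Y_def[symmetric] add_0 t.N.minus_self[OF Y])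
  qed
  then show ?case unfolding bar_simps .
next
  case (Suc n)
  let ?n = "Suc n"
  have "bar_diff k A ?n (bar_diff k A (Suc ?n) X) = (\<lambda>_. \<zero>\<^bsub>bar k A ?n\<^esub>) X"
  proof (rule bar_hom_eq[OF bar_left_module lmod_hom_comp[OF bar_diff_hom bar_diff_hom]
        lmod_hom_zero_fun[OF bar_left_module] _ Suc.prems])
    interpret t: left_module k "T (?n + 2)" by (rule tensor_pow_left_module)
    fix xs assume "xs \<in> tuples (Suc (Suc (Suc ?n)))"
    then have xs: "xs \<in> tuples (Suc ?n + 2)" by simp
    define Y where "Y = bar_diff k A ?n (pure xs)"
    have Y: "Y \<in> carrier (T (?n + 2))" using bar_diff_closed[OF pure_closed[OF xs]] by (simp only: Y_def)
    have i: "insert_one (?n + 2) Y \<in> carrier (T (Suc ?n + 2))" using insert_one_closed[OF Y] by (simp only: add_Suc)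
    have d: "bar_diff k A (Suc ?n) (pure (\<one> # xs)) = pure xs \<ominus>\<^bsub>T (Suc ?n + 2)\<^esub> insert_one (?n + 2) Y"
      using bar_contraction[OF pure_closed[OF xs]] insert_one_pure[OF xs] by (simp add: Y_def)
    have "bar_diff k A n Y = \<zero>\<^bsub>T (n + 2)\<^esub>" unfolding Y_def by (rule Suc.IH[OF pure_closed[OF xs]])
    then have z: "insert_one (n + 2) (bar_diff k A n Y) = \<zero>\<^bsub>T (?n + 2)\<^esub>"
      using lmod_hom_zero[OF insert_one_hom tensor_pow_group tensor_pow_group, of "n + 2"]
      by (simp only: add_Suc)
    have "bar_diff k A ?n (insert_one (?n + 2) Y) = Y"
      unfolding bar_contraction[OF Y] z by (rule t.N.minus_zero[OF Y])
    then show "bar_diff k A ?n (bar_diff k A (Suc ?n) (pure (\<one> # xs))) = \<zero>\<^bsub>bar k A ?n\<^esub>"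
      unfolding d lmod_hom_minus[OF bar_diff_linear tensor_pow_group tensor_pow_group pure_closed[OF xs] i] bar_simps
      by (simp only: Y_def[symmetric] t.N.minus_self[OF Y])
  qed
  then show ?case unfolding bar_simps .
qed

text \<open>For a cycle the contraction formula reads \<open>d h X = X\<close>, so
  \<open>h X\<close> is a preimage.\<close>

lemma bar_exact:
  assumes X: "X \<in> carrier (T (Suc n + 2))" and z: "bar_diff k A n X = \<zero>\<^bsub>T (n + 2)\<^esub>"
  shows "X \<in> bar_diff k A (Suc n) ` carrier (T (Suc (Suc n) + 2))"
proof -
  interpret t: left_module k "T (Suc n + 2)" by (rule tensor_pow_left_module)
  have i: "insert_one (n + 2) (bar_diff k A n X) = \<zero>\<^bsub>T (Suc n + 2)\<^esub>"
    using lmod_hom_zero[OF insert_one_hom tensor_pow_group tensor_pow_group, of "n + 2"] z by (simp only: add_Suc)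
  have "bar_diff k A (Suc n) (insert_one (Suc n + 2) X) = X"
    unfolding bar_contraction[OF X] i by (rule t.N.minus_zero[OF X])
  moreover have "insert_one (Suc n + 2) X \<in> carrier (T (Suc (Suc n) + 2))"
    using insert_one_closed[OF X] by (simp only: add_Suc)
  ultimately show ?thesis by (metis imageI)
qed

lemma bar_exact_0:
  assumes X: "X \<in> carrier (T 2)" and z: "bar_aug k A X = \<zero>"
  shows "X \<in> bar_diff k A 0 ` carrier (T (Suc 0 + 2))"
proof -
  interpret t: left_module k "T 2" by (rule tensor_pow_left_module)
  have "pure [\<one>, bar_aug k A X] = \<zero>\<^bsub>T 2\<^esub>"
    using pure_zero[OF pair_tuples[of "\<one>" "\<one>"], of 1] z by simp
  then have "bar_diff k A 0 (insert_one 2 X) = X"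
    unfolding bar_contraction_0[OF X] using X by (simp add: t.N.minus_zero)
  moreover have "insert_one 2 X \<in> carrier (T (Suc 0 + 2))" using insert_one_closed[OF X] by (simp only: add_Suc add_0)
  ultimately show ?thesis by (metis imageI)
qed


text \<open>A multilinear map on an algebra with a dual basis \<open>(e\<^sub>i, e\<^sub>i\<^sup>*)\<close> is lifted one argument at a
  time, by \<open>h(x, xs) = \<Sum>\<^sub>i e\<^sub>i\<^sup>*(x) h\<^sub>i(xs)\<close> with \<open>h\<^sub>i\<close> a lift of \<open>f(e\<^sub>i, _)\<close>.\<close>

lemma multilinear_lifting:
  assumes P: "projective_module k A" and X: "left_module k X" and Y: "left_module k Y"
    and g: "g \<in> lmod_hom k X Y"
    and f: "multilinear n Y f" "\<And>xs. xs \<in> tuples n \<Longrightarrow> f xs \<in> g ` carrier X"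
  shows "\<exists>h. multilinear n X h \<and> (\<forall>xs\<in>tuples n. g (h xs) = f xs)"
  using f
proof (induction n arbitrary: f)
  case 0
  \<comment> \<open>A multilinear map in no variables is the choice of one element, so any preimage
    will do.\<close>
  have t: "tuples 0 = {[]}" by (auto simp: tuples_def)
  obtain x where "x \<in> carrier X" "g x = f []" using 0(2)[of "[]"] t by auto
  then show ?case by (intro exI[of _ "\<lambda>_. x"]) (simp add: multilinear_def t)
next
  case (Suc n)
  obtain I :: "'a set" and s r where s: "s \<in> lmod_hom k A (free_module k I)"
    and r: "r \<in> lmod_hom k (free_module k I) A" and rs: "\<And>x. x \<in> carrier A \<Longrightarrow> r (s x) = x"
    using P unfolding projective_module_def by blast
  \<comment> \<open>The vectors \<open>r (free_gen k i)\<close> are the \<open>e\<^sub>i\<close> of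
    the dual basis, and the coordinates of \<open>s x\<close> are the values
    \<open>e\<^sub>i\<^sup>*(x)\<close>.\<close>
  have e: "r (free_gen k i) \<in> carrier A" if "i \<in> I" for i
    by (rule lmod_hom_closed[OF r free_gen_closed[OF k_ring that]])
  have "\<exists>h. multilinear n X h \<and> (\<forall>xs\<in>tuples n. g (h xs) = f (r (free_gen k i) # xs))" if i: "i \<in> I" for i
  proof (rule Suc.IH)
    show "multilinear n Y (\<lambda>xs. f (r (free_gen k i) # xs))"
    proof (rule multilinear_subst[OF Suc.prems(1)])
      show t: "r (free_gen k i) # xs \<in> tuples (Suc n)" if "xs \<in> tuples n" for xs
        using that e[OF i] by (simp add: tuples_Cons)
      fix xs j assume xs: "xs \<in> tuples n" and "j < n"
      then show "\<exists>ys\<in>tuples (Suc n). \<exists>j'<Suc n. \<exists>l\<in>lmod_hom k A A. \<forall>c\<in>carrier A.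
          r (free_gen k i) # xs[j := c] = ys[j' := l c]"
        by (intro bexI[OF _ t[OF xs]] exI[of _ "Suc j"] conjI bexI[OF _ lmod_hom_id]) auto
    qed
    show "f (r (free_gen k i) # xs) \<in> g ` carrier X" if "xs \<in> tuples n" for xs
      using Suc.prems(2) that e[OF i] by (simp add: tuples_Cons)
  qed
  then obtain h where hm: "\<And>i. i \<in> I \<Longrightarrow> multilinear n X (h i)"
    and hg: "\<And>i xs. \<lbrakk>i \<in> I; xs \<in> tuples n\<rbrakk> \<Longrightarrow> g (h i xs) = f (r (free_gen k i) # xs)"
    by metis
  define H where "H xs = free_ext k X (\<lambda>i. h i (tl xs)) (s (hd xs))" for xs
  have hI: "(\<lambda>i. h i ys) \<in> I \<rightarrow> carrier X" if "ys \<in> tuples n" for ys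
    using multilinearD(1)[OF hm that] by auto
  have H1: "(\<lambda>c. H (c # ys)) \<in> lmod_hom k A X" if ys: "ys \<in> tuples n" for ys
    unfolding H_def using lmod_hom_comp[OF s free_ext_hom[OF X hI[OF ys]]] by simp
  have ml: "multilinear (Suc n) X H"
    unfolding multilinear_def
  proof (intro conjI ballI allI impI)
    fix xs assume "xs \<in> tuples (Suc n)"
    then obtain x ys where xs: "xs = x # ys" "x \<in> carrier A" "ys \<in> tuples n"
      by (cases xs) (auto simp: tuples_def)
    show "H xs \<in> carrier X" using lmod_hom_closed[OF H1[OF xs(3)] xs(2)] xs(1) by simp
    fix i assume i: "i < Suc n"
    show "(\<lambda>c. H (xs[i := c])) \<in> lmod_hom k A X"
    proof (cases i)
      case 0
      then show ?thesis using H1[OF xs(3)] xs(1) by simp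
    next
      case (Suc j)
      have u: "s x \<in> carrier (free_module k I)" by (rule lmod_hom_closed[OF s xs(2)])
      \<comment> \<open>With the first entry fixed, \<open>H\<close> is a finite combination of the
        lifts \<open>h i\<close> with constant coefficients, so it inherits linearity in the
        remaining slots.\<close>
      have "(\<lambda>c. \<Oplus>\<^bsub>X\<^esub>i\<in>{i. s x i \<noteq> \<zero>\<^bsub>k\<^esub>}. s x i \<odot>\<^bsub>X\<^esub> h i (ys[j := c])) \<in> lmod_hom k A X"
        using free_support[OF u] u i Suc
        by (intro lmod_hom_sum X lmod_hom_scale k_cring multilinearD(2)[OF hm xs(3)])
          (auto simp: free_module_carrier)
      then show ?thesis by (simp add: H_def free_ext_def xs(1) Suc)
    qed
  qed
  have "g (H xs) = f xs" if t: "xs \<in> tuples (Suc n)" for xs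
  proof -
    obtain x ys where xs: "xs = x # ys" "x \<in> carrier A" "ys \<in> tuples n"
      using t by (cases xs) (auto simp: tuples_def)
    have fy: "(\<lambda>c. f (c # ys)) \<in> lmod_hom k A Y"
      using multilinearD(2)[OF Suc.prems(1) t, of 0] xs(1) by simp
    \<comment> \<open>Both sides are linear in the vector \<open>s x\<close> of the free module and
      agree on its generators; \<open>r (s x) = x\<close> then returns to \<open>A\<close>.\<close>
    have "g (free_ext k X (\<lambda>i. h i ys) (s x)) = f (r (s x) # ys)"
      by (rule free_hom_unique[OF Y lmod_hom_comp[OF free_ext_hom[OF X hI[OF xs(3)]] g]
            lmod_hom_comp[OF r fy] _ lmod_hom_closed[OF s xs(2)]])
        (simp add: free_ext_gen[OF X hI[OF xs(3)]] hg xs(3))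
    then show ?thesis using rs[OF xs(2)] by (simp add: H_def xs(1))
  qed
  then show ?case using ml by blast
qed

text \<open>The bar module is induced from its inner factors: an \<open>Ae\<close>-linear map on it
  amounts to a \<open>k\<close>-multilinear map in \<open>ys\<close>, by evaluation at
  \<open>\<one> \<otimes> ys \<otimes> \<one>\<close>. The restriction of \<open>f\<close> is lifted
  as a multilinear map and extended back over \<open>Ae\<close>.\<close>

lemma bar_lifting:
  assumes P: "projective_module k A" and X: "left_module Ae X" and Y: "left_module Ae Y"
    and g: "g \<in> lmod_hom Ae X Y" and f: "f \<in> lmod_hom Ae (bar k A n) Y"
    and im: "f ` carrier (bar k A n) \<subseteq> g ` carrier X"
  shows "\<exists>h\<in>lmod_hom Ae (bar k A n) X. \<forall>x\<in>carrier (bar k A n). g (h x) = f x"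
proof -
  note X' = restrict_scalars_left_module[OF X] and Y' = restrict_scalars_left_module[OF Y]
  let ?w = "\<lambda>ys. \<one> # ys @ [\<one>]"
  have w: "?w ys \<in> tuples (n + 2)" if "ys \<in> tuples n" for ys
    using that by (intro ends_tuples A.A.one_closed)
  have f0: "multilinear n (restrict_scalars Y) (\<lambda>ys. f (pure (?w ys)))"
  proof (rule multilinear_subst[OF multilinear_hom[OF multilinear_pure bar_hom_linear[OF f]] w])
    fix xs j assume xs: "xs \<in> tuples n" and "j < n"
    then show "\<exists>ys\<in>tuples (n + 2). \<exists>j'<n + 2. \<exists>l\<in>lmod_hom k A A. \<forall>c\<in>carrier A. ?w (xs[j := c]) = ys[j' := l c]"
      by (intro bexI[OF _ w[OF xs]] exI[of _ "Suc j"] conjI bexI[OF _ lmod_hom_id])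
        (auto simp: list_update_append tuples_length[OF xs])
  qed
  have f0_im: "f (pure (?w ys)) \<in> g ` carrier (restrict_scalars X)" if "ys \<in> tuples n" for ys
    using im pure_closed[OF w[OF that]] unfolding bar_simps restrict_scalars_simps by blast
  obtain h0 where h0: "multilinear n (restrict_scalars X) h0"
    "\<And>ys. ys \<in> tuples n \<Longrightarrow> g (h0 ys) = f (pure (?w ys))"
    using multilinear_lifting[OF P X' Y' restrict_scalars_hom[OF g] f0 f0_im] by blast
  note b = action_bilinear[OF X]
  \<comment> \<open>The only possible \<open>Ae\<close>-linear extension, as
    \<open>x \<otimes> ys \<otimes> z\<close> is \<open>x \<otimes> z\<close> acting on
    \<open>\<one> \<otimes> ys \<otimes> \<one>\<close>.\<close>
  define H where "H xs = pure [hd xs, last xs] \<odot>\<^bsub>X\<^esub> h0 (butlast (tl xs))" for xs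
  have H: "H (x # ys @ [z]) = pure [x, z] \<odot>\<^bsub>X\<^esub> h0 ys" for x ys z by (simp add: H_def)
  have h0c: "h0 ys \<in> carrier (restrict_scalars X)" if "ys \<in> tuples n" for ys
    using multilinearD(1)[OF h0(1) that] .
  have ml: "multilinear (n + 2) (restrict_scalars X) H"
    unfolding multilinear_def
  proof (intro conjI ballI allI impI)
    fix xs assume "xs \<in> tuples (n + 2)"
    then obtain x ys z where xs: "xs = x # ys @ [z]" "x \<in> carrier A" "ys \<in> tuples n" "z \<in> carrier A"
      by (rule tuples_ends)
    note l = tuples_length[OF xs(3)]
    show "H xs \<in> carrier (restrict_scalars X)"
      unfolding xs(1) H by (rule bilinear_map_closed[OF b pure_closed[OF pair_tuples[OF xs(2,4)]] h0c[OF xs(3)]])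
    fix i assume "i < n + 2"
    then consider "i = 0" | j where "i = Suc j" "j < n" | "i = Suc n"
      by (cases i) (auto simp: less_Suc_eq)
    then show "(\<lambda>c. H (xs[i := c])) \<in> lmod_hom k A (restrict_scalars X)"
    proof cases
      case 1
      then show ?thesis
        using lmod_hom_comp[OF pair_hom(1)[OF xs(4)] bilinear_mapD(1)[OF b h0c[OF xs(3)]]]
        by (simp add: xs(1) H)
    next
      case (2 j)
      then show ?thesis
        using lmod_hom_comp[OF multilinearD(2)[OF h0(1) xs(3) 2(2)]
            bilinear_mapD(2)[OF b pure_closed[OF pair_tuples[OF xs(2,4)]]]]
        by (simp add: xs(1) H list_update_append l)
    next
      case 3
      then show ?thesis
        using lmod_hom_comp[OF pair_hom(2)[OF xs(2)] bilinear_mapD(1)[OF b h0c[OF xs(3)]]]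
        by (simp add: xs(1) H list_update_append l)
    qed
  qed
  define h where "h = tensor_lift k (restrict_scalars X) H"
  have hp: "h (pure xs) = H xs" if "xs \<in> tuples (n + 2)" for xs
    unfolding h_def by (rule tensor_lift_pure[OF X' ml that])
  interpret X: left_module Ae X by fact
  have h: "h \<in> lmod_hom Ae (bar k A n) X"
  proof (rule bar_homI[OF X])
    show "h \<in> lmod_hom k (T (n + 2)) (restrict_scalars X)"
      unfolding h_def by (rule tensor_lift_hom[OF X' ml])
    fix a b xs assume ab: "a \<in> carrier A" "b \<in> carrier A" and t: "xs \<in> tuples (n + 2)"
    obtain x ys z where xs: "xs = x # ys @ [z]" "x \<in> carrier A" "ys \<in> tuples n" "z \<in> carrier A"
      using t by (rule tuples_ends)
    \<comment> \<open>Second factors multiply in the opposite order in \<open>Ae\<close>, so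
      \<open>z \<otimes> b\<close> at the end matches left multiplication by
      \<open>pure [a, b]\<close>.\<close>
    have "pure [a \<otimes> x, z \<otimes> b] = pure [a, b] \<otimes>\<^bsub>Ae\<^esub> pure [x, z]"
      using ab xs by (simp add: env_mult_pure)
    moreover have "pure [a, b] \<in> carrier Ae" "pure [x, z] \<in> carrier Ae"
      using ab xs by (auto simp: env_simps(1) intro!: pure_closed pair_tuples)
    moreover have "h (pure (sandwich n a b xs)) = pure [a \<otimes> x, z \<otimes> b] \<odot>\<^bsub>X\<^esub> h0 ys"
      unfolding hp[OF sandwich_tuples[OF ab t]] by (simp only: xs(1) sandwich_ends[OF tuples_length[OF xs(3)]] H)
    moreover have "h (pure xs) = pure [x, z] \<odot>\<^bsub>X\<^esub> h0 ys" unfolding hp[OF t] by (simp only: xs(1) H)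
    ultimately show "h (pure (sandwich n a b xs)) = pure [a, b] \<odot>\<^bsub>X\<^esub> h (pure xs)"
      using h0c[OF xs(3)] by (simp add: X.act_mult)
  qed
  have "g (h Z) = f Z" if "Z \<in> carrier (bar k A n)" for Z
  proof (rule tensor_hom_eq[OF Y' bar_hom_linear[OF lmod_hom_comp[OF h g]] bar_hom_linear[OF f] _ that[unfolded bar_simps]])
    fix xs assume t: "xs \<in> tuples (n + 2)"
    obtain x ys z where xs: "xs = x # ys @ [z]" "x \<in> carrier A" "ys \<in> tuples n" "z \<in> carrier A"
      using t by (rule tuples_ends)
    have c: "pure [x, z] \<in> carrier Ae" "pure (?w ys) \<in> carrier (bar k A n)"
      using xs unfolding env_simps bar_simps by (blast intro!: pure_closed pair_tuples w)+
    have "g (h (pure xs)) = pure [x, z] \<odot>\<^bsub>Y\<^esub> f (pure (?w ys))"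
      unfolding hp[OF t] using h0c[OF xs(3)] by (simp add: xs(1) H lmod_hom_smult[OF g c(1)] h0(2)[OF xs(3)])
    also have "\<dots> = f (pure [x, z] \<odot>\<^bsub>bar k A n\<^esub> pure (?w ys))"
      by (rule lmod_hom_smult[OF f c, symmetric])
    also have "pure [x, z] \<odot>\<^bsub>bar k A n\<^esub> pure (?w ys) = pure xs"
      using xs by (simp add: bar_pure_ends)
    finally show "g (h (pure xs)) = f (pure xs)" .
  qed
  then show ?thesis using h by blast
qed

text \<open>The free module on the carrier maps onto the bar module, and lifting the identity along
  this surjection gives the section that the definition by retracts asks for.\<close>

lemma bar_projective:
  assumes "projective_module k A"
  shows "projective_module Ae (bar k A n)"
  unfolding projective_module_def
proof (intro conjI bar_left_module)
  let ?I = "carrier (bar k A n)"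
  let ?F = "free_module Ae ?I"
  let ?r = "free_ext Ae (bar k A n) (\<lambda>x. x)"
  have id: "(\<lambda>x. x) \<in> ?I \<rightarrow> carrier (bar k A n)" by auto
  have r: "?r \<in> lmod_hom Ae ?F (bar k A n)" by (rule free_ext_hom[OF bar_left_module id])
  have "x \<in> ?r ` carrier ?F" if "x \<in> ?I" for x
    using free_ext_gen[OF bar_left_module id that] free_gen_closed[OF env_ring that] by (metis imageI)
  then have im: "(\<lambda>x. x) ` carrier (bar k A n) \<subseteq> ?r ` carrier ?F" by blast
  obtain s where "s \<in> lmod_hom Ae (bar k A n) ?F" "\<And>x. x \<in> carrier (bar k A n) \<Longrightarrow> ?r (s x) = x"
    using bar_lifting[OF assms free_module_left_module[OF env_ring] bar_left_module r lmod_hom_id im] by blast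
  then show "\<exists>I s r. s \<in> lmod_hom Ae (bar k A n) (free_module Ae (I :: ('a list \<Rightarrow> 'k) set set)) \<and>
      r \<in> lmod_hom Ae (free_module Ae I) (bar k A n) \<and> (\<forall>x\<in>carrier (bar k A n). r (s x) = x)"
    using r by blast
qed

lemma bar_resolution:
  assumes "projective_module k A"
  shows "projective_resolution Ae (env_left k A) (bar k A) (bar_diff k A) (bar_aug k A)"
  unfolding projective_resolution_def
proof (intro conjI allI bar_projective[OF assms] bar_diff_hom bar_aug_hom)
  show "bar_aug k A ` carrier (bar k A 0) = carrier (env_left k A)"
  proof
    show "bar_aug k A ` carrier (bar k A 0) \<subseteq> carrier (env_left k A)"
      using lmod_hom_closed[OF bar_aug_hom] by blast
    show "carrier (env_left k A) \<subseteq> bar_aug k A ` carrier (bar k A 0)"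
    proof
      fix x assume "x \<in> carrier (env_left k A)"
      then have x: "x \<in> carrier A" by simp
      have "pure [\<one>, x] \<in> carrier (bar k A 0)" "x = bar_aug k A (pure [\<one>, x])"
        using x pure_closed[OF pair_tuples[OF A.A.one_closed x]] by (simp_all only: bar_simps add_0 bar_aug_pure A.A.one_closed A.A.l_one)
      then show "x \<in> bar_aug k A ` carrier (bar k A 0)" by blast
    qed
  qed
  show "{x \<in> carrier (bar k A 0). bar_aug k A x = \<zero>\<^bsub>env_left k A\<^esub>} = boundaries (bar k A) (bar_diff k A) 0"
    unfolding boundaries_def bar_simps env_left_simps add_0
    using bar_exact_0 bar_aug_diff bar_diff_closed[of _ 0, unfolded add_0] by blast
  fix n
  show "cycles (bar k A) (bar_diff k A) (Suc n) = boundaries (bar k A) (bar_diff k A) (Suc n)"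
    unfolding boundaries_def cycles_def nat.case bar_simps
    using bar_exact bar_diff_diff bar_diff_closed[of _ "Suc n"] by blast
qed

end

section \<open>Derivations\<close>

locale k_derivation = k_algebra k A
  for k :: "('k, 'x) ring_scheme" and A :: "('k, 'a, 'y) module_scheme" (structure) +
  fixes \<delta> :: "'a \<Rightarrow> 'a"
  assumes derivation: "derivation k A \<delta>"
begin

lemma \<delta>_hom: "\<delta> \<in> lmod_hom k A A"
  and \<delta>_mult: "\<lbrakk>x \<in> carrier A; y \<in> carrier A\<rbrakk> \<Longrightarrow> \<delta> (x \<otimes> y) = \<delta> x \<otimes> y \<oplus> x \<otimes> \<delta> y"
  using derivation by (auto simp: derivation_def)

lemmas \<delta>_closed = lmod_hom_closed[OF \<delta>_hom]

lemma \<delta>_one: "\<delta> \<one> = \<zero>"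
proof -
  have "\<delta> \<one> = \<delta> \<one> \<oplus> \<delta> \<one>"
    using \<delta>_mult[of "\<one>" "\<one>"] by (simp add: \<delta>_closed)
  then show ?thesis by (metis A.M.add.r_cancel_one A.A.one_closed \<delta>_closed)
qed

text \<open>One family for three roles: \<open>n = 2\<close> is the derivation of \<open>Ae\<close>,
  index \<open>n + 2\<close> is the operator on the bar module of degree \<open>n\<close>, and index
  \<open>Suc n\<close> is the operator on Hochschild chains of degree \<open>n\<close>.\<close>

definition Lie :: "nat \<Rightarrow> ('a list \<Rightarrow> 'k) set \<Rightarrow> ('a list \<Rightarrow> 'k) set" where
  "Lie n = leibniz_map k (replicate n A) \<delta>"

lemma Lie_def': "Lie n = tensor_lift k (T n) (\<lambda>xs. \<Oplus>\<^bsub>T n\<^esub>j\<in>{..<n}. pure_tensor k (replicate n A) (xs[j := \<delta> (xs ! j)]))"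
  by (simp add: Lie_def leibniz_map_def tensor_pow_def)

lemma \<delta>_update_tuples: "\<lbrakk>xs \<in> tuples n; j < n\<rbrakk> \<Longrightarrow> xs[j := \<delta> (xs ! j)] \<in> tuples n"
  by (simp add: tuples_update tuples_nth \<delta>_closed)

lemma Lie_multilinear: "multilinear n (T n) (\<lambda>xs. \<Oplus>\<^bsub>T n\<^esub>j\<in>{..<n}. pure_tensor k (replicate n A) (xs[j := \<delta> (xs ! j)]))"
proof (rule multilinear_sum[OF tensor_pow_left_module])
  fix j assume "j \<in> {..<n}"
  then have j: "j < n" by simp
  \<comment> \<open>\<open>pure\<close> reads the number of factors off its argument, so the two
    maps are compared on tuples of length \<open>n\<close> only.\<close>
  have p: "multilinear n (T n) (pure_tensor k (replicate n A))"
  proof -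
    have e: "pure_tensor k (replicate n A) xs = pure xs" if "xs \<in> tuples n" for xs
      using tuples_length[OF that] by (simp add: pure_pow_def)
    show ?thesis
      unfolding multilinear_def
    proof (intro conjI ballI allI impI)
      fix xs assume xs: "xs \<in> tuples n"
      then show "pure_tensor k (replicate n A) xs \<in> carrier (T n)" by (simp add: e pure_closed)
      fix i assume i: "i < n"
      show "(\<lambda>c. pure_tensor k (replicate n A) (xs[i := c])) \<in> lmod_hom k A (T n)"
        by (rule lmod_hom_cong[OF multilinearD(2)[OF multilinear_pure xs i] Am.left_module_axioms])
          (simp add: e xs tuples_update)
    qed
  qed
  show "multilinear n (T n) (\<lambda>xs. pure_tensor k (replicate n A) (xs[j := \<delta> (xs ! j)]))"
  proof (rule multilinear_subst[OF p \<delta>_update_tuples[OF _ j]])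
    fix xs i assume xs: "xs \<in> tuples n" and i: "i < n"
    note l = tuples_length[OF xs]
    show "\<exists>ys\<in>tuples n. \<exists>j'<n. \<exists>l\<in>lmod_hom k A A. \<forall>c\<in>carrier A. xs[i := c, j := \<delta> (xs[i := c] ! j)] = ys[j' := l c]"
    proof (cases "i = j")
      case True
      then show ?thesis using i l
        by (intro bexI[OF _ xs] exI[of _ i] conjI bexI[OF _ \<delta>_hom]) auto
    next
      case False
      then show ?thesis using i l
        by (intro bexI[OF _ \<delta>_update_tuples[OF xs j]] exI[of _ i] conjI bexI[OF _ lmod_hom_id])
          (auto simp: list_update_swap)
    qed
  qed
qed

lemma Lie_hom: "Lie n \<in> lmod_hom k (T n) (T n)"
  unfolding Lie_def' by (rule tensor_lift_hom[OF tensor_pow_left_module Lie_multilinear])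

lemma Lie_pure:
  assumes xs: "xs \<in> tuples n"
  shows "Lie n (pure xs) = (\<Oplus>\<^bsub>T n\<^esub>j\<in>{..<n}. pure (xs[j := \<delta> (xs ! j)]))"
  unfolding Lie_def' tensor_lift_pure[OF tensor_pow_left_module Lie_multilinear xs]
  using tuples_length[OF xs] by (simp add: pure_pow_def)

lemmas Lie_closed = lmod_hom_closed[OF Lie_hom]

lemma env_derivation_Lie: "env_derivation k A \<delta> = Lie 2"
proof -
  have "\<And>xs. pure_tensor k [A, opposite A] xs = pure_tensor k (replicate 2 A) xs"
    by (simp add: pure_tensor_def tensor_free_env tensor_rel_env)
  then show ?thesis
    unfolding env_derivation_def Lie_def' leibniz_map_def tensor_env by (simp add: numeral_2_eq_2)
qed

text \<open>The summand that differentiates the inserted unit vanishes, so the Leibniz extension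
  commutes with the contraction on pure tensors.\<close>

lemma Lie_Cons_one:
  assumes xs: "xs \<in> tuples n"
  shows "Lie (Suc n) (pure (\<one> # xs)) = insert_one n (Lie n (pure xs))"
proof -
  interpret t: left_module k "T (Suc n)" by (rule tensor_pow_left_module)
  interpret t': left_module k "T n" by (rule tensor_pow_left_module)
  have o: "\<one> # xs \<in> tuples (Suc n)" using xs by (simp add: tuples_Cons)
  define P where "P j = pure ((\<one> # xs)[j := \<delta> ((\<one> # xs) ! j)])" for j
  have Pc: "P j \<in> carrier (T (Suc n))" if "j < Suc n" for j
    unfolding P_def by (rule pure_closed[OF \<delta>_update_tuples[OF o that]])
  have c: "pure (xs[j := \<delta> (xs ! j)]) \<in> carrier (T n)" if "j < n" for j
    by (rule pure_closed[OF \<delta>_update_tuples[OF xs that]])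
  have "P 0 = \<zero>\<^bsub>T (Suc n)\<^esub>" using pure_zero[OF o, of 0] by (simp add: \<delta>_one P_def)
  moreover have "(\<Oplus>\<^bsub>T (Suc n)\<^esub>j\<in>{..<Suc n}. P j) = P 0 \<oplus>\<^bsub>T (Suc n)\<^esub> (\<Oplus>\<^bsub>T (Suc n)\<^esub>j\<in>{..<n}. P (Suc j))"
    by (rule t.N.finsum_lessThan_Suc) (use Pc in auto)
  moreover have "(\<Oplus>\<^bsub>T (Suc n)\<^esub>j\<in>{..<n}. P (Suc j)) = (\<Oplus>\<^bsub>T (Suc n)\<^esub>j\<in>{..<n}. insert_one n (pure (xs[j := \<delta> (xs ! j)])))"
    by (rule t.N.finsum_cong'[OF refl])
      (use c insert_one_closed \<delta>_update_tuples[OF xs] in \<open>auto simp: insert_one_pure P_def\<close>)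
  moreover have "\<dots> = insert_one n (\<Oplus>\<^bsub>T n\<^esub>j\<in>{..<n}. pure (xs[j := \<delta> (xs ! j)]))"
    by (rule lmod_hom_finsum[OF insert_one_hom tensor_pow_group tensor_pow_group, symmetric]) (use c in auto)
  moreover have "insert_one n (\<Oplus>\<^bsub>T n\<^esub>j\<in>{..<n}. pure (xs[j := \<delta> (xs ! j)])) \<in> carrier (T (Suc n))"
    by (rule insert_one_closed[OF t'.N.finsum_closed]) (use c in auto)
  ultimately show ?thesis using xs o by (simp add: Lie_pure P_def)
qed

end

text \<open>Subtraction depends only on carrier, addition and zero, which the two records
  share.\<close>

lemma (in k_algebra) bar_minus: "u \<ominus>\<^bsub>bar k A n\<^esub> v = u \<ominus>\<^bsub>T (n + 2)\<^esub> v"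
  by (simp only: a_minus_def a_inv_def m_inv_def bar_simps(1-3) partial_object.simps monoid.simps)

text \<open>The terms with \<open>D b\<close> acting on \<open>\<phi> x\<close> cancel in the
  difference. With the bar differential as \<open>\<phi>\<close>, this allows its commutator with
  \<open>Lie\<close> to be tested on generators over \<open>Ae\<close>; with a comparison map as
  \<open>\<phi>\<close>, it supplies the linear difference from which the homotopy is built.\<close>

lemma left_operator_commutator:
  assumes M: "left_module B M" and N: "left_module B N" and \<phi>: "\<phi> \<in> lmod_hom B M N"
    and h: "left_operator k B D M h" and g: "left_operator k B D N g" and D: "D \<in> carrier B \<rightarrow> carrier B"
  shows "(\<lambda>x. \<phi> (h x) \<ominus>\<^bsub>N\<^esub> g (\<phi> x)) \<in> lmod_hom B M N"
proof (rule lmod_homI)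
  interpret M: left_module B M by fact
  interpret N: left_module B N by fact
  note \<phi>c = lmod_hom_closed[OF \<phi>] and Dc = funcset_mem[OF D]
  have hc: "h x \<in> carrier M" if "x \<in> carrier M" for x
    using h that unfolding left_operator_def linear_endo_def by blast
  have gc: "g x \<in> carrier N" if "x \<in> carrier N" for x
    using g that unfolding left_operator_def linear_endo_def by blast
  have ha: "h (x \<oplus>\<^bsub>M\<^esub> y) = h x \<oplus>\<^bsub>M\<^esub> h y" if "x \<in> carrier M" "y \<in> carrier M" for x y
    using h that unfolding left_operator_def linear_endo_def by blast
  have ga: "g (x \<oplus>\<^bsub>N\<^esub> y) = g x \<oplus>\<^bsub>N\<^esub> g y" if "x \<in> carrier N" "y \<in> carrier N" for x y
    using g that unfolding left_operator_def linear_endo_def by blast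
  have hs: "h (b \<odot>\<^bsub>M\<^esub> x) = D b \<odot>\<^bsub>M\<^esub> x \<oplus>\<^bsub>M\<^esub> b \<odot>\<^bsub>M\<^esub> h x" if "b \<in> carrier B" "x \<in> carrier M" for b x
    using h that unfolding left_operator_def by blast
  have gs: "g (b \<odot>\<^bsub>N\<^esub> x) = D b \<odot>\<^bsub>N\<^esub> x \<oplus>\<^bsub>N\<^esub> b \<odot>\<^bsub>N\<^esub> g x" if "b \<in> carrier B" "x \<in> carrier N" for b x
    using g that unfolding left_operator_def by blast
  have shuffle: "(a \<oplus>\<^bsub>N\<^esub> b) \<ominus>\<^bsub>N\<^esub> (c \<oplus>\<^bsub>N\<^esub> e) = (a \<ominus>\<^bsub>N\<^esub> c) \<oplus>\<^bsub>N\<^esub> (b \<ominus>\<^bsub>N\<^esub> e)"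
    if "a \<in> carrier N" "b \<in> carrier N" "c \<in> carrier N" "e \<in> carrier N" for a b c e
    using that by (simp add: a_minus_def N.N.minus_add N.N.a_ac)
  fix x assume x: "x \<in> carrier M"
  show "\<phi> (h x) \<ominus>\<^bsub>N\<^esub> g (\<phi> x) \<in> carrier N" by (intro N.N.minus_closed \<phi>c hc gc x)
  { fix y assume y: "y \<in> carrier M"
    show "\<phi> (h (x \<oplus>\<^bsub>M\<^esub> y)) \<ominus>\<^bsub>N\<^esub> g (\<phi> (x \<oplus>\<^bsub>M\<^esub> y)) = (\<phi> (h x) \<ominus>\<^bsub>N\<^esub> g (\<phi> x)) \<oplus>\<^bsub>N\<^esub> (\<phi> (h y) \<ominus>\<^bsub>N\<^esub> g (\<phi> y))"
      using x y by (simp add: ha ga lmod_hom_add[OF \<phi>] \<phi>c hc gc shuffle) }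
  fix b assume b: "b \<in> carrier B"
  have c: "D b \<odot>\<^bsub>N\<^esub> \<phi> x \<in> carrier N" "b \<odot>\<^bsub>N\<^esub> \<phi> (h x) \<in> carrier N" "b \<odot>\<^bsub>N\<^esub> g (\<phi> x) \<in> carrier N"
    by (intro N.act_closed Dc \<phi>c hc gc x b)+
  have "\<phi> (h (b \<odot>\<^bsub>M\<^esub> x)) \<ominus>\<^bsub>N\<^esub> g (\<phi> (b \<odot>\<^bsub>M\<^esub> x))
      = (D b \<odot>\<^bsub>N\<^esub> \<phi> x \<oplus>\<^bsub>N\<^esub> b \<odot>\<^bsub>N\<^esub> \<phi> (h x)) \<ominus>\<^bsub>N\<^esub> (D b \<odot>\<^bsub>N\<^esub> \<phi> x \<oplus>\<^bsub>N\<^esub> b \<odot>\<^bsub>N\<^esub> g (\<phi> x))"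
    using b x by (simp add: hs gs lmod_hom_add[OF \<phi>] lmod_hom_smult[OF \<phi>] Dc \<phi>c hc M.act_closed)
  also have "\<dots> = b \<odot>\<^bsub>N\<^esub> \<phi> (h x) \<ominus>\<^bsub>N\<^esub> b \<odot>\<^bsub>N\<^esub> g (\<phi> x)"
    using c by (simp add: shuffle N.N.minus_self)
  also have "\<dots> = b \<odot>\<^bsub>N\<^esub> (\<phi> (h x) \<ominus>\<^bsub>N\<^esub> g (\<phi> x))"
    using b x by (simp add: N.act_minus_right \<phi>c hc gc)
  finally show "\<phi> (h (b \<odot>\<^bsub>M\<^esub> x)) \<ominus>\<^bsub>N\<^esub> g (\<phi> (b \<odot>\<^bsub>M\<^esub> x)) = b \<odot>\<^bsub>N\<^esub> (\<phi> (h x) \<ominus>\<^bsub>N\<^esub> g (\<phi> x))" .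
qed

context k_derivation
begin

section \<open>Leibniz rules for the extended derivation\<close>

lemma Lie_pair:
  assumes "a \<in> carrier A" "b \<in> carrier A"
  shows "Lie 2 (pure [a, b]) = pure [\<delta> a, b] \<oplus>\<^bsub>T 2\<^esub> pure [a, \<delta> b]"
proof -
  interpret t: left_module k "T 2" by (rule tensor_pow_left_module)
  have c: "pure [\<delta> a, b] \<in> carrier (T 2)" "pure [a, \<delta> b] \<in> carrier (T 2)"
    using assms by (simp_all add: pure_closed pair_tuples \<delta>_closed)
  have s: "{..<2} = insert 0 {1::nat}" by auto
  show ?thesis using c unfolding Lie_pure[OF pair_tuples[OF assms]] s by simp
qed

lemma insert_one_Lie:
  assumes X: "X \<in> carrier (T n)"
  shows "Lie (Suc n) (insert_one n X) = insert_one n (Lie n X)"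
  by (rule tensor_hom_eq[OF tensor_pow_left_module lmod_hom_comp[OF insert_one_hom Lie_hom]
        lmod_hom_comp[OF Lie_hom insert_one_hom] _ X])
    (simp add: insert_one_pure Lie_Cons_one)

lemma Lie_env_mult:
  assumes X: "X \<in> carrier (T 2)" and Y: "Y \<in> carrier (T 2)"
  shows "Lie 2 (X \<otimes>\<^bsub>Ae\<^esub> Y) = Lie 2 X \<otimes>\<^bsub>Ae\<^esub> Y \<oplus>\<^bsub>T 2\<^esub> X \<otimes>\<^bsub>Ae\<^esub> Lie 2 Y"
proof (rule bilinear_eq[OF tensor_pow_left_module bilinear_map_compose[OF env_mult_bilinear Lie_hom]
      bilinear_map_plus[OF tensor_pow_left_module bilinear_map_arg1[OF env_mult_bilinear Lie_hom]
        bilinear_map_arg2[OF env_mult_bilinear Lie_hom]] _ X Y])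
  interpret t: left_module k "T 2" by (rule tensor_pow_left_module)
  fix u v assume u: "u \<in> tuples 2" and v: "v \<in> tuples 2"
  obtain a b where ab: "u = [a, b]" "a \<in> carrier A" "b \<in> carrier A" using u by (auto simp: tuples2)
  obtain c d where cd: "v = [c, d]" "c \<in> carrier A" "d \<in> carrier A" using v by (auto simp: tuples2)
  have p: "pure [x, y] \<in> carrier (T 2)" if "x \<in> carrier A" "y \<in> carrier A" for x y
    using that by (simp add: pure_closed pair_tuples)
  note add = lmod_hom_add[OF bilinear_mapD(1)[OF env_mult_bilinear]] lmod_hom_add[OF bilinear_mapD(2)[OF env_mult_bilinear]]
  show "Lie 2 (pure u \<otimes>\<^bsub>Ae\<^esub> pure v) = Lie 2 (pure u) \<otimes>\<^bsub>Ae\<^esub> pure v \<oplus>\<^bsub>T 2\<^esub> pure u \<otimes>\<^bsub>Ae\<^esub> Lie 2 (pure v)"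
    using ab(2,3) cd(2,3)
    by (simp add: ab(1) cd(1) env_mult_pure Lie_pair add p \<delta>_closed \<delta>_mult pair_add t.N.a_ac t.N.a_closed)
qed

lemma env_derivation_derivation: "Defs.derivation k Ae (env_derivation k A \<delta>)"
  unfolding Defs.derivation_def env_derivation_Lie
proof (intro conjI ballI)
  have "lmod_hom k Ae Ae = lmod_hom k (T 2) (T 2)"
    by (rule lmod_hom_cong_structure) (simp_all only: env_simps)
  then show "Lie 2 \<in> lmod_hom k Ae Ae" using Lie_hom by simp
  fix X Y assume "X \<in> carrier Ae" "Y \<in> carrier Ae"
  then show "Lie 2 (X \<otimes>\<^bsub>Ae\<^esub> Y) = Lie 2 X \<otimes>\<^bsub>Ae\<^esub> Y \<oplus>\<^bsub>Ae\<^esub> X \<otimes>\<^bsub>Ae\<^esub> Lie 2 Y"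
    using Lie_env_mult by (simp only: env_simps(1,2))
qed

lemma \<delta>_left_operator: "left_operator k Ae (env_derivation k A \<delta>) (env_left k A) \<delta>"
  unfolding left_operator_def linear_endo_def scal_def[symmetric] env_derivation_Lie
proof (intro conjI ballI)
  show "\<delta> \<in> carrier (env_left k A) \<rightarrow> carrier (env_left k A)" by (simp add: \<delta>_closed)
  fix x assume "x \<in> carrier (env_left k A)"
  then have x: "x \<in> carrier A" by simp
  { fix y assume "y \<in> carrier (env_left k A)"
    then show "\<delta> (x \<oplus>\<^bsub>env_left k A\<^esub> y) = \<delta> x \<oplus>\<^bsub>env_left k A\<^esub> \<delta> y"
      using x by (simp add: lmod_hom_add[OF \<delta>_hom]) }
  { fix r assume "r \<in> carrier k"
    then show "\<delta> (scal r \<odot>\<^bsub>env_left k A\<^esub> x) = scal r \<odot>\<^bsub>env_left k A\<^esub> \<delta> x"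
      using x by (simp add: scal_env_left \<delta>_closed lmod_hom_smult[OF \<delta>_hom]) }
next
  fix E x assume "E \<in> carrier Ae" "x \<in> carrier (env_left k A)"
  then have E: "E \<in> carrier (T 2)" and x: "x \<in> carrier A" by (simp_all add: env_simps(1))
  note m = bilinear_mapD(1)[OF env_left_bilinear]
  have "\<delta> (E \<odot>\<^bsub>env_left k A\<^esub> x) = Lie 2 E \<odot>\<^bsub>env_left k A\<^esub> x \<oplus> E \<odot>\<^bsub>env_left k A\<^esub> \<delta> x"
  proof (rule tensor_hom_eq[OF Am.left_module_axioms lmod_hom_comp[OF m[OF x] \<delta>_hom]
        lmod_hom_plus[OF Am.left_module_axioms lmod_hom_comp[OF Lie_hom m[OF x]] m[OF \<delta>_closed[OF x]]] _ E])
    fix u assume "u \<in> tuples 2"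
    then obtain a b where ab: "u = [a, b]" "a \<in> carrier A" "b \<in> carrier A" by (auto simp: tuples2)
    show "\<delta> (pure u \<odot>\<^bsub>env_left k A\<^esub> x) = Lie 2 (pure u) \<odot>\<^bsub>env_left k A\<^esub> x \<oplus> pure u \<odot>\<^bsub>env_left k A\<^esub> \<delta> x"
      using ab(2,3) x
      by (simp add: ab(1) Lie_pair lmod_hom_add[OF m] pure_closed pair_tuples \<delta>_closed env_left_pure \<delta>_mult
          A.A.l_distr A.A.r_distr A.M.a_ac A.M.a_closed)
  qed
  then show "\<delta> (E \<odot>\<^bsub>env_left k A\<^esub> x) = Lie 2 E \<odot>\<^bsub>env_left k A\<^esub> x \<oplus>\<^bsub>env_left k A\<^esub> E \<odot>\<^bsub>env_left k A\<^esub> \<delta> x"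
    by simp
qed

lemma \<delta>_right_operator: "right_operator k Ae (env_derivation k A \<delta>) (env_right k A) \<delta>"
  unfolding right_operator_def linear_endo_def scal_def[symmetric] env_derivation_Lie
proof (intro conjI ballI)
  show "\<delta> \<in> carrier (env_right k A) \<rightarrow> carrier (env_right k A)" by (simp add: \<delta>_closed)
  fix x assume "x \<in> carrier (env_right k A)"
  then have x: "x \<in> carrier A" by simp
  { fix y assume "y \<in> carrier (env_right k A)"
    then show "\<delta> (x \<oplus>\<^bsub>env_right k A\<^esub> y) = \<delta> x \<oplus>\<^bsub>env_right k A\<^esub> \<delta> y"
      using x by (simp add: lmod_hom_add[OF \<delta>_hom]) }
  { fix r assume "r \<in> carrier k"
    then show "\<delta> (scal r \<odot>\<^bsub>env_right k A\<^esub> x) = scal r \<odot>\<^bsub>env_right k A\<^esub> \<delta> x"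
      using x by (simp add: scal_env_right \<delta>_closed lmod_hom_smult[OF \<delta>_hom]) }
next
  fix E x assume "E \<in> carrier Ae" "x \<in> carrier (env_right k A)"
  then have E: "E \<in> carrier (T 2)" and x: "x \<in> carrier A" by (simp_all add: env_simps(1))
  note m = bilinear_mapD(1)[OF env_right_bilinear]
  have "\<delta> (E \<odot>\<^bsub>env_right k A\<^esub> x) = E \<odot>\<^bsub>env_right k A\<^esub> \<delta> x \<oplus> Lie 2 E \<odot>\<^bsub>env_right k A\<^esub> x"
  proof (rule tensor_hom_eq[OF Am.left_module_axioms lmod_hom_comp[OF m[OF x] \<delta>_hom]
        lmod_hom_plus[OF Am.left_module_axioms m[OF \<delta>_closed[OF x]] lmod_hom_comp[OF Lie_hom m[OF x]]] _ E])
    fix u assume "u \<in> tuples 2"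
    then obtain a b where ab: "u = [a, b]" "a \<in> carrier A" "b \<in> carrier A" by (auto simp: tuples2)
    show "\<delta> (pure u \<odot>\<^bsub>env_right k A\<^esub> x) = pure u \<odot>\<^bsub>env_right k A\<^esub> \<delta> x \<oplus> Lie 2 (pure u) \<odot>\<^bsub>env_right k A\<^esub> x"
      using ab(2,3) x
      by (simp add: ab(1) Lie_pair lmod_hom_add[OF m] pure_closed pair_tuples \<delta>_closed env_right_pure \<delta>_mult
          A.A.l_distr A.A.r_distr A.M.a_ac A.M.a_closed)
  qed
  then show "\<delta> (E \<odot>\<^bsub>env_right k A\<^esub> x) = E \<odot>\<^bsub>env_right k A\<^esub> \<delta> x \<oplus>\<^bsub>env_right k A\<^esub> Lie 2 E \<odot>\<^bsub>env_right k A\<^esub> x"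
    by simp
qed

text \<open>The ends of the product are \<open>a \<otimes> x\<close> and
  \<open>z \<otimes> b\<close>. Summand by summand, \<open>G j = H j + K j\<close>: \<open>H\<close>
  differentiates the entries of \<open>xs\<close>, and \<open>K\<close> collects what the product
  rule adds at the two ends.\<close>

lemma Lie_bar_pure:
  assumes a: "a \<in> carrier A" and b: "b \<in> carrier A" and t: "xs \<in> tuples (n + 2)"
  shows "Lie (n + 2) (pure [a, b] \<odot>\<^bsub>bar k A n\<^esub> pure xs)
    = Lie 2 (pure [a, b]) \<odot>\<^bsub>bar k A n\<^esub> pure xs \<oplus>\<^bsub>T (n + 2)\<^esub> pure [a, b] \<odot>\<^bsub>bar k A n\<^esub> Lie (n + 2) (pure xs)"
proof -
  let ?T = "T (n + 2)"
  interpret t: left_module k ?T by (rule tensor_pow_left_module)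
  obtain x ys z where xs: "xs = x # ys @ [z]" "x \<in> carrier A" "ys \<in> tuples n" "z \<in> carrier A"
    using t by (rule tuples_ends)
  have l: "length ys = n" using xs(3) by (rule tuples_length)
  note p = pure_closed[OF pair_tuples]
  note m1 = bilinear_mapD(1)[OF bar_bilinear, of _ n] and m2 = bilinear_mapD(2)[OF bar_bilinear, of _ n]
  have ax: "a \<otimes> x \<in> carrier A" "z \<otimes> b \<in> carrier A" using a b xs by auto
  have e: "pure (u # w @ [v]) \<in> carrier ?T" if "u \<in> carrier A" "w \<in> tuples n" "v \<in> carrier A" for u w v
    by (rule pure_closed[OF ends_tuples[OF that]])
  define s where "s = (a \<otimes> x) # ys @ [z \<otimes> b]"
  have s: "s \<in> tuples (n + 2)" unfolding s_def using ax xs by (intro ends_tuples)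
  define G where "G j = pure (s[j := \<delta> (s ! j)])" for j
  define H where "H j = pure [a, b] \<odot>\<^bsub>bar k A n\<^esub> pure (xs[j := \<delta> (xs ! j)])" for j
  define K0 where "K0 = pure [\<delta> a, b] \<odot>\<^bsub>bar k A n\<^esub> pure xs"
  define K1 where "K1 = pure [a, \<delta> b] \<odot>\<^bsub>bar k A n\<^esub> pure xs"
  have Hc: "H j \<in> carrier ?T" if "j < n + 2" for j
    unfolding H_def by (rule bilinear_map_closed[OF bar_bilinear p[OF a b] pure_closed[OF \<delta>_update_tuples[OF t that]]])
  have Kc: "K0 \<in> carrier ?T" "K1 \<in> carrier ?T"
    unfolding K0_def K1_def by (intro bilinear_map_closed[OF bar_bilinear] pure_closed[OF pair_tuples] pure_closed[OF t] \<delta>_closed a b)+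
  \<comment> \<open>As a function of the slot, the contributions of \<open>\<delta> a\<close> and
    \<open>\<delta> b\<close> sit at \<open>0\<close> and \<open>Suc n\<close>; writing
    \<open>K\<close> as a sum of two indicator functions lets each be summed separately.\<close>
  define K where "K j = (if 0 = j then K0 else \<zero>\<^bsub>?T\<^esub>) \<oplus>\<^bsub>?T\<^esub> (if Suc n = j then K1 else \<zero>\<^bsub>?T\<^esub>)" for j
  have GHK: "G j = H j \<oplus>\<^bsub>?T\<^esub> K j" if j: "j < n + 2" for j
  proof -
    consider "j = 0" | i where "j = Suc i" "i < n" | "j = Suc n"
      using j by (cases j) (auto simp: less_Suc_eq)
    then show ?thesis
    proof cases
      case 1
      have "G j = pure (((\<delta> a \<otimes> x) \<oplus> (a \<otimes> \<delta> x)) # ys @ [z \<otimes> b])"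
        using a xs by (simp add: G_def s_def 1 \<delta>_mult)
      also have "\<dots> = pure ((\<delta> a \<otimes> x) # ys @ [z \<otimes> b]) \<oplus>\<^bsub>?T\<^esub> pure ((a \<otimes> \<delta> x) # ys @ [z \<otimes> b])"
        using pure_add[OF s, of 0 "\<delta> a \<otimes> x" "a \<otimes> \<delta> x"] a xs by (simp add: s_def \<delta>_closed)
      also have "\<dots> = K0 \<oplus>\<^bsub>?T\<^esub> H j"
        using a b xs by (simp add: K0_def H_def 1 bar_pure_ends \<delta>_closed)
      also have "\<dots> = H j \<oplus>\<^bsub>?T\<^esub> K j"
        using Hc[OF j] Kc 1 by (simp add: K_def t.N.a_comm del: add_2_eq_Suc')
      finally show ?thesis .
    next
      case (2 i)
      have "ys[i := \<delta> (ys ! i)] \<in> tuples n" using \<delta>_update_tuples[OF xs(3) 2(2)] .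
      then have "G j = H j" using a b xs 2
        by (simp add: G_def H_def s_def l nth_append list_update_append bar_pure_ends)
      then show ?thesis using Hc[OF j] 2 by (simp add: K_def del: add_2_eq_Suc')
    next
      case 3
      have nth: "((u::'a) # ys @ [v]) ! Suc n = v" for u v by (simp add: l nth_append)
      have upd: "((u::'a) # ys @ [v])[Suc n := w] = u # ys @ [w]" for u v w by (simp add: l list_update_append)
      have "G j = pure ((a \<otimes> x) # ys @ [(\<delta> z \<otimes> b) \<oplus> (z \<otimes> \<delta> b)])"
        using b xs by (simp only: G_def s_def 3 nth upd \<delta>_mult)
      also have "\<dots> = pure ((a \<otimes> x) # ys @ [\<delta> z \<otimes> b]) \<oplus>\<^bsub>?T\<^esub> pure ((a \<otimes> x) # ys @ [z \<otimes> \<delta> b])"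
        using pure_add[OF s, of "Suc n" "\<delta> z \<otimes> b" "z \<otimes> \<delta> b"] b xs
        by (simp add: s_def \<delta>_closed l list_update_append)
      also have "\<dots> = H j \<oplus>\<^bsub>?T\<^esub> K1"
        using a b xs by (simp add: K1_def H_def 3 bar_pure_ends \<delta>_closed l nth_append list_update_append)
      also have "\<dots> = H j \<oplus>\<^bsub>?T\<^esub> K j" using Kc 3 by (simp add: K_def del: add_2_eq_Suc')
      finally show ?thesis .
    qed
  qed
  have Kj: "K j \<in> carrier ?T" for j using Kc by (simp add: K_def del: add_2_eq_Suc')
  have "(\<Oplus>\<^bsub>?T\<^esub>j\<in>{..<n+2}. K j) = (\<Oplus>\<^bsub>?T\<^esub>j\<in>{..<n+2}. if 0 = j then K0 else \<zero>\<^bsub>?T\<^esub>)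
      \<oplus>\<^bsub>?T\<^esub> (\<Oplus>\<^bsub>?T\<^esub>j\<in>{..<n+2}. if Suc n = j then K1 else \<zero>\<^bsub>?T\<^esub>)"
    unfolding K_def by (rule t.N.finsum_addf) (use Kc t.N.zero_closed in \<open>auto simp del: add_2_eq_Suc' t.N.zero_closed\<close>)
  also have "(\<Oplus>\<^bsub>?T\<^esub>j\<in>{..<n+2}. if 0 = j then K0 else \<zero>\<^bsub>?T\<^esub>) = K0"
    by (rule t.N.finsum_singleton) (use Kc in auto)
  also have "(\<Oplus>\<^bsub>?T\<^esub>j\<in>{..<n+2}. if Suc n = j then K1 else \<zero>\<^bsub>?T\<^esub>) = K1"
    by (rule t.N.finsum_singleton) (use Kc in auto)
  finally have K: "(\<Oplus>\<^bsub>?T\<^esub>j\<in>{..<n+2}. K j) = K0 \<oplus>\<^bsub>?T\<^esub> K1" .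
  have H: "(\<Oplus>\<^bsub>?T\<^esub>j\<in>{..<n+2}. H j) = pure [a, b] \<odot>\<^bsub>bar k A n\<^esub> Lie (n + 2) (pure xs)"
    unfolding H_def Lie_pure[OF t]
    by (rule lmod_hom_finsum[OF m2[OF p[OF a b]] tensor_pow_group tensor_pow_group, symmetric])
      (use pure_closed[OF \<delta>_update_tuples[OF t]] in blast)
  have "Lie (n + 2) (pure [a, b] \<odot>\<^bsub>bar k A n\<^esub> pure xs) = Lie (n + 2) (pure s)"
    using a b xs by (simp only: s_def bar_pure_ends)
  also have "\<dots> = (\<Oplus>\<^bsub>?T\<^esub>j\<in>{..<n+2}. H j \<oplus>\<^bsub>?T\<^esub> K j)"
    unfolding Lie_pure[OF s] G_def[symmetric]
    by (rule t.N.finsum_cong'[OF refl]) (use GHK Hc Kj in \<open>auto simp del: add_2_eq_Suc'\<close>)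
  also have "\<dots> = (\<Oplus>\<^bsub>?T\<^esub>j\<in>{..<n+2}. H j) \<oplus>\<^bsub>?T\<^esub> (\<Oplus>\<^bsub>?T\<^esub>j\<in>{..<n+2}. K j)"
    by (rule t.N.finsum_addf) (use Hc Kj in blast)+
  also have "\<dots> = (K0 \<oplus>\<^bsub>?T\<^esub> K1) \<oplus>\<^bsub>?T\<^esub> pure [a, b] \<odot>\<^bsub>bar k A n\<^esub> Lie (n + 2) (pure xs)"
    unfolding H K
    by (rule t.N.a_comm[OF bilinear_map_closed[OF bar_bilinear p[OF a b] Lie_closed[OF pure_closed[OF t]]] t.N.a_closed[OF Kc]])
  also have "K0 \<oplus>\<^bsub>?T\<^esub> K1 = Lie 2 (pure [a, b]) \<odot>\<^bsub>bar k A n\<^esub> pure xs"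
    unfolding K0_def K1_def Lie_pair[OF a b]
    by (rule lmod_hom_add[OF m1[OF pure_closed[OF t]] p p, symmetric]) (use a b \<delta>_closed in auto)
  finally show ?thesis .
qed

lemma Lie_bar:
  assumes E: "E \<in> carrier (T 2)" and X: "X \<in> carrier (T (n + 2))"
  shows "Lie (n + 2) (E \<odot>\<^bsub>bar k A n\<^esub> X) = Lie 2 E \<odot>\<^bsub>bar k A n\<^esub> X \<oplus>\<^bsub>T (n + 2)\<^esub> E \<odot>\<^bsub>bar k A n\<^esub> Lie (n + 2) X"
  by (rule bilinear_eq[OF tensor_pow_left_module bilinear_map_compose[OF bar_bilinear Lie_hom]
      bilinear_map_plus[OF tensor_pow_left_module bilinear_map_arg1[OF bar_bilinear Lie_hom]
        bilinear_map_arg2[OF bar_bilinear Lie_hom]] _ E X])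
    (auto simp: tuples2 Lie_bar_pure simp del: add_2_eq_Suc')

lemma Lie_left_operator: "left_operator k Ae (env_derivation k A \<delta>) (bar k A n) (Lie (n + 2))"
  unfolding left_operator_def linear_endo_def scal_def[symmetric] env_derivation_Lie
proof (intro conjI ballI)
  show "Lie (n + 2) \<in> carrier (bar k A n) \<rightarrow> carrier (bar k A n)" unfolding bar_simps using Lie_closed by blast
  fix X assume "X \<in> carrier (bar k A n)"
  then have X: "X \<in> carrier (T (n + 2))" unfolding bar_simps .
  { fix Y assume "Y \<in> carrier (bar k A n)"
    then show "Lie (n + 2) (X \<oplus>\<^bsub>bar k A n\<^esub> Y) = Lie (n + 2) X \<oplus>\<^bsub>bar k A n\<^esub> Lie (n + 2) Y"
      using lmod_hom_add[OF Lie_hom X] unfolding bar_simps by blast }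
  { fix r assume "r \<in> carrier k"
    then show "Lie (n + 2) (scal r \<odot>\<^bsub>bar k A n\<^esub> X) = scal r \<odot>\<^bsub>bar k A n\<^esub> Lie (n + 2) X"
      using X lmod_hom_smult[OF Lie_hom _ X] by (simp only: scal_bar Lie_closed) }
next
  fix E X assume "E \<in> carrier Ae" "X \<in> carrier (bar k A n)"
  then show "Lie (n + 2) (E \<odot>\<^bsub>bar k A n\<^esub> X) = Lie 2 E \<odot>\<^bsub>bar k A n\<^esub> X \<oplus>\<^bsub>bar k A n\<^esub> E \<odot>\<^bsub>bar k A n\<^esub> Lie (n + 2) X"
    using Lie_bar by (simp only: bar_simps(1,2) env_simps(1))
qed

section \<open>Compatibility of the Leibniz extension with augmentation and differential\<close>

lemma bar_aug_Lie:
  assumes X: "X \<in> carrier (T 2)"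
  shows "bar_aug k A (Lie 2 X) = \<delta> (bar_aug k A X)"
  by (rule tensor_hom_eq[OF Am.left_module_axioms lmod_hom_comp[OF Lie_hom bar_aug_linear]
        lmod_hom_comp[OF bar_aug_linear \<delta>_hom] _ X])
    (auto simp: tuples2 Lie_pair lmod_hom_add[OF bar_aug_linear] pure_closed pair_tuples \<delta>_closed bar_aug_pure \<delta>_mult)

lemma env_derivation_closed: "env_derivation k A \<delta> \<in> carrier Ae \<rightarrow> carrier Ae"
  using Lie_closed by (simp add: env_derivation_Lie env_simps(1))

lemma Lie_bar_diff_commutator:
  "(\<lambda>X. bar_diff k A n (Lie (Suc n + 2) X) \<ominus>\<^bsub>bar k A n\<^esub> Lie (n + 2) (bar_diff k A n X))
    \<in> lmod_hom Ae (bar k A (Suc n)) (bar k A n)"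
  by (rule left_operator_commutator[OF bar_left_module bar_left_module bar_diff_hom Lie_left_operator Lie_left_operator
        env_derivation_closed])

text \<open>On the contraction \<open>h P\<close>, the two composites are
  \<open>Lie P - h (d (Lie P))\<close> and \<open>Lie P - h (Lie (d P))\<close>, because
  \<open>Lie\<close> commutes with \<open>h\<close>. They agree by the induction hypothesis for
  \<open>P\<close>. Linearity of the commutator over \<open>Ae\<close> makes the values on such
  elements sufficient.\<close>

lemma bar_diff_Lie:
  "X \<in> carrier (T (Suc n + 2)) \<Longrightarrow> bar_diff k A n (Lie (Suc n + 2) X) = Lie (n + 2) (bar_diff k A n X)"
proof (induction n arbitrary: X)
  case 0
  interpret t: left_module k "T 2" by (rule tensor_pow_left_module)
  have eq: "bar_diff k A 0 (Lie (Suc 2) X) = Lie 2 (bar_diff k A 0 X)"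
    if "bar_diff k A 0 (Lie (Suc 2) X) \<ominus>\<^bsub>T 2\<^esub> Lie 2 (bar_diff k A 0 X) = \<zero>\<^bsub>T 2\<^esub>" "X \<in> carrier (T (Suc 2))" for X
    using that bar_diff_closed[of _ 0, unfolded add_Suc add_0] Lie_closed
    by (metis t.N.minus_eq_imp_eq_plus t.N.r_zero)
  note hom = Lie_bar_diff_commutator[of 0]
  have "bar_diff k A 0 (Lie (Suc 0 + 2) X) \<ominus>\<^bsub>bar k A 0\<^esub> Lie (0 + 2) (bar_diff k A 0 X) = (\<lambda>_. \<zero>\<^bsub>bar k A 0\<^esub>) X"
  proof (rule bar_hom_eq[OF bar_left_module hom lmod_hom_zero_fun[OF bar_left_module] _ 0])
    fix xs assume "xs \<in> tuples (Suc (Suc 0))"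
    then have xs: "xs \<in> tuples 2" by (simp add: numeral_2_eq_2)
    define P where "P = pure xs"
    have P: "P \<in> carrier (T 2)" unfolding P_def by (rule pure_closed[OF xs])
    have a: "bar_aug k A P \<in> carrier A" by (rule lmod_hom_closed[OF bar_aug_linear P])
    have i: "pure (\<one> # xs) = insert_one 2 P" using insert_one_pure[OF xs] by (simp add: P_def)
    have "pure [\<delta> \<one>, bar_aug k A P] = \<zero>\<^bsub>T 2\<^esub>"
      using pure_zero[OF pair_tuples[OF A.A.one_closed a], of 0] by (simp add: \<delta>_one)
    \<comment> \<open>Degree zero has the augmentation in place of the lower differential; since
      \<open>\<delta>\<close> kills the unit, only the second factor is differentiated.\<close>
    then have 1: "Lie 2 (pure [\<one>, bar_aug k A P]) = pure [\<one>, \<delta> (bar_aug k A P)]"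
      using a by (simp add: Lie_pair pure_closed pair_tuples \<delta>_closed)
    have "bar_diff k A 0 (Lie (Suc 2) (insert_one 2 P)) = Lie 2 P \<ominus>\<^bsub>T 2\<^esub> pure [\<one>, \<delta> (bar_aug k A P)]"
      by (simp only: insert_one_Lie[OF P] bar_contraction_0[OF Lie_closed[OF P]] bar_aug_Lie[OF P])
    moreover have "Lie 2 (bar_diff k A 0 (insert_one 2 P)) = Lie 2 P \<ominus>\<^bsub>T 2\<^esub> pure [\<one>, \<delta> (bar_aug k A P)]"
      using a unfolding bar_contraction_0[OF P]
      by (subst lmod_hom_minus[OF Lie_hom tensor_pow_group tensor_pow_group P]) (simp_all add: 1 pure_closed pair_tuples)
    moreover have "Lie 2 P \<ominus>\<^bsub>T 2\<^esub> pure [\<one>, \<delta> (bar_aug k A P)] \<in> carrier (T 2)"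
      using a P by (intro t.N.minus_closed Lie_closed pure_closed pair_tuples \<delta>_closed) auto
    ultimately show "bar_diff k A 0 (Lie (Suc 0 + 2) (pure (\<one> # xs))) \<ominus>\<^bsub>bar k A 0\<^esub> Lie (0 + 2) (bar_diff k A 0 (pure (\<one> # xs))) = \<zero>\<^bsub>bar k A 0\<^esub>"
      unfolding i by (simp only: add_Suc add_0 bar_minus bar_simps t.N.minus_self)
  qed
  then show ?case using eq[of X] 0 by (simp only: add_Suc add_0 bar_minus bar_simps)
next
  case (Suc n)
  let ?n = "Suc n"
  interpret t: left_module k "T (?n + 2)" by (rule tensor_pow_left_module)
  note hom = Lie_bar_diff_commutator[of ?n]
  have "bar_diff k A ?n (Lie (Suc ?n + 2) X) \<ominus>\<^bsub>bar k A ?n\<^esub> Lie (?n + 2) (bar_diff k A ?n X) = (\<lambda>_. \<zero>\<^bsub>bar k A ?n\<^esub>) X"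
  proof (rule bar_hom_eq[OF bar_left_module hom lmod_hom_zero_fun[OF bar_left_module] _ Suc.prems])
    fix xs assume "xs \<in> tuples (Suc (Suc ?n))"
    then have xs: "xs \<in> tuples (?n + 2)" by simp
    define P where "P = pure xs"
    have P: "P \<in> carrier (T (?n + 2))" unfolding P_def by (rule pure_closed[OF xs])
    have dP: "bar_diff k A n P \<in> carrier (T (n + 2))" by (rule bar_diff_closed[OF P])
    have i: "pure (\<one> # xs) = insert_one (?n + 2) P" using insert_one_pure[OF xs] by (simp only: P_def)
    have j: "insert_one (n + 2) (bar_diff k A n P) \<in> carrier (T (?n + 2))" using insert_one_closed[OF dP] by (simp only: add_Suc)
    have L: "Lie (?n + 2) (insert_one (n + 2) (bar_diff k A n P)) = insert_one (n + 2) (Lie (n + 2) (bar_diff k A n P))"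
      using insert_one_Lie[OF dP] by (simp only: add_Suc)
    have L': "Lie (Suc ?n + 2) (insert_one (?n + 2) P) = insert_one (?n + 2) (Lie (?n + 2) P)"
      using insert_one_Lie[OF P] by (simp only: add_Suc)
    have "bar_diff k A ?n (Lie (Suc ?n + 2) (insert_one (?n + 2) P))
        = Lie (?n + 2) P \<ominus>\<^bsub>T (?n + 2)\<^esub> insert_one (n + 2) (Lie (n + 2) (bar_diff k A n P))"
      by (simp only: L' bar_contraction[OF Lie_closed[OF P]] Suc.IH[OF P])
    moreover have "Lie (?n + 2) (bar_diff k A ?n (insert_one (?n + 2) P))
        = Lie (?n + 2) P \<ominus>\<^bsub>T (?n + 2)\<^esub> insert_one (n + 2) (Lie (n + 2) (bar_diff k A n P))"
      by (simp only: bar_contraction[OF P] lmod_hom_minus[OF Lie_hom tensor_pow_group tensor_pow_group P j] L)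
    moreover have "insert_one (n + 2) (Lie (n + 2) (bar_diff k A n P)) \<in> carrier (T (?n + 2))"
      using insert_one_closed[OF Lie_closed[OF dP]] by (simp only: add_Suc)
    ultimately show "bar_diff k A ?n (Lie (Suc ?n + 2) (pure (\<one> # xs))) \<ominus>\<^bsub>bar k A ?n\<^esub> Lie (?n + 2) (bar_diff k A ?n (pure (\<one> # xs))) = \<zero>\<^bsub>bar k A ?n\<^esub>"
      unfolding i bar_minus by (simp only: bar_simps t.N.minus_self t.N.minus_closed Lie_closed[OF P])
  qed
  then have "bar_diff k A ?n (Lie (Suc ?n + 2) X) \<ominus>\<^bsub>T (?n + 2)\<^esub> Lie (?n + 2) (bar_diff k A ?n X) = \<zero>\<^bsub>T (?n + 2)\<^esub>"
    unfolding bar_minus bar_simps .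
  then show ?case
    using t.N.minus_eq_imp_eq_plus[OF _ bar_diff_closed[OF Lie_closed[OF Suc.prems]] Lie_closed[OF bar_diff_closed[OF Suc.prems]]]
      t.N.r_zero[OF Lie_closed[OF bar_diff_closed[OF Suc.prems]]] by simp
qed

end

section \<open>The balanced tensor product\<close>

definition balanced_map ::
    "('k, 'x) ring_scheme \<Rightarrow> ('k, 'b, 'w) module_scheme \<Rightarrow> ('b, 'm, 'y) module_scheme
      \<Rightarrow> ('b, 'n, 'z) module_scheme \<Rightarrow> ('k, 'v, 'u) module_scheme \<Rightarrow> ('m \<Rightarrow> 'n \<Rightarrow> 'v) \<Rightarrow> bool" where
  "balanced_map k B M N W \<beta> \<longleftrightarrow>
     (\<forall>m\<in>carrier M. \<forall>n\<in>carrier N. \<beta> m n \<in> carrier W) \<and>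
     (\<forall>m\<in>carrier M. \<forall>m'\<in>carrier M. \<forall>n\<in>carrier N. \<beta> (m \<oplus>\<^bsub>M\<^esub> m') n = \<beta> m n \<oplus>\<^bsub>W\<^esub> \<beta> m' n) \<and>
     (\<forall>m\<in>carrier M. \<forall>n\<in>carrier N. \<forall>n'\<in>carrier N. \<beta> m (n \<oplus>\<^bsub>N\<^esub> n') = \<beta> m n \<oplus>\<^bsub>W\<^esub> \<beta> m n') \<and>
     (\<forall>m\<in>carrier M. \<forall>b\<in>carrier B. \<forall>n\<in>carrier N. \<beta> (b \<odot>\<^bsub>M\<^esub> m) n = \<beta> m (b \<odot>\<^bsub>N\<^esub> n)) \<and>
     (\<forall>r\<in>carrier k. \<forall>m\<in>carrier M. \<forall>n\<in>carrier N. \<beta> ((r \<odot>\<^bsub>B\<^esub> \<one>\<^bsub>B\<^esub>) \<odot>\<^bsub>M\<^esub> m) n = r \<odot>\<^bsub>W\<^esub> \<beta> m n)"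

lemma balanced_mapI:
  assumes "\<And>m n. \<lbrakk>m \<in> carrier M; n \<in> carrier N\<rbrakk> \<Longrightarrow> \<beta> m n \<in> carrier W"
    and "\<And>m m' n. \<lbrakk>m \<in> carrier M; m' \<in> carrier M; n \<in> carrier N\<rbrakk> \<Longrightarrow> \<beta> (m \<oplus>\<^bsub>M\<^esub> m') n = \<beta> m n \<oplus>\<^bsub>W\<^esub> \<beta> m' n"
    and "\<And>m n n'. \<lbrakk>m \<in> carrier M; n \<in> carrier N; n' \<in> carrier N\<rbrakk> \<Longrightarrow> \<beta> m (n \<oplus>\<^bsub>N\<^esub> n') = \<beta> m n \<oplus>\<^bsub>W\<^esub> \<beta> m n'"
    and "\<And>m b n. \<lbrakk>m \<in> carrier M; b \<in> carrier B; n \<in> carrier N\<rbrakk> \<Longrightarrow> \<beta> (b \<odot>\<^bsub>M\<^esub> m) n = \<beta> m (b \<odot>\<^bsub>N\<^esub> n)"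
    and "\<And>r m n. \<lbrakk>r \<in> carrier k; m \<in> carrier M; n \<in> carrier N\<rbrakk> \<Longrightarrow> \<beta> ((r \<odot>\<^bsub>B\<^esub> \<one>\<^bsub>B\<^esub>) \<odot>\<^bsub>M\<^esub> m) n = r \<odot>\<^bsub>W\<^esub> \<beta> m n"
  shows "balanced_map k B M N W \<beta>"
  using assms by (simp add: balanced_map_def)

lemma balanced_mapD:
  assumes "balanced_map k B M N W \<beta>"
  shows "\<lbrakk>m \<in> carrier M; n \<in> carrier N\<rbrakk> \<Longrightarrow> \<beta> m n \<in> carrier W"
    and "\<lbrakk>m \<in> carrier M; m' \<in> carrier M; n \<in> carrier N\<rbrakk> \<Longrightarrow> \<beta> (m \<oplus>\<^bsub>M\<^esub> m') n = \<beta> m n \<oplus>\<^bsub>W\<^esub> \<beta> m' n"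
    and "\<lbrakk>m \<in> carrier M; n \<in> carrier N; n' \<in> carrier N\<rbrakk> \<Longrightarrow> \<beta> m (n \<oplus>\<^bsub>N\<^esub> n') = \<beta> m n \<oplus>\<^bsub>W\<^esub> \<beta> m n'"
    and "\<lbrakk>m \<in> carrier M; b \<in> carrier B; n \<in> carrier N\<rbrakk> \<Longrightarrow> \<beta> (b \<odot>\<^bsub>M\<^esub> m) n = \<beta> m (b \<odot>\<^bsub>N\<^esub> n)"
    and "\<lbrakk>r \<in> carrier k; m \<in> carrier M; n \<in> carrier N\<rbrakk> \<Longrightarrow> \<beta> ((r \<odot>\<^bsub>B\<^esub> \<one>\<^bsub>B\<^esub>) \<odot>\<^bsub>M\<^esub> m) n = r \<odot>\<^bsub>W\<^esub> \<beta> m n"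
  using assms by (simp_all add: balanced_map_def)

text \<open>The right module is fixed, whereas the left module stays out of the parameters: it
  changes with the degree, and its type differs between the bar resolution and
  \<open>Q\<close>.\<close>

locale balanced_tensor =
  fixes k :: "('k, 'x) ring_scheme" and B :: "('k, 'b, 'w) module_scheme" and M :: "('b, 'm, 'y) module_scheme"
  assumes k_ring: "ring k" and M_group: "abelian_group M"
    and M_act: "\<lbrakk>b \<in> carrier B; m \<in> carrier M\<rbrakk> \<Longrightarrow> b \<odot>\<^bsub>M\<^esub> m \<in> carrier M"
    and scalar_closed: "r \<in> carrier k \<Longrightarrow> r \<odot>\<^bsub>B\<^esub> \<one>\<^bsub>B\<^esub> \<in> carrier B"
begin

abbreviation tens where "tens N \<equiv> bal_tensor k B M N"
abbreviation tens_pure where "tens_pure N m n \<equiv> bal_pure k B M N m n"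

definition bal_relators :: "('b, 'n, 'z) module_scheme \<Rightarrow> ('m \<times> 'n \<Rightarrow> 'k) set" where
  "bal_relators N = (let F = bal_free k M N in
    {free_gen k (m \<oplus>\<^bsub>M\<^esub> m', n) \<ominus>\<^bsub>F\<^esub> (free_gen k (m, n) \<oplus>\<^bsub>F\<^esub> free_gen k (m', n))
      | m m' n. m \<in> carrier M \<and> m' \<in> carrier M \<and> n \<in> carrier N} \<union>
    {free_gen k (m, n \<oplus>\<^bsub>N\<^esub> n') \<ominus>\<^bsub>F\<^esub> (free_gen k (m, n) \<oplus>\<^bsub>F\<^esub> free_gen k (m, n'))
      | m n n'. m \<in> carrier M \<and> n \<in> carrier N \<and> n' \<in> carrier N} \<union>
    {free_gen k (b \<odot>\<^bsub>M\<^esub> m, n) \<ominus>\<^bsub>F\<^esub> free_gen k (m, b \<odot>\<^bsub>N\<^esub> n)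
      | m b n. m \<in> carrier M \<and> b \<in> carrier B \<and> n \<in> carrier N} \<union>
    {free_gen k ((r \<odot>\<^bsub>B\<^esub> \<one>\<^bsub>B\<^esub>) \<odot>\<^bsub>M\<^esub> m, n) \<ominus>\<^bsub>F\<^esub> (r \<odot>\<^bsub>F\<^esub> free_gen k (m, n))
      | r m n. r \<in> carrier k \<and> m \<in> carrier M \<and> n \<in> carrier N})"

lemma bal_relatorsE:
  assumes "u \<in> bal_relators N"
  obtains m m' n where "m \<in> carrier M" "m' \<in> carrier M" "n \<in> carrier N"
      "u = free_gen k (m \<oplus>\<^bsub>M\<^esub> m', n) \<ominus>\<^bsub>bal_free k M N\<^esub> (free_gen k (m, n) \<oplus>\<^bsub>bal_free k M N\<^esub> free_gen k (m', n))"
  | m n n' where "m \<in> carrier M" "n \<in> carrier N" "n' \<in> carrier N"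
      "u = free_gen k (m, n \<oplus>\<^bsub>N\<^esub> n') \<ominus>\<^bsub>bal_free k M N\<^esub> (free_gen k (m, n) \<oplus>\<^bsub>bal_free k M N\<^esub> free_gen k (m, n'))"
  | m b n where "m \<in> carrier M" "b \<in> carrier B" "n \<in> carrier N"
      "u = free_gen k (b \<odot>\<^bsub>M\<^esub> m, n) \<ominus>\<^bsub>bal_free k M N\<^esub> free_gen k (m, b \<odot>\<^bsub>N\<^esub> n)"
  | r m n where "r \<in> carrier k" "m \<in> carrier M" "n \<in> carrier N"
      "u = free_gen k ((r \<odot>\<^bsub>B\<^esub> \<one>\<^bsub>B\<^esub>) \<odot>\<^bsub>M\<^esub> m, n) \<ominus>\<^bsub>bal_free k M N\<^esub> (r \<odot>\<^bsub>bal_free k M N\<^esub> free_gen k (m, n))"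
  using assms unfolding bal_relators_def Let_def by blast

context
  fixes N :: "('b, 'n, 'z) module_scheme"
  assumes N: "left_module B N"
begin

interpretation N: left_module B N by (rule N)
interpretation Mg: abelian_group M by (rule M_group)
interpretation F: left_module k "bal_free k M N"
  unfolding bal_free_def by (rule free_module_left_module[OF k_ring])

lemma gen_closed: "\<lbrakk>m \<in> carrier M; n \<in> carrier N\<rbrakk> \<Longrightarrow> free_gen k (m, n) \<in> carrier (bal_free k M N)"
  unfolding bal_free_def by (rule free_gen_closed[OF k_ring]) simp

interpretation p: presented k "carrier M \<times> carrier N" "bal_relators N"
  unfolding presented_def bal_free_def[symmetric]
proof (intro conjI k_ring subsetI)
  fix u assume "u \<in> bal_relators N"
  then show "u \<in> carrier (bal_free k M N)"
    by (rule bal_relatorsE)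
      (simp_all only: F.N.minus_closed F.N.a_closed F.act_closed gen_closed Mg.a_closed N.N.a_closed N.act_closed
        M_act scalar_closed)
qed

lemma bal_rel_eq: "bal_rel k B M N = p.S"
  unfolding bal_rel_def bal_relators_def Let_def bal_free_def by simp

lemma bal_tensor_eq: "tens N = p.T"
  unfolding bal_tensor_def bal_rel_eq by (simp add: bal_free_def)

lemma bal_pure_eq: "tens_pure N m n = p.cls (m, n)"
  unfolding bal_pure_def bal_rel_eq by (simp add: bal_free_def)

lemma tens_left_module: "left_module k (tens N)"
  unfolding bal_tensor_eq by (rule p.quot_left_module)

lemma tens_pure_balanced: "balanced_map k B M N (tens N) (tens_pure N)"
proof -
  have F: "bal_free k M N = p.F" by (simp add: bal_free_def)
  note g = gen_closed[unfolded F]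
  have eq: "p.S +>\<^bsub>p.F\<^esub> u = p.S +>\<^bsub>p.F\<^esub> v"
    if "u \<ominus>\<^bsub>p.F\<^esub> v \<in> bal_relators N" "u \<in> carrier p.F" "v \<in> carrier p.F" for u v
    using that p.F.span_submodule(2)[OF p.relators] p.coset_eq[of u v] by blast
  note act = N.act_closed M_act Mg.a_closed N.N.a_closed M_act[OF scalar_closed]
  show ?thesis
    unfolding bal_tensor_eq bal_pure_eq
  proof (rule balanced_mapI)
    fix m n assume m: "m \<in> carrier M" and n: "n \<in> carrier N"
    show "p.cls (m, n) \<in> carrier p.T" using m n by (intro p.cls_closed) simp
    { fix m' assume m': "m' \<in> carrier M"
      have "free_gen k (m \<oplus>\<^bsub>M\<^esub> m', n) \<ominus>\<^bsub>p.F\<^esub> (free_gen k (m, n) \<oplus>\<^bsub>p.F\<^esub> free_gen k (m', n)) \<in> bal_relators N"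
        unfolding bal_relators_def Let_def F using m m' n by blast
      then have "p.cls (m \<oplus>\<^bsub>M\<^esub> m', n) = p.S +>\<^bsub>p.F\<^esub> (free_gen k (m, n) \<oplus>\<^bsub>p.F\<^esub> free_gen k (m', n))"
        by (rule eq) (intro g p.F.N.a_closed act m m' n)+
      then show "p.cls (m \<oplus>\<^bsub>M\<^esub> m', n) = p.cls (m, n) \<oplus>\<^bsub>p.T\<^esub> p.cls (m', n)"
        by (simp only: p.coset_add g m m' n) }
    { fix n' assume n': "n' \<in> carrier N"
      have "free_gen k (m, n \<oplus>\<^bsub>N\<^esub> n') \<ominus>\<^bsub>p.F\<^esub> (free_gen k (m, n) \<oplus>\<^bsub>p.F\<^esub> free_gen k (m, n')) \<in> bal_relators N"
        unfolding bal_relators_def Let_def F using m n' n by blast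
      then have "p.cls (m, n \<oplus>\<^bsub>N\<^esub> n') = p.S +>\<^bsub>p.F\<^esub> (free_gen k (m, n) \<oplus>\<^bsub>p.F\<^esub> free_gen k (m, n'))"
        by (rule eq) (intro g p.F.N.a_closed act m n' n)+
      then show "p.cls (m, n \<oplus>\<^bsub>N\<^esub> n') = p.cls (m, n) \<oplus>\<^bsub>p.T\<^esub> p.cls (m, n')"
        by (simp only: p.coset_add g m n' n) }
    { fix b assume b: "b \<in> carrier B"
      have "free_gen k (b \<odot>\<^bsub>M\<^esub> m, n) \<ominus>\<^bsub>p.F\<^esub> free_gen k (m, b \<odot>\<^bsub>N\<^esub> n) \<in> bal_relators N"
        unfolding bal_relators_def Let_def F using m b n by blast
      then show "p.cls (b \<odot>\<^bsub>M\<^esub> m, n) = p.cls (m, b \<odot>\<^bsub>N\<^esub> n)"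
        by (rule eq) (intro g act b m n)+ }
    { fix r assume r: "r \<in> carrier k"
      have "free_gen k ((r \<odot>\<^bsub>B\<^esub> \<one>\<^bsub>B\<^esub>) \<odot>\<^bsub>M\<^esub> m, n) \<ominus>\<^bsub>p.F\<^esub> (r \<odot>\<^bsub>p.F\<^esub> free_gen k (m, n)) \<in> bal_relators N"
        unfolding bal_relators_def Let_def F using m r n by blast
      then have "p.cls ((r \<odot>\<^bsub>B\<^esub> \<one>\<^bsub>B\<^esub>) \<odot>\<^bsub>M\<^esub> m, n) = p.S +>\<^bsub>p.F\<^esub> (r \<odot>\<^bsub>p.F\<^esub> free_gen k (m, n))"
        by (rule eq) (intro g p.F.act_closed M_act scalar_closed r m n)+
      then show "p.cls ((r \<odot>\<^bsub>B\<^esub> \<one>\<^bsub>B\<^esub>) \<odot>\<^bsub>M\<^esub> m, n) = r \<odot>\<^bsub>p.T\<^esub> p.cls (m, n)"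
        by (simp only: p.coset_smult g r m n) }
  qed
qed

lemma tens_lift:
  assumes W: "left_module k W" and \<beta>: "balanced_map k B M N W \<beta>"
  shows tens_lift_hom: "tensor_lift k W (\<lambda>(m, n). \<beta> m n) \<in> lmod_hom k (tens N) W"
    and tens_lift_pure: "\<lbrakk>m \<in> carrier M; n \<in> carrier N\<rbrakk> \<Longrightarrow> tensor_lift k W (\<lambda>(m, n). \<beta> m n) (tens_pure N m n) = \<beta> m n"
proof -
  interpret W: left_module k W by fact
  let ?\<phi> = "\<lambda>(m, n). \<beta> m n"
  have \<phi>: "?\<phi> \<in> carrier M \<times> carrier N \<rightarrow> carrier W" using balanced_mapD(1)[OF \<beta>] by auto
  note e = free_ext_hom[OF W \<phi>, folded bal_free_def]
  have eg: "free_ext k W ?\<phi> (free_gen k (m, n)) = \<beta> m n" if "m \<in> carrier M" "n \<in> carrier N" for m n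
    using free_ext_gen[OF W \<phi>, of "(m, n)"] that by simp
  note em = lmod_hom_minus[OF e F.N.abelian_group_axioms W.N.abelian_group_axioms]
  have z: "free_ext k W ?\<phi> u = \<zero>\<^bsub>W\<^esub>" if "u \<in> bal_relators N" for u
    using that
  proof (cases rule: bal_relatorsE)
    case (1 m m' n)
    show ?thesis unfolding 1(4) using 1(1-3)
      by (simp only: em gen_closed Mg.a_closed F.N.a_closed lmod_hom_add[OF e] eg balanced_mapD(2)[OF \<beta>]
          W.N.minus_self W.N.a_closed balanced_mapD(1)[OF \<beta>])
  next
    case (2 m n n')
    show ?thesis unfolding 2(4) using 2(1-3)
      by (simp only: em gen_closed N.N.a_closed F.N.a_closed lmod_hom_add[OF e] eg balanced_mapD(3)[OF \<beta>]
          W.N.minus_self W.N.a_closed balanced_mapD(1)[OF \<beta>])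
  next
    case (3 m b n)
    show ?thesis unfolding 3(4) using 3(1-3)
      by (simp only: em gen_closed M_act N.act_closed eg balanced_mapD(4)[OF \<beta>]
          W.N.minus_self balanced_mapD(1)[OF \<beta>])
  next
    case (4 r m n)
    show ?thesis unfolding 4(4) using 4(1-3)
      by (simp only: em gen_closed M_act scalar_closed F.act_closed lmod_hom_smult[OF e] eg balanced_mapD(5)[OF \<beta>]
          W.N.minus_self W.act_closed balanced_mapD(1)[OF \<beta>])
  qed
  show "tensor_lift k W ?\<phi> \<in> lmod_hom k (tens N) W"
    unfolding bal_tensor_eq by (rule p.lift_hom[OF W \<phi> z])
  show "tensor_lift k W ?\<phi> (tens_pure N m n) = \<beta> m n" if "m \<in> carrier M" "n \<in> carrier N"
    unfolding bal_pure_eq using p.lift_cls[OF W \<phi> z, of "(m, n)"] that by simp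
qed

lemma tens_hom_eq:
  assumes W: "left_module k W" and h: "h \<in> lmod_hom k (tens N) W" "h' \<in> lmod_hom k (tens N) W"
    and eq: "\<And>m n. \<lbrakk>m \<in> carrier M; n \<in> carrier N\<rbrakk> \<Longrightarrow> h (tens_pure N m n) = h' (tens_pure N m n)"
    and X: "X \<in> carrier (tens N)"
  shows "h X = h' X"
  by (rule p.hom_unique[OF W h[unfolded bal_tensor_eq] _ X[unfolded bal_tensor_eq]])
    (use eq in \<open>auto simp: bal_pure_eq\<close>)

end

lemmas tens_pure_closed = balanced_mapD(1)[OF tens_pure_balanced]
  and tens_pure_add_left = balanced_mapD(2)[OF tens_pure_balanced]
  and tens_pure_add_right = balanced_mapD(3)[OF tens_pure_balanced]
  and tens_pure_act = balanced_mapD(4)[OF tens_pure_balanced]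
  and tens_pure_scalar = balanced_mapD(5)[OF tens_pure_balanced]

lemma tens_pure_zero:
  assumes N: "left_module B N" and m: "m \<in> carrier M"
  shows "tens_pure N m \<zero>\<^bsub>N\<^esub> = \<zero>\<^bsub>tens N\<^esub>"
  using additive_zero[of N "tens N" "tens_pure N m"] tens_left_module[OF N] N tens_pure_closed[OF N m]
    tens_pure_add_right[OF N m]
  by (auto simp: left_module_def)

text \<open>The differential \<^const>\<open>tensor_diff\<close> is an instance.\<close>

definition tens_map :: "('b, 'n, 'z) module_scheme \<Rightarrow> ('q \<Rightarrow> 'n) \<Rightarrow> ('m \<times> 'q \<Rightarrow> 'k) set \<Rightarrow> ('m \<times> 'n \<Rightarrow> 'k) set" where
  "tens_map N \<theta> = tensor_lift k (tens N) (\<lambda>(m, q). tens_pure N m (\<theta> q))"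

lemma tens_map:
  assumes N: "left_module B N" and N': "left_module B N'" and \<theta>: "\<theta> \<in> lmod_hom B N N'"
  shows tens_map_hom: "tens_map N' \<theta> \<in> lmod_hom k (tens N) (tens N')"
    and tens_map_pure: "\<lbrakk>m \<in> carrier M; n \<in> carrier N\<rbrakk> \<Longrightarrow> tens_map N' \<theta> (tens_pure N m n) = tens_pure N' m (\<theta> n)"
proof -
  have b: "balanced_map k B M N (tens N') (\<lambda>m n. tens_pure N' m (\<theta> n))"
    by (rule balanced_mapI)
      (simp_all add: lmod_hom_closed[OF \<theta>] lmod_hom_add[OF \<theta>] lmod_hom_smult[OF \<theta>] tens_pure_closed[OF N']
        tens_pure_add_left[OF N'] tens_pure_add_right[OF N'] tens_pure_act[OF N'] tens_pure_scalar[OF N'])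
  show "tens_map N' \<theta> \<in> lmod_hom k (tens N) (tens N')"
    unfolding tens_map_def by (rule tens_lift_hom[OF N tens_left_module[OF N'] b])
  show "tens_map N' \<theta> (tens_pure N m n) = tens_pure N' m (\<theta> n)" if "m \<in> carrier M" "n \<in> carrier N"
    unfolding tens_map_def by (rule tens_lift_pure[OF N tens_left_module[OF N'] b that])
qed

section \<open>Tensoring complexes, chain maps and homotopies\<close>

lemma tensor_diff_tens_map: "tensor_diff k B M Q dQ n = tens_map (Q n) (dQ n)"
  by (simp add: tensor_diff_def tens_map_def)

lemma tens_complex:
  assumes Q: "chain_complex B Q d"
  shows "chain_complex k (\<lambda>n. tens (Q n)) (tensor_diff k B M Q d)"
  unfolding chain_complex_def tensor_diff_tens_map
proof (intro conjI allI ballI)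
  note L = chain_complexD(1)[OF Q] and d = chain_complexD(2)[OF Q]
  note h = tens_map_hom[OF L L d] and hp = tens_map_pure[OF L L d]
  fix n
  show "left_module k (tens (Q n))" by (rule tens_left_module[OF L])
  show "tens_map (Q n) (d n) \<in> lmod_hom k (tens (Q (Suc n))) (tens (Q n))" by (rule h)
  fix X assume X: "X \<in> carrier (tens (Q (Suc (Suc n))))"
  show "tens_map (Q n) (d n) (tens_map (Q (Suc n)) (d (Suc n)) X) = \<zero>\<^bsub>tens (Q n)\<^esub>"
    by (rule tens_hom_eq[OF L tens_left_module[OF L] lmod_hom_comp[OF h h] lmod_hom_zero_fun[OF tens_left_module[OF L]] _ X])
      (simp add: hp lmod_hom_closed[OF d] chain_complexD(3)[OF Q] tens_pure_zero[OF L])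
qed

lemma tens_chain_map:
  assumes P: "chain_complex B P d" and Q: "chain_complex B Q d'" and f: "chain_map B P d Q d' f"
  shows "chain_map k (\<lambda>n. tens (P n)) (tensor_diff k B M P d) (\<lambda>n. tens (Q n)) (tensor_diff k B M Q d')
    (\<lambda>n. tens_map (Q n) (f n))"
  unfolding chain_map_def tensor_diff_tens_map
proof (intro conjI allI ballI)
  note LP = chain_complexD(1)[OF P] and dP = chain_complexD(2)[OF P]
  note LQ = chain_complexD(1)[OF Q] and dQ = chain_complexD(2)[OF Q] and f' = chain_mapD(1)[OF f]
  note hP = tens_map_hom[OF LP LP dP] tens_map_pure[OF LP LP dP]
  note hQ = tens_map_hom[OF LQ LQ dQ] tens_map_pure[OF LQ LQ dQ]
  note hf = tens_map_hom[OF LP LQ f'] tens_map_pure[OF LP LQ f']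
  fix n
  show "tens_map (Q n) (f n) \<in> lmod_hom k (tens (P n)) (tens (Q n))" by (rule hf)
  fix X assume X: "X \<in> carrier (tens (P (Suc n)))"
  show "tens_map (Q n) (d' n) (tens_map (Q (Suc n)) (f (Suc n)) X) = tens_map (Q n) (f n) (tens_map (P n) (d n) X)"
    by (rule tens_hom_eq[OF LP tens_left_module[OF LQ] lmod_hom_comp[OF hf(1) hQ(1)] lmod_hom_comp[OF hP(1) hf(1)] _ X])
      (simp add: hP(2) hQ(2) hf(2) lmod_hom_closed[OF dP] lmod_hom_closed[OF f'] chain_mapD(2)[OF f])
qed

text \<open>The homotopy is \<open>1 \<otimes> s\<close>. The maps \<open>U\<close> and
  \<open>V\<close> need not be induced by linear maps of resolutions; only their values on pure
  tensors are compared.\<close>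

lemma tens_homotopicI:
  assumes P: "chain_complex B P d" and Q: "chain_complex B Q d'"
    and s: "\<And>n. s n \<in> lmod_hom B (P n) (Q (Suc n))"
    and U: "\<And>n. U n \<in> lmod_hom k (tens (P n)) (tens (Q n))"
    and V: "\<And>n. V n \<in> lmod_hom k (tens (P n)) (tens (Q n))"
    and UV0: "\<And>m q. \<lbrakk>m \<in> carrier M; q \<in> carrier (P 0)\<rbrakk> \<Longrightarrow>
      U 0 (tens_pure (P 0) m q) = V 0 (tens_pure (P 0) m q) \<oplus>\<^bsub>tens (Q 0)\<^esub> tens_pure (Q 0) m (d' 0 (s 0 q))"
    and UV: "\<And>n m q. \<lbrakk>m \<in> carrier M; q \<in> carrier (P (Suc n))\<rbrakk> \<Longrightarrow>
      U (Suc n) (tens_pure (P (Suc n)) m q) = V (Suc n) (tens_pure (P (Suc n)) m q) \<oplus>\<^bsub>tens (Q (Suc n))\<^esub>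
        tens_pure (Q (Suc n)) m (d' (Suc n) (s (Suc n) q) \<oplus>\<^bsub>Q (Suc n)\<^esub> s n (d n q))"
  shows "chain_homotopic k (\<lambda>n. tens (P n)) (tensor_diff k B M P d) (\<lambda>n. tens (Q n)) (tensor_diff k B M Q d') U V"
  unfolding chain_homotopic_def tensor_diff_tens_map
proof (intro exI[of _ "\<lambda>n. tens_map (Q (Suc n)) (s n)"] conjI allI ballI)
  note LP = chain_complexD(1)[OF P] and dP = chain_complexD(2)[OF P]
  note LQ = chain_complexD(1)[OF Q] and dQ = chain_complexD(2)[OF Q]
  note hP = tens_map_hom[OF LP LP dP] tens_map_pure[OF LP LP dP]
  note hQ = tens_map_hom[OF LQ LQ dQ] tens_map_pure[OF LQ LQ dQ]
  note hs = tens_map_hom[OF LP LQ s] tens_map_pure[OF LP LQ s]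
  note T = tens_left_module[OF LQ]
  { fix n show "tens_map (Q (Suc n)) (s n) \<in> lmod_hom k (tens (P n)) (tens (Q (Suc n)))" by (rule hs) }
  { fix X assume X: "X \<in> carrier (tens (P 0))"
    show "U 0 X = V 0 X \<oplus>\<^bsub>tens (Q 0)\<^esub> tens_map (Q 0) (d' 0) (tens_map (Q (Suc 0)) (s 0) X)"
      by (rule tens_hom_eq[OF LP T U lmod_hom_plus[OF T V lmod_hom_comp[OF hs(1) hQ(1)]] _ X])
        (simp add: UV0 hs(2) hQ(2) lmod_hom_closed[OF s]) }
  { fix n X assume X: "X \<in> carrier (tens (P (Suc n)))"
    show "U (Suc n) X = V (Suc n) X \<oplus>\<^bsub>tens (Q (Suc n))\<^esub>
        (tens_map (Q (Suc n)) (d' (Suc n)) (tens_map (Q (Suc (Suc n))) (s (Suc n)) X) \<oplus>\<^bsub>tens (Q (Suc n))\<^esub>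
         tens_map (Q (Suc n)) (s n) (tens_map (P n) (d n) X))"
      by (rule tens_hom_eq[OF LP T U lmod_hom_plus[OF T V lmod_hom_plus[OF T lmod_hom_comp[OF hs(1) hQ(1)]
            lmod_hom_comp[OF hP(1) hs(1)]]] _ X])
        (simp add: UV hs(2) hQ(2) hP(2) lmod_hom_closed[OF s] lmod_hom_closed[OF dP] lmod_hom_closed[OF dQ]
          tens_pure_add_right[OF LQ]) }
qed

text \<open>\<open>R\<close> is a summand common to \<open>U\<close> and \<open>V\<close>. In the
  application it is \<open>\<delta> m \<otimes> \<phi> q\<close>, which is not balanced on its own;
  neither need \<open>m \<otimes> f q\<close> be, but their sum is. The common part disappears in
  the comparison of \<open>U\<close> with \<open>V\<close>, leaving the tensored homotopy.\<close>

lemma tens_homotopic: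
  assumes P: "chain_complex B P d" and Q: "chain_complex B Q d'"
    and fg: "chain_homotopic B P d Q d' f g"
    and g: "\<And>n q. q \<in> carrier (P n) \<Longrightarrow> g n q \<in> carrier (Q n)"
    and U: "\<And>n. U n \<in> lmod_hom k (tens (P n)) (tens (Q n))"
      "\<And>n m q. \<lbrakk>m \<in> carrier M; q \<in> carrier (P n)\<rbrakk> \<Longrightarrow> U n (tens_pure (P n) m q) = R n m q \<oplus>\<^bsub>tens (Q n)\<^esub> tens_pure (Q n) m (f n q)"
    and V: "\<And>n. V n \<in> lmod_hom k (tens (P n)) (tens (Q n))"
      "\<And>n m q. \<lbrakk>m \<in> carrier M; q \<in> carrier (P n)\<rbrakk> \<Longrightarrow> V n (tens_pure (P n) m q) = R n m q \<oplus>\<^bsub>tens (Q n)\<^esub> tens_pure (Q n) m (g n q)"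
    and R: "\<And>n m q. \<lbrakk>m \<in> carrier M; q \<in> carrier (P n)\<rbrakk> \<Longrightarrow> R n m q \<in> carrier (tens (Q n))"
  shows "chain_homotopic k (\<lambda>n. tens (P n)) (tensor_diff k B M P d) (\<lambda>n. tens (Q n)) (tensor_diff k B M Q d') U V"
proof -
  obtain s where s: "\<And>n. s n \<in> lmod_hom B (P n) (Q (Suc n))"
    "\<And>x. x \<in> carrier (P 0) \<Longrightarrow> f 0 x = g 0 x \<oplus>\<^bsub>Q 0\<^esub> d' 0 (s 0 x)"
    "\<And>n x. x \<in> carrier (P (Suc n)) \<Longrightarrow> f (Suc n) x =
        g (Suc n) x \<oplus>\<^bsub>Q (Suc n)\<^esub> (d' (Suc n) (s (Suc n) x) \<oplus>\<^bsub>Q (Suc n)\<^esub> s n (d n x))"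
    using fg unfolding chain_homotopic_def by blast
  note L = chain_complexD(1)[OF Q]
  note cl = lmod_hom_closed[OF s(1)] lmod_hom_closed[OF chain_complexD(2)[OF Q]]
    lmod_hom_closed[OF chain_complexD(2)[OF P]]
  have assoc: "a \<oplus>\<^bsub>tens (Q n)\<^esub> (b \<oplus>\<^bsub>tens (Q n)\<^esub> c) = a \<oplus>\<^bsub>tens (Q n)\<^esub> b \<oplus>\<^bsub>tens (Q n)\<^esub> c"
    if "a \<in> carrier (tens (Q n))" "b \<in> carrier (tens (Q n))" "c \<in> carrier (tens (Q n))" for a b c n
  proof -
    interpret left_module k "tens (Q n)" by (rule tens_left_module[OF L])
    show ?thesis using that by (rule N.a_assoc[symmetric])
  qed
  have ac: "x \<oplus>\<^bsub>Q n\<^esub> y \<in> carrier (Q n)" if "x \<in> carrier (Q n)" "y \<in> carrier (Q n)" for n x y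
    using L[of n] that by (auto simp: left_module_def abelian_group_def abelian_monoid.a_closed)
  note p = tens_pure_closed[OF L] and add = tens_pure_add_right[OF L]
  show ?thesis
  proof (rule tens_homotopicI[where s = s, OF P Q s(1) U(1) V(1)])
    fix m q assume m: "m \<in> carrier M" and q: "q \<in> carrier (P 0)"
    then show "U 0 (tens_pure (P 0) m q) = V 0 (tens_pure (P 0) m q) \<oplus>\<^bsub>tens (Q 0)\<^esub> tens_pure (Q 0) m (d' 0 (s 0 q))"
      by (simp add: U(2) V(2) s(2) g cl p add R assoc)
  next
    fix n m q assume m: "m \<in> carrier M" and q: "q \<in> carrier (P (Suc n))"
    let ?y = "d' (Suc n) (s (Suc n) q) \<oplus>\<^bsub>Q (Suc n)\<^esub> s n (d n q)"
    have y: "?y \<in> carrier (Q (Suc n))" using q by (intro ac cl)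
    show "U (Suc n) (tens_pure (P (Suc n)) m q) = V (Suc n) (tens_pure (P (Suc n)) m q) \<oplus>\<^bsub>tens (Q (Suc n))\<^esub> tens_pure (Q (Suc n)) m ?y"
      unfolding U(2)[OF m q] V(2)[OF m q] s(3)[OF q] add[OF m g[OF q] y]
      by (rule assoc[OF R[OF m q] p[OF m g[OF q]] p[OF m y]])
  qed
qed

text \<open>The case of a zero common summand, for linear chain maps.\<close>

lemma tens_map_homotopic:
  assumes P: "chain_complex B P d" and Q: "chain_complex B Q d'"
    and fg: "chain_homotopic B P d Q d' f g"
    and f: "\<And>n. f n \<in> lmod_hom B (P n) (Q n)" and g: "\<And>n. g n \<in> lmod_hom B (P n) (Q n)"
  shows "chain_homotopic k (\<lambda>n. tens (P n)) (tensor_diff k B M P d) (\<lambda>n. tens (Q n)) (tensor_diff k B M Q d')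
    (\<lambda>n. tens_map (Q n) (f n)) (\<lambda>n. tens_map (Q n) (g n))"
proof -
  note LP = chain_complexD(1)[OF P] and LQ = chain_complexD(1)[OF Q]
  have m: "abelian_monoid (tens (Q n))" for n
    using tens_left_module[OF LQ] by (simp add: left_module_def abelian_group_def)
  note z = abelian_monoid.zero_closed[OF m] abelian_monoid.l_zero[OF m]
  show ?thesis
    by (rule tens_homotopic[where R = "\<lambda>n m q. \<zero>\<^bsub>tens (Q n)\<^esub>", OF P Q fg lmod_hom_closed[OF g]
          tens_map_hom[OF LP LQ f] _ tens_map_hom[OF LP LQ g] _ z(1)])
      (simp_all add: tens_map_pure[OF LP LQ f] tens_map_pure[OF LP LQ g] z(2) tens_pure_closed[OF LQ]
        lmod_hom_closed[OF f] lmod_hom_closed[OF g])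
qed

lemma tens_map_comp:
  assumes L: "left_module B N" "left_module B N'" "left_module B N''"
    and f: "f \<in> lmod_hom B N N'" and g: "g \<in> lmod_hom B N' N''" and X: "X \<in> carrier (tens N)"
  shows "tens_map N'' (\<lambda>x. g (f x)) X = tens_map N'' g (tens_map N' f X)"
  by (rule tens_hom_eq[OF L(1) tens_left_module[OF L(3)] tens_map_hom[OF L(1,3) lmod_hom_comp[OF f g]]
        lmod_hom_comp[OF tens_map_hom[OF L(1,2) f] tens_map_hom[OF L(2,3) g]] _ X])
    (simp add: tens_map_pure[OF L(1,3) lmod_hom_comp[OF f g]] tens_map_pure[OF L(1,2) f] tens_map_pure[OF L(2,3) g]
      lmod_hom_closed[OF f])

lemma tens_map_id:
  assumes N: "left_module B N" and X: "X \<in> carrier (tens N)"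
  shows "tens_map N (\<lambda>x. x) X = X"
  by (rule tens_hom_eq[OF N tens_left_module[OF N] tens_map_hom[OF N N lmod_hom_id] lmod_hom_id _ X])
    (simp add: tens_map_pure[OF N N lmod_hom_id])

section \<open>Operators on a balanced tensor product\<close>

definition tens_operator :: "('b, 'n, 'z) module_scheme \<Rightarrow> ('m \<Rightarrow> 'm) \<Rightarrow> ('n \<Rightarrow> 'n)
    \<Rightarrow> ('m \<times> 'n \<Rightarrow> 'k) set \<Rightarrow> ('m \<times> 'n \<Rightarrow> 'k) set" where
  "tens_operator N f g = tensor_lift k (tens N) (\<lambda>(m, q). tens_pure N (f m) q \<oplus>\<^bsub>tens N\<^esub> tens_pure N m (g q))"

text \<open>The Leibniz defect of \<open>f\<close> contributes \<open>m\<close> acted on by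
  \<open>D b\<close>, tensored with \<open>n\<close>; that of \<open>g\<close> contributes
  \<open>m\<close> tensored with \<open>D b\<close> acting on \<open>n\<close>. Balancing identifies
  these two terms, so the sum descends.\<close>

lemma tens_operator:
  assumes N: "left_module B N" and f: "right_operator k B D M f" and g: "left_operator k B D N g"
    and D: "D \<in> carrier B \<rightarrow> carrier B"
  shows tens_operator_hom: "tens_operator N f g \<in> lmod_hom k (tens N) (tens N)"
    and tens_operator_pure: "\<lbrakk>m \<in> carrier M; n \<in> carrier N\<rbrakk> \<Longrightarrow>
      tens_operator N f g (tens_pure N m n) = tens_pure N (f m) n \<oplus>\<^bsub>tens N\<^esub> tens_pure N m (g n)"
proof -
  interpret N: left_module B N by fact
  interpret W: left_module k "tens N" by (rule tens_left_module[OF N])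
  interpret Mg: abelian_group M by (rule M_group)
  have fc: "f m \<in> carrier M" if "m \<in> carrier M" for m
    using f that unfolding right_operator_def linear_endo_def by blast
  have gc: "g n \<in> carrier N" if "n \<in> carrier N" for n
    using g that unfolding left_operator_def linear_endo_def by blast
  have fa: "f (m \<oplus>\<^bsub>M\<^esub> m') = f m \<oplus>\<^bsub>M\<^esub> f m'" if "m \<in> carrier M" "m' \<in> carrier M" for m m'
    using f that unfolding right_operator_def linear_endo_def by blast
  have ga: "g (m \<oplus>\<^bsub>N\<^esub> m') = g m \<oplus>\<^bsub>N\<^esub> g m'" if "m \<in> carrier N" "m' \<in> carrier N" for m m'
    using g that unfolding left_operator_def linear_endo_def by blast
  have fs: "f ((r \<odot>\<^bsub>B\<^esub> \<one>\<^bsub>B\<^esub>) \<odot>\<^bsub>M\<^esub> m) = (r \<odot>\<^bsub>B\<^esub> \<one>\<^bsub>B\<^esub>) \<odot>\<^bsub>M\<^esub> f m" if "r \<in> carrier k" "m \<in> carrier M" for r m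
    using f that unfolding right_operator_def linear_endo_def by blast
  have fb: "f (b \<odot>\<^bsub>M\<^esub> m) = b \<odot>\<^bsub>M\<^esub> f m \<oplus>\<^bsub>M\<^esub> D b \<odot>\<^bsub>M\<^esub> m" if "b \<in> carrier B" "m \<in> carrier M" for b m
    using f that unfolding right_operator_def by blast
  have gb: "g (b \<odot>\<^bsub>N\<^esub> n) = D b \<odot>\<^bsub>N\<^esub> n \<oplus>\<^bsub>N\<^esub> b \<odot>\<^bsub>N\<^esub> g n" if "b \<in> carrier B" "n \<in> carrier N" for b n
    using g that unfolding left_operator_def by blast
  note p = tens_pure_closed[OF N] tens_pure_add_left[OF N] tens_pure_add_right[OF N] tens_pure_act[OF N]
    tens_pure_scalar[OF N]
  have b: "balanced_map k B M N (tens N) (\<lambda>m q. tens_pure N (f m) q \<oplus>\<^bsub>tens N\<^esub> tens_pure N m (g q))"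
  proof (rule balanced_mapI)
    fix m n assume mn: "m \<in> carrier M" "n \<in> carrier N"
    show "tens_pure N (f m) n \<oplus>\<^bsub>tens N\<^esub> tens_pure N m (g n) \<in> carrier (tens N)"
      using mn by (simp add: p fc gc)
    { fix m' assume "m' \<in> carrier M"
      then show "tens_pure N (f (m \<oplus>\<^bsub>M\<^esub> m')) n \<oplus>\<^bsub>tens N\<^esub> tens_pure N (m \<oplus>\<^bsub>M\<^esub> m') (g n)
        = tens_pure N (f m) n \<oplus>\<^bsub>tens N\<^esub> tens_pure N m (g n) \<oplus>\<^bsub>tens N\<^esub> (tens_pure N (f m') n \<oplus>\<^bsub>tens N\<^esub> tens_pure N m' (g n))"
        using mn by (simp add: fa p fc gc W.N.a_ac) }
    { fix n' assume "n' \<in> carrier N"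
      then show "tens_pure N (f m) (n \<oplus>\<^bsub>N\<^esub> n') \<oplus>\<^bsub>tens N\<^esub> tens_pure N m (g (n \<oplus>\<^bsub>N\<^esub> n'))
        = tens_pure N (f m) n \<oplus>\<^bsub>tens N\<^esub> tens_pure N m (g n) \<oplus>\<^bsub>tens N\<^esub> (tens_pure N (f m) n' \<oplus>\<^bsub>tens N\<^esub> tens_pure N m (g n'))"
        using mn by (simp add: ga p fc gc W.N.a_ac) }
    { fix b assume "b \<in> carrier B"
      then show "tens_pure N (f (b \<odot>\<^bsub>M\<^esub> m)) n \<oplus>\<^bsub>tens N\<^esub> tens_pure N (b \<odot>\<^bsub>M\<^esub> m) (g n)
        = tens_pure N (f m) (b \<odot>\<^bsub>N\<^esub> n) \<oplus>\<^bsub>tens N\<^esub> tens_pure N m (g (b \<odot>\<^bsub>N\<^esub> n))"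
        using mn D by (simp add: fb gb p fc gc M_act funcset_mem[OF D] N.act_closed W.N.a_ac) }
    { fix r assume "r \<in> carrier k"
      then show "tens_pure N (f ((r \<odot>\<^bsub>B\<^esub> \<one>\<^bsub>B\<^esub>) \<odot>\<^bsub>M\<^esub> m)) n \<oplus>\<^bsub>tens N\<^esub> tens_pure N ((r \<odot>\<^bsub>B\<^esub> \<one>\<^bsub>B\<^esub>) \<odot>\<^bsub>M\<^esub> m) (g n)
        = r \<odot>\<^bsub>tens N\<^esub> (tens_pure N (f m) n \<oplus>\<^bsub>tens N\<^esub> tens_pure N m (g n))"
        using mn by (simp add: fs p(1,5) fc gc W.act_add_right) }
  qed
  show "tens_operator N f g \<in> lmod_hom k (tens N) (tens N)"
    unfolding tens_operator_def by (rule tens_lift_hom[OF N tens_left_module[OF N] b])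
  show "tens_operator N f g (tens_pure N m n) = tens_pure N (f m) n \<oplus>\<^bsub>tens N\<^esub> tens_pure N m (g n)"
    if "m \<in> carrier M" "n \<in> carrier N"
    unfolding tens_operator_def by (rule tens_lift_pure[OF N tens_left_module[OF N] b that])
qed

lemma tens_operator_chain_map:
  assumes Q: "chain_complex B Q d" and f: "right_operator k B D M f"
    and g: "\<And>i. left_operator k B D (Q i) (g i)"
    and dg: "\<And>i x. x \<in> carrier (Q (Suc i)) \<Longrightarrow> d i (g (Suc i) x) = g i (d i x)"
    and D: "D \<in> carrier B \<rightarrow> carrier B"
  shows "chain_map k (\<lambda>n. tens (Q n)) (tensor_diff k B M Q d) (\<lambda>n. tens (Q n)) (tensor_diff k B M Q d)
    (\<lambda>n. tens_operator (Q n) f (g n))"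
  unfolding chain_map_def tensor_diff_tens_map
proof (intro conjI allI ballI)
  note L = chain_complexD(1)[OF Q] and d = chain_complexD(2)[OF Q]
  note T = tens_left_module[OF L]
  note h = tens_map_hom[OF L L d] tens_map_pure[OF L L d]
  note o = tens_operator_hom[OF L f g D] tens_operator_pure[OF L f g D]
  have fc: "f m \<in> carrier M" if "m \<in> carrier M" for m
    using f that unfolding right_operator_def linear_endo_def by blast
  have gc: "g i n \<in> carrier (Q i)" if "n \<in> carrier (Q i)" for n i
    using g[of i] that unfolding left_operator_def linear_endo_def by blast
  fix n
  show "tens_operator (Q n) f (g n) \<in> lmod_hom k (tens (Q n)) (tens (Q n))" by (rule o(1))
  fix X assume X: "X \<in> carrier (tens (Q (Suc n)))"
  show "tens_map (Q n) (d n) (tens_operator (Q (Suc n)) f (g (Suc n)) X)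
      = tens_operator (Q n) f (g n) (tens_map (Q n) (d n) X)"
    by (rule tens_hom_eq[OF L T lmod_hom_comp[OF o(1) h(1)] lmod_hom_comp[OF h(1) o(1)] _ X])
      (simp add: o(2) h(2) lmod_hom_add[OF h(1)] tens_pure_closed[OF L] fc gc lmod_hom_closed[OF d] dg)
qed

end

section \<open>The Hochschild complex and the bar resolution\<close>

context k_algebra
begin

sublocale bt: balanced_tensor k Ae "env_right k A"
proof (rule balanced_tensor.intro)
  show "abelian_group (env_right k A)"
    by (rule abelian_group_cong[OF A.M.abelian_group_axioms]) simp_all
qed (use scal_closed in \<open>auto simp: k_ring env_ring env_right_closed scal_def\<close>)

text \<open>A scalar in the second argument is moved to the coefficient in \<open>A\<close> by
  balancing, where the relation for scalars applies.\<close>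

lemma tens_pure_bilinear:
  assumes N: "left_module Ae N"
  shows "bilinear_map k A (restrict_scalars N) (bt.tens N) (bt.tens_pure N)"
  unfolding bilinear_map_def
proof (intro conjI ballI lmod_homI)
  fix m y assume "y \<in> carrier (restrict_scalars N)" and m: "m \<in> carrier A"
  then have y: "y \<in> carrier N" by simp
  show "bt.tens_pure N m y \<in> carrier (bt.tens N)" using bt.tens_pure_closed[OF N] m y by simp
  { fix m' assume "m' \<in> carrier A"
    then show "bt.tens_pure N (m \<oplus> m') y = bt.tens_pure N m y \<oplus>\<^bsub>bt.tens N\<^esub> bt.tens_pure N m' y"
      using bt.tens_pure_add_left[OF N] m y by simp }
  { fix r assume r: "r \<in> carrier k"
    show "bt.tens_pure N (r \<odot> m) y = r \<odot>\<^bsub>bt.tens N\<^esub> bt.tens_pure N m y"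
      using bt.tens_pure_scalar[OF N r, of m y] scal_env_right[OF r m] m y by (simp add: scal_def) }
next
  fix m y assume "y \<in> carrier (restrict_scalars N)" and m: "m \<in> carrier A"
  then have y: "y \<in> carrier N" by simp
  show "bt.tens_pure N m y \<in> carrier (bt.tens N)" using bt.tens_pure_closed[OF N] m y by simp
  { fix y' assume "y' \<in> carrier (restrict_scalars N)"
    then show "bt.tens_pure N m (y \<oplus>\<^bsub>restrict_scalars N\<^esub> y') = bt.tens_pure N m y \<oplus>\<^bsub>bt.tens N\<^esub> bt.tens_pure N m y'"
      using bt.tens_pure_add_right[OF N] m y by simp }
  { fix r assume r: "r \<in> carrier k"
    show "bt.tens_pure N m (r \<odot>\<^bsub>restrict_scalars N\<^esub> y) = r \<odot>\<^bsub>bt.tens N\<^esub> bt.tens_pure N m y"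
      using bt.tens_pure_scalar[OF N r, of m y] bt.tens_pure_act[OF N _ scal_closed[OF r] y, of m] m y
      by (simp add: scal_def) }
qed

section \<open>The isomorphism between Hochschild chains and the tensored bar modules\<close>

definition wrap :: "'a list \<Rightarrow> 'a list" where
  "wrap ys = \<one> # ys @ [\<one>]"

lemma wrap_tuples: "ys \<in> tuples n \<Longrightarrow> wrap ys \<in> tuples (n + 2)"
  unfolding wrap_def by (intro ends_tuples A.A.one_closed)

lemma wrap_hom:
  assumes "ys \<in> tuples n" "j < n"
  shows "(\<lambda>c. pure (wrap (ys[j := c]))) \<in> lmod_hom k A (T (n + 2))"
  using multilinearD(2)[OF multilinear_pure wrap_tuples[OF assms(1)], of "Suc j"] assms
  by (simp add: wrap_def list_update_append tuples_length)

text \<open>The chain-level map inside \<open>HH_to_Tor\<close>, with the comparison map as a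
  parameter: \<open>\<theta> = \<phi> n\<close> gives the identification itself, and the identity
  gives the map to the tensored bar module.\<close>

definition to_tens :: "(('a list \<Rightarrow> 'k) set, 'n, 'z) module_scheme \<Rightarrow> (('a list \<Rightarrow> 'k) set \<Rightarrow> 'n)
    \<Rightarrow> ('a list \<Rightarrow> 'k) set \<Rightarrow> ('a \<times> 'n \<Rightarrow> 'k) set" where
  "to_tens N \<theta> = tensor_lift k (bt.tens N) (\<lambda>xs. bt.tens_pure N (hd xs) (\<theta> (pure (\<one> # tl xs @ [\<one>]))))"

lemma to_tens:
  assumes N: "left_module Ae N" and \<theta>: "\<theta> \<in> lmod_hom Ae (bar k A n) N"
  shows to_tens_hom: "to_tens N \<theta> \<in> lmod_hom k (T (Suc n)) (bt.tens N)"
    and to_tens_pure: "\<lbrakk>x \<in> carrier A; ys \<in> tuples n\<rbrakk> \<Longrightarrow>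
      to_tens N \<theta> (pure (x # ys)) = bt.tens_pure N x (\<theta> (pure (wrap ys)))"
proof -
  note W = bt.tens_left_module[OF N] and b = tens_pure_bilinear[OF N]
  note \<theta>k = bar_hom_linear[OF \<theta>]
  let ?f = "\<lambda>xs. bt.tens_pure N (hd xs) (\<theta> (pure (\<one> # tl xs @ [\<one>])))"
  have f: "?f (x # ys) = bt.tens_pure N x (\<theta> (pure (wrap ys)))" for x ys by (simp add: wrap_def)
  have \<theta>c: "\<theta> (pure (wrap ys)) \<in> carrier (restrict_scalars N)" if "ys \<in> tuples n" for ys
    by (rule lmod_hom_closed[OF \<theta>k pure_closed[OF wrap_tuples[OF that]]])
  have ml: "multilinear (Suc n) (bt.tens N) ?f"
    unfolding multilinear_def
  proof (intro conjI ballI allI impI)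
    fix xs assume "xs \<in> tuples (Suc n)"
    then obtain x ys where xs: "xs = x # ys" "x \<in> carrier A" "ys \<in> tuples n"
      by (cases xs) (auto simp: tuples_def)
    show "?f xs \<in> carrier (bt.tens N)"
      unfolding xs(1) f by (rule bilinear_map_closed[OF b xs(2) \<theta>c[OF xs(3)]])
    fix i assume i: "i < Suc n"
    show "(\<lambda>c. ?f (xs[i := c])) \<in> lmod_hom k A (bt.tens N)"
    proof (cases i)
      case 0
      then show ?thesis using bilinear_mapD(1)[OF b \<theta>c[OF xs(3)]] by (simp only: xs(1) list_update_code f)
    next
      case (Suc j)
      then have j: "j < n" using i by simp
      show ?thesis
        using lmod_hom_comp[OF lmod_hom_comp[OF wrap_hom[OF xs(3) j] \<theta>k] bilinear_mapD(2)[OF b xs(2)]]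
        by (simp only: xs(1) Suc list_update_code f)
    qed
  qed
  show "to_tens N \<theta> \<in> lmod_hom k (T (Suc n)) (bt.tens N)"
    unfolding to_tens_def by (rule tensor_lift_hom[OF W ml])
  show "to_tens N \<theta> (pure (x # ys)) = bt.tens_pure N x (\<theta> (pure (wrap ys)))"
    if "x \<in> carrier A" "ys \<in> tuples n"
    unfolding to_tens_def using tensor_lift_pure[OF W ml, of "x # ys"] that by (simp add: tuples_Cons wrap_def)
qed

definition hoch_to_bar :: "nat \<Rightarrow> ('a list \<Rightarrow> 'k) set \<Rightarrow> ('a \<times> ('a list \<Rightarrow> 'k) set \<Rightarrow> 'k) set" where
  "hoch_to_bar n = to_tens (bar k A n) (\<lambda>x. x)"

lemmas hoch_to_bar_hom = to_tens_hom[OF bar_left_module lmod_hom_id, folded hoch_to_bar_def]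
  and hoch_to_bar_pure = to_tens_pure[OF bar_left_module lmod_hom_id, folded hoch_to_bar_def]

text \<open>Reduces questions about an arbitrary resolution to the tensored bar complex, where
  explicit formulas are available.\<close>

lemma to_tens_factor:
  assumes N: "left_module Ae N" and \<theta>: "\<theta> \<in> lmod_hom Ae (bar k A n) N" and X: "X \<in> carrier (T (Suc n))"
  shows "to_tens N \<theta> X = bt.tens_map N \<theta> (hoch_to_bar n X)"
proof (rule tensor_hom_eq[OF bt.tens_left_module[OF N] to_tens_hom[OF N \<theta>]
      lmod_hom_comp[OF hoch_to_bar_hom bt.tens_map_hom[OF bar_left_module N \<theta>]] _ X])
  fix xs assume "xs \<in> tuples (Suc n)"
  then obtain x ys where xs: "xs = x # ys" "x \<in> carrier A" "ys \<in> tuples n" by (rule tuples_SucE)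
  have "pure (wrap ys) \<in> carrier (bar k A n)"
    using pure_closed[OF wrap_tuples[OF xs(3)]] by (simp only: bar_simps)
  then show "to_tens N \<theta> (pure xs) = bt.tens_map N \<theta> (hoch_to_bar n (pure xs))"
    using xs(2,3) by (simp add: xs(1) to_tens_pure[OF N \<theta>] hoch_to_bar_pure bt.tens_map_pure[OF bar_left_module N \<theta>])
qed

text \<open>The inverse of \<open>hoch_to_bar\<close> sends \<open>m \<otimes> (x \<otimes> ys \<otimes> z)\<close> to \<open>zmx \<otimes> ys\<close>.\<close>

definition cyclic_act :: "nat \<Rightarrow> 'a \<Rightarrow> ('a list \<Rightarrow> 'k) set \<Rightarrow> ('a list \<Rightarrow> 'k) set" where
  "cyclic_act n m = tensor_lift k (T (Suc n)) (\<lambda>xs. pure ((last xs \<otimes> m \<otimes> hd xs) # butlast (tl xs)))"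

text \<open>The outer factors are merged around \<open>m\<close>: the first slot enters through left
  multiplication by \<open>z \<otimes> m\<close>, the last through right multiplication by
  \<open>m\<close> and then by \<open>x\<close>, and the inner slots are unchanged.\<close>

lemma cyclic_act:
  shows cyclic_act_bilinear: "bilinear_map k A (T (n + 2)) (T (Suc n)) (cyclic_act n)"
    and cyclic_act_pure: "\<lbrakk>m \<in> carrier A; x \<in> carrier A; ys \<in> tuples n; z \<in> carrier A\<rbrakk> \<Longrightarrow>
      cyclic_act n m (pure (x # ys @ [z])) = pure ((z \<otimes> m \<otimes> x) # ys)"
proof -
  let ?F = "\<lambda>m xs. (last xs \<otimes> m \<otimes> hd xs) # butlast (tl xs)"
  have ml: "multilinear (n + 2) (T (Suc n)) (\<lambda>xs. pure (?F m xs))" if m: "m \<in> carrier A" for m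
  proof (rule multilinear_subst[OF multilinear_pure])
    show t: "?F m xs \<in> tuples (Suc n)" if "xs \<in> tuples (n + 2)" for xs
      using that m by (elim tuples_ends) (simp add: tuples_Cons)
    fix xs i assume ts: "xs \<in> tuples (n + 2)" and i: "i < n + 2"
    obtain x ys z where xs: "xs = x # ys @ [z]" "x \<in> carrier A" "ys \<in> tuples n" "z \<in> carrier A"
      using ts by (rule tuples_ends)
    have l: "length ys = n" using xs(3) by (rule tuples_length)
    have zm: "(\<lambda>c. z \<otimes> m \<otimes> c) \<in> lmod_hom k A A" by (rule mult_left_hom) (use m xs in auto)
    have mx: "(\<lambda>c. c \<otimes> m \<otimes> x) \<in> lmod_hom k A A"
      by (rule lmod_hom_comp[OF mult_right_hom[OF m] mult_right_hom[OF xs(2)]])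
    consider "i = 0" | j where "i = Suc j" "j < n" | "i = Suc n"
      using i by (cases i) (auto simp: less_Suc_eq)
    then show "\<exists>ws\<in>tuples (Suc n). \<exists>j<Suc n. \<exists>l\<in>lmod_hom k A A. \<forall>c\<in>carrier A. ?F m (xs[i := c]) = ws[j := l c]"
    proof cases
      case 1
      then show ?thesis
        by (intro bexI[OF _ t[OF ts]] exI[of _ 0] conjI bexI[OF _ zm]) (simp_all add: xs(1))
    next
      case (2 j)
      then show ?thesis
        by (intro bexI[OF _ t[OF ts]] exI[of _ "Suc j"] conjI bexI[OF _ lmod_hom_id])
          (simp_all add: xs(1) l list_update_append)
    next
      case 3
      then show ?thesis
        by (intro bexI[OF _ t[OF ts]] exI[of _ 0] conjI bexI[OF _ mx]) (simp_all add: xs(1) l list_update_append)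
    qed
  qed
  note W = tensor_pow_left_module
  have h: "cyclic_act n m \<in> lmod_hom k (T (n + 2)) (T (Suc n))" if "m \<in> carrier A" for m
    unfolding cyclic_act_def by (rule tensor_lift_hom[OF W ml[OF that]])
  show p: "cyclic_act n m (pure (x # ys @ [z])) = pure ((z \<otimes> m \<otimes> x) # ys)"
    if "m \<in> carrier A" "x \<in> carrier A" "ys \<in> tuples n" "z \<in> carrier A" for m x ys z
    unfolding cyclic_act_def using tensor_lift_pure[OF W ml[OF that(1)] ends_tuples[OF that(2-4)]] by simp
  have e: "(\<lambda>c. pure (c # ys)) \<in> lmod_hom k A (T (Suc n))" if "ys \<in> tuples n" for ys
    using multilinearD(2)[OF multilinear_pure, of "\<one> # ys" "Suc n" 0] that by (simp add: tuples_Cons)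
  show "bilinear_map k A (T (n + 2)) (T (Suc n)) (cyclic_act n)"
    unfolding bilinear_map_def
  proof (intro conjI ballI h lmod_homI)
    fix Y m assume Y: "Y \<in> carrier (T (n + 2))" and m: "m \<in> carrier A"
    show "cyclic_act n m Y \<in> carrier (T (Suc n))" by (rule lmod_hom_closed[OF h[OF m] Y])
    { fix m' assume m': "m' \<in> carrier A"
      show "cyclic_act n (m \<oplus> m') Y = cyclic_act n m Y \<oplus>\<^bsub>T (Suc n)\<^esub> cyclic_act n m' Y"
      proof (rule tensor_hom_eq[OF W h[OF A.M.a_closed[OF m m']] lmod_hom_plus[OF W h[OF m] h[OF m']] _ Y])
        fix xs assume "xs \<in> tuples (n + 2)"
        then obtain x ys z where xs: "xs = x # ys @ [z]" "x \<in> carrier A" "ys \<in> tuples n" "z \<in> carrier A"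
          by (rule tuples_ends)
        show "cyclic_act n (m \<oplus> m') (pure xs) = cyclic_act n m (pure xs) \<oplus>\<^bsub>T (Suc n)\<^esub> cyclic_act n m' (pure xs)"
          using lmod_hom_add[OF e[OF xs(3)], of "z \<otimes> m \<otimes> x" "z \<otimes> m' \<otimes> x"] m m' xs
          by (simp add: p A.A.r_distr A.A.l_distr A.M.a_closed)
      qed }
    { fix r assume r: "r \<in> carrier k"
      show "cyclic_act n (r \<odot> m) Y = r \<odot>\<^bsub>T (Suc n)\<^esub> cyclic_act n m Y"
      proof (rule tensor_hom_eq[OF W h[OF Am.act_closed[OF r m]] lmod_hom_scale[OF k_cring W h[OF m] r] _ Y])
        fix xs assume "xs \<in> tuples (n + 2)"
        then obtain x ys z where xs: "xs = x # ys @ [z]" "x \<in> carrier A" "ys \<in> tuples n" "z \<in> carrier A"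
          by (rule tuples_ends)
        show "cyclic_act n (r \<odot> m) (pure xs) = r \<odot>\<^bsub>T (Suc n)\<^esub> cyclic_act n m (pure xs)"
          using lmod_hom_smult[OF e[OF xs(3)] r, of "z \<otimes> m \<otimes> x"] m r xs
          by (simp add: p A.smult_mult_right A.smult_mult_left)
      qed }
  qed
qed

text \<open>On pure tensors, letting \<open>p \<otimes> q\<close> act on \<open>m\<close> or on the
  bar factor gives \<open>z (q m p) x\<close> or \<open>(z q) m (p x)\<close>, equal by
  associativity.\<close>

lemma cyclic_act_balanced: "balanced_map k Ae (env_right k A) (bar k A n) (T (Suc n)) (cyclic_act n)"
proof (rule balanced_mapI; (unfold bar_simps env_right_simps)?)
  note b = cyclic_act_bilinear[of n]
  fix m Y assume m: "m \<in> carrier A" and Y: "Y \<in> carrier (T (n + 2))"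
  show "cyclic_act n m Y \<in> carrier (T (Suc n))" by (rule bilinear_map_closed[OF b m Y])
  { fix m' assume m': "m' \<in> carrier A"
    show "cyclic_act n (m \<oplus> m') Y = cyclic_act n m Y \<oplus>\<^bsub>T (Suc n)\<^esub> cyclic_act n m' Y"
      by (rule lmod_hom_add[OF bilinear_mapD(1)[OF b Y] m m']) }
  { fix Y' assume Y': "Y' \<in> carrier (T (n + 2))"
    show "cyclic_act n m (Y \<oplus>\<^bsub>T (n + 2)\<^esub> Y') = cyclic_act n m Y \<oplus>\<^bsub>T (Suc n)\<^esub> cyclic_act n m Y'"
      by (rule lmod_hom_add[OF bilinear_mapD(2)[OF b m] Y Y']) }
  { fix r assume r: "r \<in> carrier k"
    show "cyclic_act n ((r \<odot>\<^bsub>Ae\<^esub> \<one>\<^bsub>Ae\<^esub>) \<odot>\<^bsub>env_right k A\<^esub> m) Y = r \<odot>\<^bsub>T (Suc n)\<^esub> cyclic_act n m Y"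
      using lmod_hom_smult[OF bilinear_mapD(1)[OF b Y] r m] scal_env_right[OF r m] by (simp add: scal_def) }
  fix E assume "E \<in> carrier Ae"
  then have E: "E \<in> carrier (T 2)" by (simp only: env_simps)
  have "cyclic_act n (E \<odot>\<^bsub>env_right k A\<^esub> m) Y = cyclic_act n m (E \<odot>\<^bsub>bar k A n\<^esub> Y)"
  proof (rule bilinear_eq[OF tensor_pow_left_module
        bilinear_map_arg1[OF b bilinear_mapD(1)[OF env_right_bilinear m]]
        bilinear_map_compose[OF bar_bilinear bilinear_mapD(2)[OF b m]] _ E Y])
    fix u v assume "u \<in> tuples 2" "v \<in> tuples (n + 2)"
    then obtain p q x ys z where "u = [p, q]" "p \<in> carrier A" "q \<in> carrier A"
      and "v = x # ys @ [z]" "x \<in> carrier A" "ys \<in> tuples n" "z \<in> carrier A"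
      by (elim tuples_ends) (auto simp: tuples2)
    then show "cyclic_act n (pure u \<odot>\<^bsub>env_right k A\<^esub> m) (pure v) = cyclic_act n m (pure u \<odot>\<^bsub>bar k A n\<^esub> pure v)"
      using m by (simp add: env_right_pure bar_pure_ends cyclic_act_pure A.A.m_assoc)
  qed
  then show "cyclic_act n (E \<odot>\<^bsub>env_right k A\<^esub> m) Y
      = cyclic_act n m (tensor_lift k (T (n + 2)) (\<lambda>u. tensor_lift k (T (n + 2))
         (\<lambda>xs. pure (sandwich n (u ! 0) (u ! 1) xs)) Y) E)"
    by (simp only: bar_simps)
qed

definition bar_to_hoch :: "nat \<Rightarrow> ('a \<times> ('a list \<Rightarrow> 'k) set \<Rightarrow> 'k) set \<Rightarrow> ('a list \<Rightarrow> 'k) set" where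
  "bar_to_hoch n = tensor_lift k (T (Suc n)) (\<lambda>(m, Y). cyclic_act n m Y)"

lemma bar_to_hoch_hom: "bar_to_hoch n \<in> lmod_hom k (bt.tens (bar k A n)) (T (Suc n))"
  unfolding bar_to_hoch_def
  by (rule bt.tens_lift_hom[OF bar_left_module tensor_pow_left_module cyclic_act_balanced])

lemma bar_to_hoch_pure:
  "\<lbrakk>m \<in> carrier A; Y \<in> carrier (T (n + 2))\<rbrakk> \<Longrightarrow> bar_to_hoch n (bt.tens_pure (bar k A n) m Y) = cyclic_act n m Y"
  unfolding bar_to_hoch_def
  using bt.tens_lift_pure[OF bar_left_module tensor_pow_left_module cyclic_act_balanced, unfolded bar_simps env_right_simps] .

lemma bar_to_hoch_to_bar:
  assumes X: "X \<in> carrier (T (Suc n))"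
  shows "bar_to_hoch n (hoch_to_bar n X) = X"
proof (rule tensor_hom_eq[OF tensor_pow_left_module lmod_hom_comp[OF hoch_to_bar_hom bar_to_hoch_hom] lmod_hom_id _ X])
  fix xs assume "xs \<in> tuples (Suc n)"
  then obtain x ys where xs: "xs = x # ys" "x \<in> carrier A" "ys \<in> tuples n" by (rule tuples_SucE)
  have "bar_to_hoch n (hoch_to_bar n (pure xs)) = cyclic_act n x (pure (wrap ys))"
    unfolding xs(1) hoch_to_bar_pure[OF xs(2,3)]
    by (rule bar_to_hoch_pure[OF xs(2) pure_closed[OF wrap_tuples[OF xs(3)]]])
  then show "bar_to_hoch n (hoch_to_bar n (pure xs)) = pure xs"
    using xs by (simp add: wrap_def cyclic_act_pure)
qed

text \<open>Write the bar factor as \<open>x \<otimes> z\<close> acting on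
  \<open>\<one> \<otimes> ys \<otimes> \<one>\<close> and move this scalar to the coefficient, which
  becomes \<open>z m x\<close>. This shows that the values of \<open>hoch_to_bar\<close> exhaust the
  tensors with pure bar factor.\<close>

lemma bar_tens_pure_ends:
  assumes "m \<in> carrier A" "x \<in> carrier A" "ys \<in> tuples n" "z \<in> carrier A"
  shows "bt.tens_pure (bar k A n) m (pure (x # ys @ [z])) = hoch_to_bar n (pure ((z \<otimes> m \<otimes> x) # ys))"
proof -
  have c: "pure [x, z] \<in> carrier Ae" "pure (wrap ys) \<in> carrier (bar k A n)"
    using pure_closed[OF wrap_tuples[OF assms(3)]] pure_closed[OF pair_tuples[OF assms(2,4)]]
    by (simp_all only: env_simps bar_simps)
  have "pure (x # ys @ [z]) = pure [x, z] \<odot>\<^bsub>bar k A n\<^esub> pure (wrap ys)"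
    using assms by (simp add: wrap_def bar_pure_ends)
  then have "bt.tens_pure (bar k A n) m (pure (x # ys @ [z]))
      = bt.tens_pure (bar k A n) (pure [x, z] \<odot>\<^bsub>env_right k A\<^esub> m) (pure (wrap ys))"
    using bt.tens_pure_act[OF bar_left_module _ c, of m] assms(1) by simp
  then show ?thesis
    using assms by (simp add: env_right_pure hoch_to_bar_pure)
qed

lemma hoch_to_bar_to_hoch:
  assumes X: "X \<in> carrier (bt.tens (bar k A n))"
  shows "hoch_to_bar n (bar_to_hoch n X) = X"
proof (rule bt.tens_hom_eq[OF bar_left_module bt.tens_left_module[OF bar_left_module]
      lmod_hom_comp[OF bar_to_hoch_hom hoch_to_bar_hom] lmod_hom_id _ X])
  fix m Y assume "m \<in> carrier (env_right k A)" "Y \<in> carrier (bar k A n)"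
  then have m: "m \<in> carrier A" and Y: "Y \<in> carrier (T (n + 2))" by (simp_all only: bar_simps env_right_simps)
  have "hoch_to_bar n (cyclic_act n m Y) = bt.tens_pure (bar k A n) m Y"
  proof (rule tensor_hom_eq[OF bt.tens_left_module[OF bar_left_module]
        lmod_hom_comp[OF bilinear_mapD(2)[OF cyclic_act_bilinear m] hoch_to_bar_hom]
        bilinear_mapD(2)[OF tens_pure_bilinear[OF bar_left_module] m, unfolded bar_hom_restrict] _ Y])
    fix xs assume "xs \<in> tuples (n + 2)"
    then obtain x ys z where xs: "xs = x # ys @ [z]" "x \<in> carrier A" "ys \<in> tuples n" "z \<in> carrier A"
      by (rule tuples_ends)
    show "hoch_to_bar n (cyclic_act n m (pure xs)) = bt.tens_pure (bar k A n) m (pure xs)"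
      using m xs by (simp add: cyclic_act_pure bar_tens_pure_ends)
  qed
  then show "hoch_to_bar n (bar_to_hoch n (bt.tens_pure (bar k A n) m Y)) = bt.tens_pure (bar k A n) m Y"
    using bar_to_hoch_pure[OF m Y] by simp
qed

section \<open>Matching the Hochschild and bar differentials\<close>

lemma hochschild_eq: "hochschild k A n = T (Suc n)"
  by (simp add: hochschild_def)

lemma hochschild_diff_multilinear:
  "multilinear (n + 2) (T (Suc n)) (\<lambda>xs. (\<Oplus>\<^bsub>T (Suc n)\<^esub>i\<in>{..n}.
       sgn_pow k i \<odot>\<^bsub>T (Suc n)\<^esub> pure_pow k A (merge_at A i xs)) \<oplus>\<^bsub>T (Suc n)\<^esub>
     sgn_pow k (Suc n) \<odot>\<^bsub>T (Suc n)\<^esub> pure_pow k A ((last xs \<otimes> hd xs) # butlast (tl xs)))"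
proof (intro multilinear_plus multilinear_sum multilinear_scale tensor_pow_left_module sgn_pow_closed)
  show "multilinear (n + 2) (T (Suc n)) (\<lambda>xs. pure (merge_at A i xs))" if "i \<in> {..n}" for i
    using multilinear_merge_at[of i "Suc n"] that by simp
  \<comment> \<open>The wrap-around term is \<open>cyclic_act\<close> with
    \<open>m = \<one>\<close>, already known to be linear on the tensor power.\<close>
  show "multilinear (n + 2) (T (Suc n)) (\<lambda>xs. pure ((last xs \<otimes> hd xs) # butlast (tl xs)))"
    by (rule multilinear_cong[OF multilinear_hom[OF multilinear_pure bilinear_mapD(2)[OF cyclic_act_bilinear A.A.one_closed]]])
      (erule tuples_ends, simp add: cyclic_act_pure)
qed

lemma hochschild_diff_hom: "hochschild_diff k A n \<in> lmod_hom k (T (n + 2)) (T (Suc n))"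
  unfolding hochschild_diff_def hochschild_eq
  by (rule tensor_lift_hom[OF tensor_pow_left_module hochschild_diff_multilinear])

lemma hochschild_diff_pure:
  assumes "x \<in> carrier A" "ys \<in> tuples n" "z \<in> carrier A"
  shows "hochschild_diff k A n (pure (x # ys @ [z])) = (\<Oplus>\<^bsub>T (Suc n)\<^esub>i\<in>{..n}.
       sgn_pow k i \<odot>\<^bsub>T (Suc n)\<^esub> pure (merge_at A i (x # ys @ [z]))) \<oplus>\<^bsub>T (Suc n)\<^esub>
     sgn_pow k (Suc n) \<odot>\<^bsub>T (Suc n)\<^esub> pure ((z \<otimes> x) # ys)"
  unfolding hochschild_diff_def hochschild_eq
  using tensor_lift_pure[OF tensor_pow_left_module hochschild_diff_multilinear ends_tuples[OF assms]] by simp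

lemma merge_at_snoc: "Suc i < length ws \<Longrightarrow> merge_at A i (ws @ [z]) = merge_at A i ws @ [z]"
  by (simp add: merge_at_def nth_append)

text \<open>The faces of \<open>\<one> \<otimes> ws \<otimes> \<one>\<close> match the Hochschild
  faces one by one with the same signs: the inner ones directly, the two outer ones after balancing
  has moved an end factor to the coefficient.\<close>

lemma hoch_to_bar_diff:
  assumes X: "X \<in> carrier (T (n + 2))"
  shows "hoch_to_bar n (hochschild_diff k A n X)
    = bt.tens_map (bar k A n) (bar_diff k A n) (hoch_to_bar (Suc n) X)"
proof (rule tensor_hom_eq[OF bt.tens_left_module[OF bar_left_module]
      lmod_hom_comp[OF hochschild_diff_hom hoch_to_bar_hom] _ _ X])
  let ?N = "bar k A n" and ?W = "bt.tens (bar k A n)"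
  interpret W: left_module k ?W by (rule bt.tens_left_module[OF bar_left_module])
  interpret t: left_module k "T (n + 2)" by (rule tensor_pow_left_module)
  interpret t': left_module k "T (Suc n)" by (rule tensor_pow_left_module)
  note dh = bt.tens_map_hom[OF bar_left_module bar_left_module bar_diff_hom, of n]
  show "(\<lambda>X. bt.tens_map ?N (bar_diff k A n) (hoch_to_bar (Suc n) X)) \<in> lmod_hom k (T (n + 2)) ?W"
    using lmod_hom_comp[OF hoch_to_bar_hom[of "Suc n"] dh] by simp
  fix xs assume "xs \<in> tuples (n + 2)"
  then obtain x ys z where xs: "xs = x # ys @ [z]" "x \<in> carrier A" "ys \<in> tuples n" "z \<in> carrier A"
    by (rule tuples_ends)
  define ws where "ws = ys @ [z]"
  have ws: "ws \<in> tuples (Suc n)" unfolding ws_def tuples_snoc using xs by simp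
  have lw: "length ws = Suc n" using ws by (rule tuples_length)
  have xw: "xs = x # ws" by (simp add: xs(1) ws_def)
  have xt: "x # ws \<in> tuples (Suc (Suc n))" using ws xs by (simp add: tuples_Cons)
  have wt: "wrap ws \<in> tuples (Suc n + 2)" by (rule wrap_tuples[OF ws])
  have ml: "merge_at A i (x # ws) \<in> tuples (Suc n)" if "i \<le> n" for i
    using merge_at_tuples[OF xt, of i] that by simp
  have mr: "merge_at A i (wrap ws) \<in> tuples (n + 2)" if "i \<le> Suc n" for i
    using merge_at_tuples[of "wrap ws" "n + 2" i] wt that by simp
  note px = bilinear_mapD(2)[OF tens_pure_bilinear[OF bar_left_module] xs(2), unfolded bar_hom_restrict, of n]
  let ?R = "\<lambda>i. bt.tens_pure ?N x (pure (merge_at A i (wrap ws)))"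
  have Rc: "?R i \<in> carrier ?W" if "i \<le> Suc n" for i
    by (rule lmod_hom_closed[OF px pure_closed[OF mr[OF that]]])
  have face: "hoch_to_bar n (pure (merge_at A i (x # ws))) = ?R i" if i: "i \<le> n" for i
  proof (cases i)
    \<comment> \<open>Merging the leading unit leaves \<open>w\<close> in front; balancing moves it
      to the right of the coefficient, giving \<open>x \<otimes> w\<close>.\<close>
    case 0
    obtain w vs where w: "ws = w # vs" "w \<in> carrier A" "vs \<in> tuples n" using ws by (rule tuples_SucE)
    have "hoch_to_bar n (pure (merge_at A i (x # ws))) = hoch_to_bar n (pure ((\<one> \<otimes> x \<otimes> w) # vs))"
      using xs(2) by (simp add: 0 w(1) merge_at_0)
    also have "\<dots> = bt.tens_pure ?N x (pure (w # vs @ [\<one>]))"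
      by (rule bar_tens_pure_ends[OF xs(2) w(2,3) A.A.one_closed, symmetric])
    finally show ?thesis using w(2) by (simp add: 0 w(1) wrap_def merge_at_0)
  next
    case (Suc j)
    then have j: "Suc j < length ws" using i lw by simp
    have mj: "merge_at A j ws \<in> tuples n" using merge_at_tuples[OF ws, of j] Suc i by simp
    show ?thesis
      using hoch_to_bar_pure[OF xs(2) mj] merge_at_snoc[OF j]
      by (simp add: Suc wrap_def merge_at_Cons)
  qed
  \<comment> \<open>Merging the final unit leaves \<open>z\<close> at the end; balancing carries it
    to the left of the coefficient, which produces the cyclic term.\<close>
  have last: "hoch_to_bar n (pure ((z \<otimes> x) # ys)) = ?R (Suc n)"
  proof -
    have "merge_at A (Suc n) (wrap ws) = \<one> # ys @ [z]"
      using xs tuples_length[OF xs(3)] by (simp add: wrap_def ws_def merge_at_def nth_append)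
    then show ?thesis
      using bar_tens_pure_ends[OF xs(2) A.A.one_closed xs(3,4)] xs by simp
  qed
  have "hoch_to_bar n (hochschild_diff k A n (pure xs)) = hoch_to_bar n ((\<Oplus>\<^bsub>T (Suc n)\<^esub>i\<in>{..n}.
       sgn_pow k i \<odot>\<^bsub>T (Suc n)\<^esub> pure (merge_at A i (x # ws))) \<oplus>\<^bsub>T (Suc n)\<^esub>
     sgn_pow k (Suc n) \<odot>\<^bsub>T (Suc n)\<^esub> pure ((z \<otimes> x) # ys))"
    using hochschild_diff_pure[OF xs(2-4)] by (simp add: xs(1) ws_def)
  also have "\<dots> = hoch_to_bar n (\<Oplus>\<^bsub>T (Suc n)\<^esub>i\<in>{..n}. sgn_pow k i \<odot>\<^bsub>T (Suc n)\<^esub> pure (merge_at A i (x # ws)))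
      \<oplus>\<^bsub>?W\<^esub> hoch_to_bar n (sgn_pow k (Suc n) \<odot>\<^bsub>T (Suc n)\<^esub> pure ((z \<otimes> x) # ys))"
    using ml xs by (intro lmod_hom_add[OF hoch_to_bar_hom] t'.N.finsum_closed t'.act_closed sgn_pow_closed)
      (auto intro!: t'.act_closed sgn_pow_closed pure_closed simp: tuples_Cons)
  also have "hoch_to_bar n (sgn_pow k (Suc n) \<odot>\<^bsub>T (Suc n)\<^esub> pure ((z \<otimes> x) # ys)) = sgn_pow k (Suc n) \<odot>\<^bsub>?W\<^esub> ?R (Suc n)"
    using lmod_hom_smult[OF hoch_to_bar_hom sgn_pow_closed pure_closed, of "(z \<otimes> x) # ys" n "Suc n"] xs
    by (simp add: last tuples_Cons)
  also have "hoch_to_bar n (\<Oplus>\<^bsub>T (Suc n)\<^esub>i\<in>{..n}. sgn_pow k i \<odot>\<^bsub>T (Suc n)\<^esub> pure (merge_at A i (x # ws)))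
      = (\<Oplus>\<^bsub>?W\<^esub>i\<in>{..n}. hoch_to_bar n (sgn_pow k i \<odot>\<^bsub>T (Suc n)\<^esub> pure (merge_at A i (x # ws))))"
    by (rule lmod_hom_finsum[OF hoch_to_bar_hom tensor_pow_group W.N.abelian_group_axioms])
      (use ml in \<open>auto intro!: t'.act_closed sgn_pow_closed pure_closed\<close>)
  also have "\<dots> = (\<Oplus>\<^bsub>?W\<^esub>i\<in>{..n}. sgn_pow k i \<odot>\<^bsub>?W\<^esub> ?R i)"
    by (rule W.N.finsum_cong'[OF refl])
      (use ml Rc in \<open>auto intro!: W.act_closed sgn_pow_closed simp: lmod_hom_smult[OF hoch_to_bar_hom sgn_pow_closed pure_closed[OF ml]] face\<close>)
  also have "\<dots> \<oplus>\<^bsub>?W\<^esub> sgn_pow k (Suc n) \<odot>\<^bsub>?W\<^esub> ?R (Suc n) = (\<Oplus>\<^bsub>?W\<^esub>i\<in>{..Suc n}. sgn_pow k i \<odot>\<^bsub>?W\<^esub> ?R i)"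
  proof -
    have "(\<Oplus>\<^bsub>?W\<^esub>i\<in>{..Suc n}. sgn_pow k i \<odot>\<^bsub>?W\<^esub> ?R i) = sgn_pow k (Suc n) \<odot>\<^bsub>?W\<^esub> ?R (Suc n) \<oplus>\<^bsub>?W\<^esub> (\<Oplus>\<^bsub>?W\<^esub>i\<in>{..n}. sgn_pow k i \<odot>\<^bsub>?W\<^esub> ?R i)"
      by (rule W.N.finsum_Suc) (use Rc in \<open>blast intro!: W.act_closed sgn_pow_closed\<close>)
    also have "\<dots> = (\<Oplus>\<^bsub>?W\<^esub>i\<in>{..n}. sgn_pow k i \<odot>\<^bsub>?W\<^esub> ?R i) \<oplus>\<^bsub>?W\<^esub> sgn_pow k (Suc n) \<odot>\<^bsub>?W\<^esub> ?R (Suc n)"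
      by (rule W.N.a_comm) (use Rc in \<open>auto intro!: W.act_closed sgn_pow_closed W.N.finsum_closed\<close>)
    finally show ?thesis by simp
  qed
  also have "\<dots> = (\<Oplus>\<^bsub>?W\<^esub>i\<in>{..Suc n}. bt.tens_pure ?N x (sgn_pow k i \<odot>\<^bsub>T (n + 2)\<^esub> pure (merge_at A i (wrap ws))))"
  proof (rule W.N.finsum_cong'[OF refl])
    show "(\<lambda>i. bt.tens_pure ?N x (sgn_pow k i \<odot>\<^bsub>T (n + 2)\<^esub> pure (merge_at A i (wrap ws)))) \<in> {..Suc n} \<rightarrow> carrier ?W"
      by (intro funcsetI lmod_hom_closed[OF px] t.act_closed sgn_pow_closed pure_closed mr) simp
    fix i assume "i \<in> {..Suc n}"
    then have "i \<le> Suc n" by simp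
    then show "sgn_pow k i \<odot>\<^bsub>?W\<^esub> ?R i = bt.tens_pure ?N x (sgn_pow k i \<odot>\<^bsub>T (n + 2)\<^esub> pure (merge_at A i (wrap ws)))"
      by (rule lmod_hom_smult[OF px sgn_pow_closed pure_closed[OF mr], symmetric])
  qed
  also have "\<dots> = bt.tens_pure ?N x (\<Oplus>\<^bsub>T (n + 2)\<^esub>i\<in>{..Suc n}. sgn_pow k i \<odot>\<^bsub>T (n + 2)\<^esub> pure (merge_at A i (wrap ws)))"
    by (rule lmod_hom_finsum[OF px tensor_pow_group W.N.abelian_group_axioms, symmetric])
      (use mr in \<open>blast intro!: t.act_closed sgn_pow_closed pure_closed\<close>)
  also have "\<dots> = bt.tens_pure ?N x (bar_diff k A n (pure (wrap ws)))"
    by (simp only: bar_diff_pure[OF wt])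
  also have "\<dots> = bt.tens_map ?N (bar_diff k A n) (bt.tens_pure (bar k A (Suc n)) x (pure (wrap ws)))"
    using pure_closed[OF wt] xs(2)
    by (intro bt.tens_map_pure[OF bar_left_module bar_left_module bar_diff_hom, symmetric]) (simp_all only: bar_simps env_right_simps)
  also have "\<dots> = bt.tens_map ?N (bar_diff k A n) (hoch_to_bar (Suc n) (pure xs))"
    using hoch_to_bar_pure[OF xs(2) ws] by (simp add: xw)
  finally show "hoch_to_bar n (hochschild_diff k A n (pure xs)) = bt.tens_map ?N (bar_diff k A n) (hoch_to_bar (Suc n) (pure xs))" .
qed


lemma bar_complex: "chain_complex Ae (bar k A) (bar_diff k A)"
  unfolding chain_complex_def
  using bar_left_module bar_diff_hom bar_diff_diff by (simp only: bar_simps) blast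

lemmas bar_tens_complex = bt.tens_complex[OF bar_complex]

text \<open>The square of the Hochschild differential is not expanded: \<open>hoch_to_bar\<close>
  intertwines it with the tensored bar differential and has a left inverse.\<close>

lemma hoch_complex: "chain_complex k (hochschild k A) (hochschild_diff k A)"
  unfolding chain_complex_def hochschild_eq
proof (intro conjI allI ballI)
  fix n
  show "left_module k (T (Suc n))" by (rule tensor_pow_left_module)
  have h: "hochschild_diff k A n \<in> lmod_hom k (T (Suc (Suc n))) (T (Suc n))" for n
    using hochschild_diff_hom[of n] by simp
  then show "hochschild_diff k A n \<in> lmod_hom k (T (Suc (Suc n))) (T (Suc n))" .
  have d: "hoch_to_bar n (hochschild_diff k A n X) = bt.tens_map (bar k A n) (bar_diff k A n) (hoch_to_bar (Suc n) X)"
    if "X \<in> carrier (T (Suc (Suc n)))" for X n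
    using hoch_to_bar_diff[of X n] that by simp
  fix X assume X: "X \<in> carrier (T (Suc (Suc (Suc n))))"
  let ?Y = "hochschild_diff k A n (hochschild_diff k A (Suc n) X)"
  have c: "hochschild_diff k A (Suc n) X \<in> carrier (T (Suc (Suc n)))" "?Y \<in> carrier (T (Suc n))"
    using lmod_hom_closed[OF h] X by auto
  have "hoch_to_bar n ?Y = bt.tens_map (bar k A n) (bar_diff k A n)
      (bt.tens_map (bar k A (Suc n)) (bar_diff k A (Suc n)) (hoch_to_bar (Suc (Suc n)) X))"
    using d c X by simp
  also have "\<dots> = \<zero>\<^bsub>bt.tens (bar k A n)\<^esub>"
    using chain_complexD(3)[OF bar_tens_complex lmod_hom_closed[OF hoch_to_bar_hom X]]
    by (simp add: bt.tensor_diff_tens_map)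
  finally have "bar_to_hoch n (hoch_to_bar n ?Y) = \<zero>\<^bsub>T (Suc n)\<^esub>"
    using lmod_hom_zero[OF bar_to_hoch_hom _ tensor_pow_group] bt.tens_left_module[OF bar_left_module]
    by (simp add: left_module_def)
  then show "?Y = \<zero>\<^bsub>T (Suc n)\<^esub>" using bar_to_hoch_to_bar[OF c(2)] by simp
qed

lemma hoch_to_bar_chain_map:
  "chain_map k (hochschild k A) (hochschild_diff k A) (\<lambda>n. bt.tens (bar k A n))
    (tensor_diff k Ae (env_right k A) (bar k A) (bar_diff k A)) hoch_to_bar"
  unfolding chain_map_def hochschild_eq bt.tensor_diff_tens_map
  using hoch_to_bar_hom hoch_to_bar_diff by simp

text \<open>The inverse of an invertible chain map commutes with the differentials
  automatically.\<close>

lemma bar_to_hoch_chain_map: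
  "chain_map k (\<lambda>n. bt.tens (bar k A n)) (tensor_diff k Ae (env_right k A) (bar k A) (bar_diff k A))
    (hochschild k A) (hochschild_diff k A) bar_to_hoch"
  unfolding chain_map_def hochschild_eq
proof (intro conjI allI ballI bar_to_hoch_hom)
  fix n X assume X: "X \<in> carrier (bt.tens (bar k A (Suc n)))"
  let ?Y = "bar_to_hoch (Suc n) X"
  have Y: "?Y \<in> carrier (hochschild k A (Suc n))"
    unfolding hochschild_eq by (rule lmod_hom_closed[OF bar_to_hoch_hom X])
  have "hochschild_diff k A n ?Y = bar_to_hoch n (hoch_to_bar n (hochschild_diff k A n ?Y))"
    using bar_to_hoch_to_bar lmod_hom_closed[OF chain_complexD(2)[OF hoch_complex] Y] by (simp add: hochschild_eq)
  also have "hoch_to_bar n (hochschild_diff k A n ?Y)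
      = tensor_diff k Ae (env_right k A) (bar k A) (bar_diff k A) n (hoch_to_bar (Suc n) ?Y)"
    by (rule chain_mapD(2)[OF hoch_to_bar_chain_map Y, symmetric])
  also have "hoch_to_bar (Suc n) ?Y = X" by (rule hoch_to_bar_to_hoch[OF X])
  finally show "hochschild_diff k A n ?Y
      = bar_to_hoch n (tensor_diff k Ae (env_right k A) (bar k A) (bar_diff k A) n X)" .
qed

end

section \<open>The Lie derivative\<close>

context k_derivation
begin

text \<open>The summands at the two outer units vanish: the left one through
  \<open>Lie_Cons_one\<close>, the right one as the term \<open>P n\<close>.\<close>

lemma Lie_wrap:
  assumes ys: "ys \<in> tuples n"
  shows "Lie (n + 2) (pure (wrap ys)) = (\<Oplus>\<^bsub>T (n + 2)\<^esub>j\<in>{..<n}. pure (wrap (ys[j := \<delta> (ys ! j)])))"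
proof -
  interpret t: left_module k "T (Suc n)" by (rule tensor_pow_left_module)
  interpret t2: left_module k "T (Suc (Suc n))" by (rule tensor_pow_left_module)
  have l: "length ys = n" using ys by (rule tuples_length)
  have y1: "ys @ [\<one>] \<in> tuples (Suc n)" using ys by (simp add: tuples_snoc)
  define P where "P j = pure ((ys @ [\<one>])[j := \<delta> ((ys @ [\<one>]) ! j)])" for j
  have Pc: "P j \<in> carrier (T (Suc n))" if "j < Suc n" for j
    unfolding P_def by (rule pure_closed[OF \<delta>_update_tuples[OF y1 that]])
  have "P n = \<zero>\<^bsub>T (Suc n)\<^esub>" using pure_zero[OF y1, of n] by (simp add: P_def l nth_append list_update_append \<delta>_one)
  moreover have "(\<Oplus>\<^bsub>T (Suc n)\<^esub>j\<in>{..<Suc n}. P j) = P n \<oplus>\<^bsub>T (Suc n)\<^esub> (\<Oplus>\<^bsub>T (Suc n)\<^esub>j\<in>{..<n}. P j)"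
    unfolding lessThan_Suc by (rule t.N.finsum_insert) (use Pc in auto)
  ultimately have 1: "Lie (Suc n) (pure (ys @ [\<one>])) = (\<Oplus>\<^bsub>T (Suc n)\<^esub>j\<in>{..<n}. P j)"
    using Pc t.N.finsum_closed[of P "{..<n}"] by (simp add: Lie_pure[OF y1] P_def[symmetric] Pi_iff)
  have "Lie (Suc (Suc n)) (pure (wrap ys)) = insert_one (Suc n) (\<Oplus>\<^bsub>T (Suc n)\<^esub>j\<in>{..<n}. P j)"
    unfolding wrap_def Lie_Cons_one[OF y1] 1 ..
  also have "\<dots> = (\<Oplus>\<^bsub>T (Suc (Suc n))\<^esub>j\<in>{..<n}. insert_one (Suc n) (P j))"
    by (rule lmod_hom_finsum[OF insert_one_hom tensor_pow_group tensor_pow_group]) (use Pc in auto)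
  also have "\<dots> = (\<Oplus>\<^bsub>T (Suc (Suc n))\<^esub>j\<in>{..<n}. pure (wrap (ys[j := \<delta> (ys ! j)])))"
  proof (rule t2.N.finsum_cong'[OF refl])
    show "(\<lambda>j. pure (wrap (ys[j := \<delta> (ys ! j)]))) \<in> {..<n} \<rightarrow> carrier (T (Suc (Suc n)))"
      using pure_closed[OF wrap_tuples[OF \<delta>_update_tuples[OF ys]]] by simp
    fix j assume "j \<in> {..<n}"
    then have j: "j < n" by simp
    have "(ys @ [\<one>])[j := \<delta> ((ys @ [\<one>]) ! j)] = ys[j := \<delta> (ys ! j)] @ [\<one>]"
      using j l by (simp add: nth_append list_update_append)
    moreover have "ys[j := \<delta> (ys ! j)] @ [\<one>] \<in> tuples (Suc n)"
      using \<delta>_update_tuples[OF ys j] by (simp add: tuples_snoc)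
    ultimately show "insert_one (Suc n) (P j) = pure (wrap (ys[j := \<delta> (ys ! j)]))"
      by (simp add: P_def insert_one_pure wrap_def)
  qed
  finally show ?thesis by simp
qed

text \<open>The summand of index zero differentiates the coefficient and is accounted for by
  \<open>\<delta> \<otimes> 1\<close>; the summands of positive index differentiate the bar factor
  and together form \<open>1 \<otimes> Lie\<close>.\<close>

lemma hoch_to_bar_Lie:
  assumes X: "X \<in> carrier (T (Suc n))"
  shows "hoch_to_bar n (Lie (Suc n) X) = bt.tens_operator (bar k A n) \<delta> (Lie (n + 2)) (hoch_to_bar n X)"
proof (rule tensor_hom_eq[OF bt.tens_left_module[OF bar_left_module] lmod_hom_comp[OF Lie_hom hoch_to_bar_hom] _ _ X])
  let ?N = "bar k A n" and ?W = "bt.tens (bar k A n)"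
  note op = bt.tens_operator_hom[OF bar_left_module \<delta>_right_operator Lie_left_operator env_derivation_closed]
    bt.tens_operator_pure[OF bar_left_module \<delta>_right_operator Lie_left_operator env_derivation_closed]
  show "(\<lambda>X. bt.tens_operator ?N \<delta> (Lie (n + 2)) (hoch_to_bar n X)) \<in> lmod_hom k (T (Suc n)) ?W"
    by (rule lmod_hom_comp[OF hoch_to_bar_hom op(1)])
  interpret W: left_module k ?W by (rule bt.tens_left_module[OF bar_left_module])
  fix xs assume t: "xs \<in> tuples (Suc n)"
  then obtain x ys where xs: "xs = x # ys" "x \<in> carrier A" "ys \<in> tuples n" by (rule tuples_SucE)
  define P where "P j = hoch_to_bar n (pure (xs[j := \<delta> (xs ! j)]))" for j
  have Pc: "P j \<in> carrier ?W" if "j < Suc n" for j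
    unfolding P_def by (rule lmod_hom_closed[OF hoch_to_bar_hom pure_closed[OF \<delta>_update_tuples[OF t that]]])
  note px = bilinear_mapD(2)[OF tens_pure_bilinear[OF bar_left_module] xs(2), unfolded bar_hom_restrict, of n]
  have wc: "pure (wrap (ys[j := \<delta> (ys ! j)])) \<in> carrier (T (n + 2))" if "j < n" for j
    by (rule pure_closed[OF wrap_tuples[OF \<delta>_update_tuples[OF xs(3) that]]])
  have "hoch_to_bar n (Lie (Suc n) (pure xs)) = (\<Oplus>\<^bsub>?W\<^esub>j\<in>{..<Suc n}. P j)"
    unfolding Lie_pure[OF t] P_def
    by (rule lmod_hom_finsum[OF hoch_to_bar_hom tensor_pow_group W.N.abelian_group_axioms])
      (use pure_closed[OF \<delta>_update_tuples[OF t]] in simp)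
  also have "\<dots> = P 0 \<oplus>\<^bsub>?W\<^esub> (\<Oplus>\<^bsub>?W\<^esub>j\<in>{..<n}. P (Suc j))"
    by (rule W.N.finsum_lessThan_Suc) (use Pc in auto)
  also have "(\<Oplus>\<^bsub>?W\<^esub>j\<in>{..<n}. P (Suc j)) = (\<Oplus>\<^bsub>?W\<^esub>j\<in>{..<n}. bt.tens_pure ?N x (pure (wrap (ys[j := \<delta> (ys ! j)]))))"
  proof (rule W.N.finsum_cong'[OF refl])
    show "(\<lambda>j. bt.tens_pure ?N x (pure (wrap (ys[j := \<delta> (ys ! j)])))) \<in> {..<n} \<rightarrow> carrier ?W"
      using lmod_hom_closed[OF px wc] by simp
    fix j assume "j \<in> {..<n}"
    then have "j < n" by simp
    then show "P (Suc j) = bt.tens_pure ?N x (pure (wrap (ys[j := \<delta> (ys ! j)])))"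
      using hoch_to_bar_pure[OF xs(2) \<delta>_update_tuples[OF xs(3)]] by (simp add: P_def xs(1))
  qed
  also have "\<dots> = bt.tens_pure ?N x (Lie (n + 2) (pure (wrap ys)))"
    unfolding Lie_wrap[OF xs(3)]
    by (rule lmod_hom_finsum[OF px tensor_pow_group W.N.abelian_group_axioms, symmetric]) (use wc in blast)
  also have "P 0 = bt.tens_pure ?N (\<delta> x) (pure (wrap ys))"
    using hoch_to_bar_pure[OF \<delta>_closed[OF xs(2)] xs(3)] by (simp add: P_def xs(1))
  also have "bt.tens_pure ?N (\<delta> x) (pure (wrap ys)) \<oplus>\<^bsub>?W\<^esub> bt.tens_pure ?N x (Lie (n + 2) (pure (wrap ys)))
      = bt.tens_operator ?N \<delta> (Lie (n + 2)) (bt.tens_pure ?N x (pure (wrap ys)))"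
    using op(2)[of x "pure (wrap ys)"] pure_closed[OF wrap_tuples[OF xs(3)]] xs(2)
    by (simp only: bar_simps env_right_simps)
  also have "\<dots> = bt.tens_operator ?N \<delta> (Lie (n + 2)) (hoch_to_bar n (pure xs))"
    by (simp only: xs(1) hoch_to_bar_pure[OF xs(2,3)])
  finally show "hoch_to_bar n (Lie (Suc n) (pure xs)) = bt.tens_operator ?N \<delta> (Lie (n + 2)) (hoch_to_bar n (pure xs))" .
qed

lemma bar_operator_chain_map:
  "chain_map k (\<lambda>n. bt.tens (bar k A n)) (tensor_diff k Ae (env_right k A) (bar k A) (bar_diff k A))
    (\<lambda>n. bt.tens (bar k A n)) (tensor_diff k Ae (env_right k A) (bar k A) (bar_diff k A))
    (\<lambda>n. bt.tens_operator (bar k A n) \<delta> (Lie (n + 2)))"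
  by (rule bt.tens_operator_chain_map[OF bar_complex \<delta>_right_operator Lie_left_operator bar_diff_Lie env_derivation_closed])
    (simp only: bar_simps)

text \<open>Under the isomorphism with the tensored bar complex the operator becomes
  \<open>\<delta> \<otimes> 1 + 1 \<otimes> Lie\<close>, already known to be a chain map;
  conjugating back requires no computation with Hochschild faces.\<close>

lemma Lie_chain_map: "chain_map k (hochschild k A) (hochschild_diff k A) (hochschild k A) (hochschild_diff k A) (\<lambda>n. Lie (Suc n))"
proof -
  note c = chain_map_comp[OF chain_map_comp[OF hoch_to_bar_chain_map bar_operator_chain_map] bar_to_hoch_chain_map]
  have e: "Lie (Suc n) X = bar_to_hoch n (bt.tens_operator (bar k A n) \<delta> (Lie (n + 2)) (hoch_to_bar n X))"
    if "X \<in> carrier (hochschild k A n)" for n X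
    using that bar_to_hoch_to_bar[OF Lie_closed] hoch_to_bar_Lie unfolding hochschild_eq by metis
  show ?thesis
    unfolding chain_map_def
  proof (intro conjI allI ballI)
    fix n
    show "Lie (Suc n) \<in> lmod_hom k (hochschild k A n) (hochschild k A n)" unfolding hochschild_eq by (rule Lie_hom)
    fix X assume X: "X \<in> carrier (hochschild k A (Suc n))"
    then have "hochschild_diff k A n X \<in> carrier (hochschild k A n)"
      by (rule lmod_hom_closed[OF chain_complexD(2)[OF hoch_complex]])
    then show "hochschild_diff k A n (Lie (Suc (Suc n)) X) = Lie (Suc n) (hochschild_diff k A n X)"
      using chain_mapD(2)[OF c X] by (simp only: e X)
  qed
qed

section \<open>Comparison with an arbitrary resolution and lifting\<close>

context
  fixes Q :: "nat \<Rightarrow> (('a list \<Rightarrow> 'k) set, 'q, 'z) module_scheme" and dQ :: "nat \<Rightarrow> 'q \<Rightarrow> 'q" and \<eta> :: "'q \<Rightarrow> 'a"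
    and gs :: "nat \<Rightarrow> 'q \<Rightarrow> 'q" and \<phi> :: "nat \<Rightarrow> ('a list \<Rightarrow> 'k) set \<Rightarrow> 'q"
  assumes projective: "projective_module k A"
    and Q: "projective_resolution Ae (env_left k A) Q dQ \<eta>"
    and gs: "operator_lifting k Ae (env_derivation k A \<delta>) Q dQ \<eta> \<delta> gs"
    and \<phi>: "comparison_map Ae (bar k A) (bar_diff k A) (bar_aug k A) Q dQ \<eta> \<phi>"
begin

abbreviation "dbar \<equiv> tensor_diff k Ae (env_right k A) (bar k A) (bar_diff k A)"
abbreviation "dtor \<equiv> tensor_diff k Ae (env_right k A) Q dQ"

lemma Q_complex: "chain_complex Ae Q dQ"
  by (rule projective_resolution_complex[OF Q])

lemmas tor_complex = bt.tens_complex[OF Q_complex]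

lemma \<phi>_chain_map: "chain_map Ae (bar k A) (bar_diff k A) Q dQ \<phi>"
  using \<phi> by (simp add: comparison_map_def chain_map_def)

lemmas \<phi>_tens_chain_map = bt.tens_chain_map[OF bar_complex Q_complex \<phi>_chain_map]

lemma to_tens_\<phi>:
  "X \<in> carrier (hochschild k A n) \<Longrightarrow> to_tens (Q n) (\<phi> n) X = bt.tens_map (Q n) (\<phi> n) (hoch_to_bar n X)"
  unfolding hochschild_eq by (rule to_tens_factor[OF chain_complexD(1)[OF Q_complex] chain_mapD(1)[OF \<phi>_chain_map]])

lemma to_tens_chain_map:
  "chain_map k (hochschild k A) (hochschild_diff k A) (\<lambda>n. bt.tens (Q n)) dtor (\<lambda>n. to_tens (Q n) (\<phi> n))"
proof -
  note c = chain_map_comp[OF hoch_to_bar_chain_map \<phi>_tens_chain_map]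
  show ?thesis
    unfolding chain_map_def
  proof (intro conjI allI ballI)
    fix n
    show "to_tens (Q n) (\<phi> n) \<in> lmod_hom k (hochschild k A n) (bt.tens (Q n))"
      unfolding hochschild_eq
      by (rule to_tens_hom[OF chain_complexD(1)[OF Q_complex] chain_mapD(1)[OF \<phi>_chain_map]])
    fix X assume X: "X \<in> carrier (hochschild k A (Suc n))"
    then have "hochschild_diff k A n X \<in> carrier (hochschild k A n)"
      by (rule lmod_hom_closed[OF chain_complexD(2)[OF hoch_complex]])
    then show "dtor n (to_tens (Q (Suc n)) (\<phi> (Suc n)) X) = to_tens (Q n) (\<phi> n) (hochschild_diff k A n X)"
      using chain_mapD(2)[OF c X] by (simp only: to_tens_\<phi> X)
  qed
qed

lemma HH_to_Tor_eq:
  "HH_to_Tor k A Q dQ \<phi> n = homology_map (\<lambda>n. bt.tens (Q n)) dtor (\<lambda>n. to_tens (Q n) (\<phi> n)) n"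
  by (simp add: HH_to_Tor_def to_tens_def)

text \<open>A comparison map \<open>\<psi>\<close> in the opposite direction exists because
  \<open>Q\<close> is projective and the bar complex exact; both composites are homotopic to
  identities, and stay so after tensoring. Followed by \<open>bar_to_hoch\<close>, the tensored
  \<open>\<psi>\<close> is a homotopy inverse.\<close>

lemma HH_to_Tor_iso:
  "HH_to_Tor k A Q dQ \<phi> n \<in> lmod_iso k (HH k A n) (Tor k Ae (env_right k A) Q dQ n)"
proof -
  note bar = bar_resolution[OF projective]
  obtain \<psi> where \<psi>: "comparison_map Ae Q dQ \<eta> (bar k A) (bar_diff k A) (bar_aug k A) \<psi>"
    using comparison_map_exists[OF Q bar env_left_left_module] by blast
  have \<psi>_map: "chain_map Ae Q dQ (bar k A) (bar_diff k A) \<psi>"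
    using \<psi> by (simp add: comparison_map_def chain_map_def)
  note LQ = chain_complexD(1)[OF Q_complex]
  note \<phi>h = chain_mapD(1)[OF \<phi>_chain_map] and \<psi>h = chain_mapD(1)[OF \<psi>_map]
  note \<phi>c = lmod_hom_closed[OF \<phi>h] and \<psi>c = lmod_hom_closed[OF \<psi>h]
  note \<Phi> = bt.tens_map_hom[OF bar_left_module LQ \<phi>h] bt.tens_map_pure[OF bar_left_module LQ \<phi>h]
  note \<Psi> = bt.tens_map_hom[OF LQ bar_left_module \<psi>h] bt.tens_map_pure[OF LQ bar_left_module \<psi>h]
  note \<Psi>_map = bt.tens_chain_map[OF Q_complex bar_complex \<psi>_map]
  have aug: "\<eta> (\<phi> 0 x) = bar_aug k A x" if "x \<in> carrier (bar k A 0)" for x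
    using \<phi> that by (simp add: comparison_map_def)
  have aug': "bar_aug k A (\<psi> 0 x) = \<eta> x" if "x \<in> carrier (Q 0)" for x
    using \<psi> that by (simp add: comparison_map_def)
  have 1: "chain_homotopic k (\<lambda>n. bt.tens (bar k A n)) dbar (\<lambda>n. bt.tens (bar k A n)) dbar
      (\<lambda>n X. bt.tens_map (bar k A n) (\<psi> n) (bt.tens_map (Q n) (\<phi> n) X)) (\<lambda>n X. X)"
  proof (rule chain_homotopic_cong[OF bt.tens_map_homotopic[OF bar_complex bar_complex _ lmod_hom_comp[OF \<phi>h \<psi>h] lmod_hom_id]])
    show "chain_homotopic Ae (bar k A) (bar_diff k A) (bar k A) (bar_diff k A) (\<lambda>n x. \<psi> n (\<phi> n x)) (\<lambda>n x. x)"
      by (rule projective_resolution_homotopic[OF bar bar env_left_left_module])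
        (auto intro!: lmod_hom_diff[OF bar_left_module] lmod_hom_comp[OF \<phi>h \<psi>h] lmod_hom_id
          simp: \<phi>c \<psi>c chain_mapD(2)[OF \<phi>_chain_map] chain_mapD(2)[OF \<psi>_map] aug aug')
  qed (simp_all add: bt.tens_map_comp[OF bar_left_module LQ bar_left_module \<phi>h \<psi>h] bt.tens_map_id[OF bar_left_module])
  have 2: "chain_homotopic k (\<lambda>n. bt.tens (Q n)) dtor (\<lambda>n. bt.tens (Q n)) dtor
      (\<lambda>n X. bt.tens_map (Q n) (\<phi> n) (bt.tens_map (bar k A n) (\<psi> n) X)) (\<lambda>n X. X)"
  proof (rule chain_homotopic_cong[OF bt.tens_map_homotopic[OF Q_complex Q_complex _ lmod_hom_comp[OF \<psi>h \<phi>h] lmod_hom_id]])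
    show "chain_homotopic Ae Q dQ Q dQ (\<lambda>n x. \<phi> n (\<psi> n x)) (\<lambda>n x. x)"
      by (rule projective_resolution_homotopic[OF Q Q env_left_left_module])
        (auto intro!: lmod_hom_diff[OF LQ] lmod_hom_comp[OF \<psi>h \<phi>h] lmod_hom_id
          simp: \<phi>c \<psi>c chain_mapD(2)[OF \<phi>_chain_map] chain_mapD(2)[OF \<psi>_map] aug aug')
  qed (simp_all add: bt.tens_map_comp[OF LQ bar_left_module LQ \<psi>h \<phi>h] bt.tens_map_id[OF LQ])
  have "homology_map (\<lambda>n. bt.tens (Q n)) dtor (\<lambda>n. to_tens (Q n) (\<phi> n)) n
      \<in> lmod_iso k (homology (hochschild k A) (hochschild_diff k A) n) (homology (\<lambda>n. bt.tens (Q n)) dtor n)"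
  proof (rule homology_map_lmod_iso[OF hoch_complex tor_complex to_tens_chain_map
        chain_map_comp[OF \<Psi>_map bar_to_hoch_chain_map]])
    show "chain_homotopic k (hochschild k A) (hochschild_diff k A) (hochschild k A) (hochschild_diff k A)
        (\<lambda>n x. bar_to_hoch n (bt.tens_map (bar k A n) (\<psi> n) (to_tens (Q n) (\<phi> n) x))) (\<lambda>n x. x)"
      by (rule chain_homotopic_cong[OF chain_homotopic_postcomp[OF chain_homotopic_precomp[OF 1 hoch_to_bar_chain_map]
              bar_to_hoch_chain_map hoch_complex bar_tens_complex lmod_hom_closed[OF chain_mapD(1)[OF hoch_to_bar_chain_map]]]])
        (simp_all add: to_tens_\<phi> bar_to_hoch_to_bar hochschild_eq[symmetric])
    show "chain_homotopic k (\<lambda>n. bt.tens (Q n)) dtor (\<lambda>n. bt.tens (Q n)) dtor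
        (\<lambda>n x. to_tens (Q n) (\<phi> n) (bar_to_hoch n (bt.tens_map (bar k A n) (\<psi> n) x))) (\<lambda>n x. x)"
      by (rule chain_homotopic_cong[OF 2])
        (simp_all add: to_tens_\<phi> hochschild_eq lmod_hom_closed[OF bar_to_hoch_hom] lmod_hom_closed[OF \<Psi>(1)] hoch_to_bar_to_hoch)
  qed
  then show ?thesis by (simp add: HH_to_Tor_eq HH_def Tor_def)
qed

lemma gs_left_operator: "left_operator k Ae (env_derivation k A \<delta>) (Q i) (gs i)"
  and gs_diff: "x \<in> carrier (Q (Suc i)) \<Longrightarrow> dQ i (gs (Suc i) x) = gs i (dQ i x)"
  and gs_aug: "x \<in> carrier (Q 0) \<Longrightarrow> \<eta> (gs 0 x) = \<delta> (\<eta> x)"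
  using gs unfolding operator_lifting_def by blast+

lemmas tor_operator_chain_map =
  bt.tens_operator_chain_map[OF Q_complex \<delta>_right_operator gs_left_operator gs_diff env_derivation_closed]

text \<open>The chain-level form of the claim. A homotopy is what can be expected: \<open>gs\<close>
  is an arbitrary lifting, so the square need not commute on chains.\<close>

lemma to_tens_Lie_homotopic:
  "chain_homotopic k (hochschild k A) (hochschild_diff k A) (\<lambda>n. bt.tens (Q n)) dtor
    (\<lambda>n x. to_tens (Q n) (\<phi> n) (Lie (Suc n) x)) (\<lambda>n x. bt.tens_operator (Q n) \<delta> (gs n) (to_tens (Q n) (\<phi> n) x))"
proof -
  note LQ = chain_complexD(1)[OF Q_complex]
  note \<phi>h = chain_mapD(1)[OF \<phi>_chain_map]
  note \<phi>c = lmod_hom_closed[OF \<phi>h]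
  note \<Phi> = bt.tens_map_hom[OF bar_left_module LQ \<phi>h] bt.tens_map_pure[OF bar_left_module LQ \<phi>h]
  note opB = bt.tens_operator_hom[OF bar_left_module \<delta>_right_operator Lie_left_operator env_derivation_closed]
    bt.tens_operator_pure[OF bar_left_module \<delta>_right_operator Lie_left_operator env_derivation_closed]
  note opQ = bt.tens_operator_hom[OF LQ \<delta>_right_operator gs_left_operator env_derivation_closed]
    bt.tens_operator_pure[OF LQ \<delta>_right_operator gs_left_operator env_derivation_closed]
  have gc: "gs n x \<in> carrier (Q n)" if "x \<in> carrier (Q n)" for n x
    using gs_left_operator[of n] that unfolding left_operator_def linear_endo_def by blast
  have Lc: "Lie (n + 2) x \<in> carrier (bar k A n)" if "x \<in> carrier (bar k A n)" for n x
    using Lie_closed that by (simp only: bar_simps)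
  have LS: "bar_diff k A n (Lie (Suc n + 2) x) = Lie (n + 2) (bar_diff k A n x)" if "x \<in> carrier (bar k A (Suc n))" for n x
    using bar_diff_Lie that by (simp only: bar_simps)
  have aug: "\<eta> (\<phi> 0 x) = bar_aug k A x" if "x \<in> carrier (bar k A 0)" for x
    using \<phi> that by (simp add: comparison_map_def)
  have "chain_homotopic Ae (bar k A) (bar_diff k A) Q dQ (\<lambda>n x. \<phi> n (Lie (n + 2) x)) (\<lambda>n x. gs n (\<phi> n x))"
  proof (rule projective_resolution_homotopic[OF bar_resolution[OF projective] Q env_left_left_module])
    fix n x
    { assume x: "x \<in> carrier (bar k A n)"
      show "\<phi> n (Lie (n + 2) x) \<in> carrier (Q n)" by (rule \<phi>c[OF Lc[OF x]])
      show "gs n (\<phi> n x) \<in> carrier (Q n)" by (rule gc[OF \<phi>c[OF x]]) }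
    { assume x: "x \<in> carrier (bar k A (Suc n))"
      show "dQ n (\<phi> (Suc n) (Lie (Suc n + 2) x)) = \<phi> n (Lie (n + 2) (bar_diff k A n x))"
        by (simp only: chain_mapD(2)[OF \<phi>_chain_map Lc[OF x]] LS[OF x])
      show "dQ n (gs (Suc n) (\<phi> (Suc n) x)) = gs n (\<phi> n (bar_diff k A n x))"
        by (simp only: gs_diff[OF \<phi>c[OF x]] chain_mapD(2)[OF \<phi>_chain_map x]) }
    \<comment> \<open>\<open>Lie\<close> and \<open>gs\<close> obey the Leibniz rule with the same
      derivation of \<open>Ae\<close>, so their failures to be linear cancel.\<close>
    show "(\<lambda>x. \<phi> n (Lie (n + 2) x) \<ominus>\<^bsub>Q n\<^esub> gs n (\<phi> n x)) \<in> lmod_hom Ae (bar k A n) (Q n)"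
      by (rule left_operator_commutator[OF bar_left_module LQ \<phi>h Lie_left_operator gs_left_operator env_derivation_closed])
    assume x: "x \<in> carrier (bar k A 0)"
    then have "x \<in> carrier (T 2)" by (simp only: bar_simps add_0)
    \<comment> \<open>Both sides equal \<open>\<delta>\<close> applied to the augmentation of
      \<open>x\<close>: one by \<open>bar_aug_Lie\<close>, the other because \<open>gs\<close> lifts
      \<open>\<delta>\<close>.\<close>
    then show "\<eta> (\<phi> 0 (Lie (0 + 2) x)) = \<eta> (gs 0 (\<phi> 0 x))"
      by (simp only: aug[OF Lc[OF x]] gs_aug[OF \<phi>c[OF x]] aug[OF x]) (simp only: add_0 bar_aug_Lie)
  qed
  then have "chain_homotopic k (\<lambda>n. bt.tens (bar k A n)) dbar (\<lambda>n. bt.tens (Q n)) dtor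
      (\<lambda>n X. bt.tens_map (Q n) (\<phi> n) (bt.tens_operator (bar k A n) \<delta> (Lie (n + 2)) X))
      (\<lambda>n X. bt.tens_operator (Q n) \<delta> (gs n) (bt.tens_map (Q n) (\<phi> n) X))"
  \<comment> \<open>The common summand \<open>R\<close> comes from differentiating the coefficient
    \<open>m\<close>, which both composites do in the same way.\<close>
  proof (rule bt.tens_homotopic[where R = "\<lambda>n m q. bt.tens_pure (Q n) (\<delta> m) (\<phi> n q)", OF bar_complex Q_complex])
    fix n
    show "(\<lambda>X. bt.tens_map (Q n) (\<phi> n) (bt.tens_operator (bar k A n) \<delta> (Lie (n + 2)) X)) \<in> lmod_hom k (bt.tens (bar k A n)) (bt.tens (Q n))"
      by (rule lmod_hom_comp[OF opB(1) \<Phi>(1)])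
    show "(\<lambda>X. bt.tens_operator (Q n) \<delta> (gs n) (bt.tens_map (Q n) (\<phi> n) X)) \<in> lmod_hom k (bt.tens (bar k A n)) (bt.tens (Q n))"
      by (rule lmod_hom_comp[OF \<Phi>(1) opQ(1)])
    fix m q assume q: "q \<in> carrier (bar k A n)"
    then show "gs n (\<phi> n q) \<in> carrier (Q n)" by (intro gc \<phi>c)
    assume m: "m \<in> carrier (env_right k A)"
    then have dm: "\<delta> m \<in> carrier (env_right k A)" by (simp add: \<delta>_closed)
    show "bt.tens_pure (Q n) (\<delta> m) (\<phi> n q) \<in> carrier (bt.tens (Q n))"
      by (rule bt.tens_pure_closed[OF LQ dm \<phi>c[OF q]])
    show "bt.tens_map (Q n) (\<phi> n) (bt.tens_operator (bar k A n) \<delta> (Lie (n + 2)) (bt.tens_pure (bar k A n) m q))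
        = bt.tens_pure (Q n) (\<delta> m) (\<phi> n q) \<oplus>\<^bsub>bt.tens (Q n)\<^esub> bt.tens_pure (Q n) m (\<phi> n (Lie (n + 2) q))"
      by (simp only: opB(2)[OF m q] lmod_hom_add[OF \<Phi>(1) bt.tens_pure_closed[OF bar_left_module dm q]
            bt.tens_pure_closed[OF bar_left_module m Lc[OF q]]] \<Phi>(2)[OF dm q] \<Phi>(2)[OF m Lc[OF q]])
    show "bt.tens_operator (Q n) \<delta> (gs n) (bt.tens_map (Q n) (\<phi> n) (bt.tens_pure (bar k A n) m q))
        = bt.tens_pure (Q n) (\<delta> m) (\<phi> n q) \<oplus>\<^bsub>bt.tens (Q n)\<^esub> bt.tens_pure (Q n) m (gs n (\<phi> n q))"
      by (simp only: \<Phi>(2)[OF m q] opQ(2)[OF m \<phi>c[OF q]])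
  qed
  from chain_homotopic_precomp[OF this hoch_to_bar_chain_map] show ?thesis
  proof (rule chain_homotopic_cong)
    fix n x assume x: "x \<in> carrier (hochschild k A n)"
    have "Lie (Suc n) x \<in> carrier (hochschild k A n)" using Lie_closed x by (simp only: hochschild_eq)
    then show "to_tens (Q n) (\<phi> n) (Lie (Suc n) x)
        = bt.tens_map (Q n) (\<phi> n) (bt.tens_operator (bar k A n) \<delta> (Lie (n + 2)) (hoch_to_bar n x))"
      using hoch_to_bar_Lie x by (simp only: to_tens_\<phi> hochschild_eq)
    show "bt.tens_operator (Q n) \<delta> (gs n) (to_tens (Q n) (\<phi> n) x)
        = bt.tens_operator (Q n) \<delta> (gs n) (bt.tens_map (Q n) (\<phi> n) (hoch_to_bar n x))"
      using x by (simp only: to_tens_\<phi>)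
  qed
qed

text \<open>A class is represented by a cycle, on which homotopic maps have homologous values; the
  remaining steps evaluate the induced maps on representatives.\<close>

lemma nabla_HH_to_Tor:
  assumes X: "X \<in> carrier (HH k A n)"
  shows "nabla k Ae (env_right k A) Q dQ \<delta> gs n (HH_to_Tor k A Q dQ \<phi> n X)
    = HH_to_Tor k A Q dQ \<phi> n (lie_derivative k A \<delta> n X)"
proof -
  obtain z where z: "z \<in> cycles (hochschild k A) (hochschild_diff k A) n"
    "X = boundaries (hochschild k A) (hochschild_diff k A) n +>\<^bsub>hochschild k A n\<^esub> z"
    using X unfolding HH_def homology_carrier[OF hoch_complex] by blast
  have nabla: "nabla k Ae (env_right k A) Q dQ \<delta> gs n
      = homology_map (\<lambda>n. bt.tens (Q n)) dtor (\<lambda>n. bt.tens_operator (Q n) \<delta> (gs n)) n"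
    by (simp add: nabla_def bt.tens_operator_def)
  have lie: "lie_derivative k A \<delta> n
      = homology_map (hochschild k A) (hochschild_diff k A) (\<lambda>n. Lie (Suc n)) n"
    by (simp add: lie_derivative_def Lie_def)
  note cycles = chain_map_cycles[OF hoch_complex tor_complex to_tens_chain_map z(1)]
    chain_map_cycles[OF hoch_complex hoch_complex Lie_chain_map z(1)]
  show ?thesis
    using homotopic_homologous[OF hoch_complex tor_complex to_tens_Lie_homotopic _ z(1)]
      chain_mapD(1)[OF chain_map_comp[OF to_tens_chain_map tor_operator_chain_map]]
    by (simp add: nabla lie HH_to_Tor_eq z(2) homology_map_class[OF hoch_complex tor_complex to_tens_chain_map]
        homology_map_class[OF hoch_complex hoch_complex Lie_chain_map]
        homology_map_class[OF tor_complex tor_complex tor_operator_chain_map] z(1) cycles)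
qed

end

end

text \<open>The existence of a comparison map keeps the statement about all comparison maps from
  being vacuous. Leaving \<open>Q\<close>, \<open>gs\<close> and \<open>\<phi>\<close> arbitrary
  expresses that the equality does not depend on how Tor and the lifting are modelled.\<close>

theorem mainTheorem4:
  fixes k :: "'k ring"
    and A :: "('k, 'a) module"
    and \<delta> :: "'a \<Rightarrow> 'a"
    and Q :: "nat \<Rightarrow> (('a list \<Rightarrow> 'k) set, 'q) module"
    and dQ :: "nat \<Rightarrow> 'q \<Rightarrow> 'q"
    and \<eta> :: "'q \<Rightarrow> 'a"
    and gs :: "nat \<Rightarrow> 'q \<Rightarrow> 'q"
  assumes "cring k"
    and "assoc_algebra k A"
    and "projective_module k A"
    and "derivation k A \<delta>"
    and "projective_resolution (enveloping k A) (env_left k A) Q dQ \<eta>"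
    and "operator_lifting k (enveloping k A) (env_derivation k A \<delta>) Q dQ \<eta> \<delta> gs"
  shows "derivation k (enveloping k A) (env_derivation k A \<delta>)
    \<and> right_operator k (enveloping k A) (env_derivation k A \<delta>) (env_right k A) \<delta>
    \<and> left_operator k (enveloping k A) (env_derivation k A \<delta>) (env_left k A) \<delta>
    \<and> (\<exists>\<phi>. comparison_map (enveloping k A) (bar k A) (bar_diff k A) (bar_aug k A) Q dQ \<eta> \<phi>)
    \<and> (\<forall>\<phi>. comparison_map (enveloping k A) (bar k A) (bar_diff k A) (bar_aug k A) Q dQ \<eta> \<phi> \<longrightarrow>
         (\<forall>n. HH_to_Tor k A Q dQ \<phi> n
                \<in> lmod_iso k (HH k A n) (Tor k (enveloping k A) (env_right k A) Q dQ n)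
            \<and> (\<forall>x\<in>carrier (HH k A n).
                 nabla k (enveloping k A) (env_right k A) Q dQ \<delta> gs n (HH_to_Tor k A Q dQ \<phi> n x)
                   = HH_to_Tor k A Q dQ \<phi> n (lie_derivative k A \<delta> n x))))"
proof -
  interpret k_derivation k A \<delta>
    by (intro k_derivation.intro k_algebra.intro k_derivation_axioms.intro assms)
  show ?thesis
    using env_derivation_derivation \<delta>_right_operator \<delta>_left_operator
      comparison_map_exists[OF bar_resolution[OF assms(3)] assms(5) env_left_left_module]
      HH_to_Tor_iso[OF assms(3,5,6)] nabla_HH_to_Tor[OF assms(3,5,6)]
    by blast
qed

end
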